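(* Let $\beta\in(0,1]$, $L>0$ and $\alpha\in(0,1)$. Consider the regression model $Y_i=l(X_i)+\varepsilon_i$, $i=1,\ldots,n$, with independent identically distributed errors having a Lebesgue density $f$ symmetric about $0$. Let $\phi_n^*$ denote the (conditional) multiscale signed rank test at level $\alpha$ based on the kernel $\psi_\beta(x)=1-|2x-1|^\beta$, $x\in[0,1]$ (the test is defined in the context). Assume that the first derivative of the error density $f$ exists and is uniformly bounded and integrable. Denote $\rho_n:=((\log n)/n)^{\beta/(2\beta+1)}$ and $$d^* := \left( \frac{2L^{1/\beta}}{(2\beta + 1)\,12\left(\int f(y)^2 \, dy\right)^2 \|\gamma_\beta\|_2^2} \right)^{\beta/(2\beta+1)}.$$ Assume that $X_i=H^{-1}(i/n)$, $i=1,\ldots,n$, where $H$ is the distribution function of a strictly positive and continuous Lebesgue probability density $h$ on $[0,1]$ of finite total variation, and suppose that the modulus of continuity of $h$ decreases with at least logarithmic rate, that is, $\sup_{|x-y|\leq \delta} |h(x) - h(y)| = O(1/\log(1/\delta))$ as $\delta \to 0$. Then for arbitrary numbers $\varepsilon_n>0$ with $\lim_{n\to\infty}\varepsilon_n=0$ and $\lim_{n\to\infty}(\log n)^{1/2}\varepsilon_n=\infty$, $$\liminf_{n\to\infty}\ \inf_{\substack{l \in \mathcal{H}_h(\beta, L): \\ \|l\sqrt{h}\|_J \geq (1+\varepsilon_n)d^*\rho_n}} \mathbb{P}_l(\phi_n^* = 1) = 1$$ for any fixed compact interval $J\subset(0,1)$.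
   Context: Hölder classes: for an interval $I\subset\mathbb{R}$, $0<\beta\le1$ and $L>0$, $\mathcal{H}(\beta,L;I):=\{g:I\to\mathbb{R}\mid |g(x)-g(y)|\le L|x-y|^\beta\ \text{for all }x,y\in I\}$. Given the design density $h$, $\mathcal{H}_h(\beta,L):=\{g/\sqrt h\mid g\in\mathcal{H}(\beta,L;[0,1])\}$. $\gamma_\beta$ denotes the solution of the problem of minimizing $\|\gamma\|_2$ over all $\gamma\in\mathcal{H}(\beta,1;\mathbb{R})$ with $\gamma(0)\ge1$; for $0<\beta\le1$ it is $\gamma_\beta(x)=I\{|x|\le1\}(1-|x|^\beta)$. The norm $\|\cdot\|_2$ is the $L_2$-norm with respect to Lebesgue measure. For $J\subset[0,1]$, $\|g\|_J:=\sup_{x\in J}|g(x)|$. $\mathbb{P}_l$ denotes probability when the regression function is $l$. The design points are deterministic and depend on $n$. Multiscale signed rank test at level $\alpha$ based on a kernel $\psi:[0,1]\to\mathbb{R}$: for $0\le s<t\le1$ let $\psi_{st}(x):=\psi\left(\frac{x-s}{t-s}\right)$ for $x\in[s,t]$, and write $\psi_{jk}:=\psi_{X_jX_k}$ for $1\le j<k\le n$. Let $R_{jk}(i)$ be the rank of $|Y_i|$ among the $k-j+1$ numbers $|Y_m|$, $m=j,\ldots,k$. Define $$T_{jk} := \frac{\sum_{i=j}^k \psi_{jk}(X_i) \operatorname{sign}(Y_i) R_{jk}(i)}{\sqrt{\sum_{i=j}^k \psi_{jk}(X_i)^2 R_{jk}(i)^2}}$$ if the denominator is nonzero and $T_{jk}:=0$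 otherwise, and $$T_n := \max_{1 \leq j < k \leq n} \left\{|T_{jk}| - \sqrt{2 \log(n/(k-j))}\right\}.$$ Let $R=R_{1n}=(R_{1n}(i))_{i=1}^n$ be the vector of ranks of $|Y_1|,\ldots,|Y_n|$, and let $\kappa_\alpha(R):=\arg\min_{C>0}\{\mathbb{P}(T_n\le C\mid R)\ge1-\alpha\}$ be the generalized $(1-\alpha)$-quantile of the conditional distribution of $T_n$ given $R$ under the null hypothesis $l=0$ (i.e. the smallest such $C$; under the null hypothesis, given $R$, the signs $\operatorname{sign}(Y_i)$ are i.i.d. uniform on $\{-1,1\}$, so this conditional distribution does not depend on the error distribution). The test equals $1$ (rejects $l=0$) if $T_n>\kappa_\alpha(R)$ and $0$ if $T_n\le\kappa_\alpha(R)$. *)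

theory Defs
  imports "HOL-Probability.Probability" "HOL-Library.Landau_Symbols"
begin

text \<open>A function on an interval \<open>I\<close> is represented by a total function whose values outside
  \<open>I\<close> are irrelevant.\<close>

definition holder_class :: "real \<Rightarrow> real \<Rightarrow> real set \<Rightarrow> (real \<Rightarrow> real) set" where
  "holder_class \<beta> L I = {g. \<forall>x\<in>I. \<forall>y\<in>I. \<bar>g x - g y\<bar> \<le> L * \<bar>x - y\<bar> powr \<beta>}"

definition weighted_holder_class :: "(real \<Rightarrow> real) \<Rightarrow> real \<Rightarrow> real \<Rightarrow> (real \<Rightarrow> real) set" where
  "weighted_holder_class h \<beta> L =
     {l. \<exists>g\<in>holder_class \<beta> L {0..1}. \<forall>x\<in>{0..1}. l x = g x / sqrt (h x)}"

definition sup_norm_on :: "real set \<Rightarrow> (real \<Rightarrow> real) \<Rightarrow> real" where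
  "sup_norm_on J g = (SUP x\<in>J. \<bar>g x\<bar>)"

definition L2_norm :: "(real \<Rightarrow> real) \<Rightarrow> real" where
  "L2_norm g = sqrt (LINT x|lborel. (g x)\<^sup>2)"

definition \<gamma>_opt :: "real \<Rightarrow> real \<Rightarrow> real" where
  "\<gamma>_opt \<beta> x = (if \<bar>x\<bar> \<le> 1 then 1 - \<bar>x\<bar> powr \<beta> else 0)"

definition bounded_variation_on :: "real set \<Rightarrow> (real \<Rightarrow> real) \<Rightarrow> bool" where
  "bounded_variation_on S g \<longleftrightarrow>
     (\<exists>V. \<forall>(m::nat) t. (\<forall>i\<le>m. t i \<in> S) \<and> (\<forall>i<m. t i \<le> t (Suc i)) \<longrightarrow>
        (\<Sum>i<m. \<bar>g (t (Suc i)) - g (t i)\<bar>) \<le> V)"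

definition modulus_of_continuity :: "real set \<Rightarrow> (real \<Rightarrow> real) \<Rightarrow> real \<Rightarrow> real" where
  "modulus_of_continuity S g \<delta> =
     (SUP (x, y)\<in>{(x, y). x \<in> S \<and> y \<in> S \<and> \<bar>x - y\<bar> \<le> \<delta>}. \<bar>g x - g y\<bar>)"

text \<open>\<open>\<gamma>_opt \<beta>\<close> solves the optimal recovery problem for the Hoelder class \<open>(\<beta>, 1)\<close>. The
  integrability condition on \<open>\<gamma>\<close> excludes competitors of infinite norm, to which \<open>L2_norm\<close>
  would assign \<open>0\<close>.\<close>

lemma \<gamma>_opt_minimizes:
  assumes "0 < \<beta>" "\<beta> \<le> 1"
  shows "\<gamma>_opt \<beta> \<in> holder_class \<beta> 1 UNIV"
    and "\<gamma>_opt \<beta> 0 \<ge> 1"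
    and "integrable lborel (\<lambda>x. (\<gamma>_opt \<beta> x)\<^sup>2)"
    and "\<And>\<gamma>. \<gamma> \<in> holder_class \<beta> 1 UNIV \<Longrightarrow> \<gamma> 0 \<ge> 1 \<Longrightarrow> integrable lborel (\<lambda>x. (\<gamma> x)\<^sup>2) \<Longrightarrow>
           L2_norm (\<gamma>_opt \<beta>) \<le> L2_norm \<gamma>"
proof -
  have sub: "(a + b) powr \<beta> \<le> a powr \<beta> + b powr \<beta>" if "a \<ge> 0" "b \<ge> 0" for a b :: real
  proof (cases "a + b = 0")
    case True
    then show ?thesis using that by simp
  next
    case False
    then have s: "a + b > 0" using that by simp
    have le: "u \<le> u powr \<beta>" if "0 \<le> u" "u \<le> 1" for u :: real
      using that assms powr_mono'[of \<beta> 1 u] by (cases "u = 0") auto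
    have "1 = a / (a + b) + b / (a + b)"
      using s by (simp add: add_divide_distrib[symmetric])
    also have "\<dots> \<le> (a / (a + b)) powr \<beta> + (b / (a + b)) powr \<beta>"
      using s that by (intro add_mono le) auto
    also have "\<dots> = (a powr \<beta> + b powr \<beta>) / (a + b) powr \<beta>"
      using s that by (simp add: powr_divide add_divide_distrib)
    finally show ?thesis using s by (simp add: field_simps)
  qed
  have alt: "\<gamma>_opt \<beta> x = max 0 (1 - \<bar>x\<bar> powr \<beta>)" for x
  proof (cases "\<bar>x\<bar> \<le> 1")
    case True
    then have "\<bar>x\<bar> powr \<beta> \<le> 1" using assms by (simp add: powr_le1)
    then show ?thesis using True by (simp add: \<gamma>_opt_def)
  next
    case False
    then have "\<bar>x\<bar> powr \<beta> \<ge> 1" using assms by (simp add: ge_one_powr_ge_zero)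
    then show ?thesis using False by (simp add: \<gamma>_opt_def)
  qed
  have diff: "\<bar>x\<bar> powr \<beta> - \<bar>y\<bar> powr \<beta> \<le> \<bar>x - y\<bar> powr \<beta>" for x y :: real
  proof -
    have "\<bar>x\<bar> powr \<beta> \<le> (\<bar>x - y\<bar> + \<bar>y\<bar>) powr \<beta>"
      using assms by (intro powr_mono2) auto
    also have "\<dots> \<le> \<bar>x - y\<bar> powr \<beta> + \<bar>y\<bar> powr \<beta>" by (rule sub) auto
    finally show ?thesis by simp
  qed
  show "\<gamma>_opt \<beta> \<in> holder_class \<beta> 1 UNIV"
    unfolding holder_class_def
  proof safe
    fix x y :: real
    show "\<bar>\<gamma>_opt \<beta> x - \<gamma>_opt \<beta> y\<bar> \<le> 1 * \<bar>x - y\<bar> powr \<beta>"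
      using diff[of x y] diff[of y x] powr_ge_zero[of "\<bar>x - y\<bar>" \<beta>]
      unfolding alt abs_minus_commute[of y x] by linarith
  qed
  show "\<gamma>_opt \<beta> 0 \<ge> 1" by (simp add: \<gamma>_opt_def)
  show int: "integrable lborel (\<lambda>x. (\<gamma>_opt \<beta> x)\<^sup>2)"
  proof (rule Bochner_Integration.integrable_bound)
    show "integrable lborel (indicator {-1..1::real} :: real \<Rightarrow> real)" by simp
    show "(\<lambda>x. (\<gamma>_opt \<beta> x)\<^sup>2) \<in> borel_measurable lborel" unfolding alt by measurable
    show "AE x in lborel. norm ((\<gamma>_opt \<beta> x)\<^sup>2) \<le> norm (indicator {-1..1} x :: real)"
    proof (rule AE_I2)
      fix x :: real
      have "0 \<le> \<gamma>_opt \<beta> x" "\<gamma>_opt \<beta> x \<le> 1" by (auto simp: alt)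
      then have "(\<gamma>_opt \<beta> x)\<^sup>2 \<le> 1" by (simp add: power_le_one)
      then show "norm ((\<gamma>_opt \<beta> x)\<^sup>2) \<le> norm (indicator {-1..1} x :: real)"
        by (auto simp: \<gamma>_opt_def indicator_def)
    qed
  qed
  fix \<gamma> assume \<gamma>: "\<gamma> \<in> holder_class \<beta> 1 UNIV" "\<gamma> 0 \<ge> 1" "integrable lborel (\<lambda>x. (\<gamma> x)\<^sup>2)"
  have "(LINT x|lborel. (\<gamma>_opt \<beta> x)\<^sup>2) \<le> (LINT x|lborel. (\<gamma> x)\<^sup>2)"
  proof (rule integral_mono[OF int \<gamma>(3)])
    fix x :: real
    have "\<bar>\<gamma> 0 - \<gamma> x\<bar> \<le> 1 * \<bar>0 - x\<bar> powr \<beta>"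
      using \<gamma>(1) unfolding holder_class_def by blast
    then have "\<bar>\<gamma>_opt \<beta> x\<bar> \<le> \<bar>\<gamma> x\<bar>" using \<gamma>(2) by (simp add: alt)
    then show "(\<gamma>_opt \<beta> x)\<^sup>2 \<le> (\<gamma> x)\<^sup>2" by (simp add: abs_le_square_iff)
  qed
  then show "L2_norm (\<gamma>_opt \<beta>) \<le> L2_norm \<gamma>" by (simp add: L2_norm_def)
qed

text \<open>\<open>h\<close> is a density on \<open>[0,1]\<close> only, so the inverse of its distribution function \<open>H\<close> is
  taken on \<open>[0,1]\<close>, where \<open>H\<close> is injective for positive \<open>h\<close>.\<close>

definition design_law :: "(real \<Rightarrow> real) \<Rightarrow> real measure" where
  "design_law h = density lborel (\<lambda>x. ennreal (indicator {0..1} x * h x))"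

definition design_point :: "(real \<Rightarrow> real) \<Rightarrow> nat \<Rightarrow> nat \<Rightarrow> real" where
  "design_point h n i = the_inv_into {0..1} (cdf (design_law h)) (real i / real n)"

definition observation ::
    "(real \<Rightarrow> real) \<Rightarrow> (nat \<Rightarrow> real) \<Rightarrow> (nat \<Rightarrow> 'a \<Rightarrow> real) \<Rightarrow> 'a \<Rightarrow> nat \<Rightarrow> real" where
  "observation l X err \<omega> i = l (X i) + err i \<omega>"

text \<open>Below, \<open>X\<close> and \<open>y\<close> are the design points and the observations, both indexed by
  \<open>1, \<dots>, n\<close>.\<close>

definition \<psi>_opt :: "real \<Rightarrow> real \<Rightarrow> real" where
  "\<psi>_opt \<beta> x = 1 - \<bar>2 * x - 1\<bar> powr \<beta>"

definition local_kernel :: "(real \<Rightarrow> real) \<Rightarrow> real \<Rightarrow> real \<Rightarrow> real \<Rightarrow> real" where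
  "local_kernel \<psi> s t x = \<psi> ((x - s) / (t - s))"

definition local_rank :: "(nat \<Rightarrow> real) \<Rightarrow> nat \<Rightarrow> nat \<Rightarrow> nat \<Rightarrow> nat" where
  "local_rank y j k i = card {m \<in> {j..k}. \<bar>y m\<bar> \<le> \<bar>y i\<bar>}"

definition rank_vector :: "nat \<Rightarrow> (nat \<Rightarrow> real) \<Rightarrow> nat \<Rightarrow> nat" where
  "rank_vector n y = (\<lambda>i\<in>{1..n}. local_rank y 1 n i)"

definition local_signed_rank_stat ::
    "(real \<Rightarrow> real) \<Rightarrow> (nat \<Rightarrow> real) \<Rightarrow> (nat \<Rightarrow> real) \<Rightarrow> nat \<Rightarrow> nat \<Rightarrow> real" where
  "local_signed_rank_stat \<psi> X y j k =
     (let w = (\<lambda>i. local_kernel \<psi> (X j) (X k) (X i));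
          r = (\<lambda>i. real (local_rank y j k i));
          d = sqrt (\<Sum>i=j..k. (w i)\<^sup>2 * (r i)\<^sup>2)
      in if d \<noteq> 0 then (\<Sum>i=j..k. w i * sgn (y i) * r i) / d else 0)"

definition multiscale_stat ::
    "(real \<Rightarrow> real) \<Rightarrow> (nat \<Rightarrow> real) \<Rightarrow> nat \<Rightarrow> (nat \<Rightarrow> real) \<Rightarrow> real" where
  "multiscale_stat \<psi> X n y =
     Max {\<bar>local_signed_rank_stat \<psi> X y j k\<bar> - sqrt (2 * ln (real n / real (k - j))) | j k.
            1 \<le> j \<and> j < k \<and> k \<le> n}"

text \<open>Generalized \<open>(1-\<alpha>)\<close>-quantile of the conditional law, given that the rank vector equals
  \<open>r\<close>, of the multiscale statistic under \<open>l = 0\<close>. Since the rank vector takes finitely many values,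
  elementary conditional probabilities suffice; they depend on the space \<open>M\<close> carrying the errors
  only formally, because given the rank vector the signs are i.i.d. uniform on \<open>{-1, 1}\<close>.
  The infimum is attained unless it is \<open>0\<close>.\<close>

definition critical_value ::
    "'a measure \<Rightarrow> (nat \<Rightarrow> 'a \<Rightarrow> real) \<Rightarrow> (real \<Rightarrow> real) \<Rightarrow> (nat \<Rightarrow> real) \<Rightarrow> nat \<Rightarrow> real \<Rightarrow>
      (nat \<Rightarrow> nat) \<Rightarrow> real" where
  "critical_value M err \<psi> X n \<alpha> r =
     Inf {C. C > 0 \<and>
       cond_prob M
         (\<lambda>\<omega>. multiscale_stat \<psi> X n (observation (\<lambda>_. 0) X err \<omega>) \<le> C)
         (\<lambda>\<omega>. rank_vector n (observation (\<lambda>_. 0) X err \<omega>) = r) \<ge> 1 - \<alpha>}"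

definition signed_rank_test ::
    "'a measure \<Rightarrow> (nat \<Rightarrow> 'a \<Rightarrow> real) \<Rightarrow> (real \<Rightarrow> real) \<Rightarrow> (nat \<Rightarrow> real) \<Rightarrow> nat \<Rightarrow> real \<Rightarrow>
      (nat \<Rightarrow> real) \<Rightarrow> nat" where
  "signed_rank_test M err \<psi> X n \<alpha> y =
     (if multiscale_stat \<psi> X n y > critical_value M err \<psi> X n \<alpha> (rank_vector n y) then 1 else 0)"

definition rate :: "real \<Rightarrow> nat \<Rightarrow> real" where
  "rate \<beta> n = (ln (real n) / real n) powr (\<beta> / (2 * \<beta> + 1))"

definition d_star :: "real \<Rightarrow> real \<Rightarrow> (real \<Rightarrow> real) \<Rightarrow> real" where
  "d_star \<beta> L f =
     (2 * L powr (1 / \<beta>) /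
       ((2 * \<beta> + 1) * 12 * (LINT y|lborel. (f y)\<^sup>2)\<^sup>2 * (L2_norm (\<gamma>_opt \<beta>))\<^sup>2))
     powr (\<beta> / (2 * \<beta> + 1))"

end

theory Submission
  imports Defs "HOL-Real_Asymp.Real_Asymp" "HOL-Combinatorics.Permutations"
begin

text \<open>
  Under the null hypothesis, given the ranks, each local statistic is a normalized Rademacher sum, and its coefficient
  vector depends on the interval in a \<open>\<beta>\<close>-Hoelder way, uniformly in the rank vector. A chaining argument over dyadic
  intervals therefore bounds the critical value by a constant that depends neither on \<open>n\<close> nor on the ranks.

  For the power, let \<open>x0\<close> be a point where the weighted signal attains \<open>(1 + \<epsilon>/2) d* \<rho>\<close>. On the window of half-width
  \<open>w = (d* \<rho> / L)^(1/\<beta>)\<close> around \<open>x0\<close> the signal dominates the kernel, and a single local statistic has to exceed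
  \<open>sqrt (2 ln (n / (k - j))) + O(1)\<close>. Writing ranks as sums of comparisons, its numerator and squared denominator are
  sums over pairs and triples of errors. Chebyshev's inequality reduces them to their means, where the shift of one
  error by a small signal \<open>s\<close> contributes \<open>2 s \<integral> f\<^sup>2\<close> to first order and the squared normalized ranks average
  \<open>1/3\<close>. The definition of \<open>d*\<close> makes the leading terms agree, so that the surplus \<open>\<epsilon> sqrt (ln n)\<close>, which tends to
  infinity, absorbs all bounded errors. Signals exceeding \<open>1 / ln n\<close> are not covered by the first-order expansion,
  but for them already a bound with a poor constant on a much longer window suffices.
\<close>

section \<open>Rademacher sums\<close>

text \<open>The surplus \<open>\<epsilon> n * sqrt (ln n)\<close> may diverge arbitrarily slowly, so
  every loss has to stay bounded instead of being merely of smaller order than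
  \<open>sqrt (ln n)\<close>. A union bound over all intervals against
  \<open>sqrt (2 * ln (n / (k - j)))\<close> loses an unbounded amount, which is why the null
  distribution needs chaining. For the same reason each relative error of the sharp bound must be
  \<open>o(1 / sqrt (ln n))\<close>; the logarithmic modulus of \<open>h\<close> and the cut at
  \<open>1 / ln n\<close> provide this.

  Conditioning stays elementary: averaging over all sign flips replaces a conditional law, and
  permuting the errors shows that every tie-free rank vector has positive probability.

  The 12 in \<open>d_star\<close> is the square of \<open>2 * sqrt 3\<close>. Over \<open>p\<close>
  points the numerator has mean about \<open>2 * p * f_energy\<close> times the sum of kernel times
  signal, while the denominator is about \<open>p\<close> times the root of a third of the squared
  kernel sum. The window holds a number of points of order
  \<open>n * (ln n / n) powr \<theta>\<close> with \<open>\<theta> = 1 / (2 * \<beta> + 1)\<close>,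
  so the threshold to beat is \<open>sqrt (2 * \<theta> * ln n)\<close>, exactly the leading term at
  height \<open>d_star * rate\<close>.\<close>

definition signs :: "nat \<Rightarrow> (nat \<Rightarrow> real) set" where
  "signs n = PiE {1..n} (\<lambda>_. {-1, 1})"

lemma finite_signs [simp]: "finite (signs n)"
  unfolding signs_def by (intro finite_PiE) auto

lemma card_signs: "card (signs n) = 2 ^ n"
  unfolding signs_def by (subst card_PiE) (auto simp: numeral_2_eq_2)

text \<open>A random sign is subgaussian. In logarithms, \<open>x^2 / 2 - ln (cosh x)\<close>
  vanishes at 0 and has derivative \<open>x - tanh x\<close>, which is nonnegative for nonnegative
  \<open>x\<close> because \<open>sinh y \<le> y * cosh y\<close> there.\<close>

lemma exp_add_exp_minus_le:
  fixes x :: real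
  shows "exp x + exp (- x) \<le> 2 * exp (x\<^sup>2 / 2)"
proof -
  have sinh_le: "sinh y \<le> y * cosh y" if "0 \<le> y" for y :: real
  proof -
    have "0 * cosh 0 - sinh 0 \<le> y * cosh y - sinh y"
    proof (rule DERIV_nonneg_imp_nondecreasing[OF that])
      fix z :: real assume z: "0 \<le> z" "z \<le> y"
      have "((\<lambda>y. y * cosh y - sinh y) has_real_derivative z * sinh z) (at z)"
        by (auto intro!: derivative_eq_intros)
      then show "\<exists>d. ((\<lambda>y. y * cosh y - sinh y) has_real_derivative d) (at z) \<and> 0 \<le> d"
        using z by (intro exI[of _ "z * sinh z"]) auto
    qed
    then show ?thesis by simp
  qed
  define g where "g x = x\<^sup>2 / 2 - ln (cosh x)" for x :: real
  have "0 \<le> g x" if "0 \<le> x" for x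
  proof -
    have "g 0 \<le> g x"
    proof (rule DERIV_nonneg_imp_nondecreasing[OF that])
      fix y :: real assume y: "0 \<le> y" "y \<le> x"
      have "(g has_real_derivative (y - sinh y / cosh y)) (at y)"
        unfolding g_def by (auto intro!: derivative_eq_intros simp: field_simps)
      moreover have "sinh y / cosh y \<le> y"
        using sinh_le[of y] y by (simp add: field_simps)
      ultimately show "\<exists>z. (g has_real_derivative z) (at y) \<and> 0 \<le> z" by force
    qed
    then show ?thesis by (simp add: g_def)
  qed
  from this[of "\<bar>x\<bar>"] have "ln (cosh x) \<le> x\<^sup>2 / 2"
    by (simp add: g_def)
  then have "cosh x \<le> exp (x\<^sup>2 / 2)"
    by (metis cosh_real_pos exp_le_cancel_iff exp_ln)
  then show ?thesis by (simp add: cosh_field_def)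
qed

text \<open>Chernoff's bound in counting form: the exponential moment under the uniform law on sign
  vectors is a product over coordinates. Counting suits the later use, where sign vectors are
  averaged pointwise in the sample.\<close>

lemma signs_tail_one_sided:
  assumes V: "(\<Sum>i=1..n. (a i)\<^sup>2) \<le> V" "0 < V" and t: "0 \<le> t"
  shows "real (card {s\<in>signs n. t \<le> (\<Sum>i=1..n. a i * s i)}) \<le> 2 ^ n * exp (- (t\<^sup>2 / (2 * V)))"
proof -
  \<comment> \<open>This value minimizes the exponent \<open>r^2 * V / 2 - r * t\<close>.\<close>
  define r where "r = t / V"
  have r: "0 \<le> r" using t V by (simp add: r_def)
  have "real (card {s\<in>signs n. t \<le> (\<Sum>i=1..n. a i * s i)}) * exp (r * t)
      = (\<Sum>s\<in>{s\<in>signs n. t \<le> (\<Sum>i=1..n. a i * s i)}. exp (r * t))"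
    by simp
  also have "\<dots> \<le> (\<Sum>s\<in>{s\<in>signs n. t \<le> (\<Sum>i=1..n. a i * s i)}. exp (r * (\<Sum>i=1..n. a i * s i)))"
    using r by (intro sum_mono) (auto intro!: mult_left_mono)
  also have "\<dots> \<le> (\<Sum>s\<in>signs n. exp (r * (\<Sum>i=1..n. a i * s i)))"
    by (intro sum_mono2) auto
  also have "\<dots> = (\<Sum>s\<in>signs n. \<Prod>i=1..n. exp (r * a i * s i))"
    by (simp add: sum_distrib_left exp_sum mult.assoc)
  also have "\<dots> = (\<Prod>i=1..n. \<Sum>x\<in>{-1, 1}. exp (r * a i * x))"
    unfolding signs_def by (subst prod_sum_PiE) simp_all
  also have "\<dots> \<le> (\<Prod>i=1..n. 2 * exp ((r * a i)\<^sup>2 / 2))"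
    using exp_add_exp_minus_le by (intro prod_mono) (auto simp: add.commute)
  also have "\<dots> = 2 ^ n * exp (\<Sum>i=1..n. (r * a i)\<^sup>2 / 2)"
    by (simp add: prod.distrib exp_sum)
  also have "(\<Sum>i=1..n. (r * a i)\<^sup>2 / 2) = r\<^sup>2 / 2 * (\<Sum>i=1..n. (a i)\<^sup>2)"
    by (simp add: sum_distrib_left power_mult_distrib)
  also have "2 ^ n * exp (r\<^sup>2 / 2 * (\<Sum>i=1..n. (a i)\<^sup>2)) \<le> 2 ^ n * exp (r\<^sup>2 / 2 * V)"
    using V by (simp add: mult_left_mono)
  finally have "real (card {s\<in>signs n. t \<le> (\<Sum>i=1..n. a i * s i)}) \<le> 2 ^ n * exp (r\<^sup>2 / 2 * V) / exp (r * t)"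
    by (simp add: field_simps)
  also have "\<dots> = 2 ^ n * exp (r\<^sup>2 / 2 * V - r * t)"
    by (simp add: exp_diff)
  also have "r\<^sup>2 / 2 * V - r * t = - (t\<^sup>2 / (2 * V))"
    using V by (simp add: r_def field_simps power2_eq_square)
  finally show ?thesis .
qed

lemma signs_tail:
  assumes V: "(\<Sum>i=1..n. (a i)\<^sup>2) \<le> V" "0 < V" and t: "0 \<le> t"
  shows "real (card {s\<in>signs n. t \<le> \<bar>\<Sum>i=1..n. a i * s i\<bar>}) \<le> 2 ^ n * (2 * exp (- (t\<^sup>2 / (2 * V))))"
proof -
  have "{s\<in>signs n. t \<le> \<bar>\<Sum>i=1..n. a i * s i\<bar>} \<subseteq>
      {s\<in>signs n. t \<le> (\<Sum>i=1..n. a i * s i)} \<union> {s\<in>signs n. t \<le> (\<Sum>i=1..n. (- a i) * s i)}"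
    by (auto simp: sum_negf abs_real_def split: if_splits)
  then have "card {s\<in>signs n. t \<le> \<bar>\<Sum>i=1..n. a i * s i\<bar>} \<le>
      card ({s\<in>signs n. t \<le> (\<Sum>i=1..n. a i * s i)} \<union> {s\<in>signs n. t \<le> (\<Sum>i=1..n. (- a i) * s i)})"
    by (intro card_mono) auto
  also have "\<dots> \<le> card {s\<in>signs n. t \<le> (\<Sum>i=1..n. a i * s i)} + card {s\<in>signs n. t \<le> (\<Sum>i=1..n. (- a i) * s i)}"
    by (rule card_Un_le)
  finally have "real (card {s\<in>signs n. t \<le> \<bar>\<Sum>i=1..n. a i * s i\<bar>}) \<le>
     real (card {s\<in>signs n. t \<le> (\<Sum>i=1..n. a i * s i)}) + real (card {s\<in>signs n. t \<le> (\<Sum>i=1..n. (- a i) * s i)})"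
    by linarith
  also have "\<dots> \<le> 2 ^ n * exp (- (t\<^sup>2 / (2 * V))) + 2 ^ n * exp (- (t\<^sup>2 / (2 * V)))"
    using V t by (intro add_mono signs_tail_one_sided) auto
  finally show ?thesis by simp
qed

section \<open>The maximum over index pairs and elementary properties of local ranks\<close>

definition index_pairs :: "nat \<Rightarrow> (nat \<times> nat) set" where
  "index_pairs n = {(j, k). 1 \<le> j \<and> j < k \<and> k \<le> n}"

lemma finite_index_pairs [simp]: "finite (index_pairs n)"
  by (rule finite_subset[of _ "{1..n} \<times> {1..n}"]) (auto simp: index_pairs_def)

lemma index_pairs_nonempty: "2 \<le> n \<Longrightarrow> index_pairs n \<noteq> {}"
proof -
  assume "2 \<le> n"
  then have "(1, 2) \<in> index_pairs n" by (simp add: index_pairs_def)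
  then show ?thesis by blast
qed

lemma multiscale_stat_eq:
  "multiscale_stat \<psi> X n y = Max ((\<lambda>(j, k). \<bar>local_signed_rank_stat \<psi> X y j k\<bar> -
     sqrt (2 * ln (real n / real (k - j)))) ` index_pairs n)"
  unfolding multiscale_stat_def index_pairs_def by (intro arg_cong[where f = Max]) auto

lemma multiscale_stat_ge:
  assumes "1 \<le> j" "j < k" "k \<le> n"
  shows "\<bar>local_signed_rank_stat \<psi> X y j k\<bar> - sqrt (2 * ln (real n / real (k - j))) \<le> multiscale_stat \<psi> X n y"
  unfolding multiscale_stat_eq
  by (intro Max_ge finite_imageI finite_index_pairs image_eqI[of _ _ "(j, k)"])
    (use assms in \<open>simp_all add: index_pairs_def\<close>)

lemma local_rank_less:
  assumes "i \<in> {j..k}" "i' \<in> {j..k}" "\<bar>y i\<bar> < \<bar>y i'\<bar>"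
  shows "local_rank y j k i < local_rank y j k i'"
proof -
  have "i' \<in> {m\<in>{j..k}. \<bar>y m\<bar> \<le> \<bar>y i'\<bar>}" "i' \<notin> {m\<in>{j..k}. \<bar>y m\<bar> \<le> \<bar>y i\<bar>}" using assms by auto
  moreover have "{m\<in>{j..k}. \<bar>y m\<bar> \<le> \<bar>y i\<bar>} \<subseteq> {m\<in>{j..k}. \<bar>y m\<bar> \<le> \<bar>y i'\<bar>}" using assms by auto
  ultimately show ?thesis unfolding local_rank_def by (intro psubset_card_mono) auto
qed

lemma inj_on_local_rank:
  assumes "inj_on (\<lambda>i. \<bar>y i\<bar>) {j..k}"
  shows "inj_on (local_rank y j k) {j..k}"
proof (rule inj_onI, rule ccontr)
  fix i i' assume *: "i \<in> {j..k}" "i' \<in> {j..k}" "local_rank y j k i = local_rank y j k i'" "i \<noteq> i'"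
  then have "\<bar>y i\<bar> \<noteq> \<bar>y i'\<bar>" using assms by (auto simp: inj_on_def)
  then consider "\<bar>y i\<bar> < \<bar>y i'\<bar>" | "\<bar>y i'\<bar> < \<bar>y i\<bar>" by linarith
  then show False using local_rank_less[of i j k i' y] local_rank_less[of i' j k i y] * by cases auto
qed

lemma local_rank_pos: "i \<in> {j..k} \<Longrightarrow> 1 \<le> local_rank y j k i"
  unfolding local_rank_def by (simp add: Suc_le_eq card_gt_0_iff) blast

section \<open>Chaining over intervals\<close>

text \<open>Rounding down to an index congruent to 1 modulo \<open>2 ^ s\<close>. Since indices
  start at 1, the rounding acts on \<open>j - 1\<close> and never leaves the index range.\<close>

definition dyad :: "nat \<Rightarrow> nat \<Rightarrow> nat" where
  "dyad s j = 1 + 2 ^ s * ((j - 1) div 2 ^ s)"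

lemma dyad_ge_1: "1 \<le> dyad s j"
  by (simp add: dyad_def)

lemma dyad_le: "1 \<le> j \<Longrightarrow> dyad s j \<le> j"
  using times_div_less_eq_dividend[of "2 ^ s" "j - 1"] unfolding dyad_def by linarith

lemma less_dyad_add: "j < dyad s j + 2 ^ s"
proof -
  have "j - 1 < 2 ^ s * ((j - 1) div 2 ^ s) + 2 ^ s"
    by (metis add.commute div_mod_decomp mult.commute mod_less_divisor nat_add_left_cancel_less zero_less_numeral zero_less_power)
  then show ?thesis by (simp add: dyad_def)
qed

lemma dyad_0: "1 \<le> j \<Longrightarrow> dyad 0 j = j"
  by (simp add: dyad_def)

text \<open>Because rounding is consistent across scales, a link of the chain is determined by its
  finer endpoint, so there are no more links than grid points on that scale.\<close>

lemma dyad_Suc_dyad: "dyad (Suc s) (dyad s j) = dyad (Suc s) j"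
  by (simp add: dyad_def mult.commute[of 2] div_mult2_eq)

text \<open>Passing to the next scale clears a single binary digit of \<open>j - 1\<close>.\<close>

lemma dyad_le_dyad_Suc: "dyad s j \<le> dyad (Suc s) j + 2 ^ s"
proof -
  define x where "x = (j - 1) div 2 ^ s"
  have "2 ^ s * x \<le> 2 ^ s * (2 * (x div 2) + 1)"
    by (intro mult_left_mono) auto
  moreover have "dyad s j = 1 + 2 ^ s * x" "dyad (Suc s) j = 1 + 2 ^ s * (2 * (x div 2))"
    by (simp_all only: dyad_def x_def power_Suc2 div_mult2_eq mult.assoc)
  ultimately show ?thesis by (simp add: distrib_left)
qed

definition grid :: "nat \<Rightarrow> nat \<Rightarrow> nat \<Rightarrow> (nat \<times> nat) set" where
  "grid n q s = {(j, k). 1 \<le> j \<and> j < k \<and> k \<le> n \<and> 2 ^ s dvd j - 1 \<and> 2 ^ s dvd k - 1 \<and>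
     2 ^ q \<le> 2 * (k - j) \<and> k - j \<le> 2 ^ (q + 2)}"

lemma finite_grid [simp]: "finite (grid n q s)"
  by (rule finite_subset[of _ "{1..n} \<times> {1..n}"]) (auto simp: grid_def)

text \<open>There are at most \<open>2 * n / 2 ^ s\<close> left endpoints and, for each, at most
  \<open>2 ^ (q + 2 - s)\<close> lengths.\<close>

lemma card_grid_le:
  assumes s: "s \<le> q" and q: "2 ^ q < n"
  shows "real (card (grid n q s)) \<le> 8 * (real n / 2 ^ q) * 4 ^ (q - s)"
proof -
  let ?f = "\<lambda>(A, d). (1 + 2 ^ s * A, 1 + 2 ^ s * A + 2 ^ s * d)"
  have "grid n q s \<subseteq> ?f ` ({0..(n - 1) div 2 ^ s} \<times> {1..2 ^ (q + 2 - s)})"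
  proof safe
    fix j k assume jk: "(j, k) \<in> grid n q s"
    then have dv: "2 ^ s dvd j - 1" "2 ^ s dvd k - 1" by (simp_all add: grid_def)
    from dv(1) obtain A where A: "j - 1 = 2 ^ s * A" by (rule dvdE)
    from dv(2) obtain B where B: "k - 1 = 2 ^ s * B" by (rule dvdE)
    have jk': "1 \<le> j" "j < k" "k \<le> n" "k - j \<le> 2 ^ (q + 2)" using jk by (auto simp: grid_def)
    have "2 ^ s * A < 2 ^ s * B" using jk' A B by linarith
    then have AB: "A < B" by simp
    have "2 ^ s * (B - A) = k - j"
      using A B jk' by (simp only: right_diff_distrib' A[symmetric] B[symmetric])
    then have "2 ^ s * (B - A) \<le> 2 ^ s * 2 ^ (q + 2 - s)"
      using jk' s by (simp flip: power_add)
    then have "B - A \<le> 2 ^ (q + 2 - s)" by simp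
    moreover have "A \<le> (n - 1) div 2 ^ s"
      using A jk' by (metis diff_le_mono div_le_mono less_imp_le_nat nonzero_mult_div_cancel_left order.trans power_not_zero zero_neq_numeral)
    moreover have "j = 1 + 2 ^ s * A" "k = 1 + 2 ^ s * A + 2 ^ s * (B - A)"
      using A B jk' AB \<open>2 ^ s * (B - A) = k - j\<close> by linarith+
    ultimately show "(j, k) \<in> ?f ` ({0..(n - 1) div 2 ^ s} \<times> {1..2 ^ (q + 2 - s)})"
      using AB by (intro image_eqI[of _ _ "(A, B - A)"]) auto
  qed
  then have "card (grid n q s) \<le> card (?f ` ({0..(n - 1) div 2 ^ s} \<times> {1..2 ^ (q + 2 - s)}))"
    by (intro card_mono) auto
  also have "\<dots> \<le> card ({0..(n - 1) div 2 ^ s} \<times> {1..(2::nat) ^ (q + 2 - s)})"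
    by (intro card_image_le) auto
  also have "\<dots> = ((n - 1) div 2 ^ s + 1) * 2 ^ (q + 2 - s)"
    by (simp add: card_cartesian_product)
  finally have "real (card (grid n q s)) \<le> real (((n - 1) div 2 ^ s + 1) * 2 ^ (q + 2 - s))"
    by linarith
  also have "\<dots> = (real ((n - 1) div 2 ^ s) + 1) * 2 ^ (q + 2 - s)"
    by (simp only: of_nat_mult of_nat_add of_nat_1 of_nat_power of_nat_numeral)
  also have "\<dots> \<le> (real n / 2 ^ s + real n / 2 ^ s) * 2 ^ (q + 2 - s)"
  proof (intro mult_right_mono add_mono)
    have "real ((n - 1) div 2 ^ s) \<le> real (n - 1) / real (2 ^ s)" by (rule of_nat_div_le_of_nat)
    also have "\<dots> \<le> real n / 2 ^ s" by (simp add: divide_right_mono)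
    finally show "real ((n - 1) div 2 ^ s) \<le> real n / 2 ^ s" .
    have "(2::real) ^ s \<le> 2 ^ q" using s by (intro power_increasing) auto
    also have "\<dots> \<le> real n" using q by (metis less_imp_le of_nat_le_iff of_nat_numeral of_nat_power)
    finally show "1 \<le> real n / 2 ^ s" by simp
  qed auto
  also have "(2::real) ^ (q + 2 - s) = 4 * 2 ^ (q - s)"
    using s by (simp only: diff_add_assoc2 power_add) simp
  also have "(real n / 2 ^ s + real n / 2 ^ s) * (4 * 2 ^ (q - s)) = 8 * (real n / 2 ^ q) * 4 ^ (q - s)"
  proof -
    have "(2::real) ^ q = 2 ^ s * 2 ^ (q - s)" using s by (simp flip: power_add)
    moreover have "(4::real) ^ (q - s) = 2 ^ (q - s) * 2 ^ (q - s)"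
      by (simp flip: power_mult_distrib)
    ultimately show ?thesis by (simp add: field_simps)
  qed
  finally show ?thesis .
qed

text \<open>Each endpoint moves by less than \<open>2 ^ s\<close>, which is at most a quarter of
  \<open>2 ^ q\<close> when \<open>s + 2 \<le> q\<close>; on scale 0 nothing moves.\<close>

lemma grid_dyad:
  assumes "1 \<le> j" "j < k" "k \<le> n" "2 ^ q \<le> k - j" "k - j < 2 ^ (q + 1)" "s = 0 \<or> s + 2 \<le> q"
  shows "(dyad s j, dyad s k) \<in> grid n q s"
proof (cases "s = 0")
  case True
  then show ?thesis using assms by (auto simp: grid_def dyad_0)
next
  case False
  then have s: "s + 2 \<le> q" using assms by auto
  have le: "(2::nat) ^ (s + 2) \<le> 2 ^ q" using s by (intro power_increasing) auto
  have 1: "dyad s j \<le> j" "j < dyad s j + 2 ^ s" "dyad s k \<le> k" "k < dyad s k + 2 ^ s"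
    using assms dyad_le[of j s] dyad_le[of k s] less_dyad_add by auto
  then have "dyad s j < dyad s k" "2 ^ q \<le> 2 * (dyad s k - dyad s j)" "dyad s k - dyad s j \<le> 2 ^ (q + 2)"
    using le assms 1 by (simp_all add: power_add)
  then show ?thesis using 1 assms dyad_ge_1 by (auto simp: grid_def dyad_def)
qed

text \<open>If \<open>m\<close> is the largest admissible scale, then \<open>ln (n / 2 ^ q)\<close>
  is at least \<open>(m - q) * ln 2\<close>, so the sum is dominated by a convergent series in
  \<open>m - q\<close>, whatever \<open>n\<close> is.\<close>

lemma sum_dyadic_scales_le:
  obtains S :: real where "0 < S"
    and "\<And>n::nat. (\<Sum>q | 2 ^ q < n. 1 / (1 + ln (real n / 2 ^ q))\<^sup>2) \<le> S"
proof -
  have sm: "summable (\<lambda>t. 4 / (1 + real t)\<^sup>2)"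
  proof -
    have "summable (\<lambda>t. 4 * inverse (real (Suc t) ^ 2))"
      using inverse_power_summable[of 2, where 'a = real] by (intro summable_mult) (subst summable_Suc_iff, simp)
    then show ?thesis by (simp add: field_simps)
  qed
  show thesis
  proof (rule that[of "suminf (\<lambda>t. 4 / (1 + real t)\<^sup>2)"])
    show "0 < suminf (\<lambda>t. 4 / (1 + real t)\<^sup>2)"
      by (intro suminf_pos sm) auto
    fix n :: nat
    have fin: "finite {q. 2 ^ q < n}"
      by (rule finite_subset[of _ "{..n}"]) (auto intro: less_imp_le less_trans[OF less_exp])
    show "(\<Sum>q | 2 ^ q < n. 1 / (1 + ln (real n / 2 ^ q))\<^sup>2) \<le> suminf (\<lambda>t. 4 / (1 + real t)\<^sup>2)"
    proof (cases "{q. 2 ^ q < n} = {}")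
      case True
      then show ?thesis by (simp only: sum.empty) (intro suminf_nonneg sm, auto)
    next
      case False
      define m where "m = Max {q. 2 ^ q < n}"
      have m: "2 ^ m < n" "\<And>q. 2 ^ q < n \<Longrightarrow> q \<le> m"
        using Max_in[OF fin False] Max_ge[OF fin] by (auto simp: m_def)
      have "(\<Sum>q | 2 ^ q < n. 1 / (1 + ln (real n / 2 ^ q))\<^sup>2) \<le> (\<Sum>q | 2 ^ q < n. 4 / (1 + real (m - q))\<^sup>2)"
      proof (rule sum_mono, clarsimp)
        fix q :: nat assume q: "2 ^ q < n"
        have "(2::real) ^ (m - q) = 2 ^ m / 2 ^ q" using m(2)[OF q] by (simp add: power_diff)
        also have "\<dots> \<le> real n / 2 ^ q"
          using m(1) by (intro divide_right_mono) (metis less_imp_le of_nat_le_iff of_nat_numeral of_nat_power, simp)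
        finally have "ln (2 ^ (m - q)) \<le> ln (real n / 2 ^ q)"
          using q by (intro ln_mono) auto
        moreover have "(1/2::real) \<le> ln 2" using ln2_ge_two_thirds by linarith
        then have "real (m - q) * (1/2) \<le> real (m - q) * ln 2" by (intro mult_left_mono) auto
        ultimately have "(1 + real (m - q)) / 2 \<le> 1 + ln (real n / 2 ^ q)"
          by (simp add: ln_realpow field_simps)
        then have "((1 + real (m - q)) / 2)\<^sup>2 \<le> (1 + ln (real n / 2 ^ q))\<^sup>2"
          by (intro power_mono) auto
        then have "1 / (1 + ln (real n / 2 ^ q))\<^sup>2 \<le> 1 / ((1 + real (m - q)) / 2)\<^sup>2"
          by (intro frac_le) auto
        then show "1 / (1 + ln (real n / 2 ^ q))\<^sup>2 \<le> 4 / (1 + real (m - q))\<^sup>2"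
          by (simp add: power_divide)
      qed
      also have "\<dots> = (\<Sum>t\<in>(\<lambda>q. m - q) ` {q. 2 ^ q < n}. 4 / (1 + real t)\<^sup>2)"
      proof (subst sum.reindex)
        show "inj_on (\<lambda>q. m - q) {q. 2 ^ q < n}"
          using m(2) by (intro inj_onI) (metis diff_diff_cancel mem_Collect_eq)
      qed simp
      also have "\<dots> \<le> suminf (\<lambda>t. 4 / (1 + real t)\<^sup>2)"
        using fin by (intro sum_le_suminf sm) auto
      finally show ?thesis .
    qed
  qed
qed

text \<open>With \<open>b = ln a\<close>, the power is the excess entropy of the coarsest grid, and
  the exponential is the cross term of the squared threshold. The shift by \<open>ln 2\<close> comes
  from taking that threshold at \<open>a / 2\<close>.\<close>

lemma powr_exp_sqrt_bounded:
  fixes p :: real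
  assumes "0 \<le> p"
  obtains S where "0 < S" "\<And>b. 0 \<le> b \<Longrightarrow> (1 + b) powr p * exp (- sqrt (2 * max 0 (b - ln 2))) \<le> S"
proof -
  have "((\<lambda>b::real. (1 + b) powr p * exp (- sqrt (2 * (b - ln 2)))) \<longlongrightarrow> 0) at_top"
    by real_asymp
  then have "eventually (\<lambda>b. (1 + b) powr p * exp (- sqrt (2 * (b - ln 2))) < 1) at_top"
    by (rule order_tendstoD(2)) simp
  then obtain b0 where b0: "\<And>b. b0 \<le> b \<Longrightarrow> (1 + b) powr p * exp (- sqrt (2 * (b - ln 2))) < 1"
    by (auto simp: eventually_at_top_linorder)
  define b1 where "b1 = max b0 1"
  show thesis
  proof (rule that[of "(1 + b1) powr p"])
    show "0 < (1 + b1) powr p" by (simp add: b1_def)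
    fix b :: real assume b: "0 \<le> b"
    show "(1 + b) powr p * exp (- sqrt (2 * max 0 (b - ln 2))) \<le> (1 + b1) powr p"
    proof (cases "b \<le> b1")
      case True
      have "(1 + b) powr p * exp (- sqrt (2 * max 0 (b - ln 2))) \<le> (1 + b1) powr p * 1"
        using True b assms by (intro mult_mono powr_mono2) auto
      then show ?thesis by simp
    next
      case False
      then have "b \<ge> b0" "b \<ge> 1" by (auto simp: b1_def)
      then have "max 0 (b - ln 2) = b - ln 2" using ln_2_less_1 by linarith
      then have "(1 + b) powr p * exp (- sqrt (2 * max 0 (b - ln 2))) \<le> 1"
        using b0[OF \<open>b \<ge> b0\<close>] by simp
      also have "1 \<le> (1 + b1) powr p"
        using assms by (intro ge_one_powr_ge_zero) (auto simp: b1_def)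
      finally show ?thesis .
    qed
  qed
qed

text \<open>The intervals of length about \<open>2^q\<close> are first approximated by those with endpoints in a grid of mesh
  \<open>2^q / 2^depth\<close>, where \<open>a = n / 2^q\<close>. This mesh is coarse enough that the entropy exceeds \<open>ln a\<close> only by a
  multiple of \<open>ln (1 + ln a)\<close>, and fine enough that the approximation error is of order \<open>1 / (1 + ln a)\<close>, which
  makes the remaining entropy \<open>ln a\<close> harmless.\<close>

definition depth :: "real \<Rightarrow> real \<Rightarrow> nat" where
  "depth \<beta> a = 2 + nat \<lceil>log 2 (1 + ln a) / \<beta>\<rceil>"

text \<open>From this depth on, the squared ratio of link threshold to link deviation, which grows
  like \<open>2 powr (\<beta> * r)\<close>, dominates the entropy \<open>ln a\<close> of the
  interval positions.\<close>

lemma depth_le: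
  assumes "0 < \<beta>" "1 \<le> a" "depth \<beta> a \<le> r"
  shows "1 + ln a \<le> 2 powr (\<beta> * real r)"
proof -
  have "log 2 (1 + ln a) / \<beta> \<le> real r"
    using assms(3) unfolding depth_def by linarith
  then have "log 2 (1 + ln a) \<le> \<beta> * real r" using assms by (simp add: field_simps)
  moreover have "0 < 1 + ln a" using assms by (simp add: add_pos_nonneg)
  ultimately show ?thesis using log_le_iff[of 2] by auto
qed

text \<open>The two extra levels in \<open>depth\<close> and the rounding up account for the factor
  \<open>4 ^ 3 = 64\<close>.\<close>

lemma four_pow_depth:
  assumes "0 < \<beta>" "1 \<le> a"
  shows "4 ^ depth \<beta> a \<le> 64 * (1 + ln a) powr (2 / \<beta>)"
proof -
  have l: "1 \<le> 1 + ln a" using assms by simp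
  then have "0 \<le> log 2 (1 + ln a)" by (subst zero_le_log_cancel_iff) auto
  then have "0 \<le> log 2 (1 + ln a) / \<beta>" using assms by simp
  then have "real (depth \<beta> a) \<le> 3 + log 2 (1 + ln a) / \<beta>" unfolding depth_def by linarith
  then have "4 powr real (depth \<beta> a) \<le> 4 powr (3 + log 2 (1 + ln a) / \<beta>)" by simp
  also have "\<dots> = 64 * 4 powr (log 2 (1 + ln a) / \<beta>)" by (simp add: powr_add)
  also have "(4::real) powr (log 2 (1 + ln a) / \<beta>) = (2 powr log 2 (1 + ln a)) powr (2 / \<beta>)"
  proof -
    have "(4::real) = 2 powr 2" by simp
    then show ?thesis by (simp only: powr_powr) (simp add: mult.commute)
  qed
  also have "2 powr log 2 (1 + ln a) = 1 + ln a" using l by (intro powr_log_cancel) auto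
  finally show ?thesis by (simp add: powr_realpow)
qed

lemma exp_minus_le_inverse_square:
  fixes x :: real
  assumes "0 < x"
  shows "exp (- x / 2) \<le> 8 / x\<^sup>2"
proof -
  have "(x / 2)\<^sup>2 / 2 \<le> exp (x / 2)"
    using exp_lower_Taylor_quadratic[of "x / 2"] assms by simp
  then have "inverse (exp (x / 2)) \<le> inverse ((x / 2)\<^sup>2 / 2)"
    using assms by (intro le_imp_inverse_le) auto
  then show ?thesis by (simp add: exp_minus field_simps power2_eq_square)
qed

text \<open>With \<open>l = ln (max 1 (a / 2))\<close>, the exponent is
  \<open>l + K * sqrt (2 * l) + K^2 / 2\<close>. The first term cancels the factor \<open>a\<close>
  up to 2, the second absorbs the polylogarithmic factor from \<open>depth\<close>, the third gives
  smallness in \<open>K\<close>. The constant is \<open>8 * 64 * 2 * 2\<close>.\<close>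

lemma base_scale_bound:
  assumes \<beta>: "0 < \<beta>" and K: "1 \<le> K" and a: "1 \<le> a"
    and S: "\<And>b. 0 \<le> b \<Longrightarrow> (1 + b) powr (2 / \<beta> + 2) * exp (- sqrt (2 * max 0 (b - ln 2))) \<le> S"
  shows "8 * a * 4 ^ depth \<beta> a * (2 * exp (- ((sqrt (2 * ln (max 1 (a / 2))) + K)\<^sup>2 / 2)))
     \<le> 2048 * S * exp (- K\<^sup>2 / 8) * (1 / (1 + ln a)\<^sup>2)"
proof -
  define b where "b = ln a"
  have b: "0 \<le> b" using a by (simp add: b_def)
  define l where "l = ln (max 1 (a / 2))"
  have l: "l = max 0 (b - ln 2)" "0 \<le> l"
    using a by (auto simp: l_def b_def max_def ln_div)
  have "exp (- ((sqrt (2 * l) + K)\<^sup>2 / 2)) = exp (- l) * exp (- K * sqrt (2 * l)) * exp (- K\<^sup>2 / 2)"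
    using l by (simp add: power2_sum field_simps flip: exp_add)
  also have "\<dots> \<le> (2 / a) * exp (- sqrt (2 * l)) * exp (- K\<^sup>2 / 8)"
  proof (intro mult_mono)
    have "exp l = max 1 (a / 2)" by (simp add: l_def)
    then have "a / 2 \<le> exp l" by simp
    then have "inverse (exp l) \<le> inverse (a / 2)" using a by (intro le_imp_inverse_le) auto
    then show "exp (- l) \<le> 2 / a" by (simp add: exp_minus)
    show "exp (- K * sqrt (2 * l)) \<le> exp (- sqrt (2 * l))" using K l by (simp add: mult_le_cancel_right1)
  qed (use a in auto)
  finally have 1: "exp (- ((sqrt (2 * l) + K)\<^sup>2 / 2)) \<le> (2 / a) * exp (- sqrt (2 * l)) * exp (- K\<^sup>2 / 8)" .
  have "8 * a * 4 ^ depth \<beta> a * (2 * exp (- ((sqrt (2 * l) + K)\<^sup>2 / 2))) \<le>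
    8 * a * (64 * (1 + b) powr (2 / \<beta>)) * (2 * ((2 / a) * exp (- sqrt (2 * l)) * exp (- K\<^sup>2 / 8)))"
    using a 1 four_pow_depth[OF \<beta> a] by (intro mult_mono) (auto simp: b_def)
  also have "\<dots> = 2048 * exp (- K\<^sup>2 / 8) * ((1 + b) powr (2 / \<beta>) * exp (- sqrt (2 * l)))"
    using a by simp
  also have "(1 + b) powr (2 / \<beta>) = (1 + b) powr (2 / \<beta> + 2) * (1 / (1 + b)\<^sup>2)"
    using b by (simp add: powr_add)
  also have "2048 * exp (- K\<^sup>2 / 8) * ((1 + b) powr (2 / \<beta> + 2) * (1 / (1 + b)\<^sup>2) * exp (- sqrt (2 * l)))
     = 2048 * exp (- K\<^sup>2 / 8) * (1 / (1 + b)\<^sup>2) * ((1 + b) powr (2 / \<beta> + 2) * exp (- sqrt (2 * l)))"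
    by simp
  also have "\<dots> \<le> 2048 * exp (- K\<^sup>2 / 8) * (1 / (1 + b)\<^sup>2) * S"
    using S[OF b] unfolding l by (intro mult_left_mono) auto
  finally show ?thesis unfolding l_def b_def by (simp add: field_simps)
qed

text \<open>Here \<open>r\<close> counts levels below \<open>q\<close>. The threshold decays like
  \<open>2 powr (- \<beta> * r / 2)\<close> and the standard deviation like its square: thresholds
  remain summable, yet the Gaussian exponent is \<open>K^2 * x / 2\<close> with growing
  \<open>x = 2 powr (\<beta> * r)\<close>. Since \<open>ln a \<le> x\<close> and
  \<open>4 ^ r = x powr (2 / \<beta>)\<close>, the number of links is at most exponential in
  \<open>x\<close>, and a large \<open>K\<close> wins.\<close>

lemma link_scale_bound:
  assumes \<beta>: "0 < \<beta>" and C: "0 < C" and K: "0 < K" "8 \<le> K\<^sup>2" "4 * (1 + 2 / \<beta>) \<le> K\<^sup>2"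
    and a: "1 \<le> a" and r: "depth \<beta> a \<le> r"
  shows "8 * a * 4 ^ r * (2 * exp (- ((2 * C * K * (2 powr (- \<beta> / 2)) ^ r)\<^sup>2 / (2 * (4 * C\<^sup>2 * (2 powr (- 2 * \<beta>)) ^ r)))))
     \<le> 1024 * exp (- K\<^sup>2 / 8) * (1 / (1 + ln a)\<^sup>2) * (2 powr (- 2 * \<beta>)) ^ r"
proof -
  define x where "x = 2 powr (\<beta> * real r)"
  have x: "1 + ln a \<le> x" "1 \<le> x" "0 < x"
    using depth_le[OF \<beta> a r] \<beta> by (auto simp: x_def intro: ge_one_powr_ge_zero)
  have p2: "(2 powr (- 2 * \<beta>)) ^ r = 1 / x\<^sup>2"
    by (simp add: x_def powr_minus powr_powr powr_realpow[symmetric] field_simps flip: powr_add)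
  have p1: "((2 powr (- \<beta> / 2)) ^ r)\<^sup>2 = 1 / x"
    by (simp add: x_def powr_minus powr_powr powr_realpow[symmetric] field_simps flip: powr_add)
  have "(2 * C * K * (2 powr (- \<beta> / 2)) ^ r)\<^sup>2 / (2 * (4 * C\<^sup>2 * (2 powr (- 2 * \<beta>)) ^ r)) = K\<^sup>2 * x / 2"
    unfolding power_mult_distrib p1 p2 using C x by (simp add: field_simps power2_eq_square)
  then have "8 * a * 4 ^ r * (2 * exp (- ((2 * C * K * (2 powr (- \<beta> / 2)) ^ r)\<^sup>2 / (2 * (4 * C\<^sup>2 * (2 powr (- 2 * \<beta>)) ^ r)))))
     = 16 * (a * 4 ^ r) * exp (- (K\<^sup>2 * x / 2))" by simp
  also have "\<dots> \<le> 16 * (exp x * exp (2 / \<beta> * x)) * exp (- (K\<^sup>2 * x / 2))"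
  proof (intro mult_right_mono mult_left_mono mult_mono)
    have "ln a \<le> x" using x by simp
    then show "a \<le> exp x" using a by (metis exp_le_cancel_iff exp_ln less_le_trans zero_less_one)
    have "(4::real) ^ r = x powr (2 / \<beta>)"
    proof -
      have "(4::real) = 2 powr 2" by simp
      then have "(4::real) ^ r = 2 powr (2 * real r)"
        by (metis powr_powr powr_realpow zero_less_numeral)
      then show ?thesis using \<beta> by (simp add: x_def powr_powr mult.commute)
    qed
    also have "\<dots> = exp (2 / \<beta> * ln x)" using x by (simp add: powr_def)
    also have "\<dots> \<le> exp (2 / \<beta> * x)" using x \<beta> ln_bound[of x] by (simp add: divide_right_mono)
    finally show "4 ^ r \<le> exp (2 / \<beta> * x)" .
  qed (use a in auto)
  also have "\<dots> = 16 * exp ((1 + 2 / \<beta> - K\<^sup>2 / 2) * x)"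
    by (simp add: algebra_simps flip: exp_add)
  also have "\<dots> \<le> 16 * exp (- K\<^sup>2 / 4 * x)"
  proof -
    have "(1 + 2 / \<beta> - K\<^sup>2 / 2) * x \<le> (- K\<^sup>2 / 4) * x"
      using K x by (intro mult_right_mono) auto
    then show ?thesis by simp
  qed
  \<comment> \<open>Half of \<open>K^2 * x / 4\<close> is at least \<open>K^2 / 8\<close> because
    \<open>1 \<le> x\<close>, and the other half is at least \<open>x\<close> because
    \<open>8 \<le> K\<^sup>2\<close>. The two factors \<open>exp (- x / 2)\<close> yield summability
    over \<open>q\<close> and over \<open>r\<close> respectively.\<close>
  also have "\<dots> \<le> 16 * exp (- K\<^sup>2 / 8 + (- x / 2 + - x / 2))"
  proof -
    have "K\<^sup>2 * 1 \<le> K\<^sup>2 * x" "8 * x \<le> K\<^sup>2 * x" using K x by (auto intro: mult_left_mono mult_right_mono)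
    then show ?thesis by simp
  qed
  also have "\<dots> = 16 * exp (- K\<^sup>2 / 8) * (exp (- x / 2) * exp (- x / 2))"
    by (simp only: exp_add mult.assoc)
  also have "\<dots> \<le> 16 * exp (- K\<^sup>2 / 8) * (8 / (1 + ln a)\<^sup>2 * (8 / x\<^sup>2))"
  proof (intro mult_left_mono mult_mono)
    have "exp (- x / 2) \<le> 8 / x\<^sup>2" using exp_minus_le_inverse_square x by auto
    also have "\<dots> \<le> 8 / (1 + ln a)\<^sup>2"
      using x ln_ge_zero[OF a] by (intro frac_le power_mono zero_less_power add_pos_nonneg) auto
    finally show "exp (- x / 2) \<le> 8 / (1 + ln a)\<^sup>2" .
    show "exp (- x / 2) \<le> 8 / x\<^sup>2" using exp_minus_le_inverse_square x by auto
  qed auto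
  also have "\<dots> = 1024 * exp (- K\<^sup>2 / 8) * (1 / (1 + ln a)\<^sup>2) * (2 powr (- 2 * \<beta>)) ^ r"
    unfolding p2 by simp
  finally show ?thesis .
qed

lemma abs_sum_dyad_telescope:
  fixes w :: "nat \<Rightarrow> nat \<Rightarrow> nat \<Rightarrow> real"
  assumes "1 \<le> j" "1 \<le> k"
  shows "\<bar>\<Sum>i=1..n. w j k i * s i\<bar> \<le> \<bar>\<Sum>i=1..n. w (dyad m j) (dyad m k) i * s i\<bar> +
    (\<Sum>r<m. \<bar>\<Sum>i=1..n. (w (dyad r j) (dyad r k) i - w (dyad (Suc r) j) (dyad (Suc r) k) i) * s i\<bar>)"
proof (induction m)
  case 0
  then show ?case using assms by (simp add: dyad_0)
next
  case (Suc m)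
  have "\<bar>\<Sum>i=1..n. w (dyad m j) (dyad m k) i * s i\<bar> \<le> \<bar>\<Sum>i=1..n. w (dyad (Suc m) j) (dyad (Suc m) k) i * s i\<bar> +
     \<bar>\<Sum>i=1..n. (w (dyad m j) (dyad m k) i - w (dyad (Suc m) j) (dyad (Suc m) k) i) * s i\<bar>"
    by (simp add: left_diff_distrib sum_subtractf)
  then show ?case using Suc by simp
qed

text \<open>Rounding an endpoint on the scale \<open>s\<close> shifts an interval of length about \<open>2^q\<close> by at most \<open>2^s\<close>, so the links
  of the chain have standard deviations geometric in \<open>q - s\<close>. The excess entropy of the first link is absorbed by
  the cross term \<open>K * sqrt (2 * ln a)\<close> of the squared threshold, which leaves \<open>1 / (1 + ln a)\<^sup>2\<close>, summable over \<open>q\<close>.\<close>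

lemma chaining_explicit:
  fixes u :: "nat \<Rightarrow> nat \<Rightarrow> nat \<Rightarrow> real"
  assumes \<beta>: "0 < \<beta>" "\<beta> \<le> 1" and C: "0 < C" and K: "1 \<le> K" "8 \<le> K\<^sup>2" "4 * (1 + 2 / \<beta>) \<le> K\<^sup>2"
    and S2: "0 < S2" "\<And>b. 0 \<le> b \<Longrightarrow> (1 + b) powr (2 / \<beta> + 2) * exp (- sqrt (2 * max 0 (b - ln 2))) \<le> S2"
    and S3: "0 < S3" "\<And>n::nat. (\<Sum>q | 2 ^ q < n. 1 / (1 + ln (real n / 2 ^ q))\<^sup>2) \<le> S3"
    and U1: "\<And>j k. 1 \<le> j \<Longrightarrow> j < k \<Longrightarrow> k \<le> n \<Longrightarrow> (\<Sum>i=1..n. (u j k i)\<^sup>2) \<le> 1"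
    and U2: "\<And>j k j' k' d. 1 \<le> j' \<Longrightarrow> j' \<le> j \<Longrightarrow> j \<le> j' + d \<Longrightarrow> j' < k' \<Longrightarrow> k' \<le> k \<Longrightarrow> k \<le> k' + d \<Longrightarrow> k \<le> n \<Longrightarrow>
        0 < d \<Longrightarrow> 4 * d \<le> k - j \<Longrightarrow> (\<Sum>i=1..n. (u j k i - u j' k' i)\<^sup>2) \<le> C\<^sup>2 * (real d / real (k - j)) powr (2 * \<beta>)"
  shows "real (card {s\<in>signs n. \<exists>j k. 1 \<le> j \<and> j < k \<and> k \<le> n \<and>
           sqrt (2 * ln (real n / real (k - j))) + (K + 2 * C * K / (1 - 2 powr (- \<beta> / 2))) < \<bar>\<Sum>i=1..n. u j k i * s i\<bar>})
     \<le> (2048 * S2 + 1024 / (1 - 2 powr (- 2 * \<beta>))) * S3 * exp (- K\<^sup>2 / 8) * 2 ^ n"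
proof -
  define rb where "rb = 2 powr (- \<beta> / 2)"
  define rq where "rq = 2 powr (- 2 * \<beta>)"
  have rb: "0 < rb" "rb < 1" and rq: "0 < rq" "rq < 1"
    using \<beta> by (auto simp: rb_def rq_def powr_less_one)
  define Q where "Q = {q. 2 ^ q < n}"
  have fin: "finite Q" unfolding Q_def
    by (rule finite_subset[of _ "{..n}"]) (auto intro: less_imp_le less_trans[OF less_exp])
  define a where "a q = real n / 2 ^ q" for q :: nat
  \<comment> \<open>Truncated subtraction is intended: when the depth exceeds \<open>q\<close>, the
    base grid is the full one on scale 0 and there are no links.\<close>
  define s0 where "s0 q = q - depth \<beta> (a q)" for q
  \<comment> \<open>For lengths below \<open>2 ^ (q + 1)\<close> the ratio
    \<open>n / (k - j)\<close> is at least both 1 and \<open>a q / 2\<close>, so this common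
    threshold is at most that of each interval in the block.\<close>
  define \<tau> where "\<tau> q = sqrt (2 * ln (max 1 (a q / 2))) + K" for q
  define \<eta> where "\<eta> q s = 2 * C * K * rb ^ (q - s)" for q s :: nat
  define Bad where "Bad q = (\<Union>(j, k)\<in>grid n q (s0 q). {s\<in>signs n. \<tau> q \<le> \<bar>\<Sum>i=1..n. u j k i * s i\<bar>})" for q
  define Link where "Link q r = (\<Union>(j, k)\<in>grid n q r. {s\<in>signs n. \<eta> q r \<le>
      \<bar>\<Sum>i=1..n. (u j k i - u (dyad (Suc r) j) (dyad (Suc r) k) i) * s i\<bar>})" for q r
  have a1: "1 \<le> a q" if "q \<in> Q" for q
  proof -
    have "real (2 ^ q) \<le> real n" using that unfolding Q_def by (simp only: of_nat_le_iff) simp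
    then show ?thesis by (simp add: a_def)
  qed
  have finB: "finite (Bad q)" "finite (Link q r)" for q r
    unfolding Bad_def Link_def by auto
  have card_Bad: "real (card (Bad q)) \<le> 2048 * S2 * exp (- K\<^sup>2 / 8) * (1 / (1 + ln (a q))\<^sup>2) * 2 ^ n" if q: "q \<in> Q" for q
  proof -
    have "card (Bad q) \<le> (\<Sum>p\<in>grid n q (s0 q). card (case p of (j, k) \<Rightarrow> {s\<in>signs n. \<tau> q \<le> \<bar>\<Sum>i=1..n. u j k i * s i\<bar>}))"
      unfolding Bad_def by (intro card_UN_le) auto
    then have "real (card (Bad q)) \<le> (\<Sum>p\<in>grid n q (s0 q). real (card (case p of (j, k) \<Rightarrow> {s\<in>signs n. \<tau> q \<le> \<bar>\<Sum>i=1..n. u j k i * s i\<bar>})))"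
      by (simp only: of_nat_le_iff flip: of_nat_sum)
    also have "\<dots> \<le> (\<Sum>p\<in>grid n q (s0 q). 2 ^ n * (2 * exp (- ((\<tau> q)\<^sup>2 / 2))))"
    proof (rule sum_mono, clarify)
      fix j k assume "(j, k) \<in> grid n q (s0 q)"
      then have "1 \<le> j" "j < k" "k \<le> n" by (auto simp: grid_def)
      moreover have "0 \<le> \<tau> q" using K by (simp add: \<tau>_def)
      ultimately show "real (card {s\<in>signs n. \<tau> q \<le> \<bar>\<Sum>i=1..n. u j k i * s i\<bar>}) \<le> 2 ^ n * (2 * exp (- ((\<tau> q)\<^sup>2 / 2)))"
        using signs_tail[of "u j k" n 1 "\<tau> q"] U1 by simp
    qed
    also have "\<dots> = real (card (grid n q (s0 q))) * (2 * exp (- ((\<tau> q)\<^sup>2 / 2))) * 2 ^ n" by simp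
    also have "\<dots> \<le> 8 * a q * 4 ^ depth \<beta> (a q) * (2 * exp (- ((\<tau> q)\<^sup>2 / 2))) * 2 ^ n"
    proof (intro mult_right_mono)
      have "real (card (grid n q (s0 q))) \<le> 8 * a q * 4 ^ (q - s0 q)"
        unfolding a_def using q by (intro card_grid_le) (auto simp: Q_def s0_def)
      also have "\<dots> \<le> 8 * a q * 4 ^ depth \<beta> (a q)"
        using a1[OF q] by (intro mult_left_mono power_increasing) (auto simp: s0_def)
      finally show "real (card (grid n q (s0 q))) \<le> 8 * a q * 4 ^ depth \<beta> (a q)" .
    qed auto
    also have "\<dots> \<le> 2048 * S2 * exp (- K\<^sup>2 / 8) * (1 / (1 + ln (a q))\<^sup>2) * 2 ^ n"
      unfolding \<tau>_def by (intro mult_right_mono base_scale_bound \<beta>(1) K a1 q S2) auto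
    finally show ?thesis .
  qed
  have link_ok: "r + 3 \<le> q" "depth \<beta> (a q) \<le> q - r" if "r < s0 q" for q r
    using that by (auto simp: s0_def depth_def)
  have card_Link: "real (card (Link q r)) \<le> 1024 * exp (- K\<^sup>2 / 8) * (1 / (1 + ln (a q))\<^sup>2) * rq ^ (q - r) * 2 ^ n"
    if q: "q \<in> Q" and r: "r < s0 q" for q r
  proof -
    have "card (Link q r) \<le> (\<Sum>p\<in>grid n q r. card (case p of (j, k) \<Rightarrow> {s\<in>signs n. \<eta> q r \<le>
      \<bar>\<Sum>i=1..n. (u j k i - u (dyad (Suc r) j) (dyad (Suc r) k) i) * s i\<bar>}))"
      unfolding Link_def by (intro card_UN_le) auto
    then have "real (card (Link q r)) \<le> (\<Sum>p\<in>grid n q r. real (card (case p of (j, k) \<Rightarrow> {s\<in>signs n. \<eta> q r \<le>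
      \<bar>\<Sum>i=1..n. (u j k i - u (dyad (Suc r) j) (dyad (Suc r) k) i) * s i\<bar>})))"
      by (simp only: of_nat_le_iff flip: of_nat_sum)
    also have "\<dots> \<le> (\<Sum>p\<in>grid n q r. 2 ^ n * (2 * exp (- ((\<eta> q r)\<^sup>2 / (2 * (4 * C\<^sup>2 * rq ^ (q - r)))))))"
    proof (rule sum_mono, clarify)
      fix j k assume jk: "(j, k) \<in> grid n q r"
      then have jk': "1 \<le> j" "j < k" "k \<le> n" "2 ^ r dvd j - 1" "2 ^ r dvd k - 1" "2 ^ q \<le> 2 * (k - j)"
        by (auto simp: grid_def)
      have dj: "dyad r j = j" "dyad r k = k" using jk' by (auto simp: dyad_def)
      have "(2::nat) ^ (r + 3) \<le> 2 ^ q" using link_ok[OF r] by (intro power_increasing) auto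
      then have 8: "4 * 2 ^ r \<le> k - j" using jk' by (simp add: power_add)
      have "(\<Sum>i=1..n. (u j k i - u (dyad (Suc r) j) (dyad (Suc r) k) i)\<^sup>2) \<le> C\<^sup>2 * (real (2 ^ r) / real (k - j)) powr (2 * \<beta>)"
      proof (intro U2)
        show "j \<le> dyad (Suc r) j + 2 ^ r" "k \<le> dyad (Suc r) k + 2 ^ r"
          using dyad_le_dyad_Suc[of r j] dyad_le_dyad_Suc[of r k] dj by auto
        then show "dyad (Suc r) j < dyad (Suc r) k"
          using 8 dyad_le[of j "Suc r"] jk' by linarith
      qed (use 8 jk' dyad_le dyad_ge_1 in auto)
      also have "\<dots> \<le> C\<^sup>2 * (2 * 2 ^ r / 2 ^ q) powr (2 * \<beta>)"
      proof (intro mult_left_mono powr_mono2)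
        have "real (2 ^ q) \<le> real (2 * (k - j))" using jk'(6) of_nat_le_iff by blast
        then have q2: "(2::real) ^ q / 2 \<le> real (k - j)" by simp
        have "real (2 ^ r) / real (k - j) \<le> 2 ^ r / (2 ^ q / 2)"
          using q2 by (intro frac_le) auto
        then show "real (2 ^ r) / real (k - j) \<le> 2 * 2 ^ r / 2 ^ q" by (simp add: mult.commute)
      qed (use \<beta> in auto)
      also have "(2 * 2 ^ r / 2 ^ q :: real) = 2 / 2 ^ (q - r)"
        using link_ok[OF r] by (simp add: power_diff)
      also have "C\<^sup>2 * (2 / 2 ^ (q - r)) powr (2 * \<beta>) = C\<^sup>2 * 2 powr (2 * \<beta>) * rq ^ (q - r)"
      proof -
        have "rq ^ (q - r) = (2 ^ (q - r)) powr (- (2 * \<beta>))"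
          by (simp add: rq_def powr_powr mult.commute flip: powr_realpow)
        then show ?thesis by (simp add: powr_divide powr_minus field_simps)
      qed
      also have "\<dots> \<le> C\<^sup>2 * 4 * rq ^ (q - r)"
      proof (intro mult_right_mono mult_left_mono)
        have "(2::real) powr (2 * \<beta>) \<le> 2 powr 2" using \<beta> by (intro powr_mono) auto
        then show "(2::real) powr (2 * \<beta>) \<le> 4" by simp
      qed (use rq in auto)
      finally have "(\<Sum>i=1..n. (u j k i - u (dyad (Suc r) j) (dyad (Suc r) k) i)\<^sup>2) \<le> 4 * C\<^sup>2 * rq ^ (q - r)"
        by (simp add: mult.commute)
      then show "real (card {s\<in>signs n. \<eta> q r \<le> \<bar>\<Sum>i=1..n. (u j k i - u (dyad (Suc r) j) (dyad (Suc r) k) i) * s i\<bar>})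
         \<le> 2 ^ n * (2 * exp (- ((\<eta> q r)\<^sup>2 / (2 * (4 * C\<^sup>2 * rq ^ (q - r))))))"
        using C K rb rq by (intro signs_tail) (auto simp: \<eta>_def)
    qed
    also have "\<dots> = real (card (grid n q r)) * (2 * exp (- ((\<eta> q r)\<^sup>2 / (2 * (4 * C\<^sup>2 * rq ^ (q - r)))))) * 2 ^ n" by simp
    also have "\<dots> \<le> 8 * a q * 4 ^ (q - r) * (2 * exp (- ((\<eta> q r)\<^sup>2 / (2 * (4 * C\<^sup>2 * rq ^ (q - r)))))) * 2 ^ n"
      unfolding a_def using q link_ok[OF r] by (intro mult_right_mono card_grid_le) (auto simp: Q_def)
    also have "\<dots> \<le> 1024 * exp (- K\<^sup>2 / 8) * (1 / (1 + ln (a q))\<^sup>2) * rq ^ (q - r) * 2 ^ n"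
      unfolding \<eta>_def rb_def rq_def using K
      by (intro mult_right_mono link_scale_bound \<beta>(1) C a1 q link_ok[OF r]) auto
    finally show ?thesis .
  qed
  \<comment> \<open>Off the bad sets, telescoping from the base scale down to scale 0 controls every
    interval: the base term stays below \<open>\<tau> q\<close>, and the link thresholds add up to a
    geometric series.\<close>
  have sub: "{s\<in>signs n. \<exists>j k. 1 \<le> j \<and> j < k \<and> k \<le> n \<and>
           sqrt (2 * ln (real n / real (k - j))) + (K + 2 * C * K / (1 - rb)) < \<bar>\<Sum>i=1..n. u j k i * s i\<bar>}
      \<subseteq> (\<Union>q\<in>Q. Bad q \<union> (\<Union>r<s0 q. Link q r))"
  proof (rule subsetI, rule ccontr, clarify)
    fix s j k
    assume s: "s \<in> signs n" and nin: "s \<notin> (\<Union>q\<in>Q. Bad q \<union> (\<Union>r<s0 q. Link q r))"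
      and jk: "1 \<le> j" "j < k" "k \<le> n"
      and gt: "sqrt (2 * ln (real n / real (k - j))) + (K + 2 * C * K / (1 - rb)) < \<bar>\<Sum>i=1..n. u j k i * s i\<bar>"
    obtain q where q: "2 ^ q \<le> k - j" "k - j < 2 ^ (q + 1)"
      using ex_power_ivl1[of 2 "k - j"] jk by (metis One_nat_def Suc_leI le_refl zero_less_diff)
    have qQ: "q \<in> Q" using q jk by (auto simp: Q_def)
    have gr: "(dyad r j, dyad r k) \<in> grid n q r" if "r \<le> s0 q" for r
    proof (rule grid_dyad)
      show "r = 0 \<or> r + 2 \<le> q" using that by (auto simp: s0_def depth_def)
    qed (use jk q in auto)
    have "\<bar>\<Sum>i=1..n. u (dyad (s0 q) j) (dyad (s0 q) k) i * s i\<bar> < \<tau> q"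
      using nin qQ gr[of "s0 q"] s unfolding Bad_def by force
    also have "\<tau> q \<le> sqrt (2 * ln (real n / real (k - j))) + K"
    proof -
      have "real (k - j) \<le> 2 ^ q * 2" using q(2) by (metis less_imp_le of_nat_le_iff of_nat_numeral of_nat_power power_Suc2 Suc_eq_plus1)
      then have "a q / 2 \<le> real n / real (k - j)"
        using jk by (simp add: a_def) (intro frac_le, auto)
      moreover have "1 \<le> real n / real (k - j)" using jk by simp
      ultimately show ?thesis by (simp add: \<tau>_def)
    qed
    finally have 1: "\<bar>\<Sum>i=1..n. u (dyad (s0 q) j) (dyad (s0 q) k) i * s i\<bar> < sqrt (2 * ln (real n / real (k - j))) + K" .
    have "(\<Sum>r<s0 q. \<bar>\<Sum>i=1..n. (u (dyad r j) (dyad r k) i - u (dyad (Suc r) j) (dyad (Suc r) k) i) * s i\<bar>)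
        \<le> (\<Sum>r<s0 q. \<eta> q r)"
    proof (rule sum_mono)
      fix r assume r: "r \<in> {..<s0 q}"
      then have "s \<notin> Link q r" using nin qQ by auto
      then have "\<bar>\<Sum>i=1..n. (u (dyad r j) (dyad r k) i - u (dyad (Suc r) (dyad r j)) (dyad (Suc r) (dyad r k)) i) * s i\<bar> < \<eta> q r"
        using gr[of r] r s unfolding Link_def by force
      then show "\<bar>\<Sum>i=1..n. (u (dyad r j) (dyad r k) i - u (dyad (Suc r) j) (dyad (Suc r) k) i) * s i\<bar> \<le> \<eta> q r"
        by (simp add: dyad_Suc_dyad)
    qed
    also have "\<dots> = 2 * C * K * (\<Sum>r\<in>(\<lambda>r. q - r) ` {..<s0 q}. rb ^ r)"
      unfolding \<eta>_def sum_distrib_left[symmetric]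
      by (subst sum.reindex) (auto simp: s0_def inj_on_def)
    also have "\<dots> \<le> 2 * C * K * (1 / (1 - rb))"
    proof (intro mult_left_mono)
      have "(\<Sum>r\<in>(\<lambda>r. q - r) ` {..<s0 q}. rb ^ r) \<le> suminf (\<lambda>r. rb ^ r)"
        using rb by (intro sum_le_suminf) (auto intro: summable_geometric)
      then show "(\<Sum>r\<in>(\<lambda>r. q - r) ` {..<s0 q}. rb ^ r) \<le> 1 / (1 - rb)"
        using rb by (simp add: suminf_geometric)
    qed (use C K in auto)
    finally have 2: "(\<Sum>r<s0 q. \<bar>\<Sum>i=1..n. (u (dyad r j) (dyad r k) i - u (dyad (Suc r) j) (dyad (Suc r) k) i) * s i\<bar>)
        \<le> 2 * C * K / (1 - rb)" by simp
    show False
      using abs_sum_dyad_telescope[of j k u s n "s0 q"] 1 2 gt jk by linarith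
  qed
  have "real (card {s\<in>signs n. \<exists>j k. 1 \<le> j \<and> j < k \<and> k \<le> n \<and>
           sqrt (2 * ln (real n / real (k - j))) + (K + 2 * C * K / (1 - rb)) < \<bar>\<Sum>i=1..n. u j k i * s i\<bar>})
      \<le> real (card (\<Union>q\<in>Q. Bad q \<union> (\<Union>r<s0 q. Link q r)))"
    using fin finB by (intro of_nat_mono card_mono sub) auto
  also have "\<dots> \<le> (\<Sum>q\<in>Q. real (card (Bad q)) + (\<Sum>r<s0 q. real (card (Link q r))))"
  proof -
    have "card (\<Union>q\<in>Q. Bad q \<union> (\<Union>r<s0 q. Link q r)) \<le> (\<Sum>q\<in>Q. card (Bad q \<union> (\<Union>r<s0 q. Link q r)))"
      using fin by (rule card_UN_le)
    also have "\<dots> \<le> (\<Sum>q\<in>Q. card (Bad q) + (\<Sum>r<s0 q. card (Link q r)))"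
      by (intro sum_mono order.trans[OF card_Un_le] add_left_mono card_UN_le) auto
    finally have "real (card (\<Union>q\<in>Q. Bad q \<union> (\<Union>r<s0 q. Link q r))) \<le> real (\<Sum>q\<in>Q. card (Bad q) + (\<Sum>r<s0 q. card (Link q r)))"
      by (rule of_nat_mono)
    then show ?thesis by simp
  qed
  also have "\<dots> \<le> (\<Sum>q\<in>Q. (2048 * S2 + 1024 / (1 - rq)) * exp (- K\<^sup>2 / 8) * 2 ^ n * (1 / (1 + ln (a q))\<^sup>2))"
  proof (rule sum_mono)
    fix q assume q: "q \<in> Q"
    have "(\<Sum>r<s0 q. real (card (Link q r))) \<le> (\<Sum>r<s0 q. 1024 * exp (- K\<^sup>2 / 8) * (1 / (1 + ln (a q))\<^sup>2) * 2 ^ n * rq ^ (q - r))"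
      using card_Link[OF q] by (intro sum_mono) (simp add: mult_ac)
    also have "\<dots> = 1024 * exp (- K\<^sup>2 / 8) * (1 / (1 + ln (a q))\<^sup>2) * 2 ^ n * (\<Sum>r\<in>(\<lambda>r. q - r) ` {..<s0 q}. rq ^ r)"
      unfolding sum_distrib_left[symmetric]
      by (subst sum.reindex) (auto simp: s0_def inj_on_def)
    also have "\<dots> \<le> 1024 * exp (- K\<^sup>2 / 8) * (1 / (1 + ln (a q))\<^sup>2) * 2 ^ n * (1 / (1 - rq))"
    proof (intro mult_left_mono)
      have "(\<Sum>r\<in>(\<lambda>r. q - r) ` {..<s0 q}. rq ^ r) \<le> suminf (\<lambda>r. rq ^ r)"
        using rq by (intro sum_le_suminf) (auto intro: summable_geometric)
      then show "(\<Sum>r\<in>(\<lambda>r. q - r) ` {..<s0 q}. rq ^ r) \<le> 1 / (1 - rq)"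
        using rq by (simp add: suminf_geometric)
    qed auto
    finally have "(\<Sum>r<s0 q. real (card (Link q r))) \<le> 1024 * exp (- K\<^sup>2 / 8) * (1 / (1 + ln (a q))\<^sup>2) * 2 ^ n * (1 / (1 - rq))" .
    then show "real (card (Bad q)) + (\<Sum>r<s0 q. real (card (Link q r)))
        \<le> (2048 * S2 + 1024 / (1 - rq)) * exp (- K\<^sup>2 / 8) * 2 ^ n * (1 / (1 + ln (a q))\<^sup>2)"
      using card_Bad[OF q] by (simp add: algebra_simps)
  qed
  also have "\<dots> = (2048 * S2 + 1024 / (1 - rq)) * exp (- K\<^sup>2 / 8) * 2 ^ n * (\<Sum>q\<in>Q. 1 / (1 + ln (a q))\<^sup>2)"
    by (simp add: sum_distrib_left)
  also have "\<dots> \<le> (2048 * S2 + 1024 / (1 - rq)) * exp (- K\<^sup>2 / 8) * 2 ^ n * S3"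
    using S3(2)[of n] S2(1) rq unfolding Q_def a_def by (intro mult_left_mono) (auto intro!: mult_nonneg_nonneg add_nonneg_nonneg)
  finally show ?thesis unfolding rb_def rq_def by (simp add: mult_ac)
qed

text \<open>The failure probability is a constant times \<open>exp (- K^2 / 8)\<close>, so a large
  \<open>K\<close> brings it below \<open>\<alpha>\<close>. The quantifier order is the point:
  \<open>K\<close> is fixed before \<open>n\<close> and the coefficients \<open>u\<close>.\<close>

lemma chaining:
  fixes \<beta> C \<alpha> :: real
  assumes \<beta>: "0 < \<beta>" "\<beta> \<le> 1" and C: "0 < C" and \<alpha>: "0 < \<alpha>"
  obtains K where "0 < K"
    and "\<And>n (u :: nat \<Rightarrow> nat \<Rightarrow> nat \<Rightarrow> real).
      (\<And>j k. 1 \<le> j \<Longrightarrow> j < k \<Longrightarrow> k \<le> n \<Longrightarrow> (\<Sum>i=1..n. (u j k i)\<^sup>2) \<le> 1) \<Longrightarrow>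
      (\<And>j k j' k' d. 1 \<le> j' \<Longrightarrow> j' \<le> j \<Longrightarrow> j \<le> j' + d \<Longrightarrow> j' < k' \<Longrightarrow> k' \<le> k \<Longrightarrow> k \<le> k' + d \<Longrightarrow> k \<le> n \<Longrightarrow>
        0 < d \<Longrightarrow> 4 * d \<le> k - j \<Longrightarrow> (\<Sum>i=1..n. (u j k i - u j' k' i)\<^sup>2) \<le> C\<^sup>2 * (real d / real (k - j)) powr (2 * \<beta>)) \<Longrightarrow>
      real (card {s\<in>signs n. \<exists>j k. 1 \<le> j \<and> j < k \<and> k \<le> n \<and>
           sqrt (2 * ln (real n / real (k - j))) + K < \<bar>\<Sum>i=1..n. u j k i * s i\<bar>}) \<le> \<alpha> * 2 ^ n"
proof -
  have "0 \<le> 2 / \<beta> + 2" using \<beta> by simp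
  then obtain S2 where S2: "0 < S2"
    "\<And>b. 0 \<le> b \<Longrightarrow> (1 + b) powr (2 / \<beta> + 2) * exp (- sqrt (2 * max 0 (b - ln 2))) \<le> S2"
    using powr_exp_sqrt_bounded by metis
  obtain S3 where S3: "0 < S3" "\<And>n::nat. (\<Sum>q | 2 ^ q < n. 1 / (1 + ln (real n / 2 ^ q))\<^sup>2) \<le> S3"
    using sum_dyadic_scales_le by metis
  define A where "A = (2048 * S2 + 1024 / (1 - 2 powr (- 2 * \<beta>))) * S3"
  have "((\<lambda>K::real. A * exp (- K\<^sup>2 / 8)) \<longlongrightarrow> 0) at_top" by real_asymp
  then have "eventually (\<lambda>K. A * exp (- K\<^sup>2 / 8) < \<alpha>) at_top"
    using \<alpha> by (rule order_tendstoD(2))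
  moreover have "eventually (\<lambda>K::real. 1 \<le> K) at_top" by (rule eventually_ge_at_top)
  moreover have "eventually (\<lambda>K::real. max 8 (4 * (1 + 2 / \<beta>)) \<le> K\<^sup>2) at_top"
  proof -
    have "filterlim (\<lambda>K::real. K\<^sup>2) at_top at_top" by real_asymp
    then show ?thesis by (simp only: filterlim_at_top)
  qed
  ultimately have "eventually (\<lambda>K. A * exp (- K\<^sup>2 / 8) < \<alpha> \<and> 1 \<le> K \<and> max 8 (4 * (1 + 2 / \<beta>)) \<le> K\<^sup>2) at_top"
    by eventually_elim auto
  then obtain K where K: "A * exp (- K\<^sup>2 / 8) < \<alpha>" "1 \<le> K" "8 \<le> K\<^sup>2" "4 * (1 + 2 / \<beta>) \<le> K\<^sup>2"
    by (auto simp: eventually_at_top_linorder)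
  have rb: "2 powr (- \<beta> / 2) < 1" using \<beta> by (simp add: powr_less_one)
  show thesis
  proof (rule that)
    show "0 < K + 2 * C * K / (1 - 2 powr (- \<beta> / 2))"
      using K C rb by (intro add_pos_nonneg divide_nonneg_nonneg) auto
    fix n and u :: "nat \<Rightarrow> nat \<Rightarrow> nat \<Rightarrow> real"
    assume U1: "\<And>j k. 1 \<le> j \<Longrightarrow> j < k \<Longrightarrow> k \<le> n \<Longrightarrow> (\<Sum>i=1..n. (u j k i)\<^sup>2) \<le> 1"
    assume U2: "\<And>j k j' k' d. 1 \<le> j' \<Longrightarrow> j' \<le> j \<Longrightarrow> j \<le> j' + d \<Longrightarrow> j' < k' \<Longrightarrow> k' \<le> k \<Longrightarrow> k \<le> k' + d \<Longrightarrow> k \<le> n \<Longrightarrow>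
        0 < d \<Longrightarrow> 4 * d \<le> k - j \<Longrightarrow> (\<Sum>i=1..n. (u j k i - u j' k' i)\<^sup>2) \<le> C\<^sup>2 * (real d / real (k - j)) powr (2 * \<beta>)"
    have "real (card {s\<in>signs n. \<exists>j k. 1 \<le> j \<and> j < k \<and> k \<le> n \<and>
           sqrt (2 * ln (real n / real (k - j))) + (K + 2 * C * K / (1 - 2 powr (- \<beta> / 2))) < \<bar>\<Sum>i=1..n. u j k i * s i\<bar>})
        \<le> A * exp (- K\<^sup>2 / 8) * 2 ^ n"
      unfolding A_def by (rule chaining_explicit[OF \<beta> C K(2-4) S2 S3 U1 U2])
    also have "\<dots> \<le> \<alpha> * 2 ^ n" using K by (intro mult_right_mono) auto
    finally show "real (card {s\<in>signs n. \<exists>j k. 1 \<le> j \<and> j < k \<and> k \<le> n \<and>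
           sqrt (2 * ln (real n / real (k - j))) + (K + 2 * C * K / (1 - 2 powr (- \<beta> / 2))) < \<bar>\<Sum>i=1..n. u j k i * s i\<bar>})
        \<le> \<alpha> * 2 ^ n" .
  qed
qed

section \<open>The statistic under sign flips\<close>

text \<open>The local kernel extended by 0 outside its interval, expressed through
  \<open>\<gamma>_opt\<close>. Sums over different intervals can then run over the same index set
  \<open>{1..n}\<close> and be compared as vectors.\<close>

definition hat :: "real \<Rightarrow> (nat \<Rightarrow> real) \<Rightarrow> nat \<Rightarrow> nat \<Rightarrow> nat \<Rightarrow> real" where
  "hat \<beta> X j k i = \<gamma>_opt \<beta> (2 * ((X i - X j) / (X k - X j)) - 1)"

lemma \<gamma>_opt_bounds:
  assumes "0 < \<beta>"
  shows "0 \<le> \<gamma>_opt \<beta> x" "\<gamma>_opt \<beta> x \<le> 1"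
  using assms powr_le1[of \<beta> "\<bar>x\<bar>"] by (auto simp: \<gamma>_opt_def)

lemma \<gamma>_opt_diff_le:
  assumes "0 < \<beta>" "\<beta> \<le> 1"
  shows "\<bar>\<gamma>_opt \<beta> x - \<gamma>_opt \<beta> y\<bar> \<le> \<bar>x - y\<bar> powr \<beta>"
  using \<gamma>_opt_minimizes(1)[OF assms] by (auto simp: holder_class_def)

text \<open>The spacing bounds \<open>c1\<close> and \<open>c2\<close> are of order
  \<open>1 / n\<close>, but only their ratio \<open>\<kappa>\<close> enters the constants below,
  which keeps these uniform in \<open>n\<close>.\<close>

locale quasi_uniform_design =
  fixes X :: "nat \<Rightarrow> real" and n :: nat and c1 c2 \<kappa> :: real
  assumes c1: "0 < c1" and \<kappa>: "1 \<le> \<kappa>" "c2 \<le> \<kappa> * c1"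
    and X_lower: "\<And>i i'. 1 \<le> i \<Longrightarrow> i \<le> i' \<Longrightarrow> i' \<le> n \<Longrightarrow> c1 * real (i' - i) \<le> X i' - X i"
    and X_upper: "\<And>i i'. 1 \<le> i \<Longrightarrow> i \<le> i' \<Longrightarrow> i' \<le> n \<Longrightarrow> X i' - X i \<le> c2 * real (i' - i)"
begin

lemma X_less: "1 \<le> i \<Longrightarrow> i < i' \<Longrightarrow> i' \<le> n \<Longrightarrow> X i < X i'"
  using X_lower[of i i'] mult_pos_pos[OF c1, of "real (i' - i)"] by simp

lemma X_le: "1 \<le> i \<Longrightarrow> i \<le> i' \<Longrightarrow> i' \<le> n \<Longrightarrow> X i \<le> X i'"
  using X_less[of i i'] by (cases "i = i'") auto

lemma hat_eq_local_kernel: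
  assumes "1 \<le> j" "j < k" "k \<le> n" "j \<le> i" "i \<le> k"
  shows "local_kernel (\<psi>_opt \<beta>) (X j) (X k) (X i) = hat \<beta> X j k i"
proof -
  have "X j < X k" "X j \<le> X i" "X i \<le> X k" using X_less X_le assms by auto
  moreover define t where "t = (X i - X j) / (X k - X j)"
  ultimately have "0 \<le> t" "t \<le> 1" by auto
  then have "\<psi>_opt \<beta> t = \<gamma>_opt \<beta> (2 * t - 1)" by (simp add: \<psi>_opt_def \<gamma>_opt_def abs_le_iff)
  then show ?thesis by (simp only: local_kernel_def hat_def t_def)
qed

lemma hat_outside:
  assumes "1 \<le> j" "j < k" "k \<le> n" "1 \<le> i" "i \<le> n" "i < j \<or> k < i"
  shows "hat \<beta> X j k i = 0"
proof -
  have jk: "X j < X k" using X_less assms by auto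
  define t where "t = (X i - X j) / (X k - X j)"
  have "t < 0 \<or> 1 < t"
  proof (cases "i < j")
    case True
    then have "X i < X j" using assms X_less[of i j] by linarith
    then show ?thesis using jk by (simp add: t_def divide_less_0_iff)
  next
    case False
    then have "X k < X i" using assms X_less[of k i] by linarith
    then show ?thesis using jk by (simp add: t_def)
  qed
  then have "\<not> \<bar>2 * t - 1\<bar> \<le> 1" by (auto simp: abs_le_iff)
  then show ?thesis by (simp only: hat_def \<gamma>_opt_def t_def if_False)
qed

text \<open>The indices at least a quarter of the length away from both ends, where the kernel is
  bounded away from 0.\<close>

definition core :: "nat \<Rightarrow> nat \<Rightarrow> nat set" where
  "core j k = {i\<in>{j..k}. k - j \<le> 4 * (i - j) \<and> k - j \<le> 4 * (k - i)}"

text \<open>The core is empty for \<open>k = j + 1\<close>, so the interval must contain an interior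
  index.\<close>

lemma card_core:
  assumes "j + 2 \<le> k"
  shows "k - j \<le> 3 * card (core j k)"
proof -
  define m where "m = k - j"
  have k: "k = j + m" "2 \<le> m" using assms by (auto simp: m_def)
  have "{j + (m + 3) div 4..j + (3 * m) div 4} \<subseteq> core j k"
    unfolding core_def k(1) by auto
  then have "card {j + (m + 3) div 4..j + (3 * m) div 4} \<le> card (core j k)"
    by (intro card_mono) (auto simp: core_def)
  then have "Suc ((3 * m) div 4) - (m + 3) div 4 \<le> card (core j k)" by simp
  moreover have "m \<le> 3 * (Suc ((3 * m) div 4) - (m + 3) div 4)" 
  proof -
    have "3 * m \<le> 4 * ((3 * m) div 4) + 3" "4 * ((m + 3) div 4) \<le> m + 3"
      using div_mult_mod_eq[of "3 * m" 4] mod_less_divisor[of 4 "3 * m"] by linarith+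
    then show ?thesis using k(2) by linarith
  qed
  ultimately show ?thesis unfolding m_def by linarith
qed

text \<open>A quarter of the indices covers at least the fraction \<open>1 / (4 * \<kappa>)\<close>
  of the interval, so the rescaled position is within \<open>1 - 1 / (2 * \<kappa>)\<close> of the
  peak of the kernel.\<close>

lemma hat_core:
  assumes \<beta>: "0 < \<beta>" and jk: "1 \<le> j" "j < k" "k \<le> n" and i: "i \<in> core j k"
  shows "1 - (1 - 1 / (2 * \<kappa>)) powr \<beta> \<le> hat \<beta> X j k i"
proof -
  define t where "t = (X i - X j) / (X k - X j)"
  have i': "j \<le> i" "i \<le> k" "real (k - j) \<le> 4 * real (i - j)" "real (k - j) \<le> 4 * real (k - i)"
    using i by (auto simp: core_def)
  have W: "0 < X k - X j" using X_less jk by auto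
  have Wu: "X k - X j \<le> \<kappa> * c1 * real (k - j)"
  proof -
    have "X k - X j \<le> c2 * real (k - j)" using jk by (intro X_upper) auto
    also have "\<dots> \<le> \<kappa> * c1 * real (k - j)" using \<kappa>(2) by (intro mult_right_mono) auto
    finally show ?thesis .
  qed
  have W1: "X k - X j \<le> 4 * \<kappa> * y" if "real (k - j) \<le> 4 * l" "c1 * l \<le> y" for l y
  proof -
    have "\<kappa> * c1 * real (k - j) \<le> \<kappa> * c1 * (4 * l)"
      using that c1 \<kappa> by (intro mult_left_mono) auto
    moreover have "4 * \<kappa> * (c1 * l) \<le> 4 * \<kappa> * y"
      using that \<kappa> by (intro mult_left_mono) auto
    ultimately show ?thesis using Wu by (simp add: mult_ac)
  qed
  have "X k - X j \<le> 4 * \<kappa> * (X i - X j)" "X k - X j \<le> 4 * \<kappa> * (X k - X i)"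
    using X_lower[of j i] X_lower[of i k] i' jk by (auto intro!: W1)
  then have "1 / (4 * \<kappa>) \<le> t" "1 / (4 * \<kappa>) \<le> 1 - t"
    using W \<kappa> by (auto simp: t_def field_simps)
  then have t: "\<bar>2 * t - 1\<bar> \<le> 1 - 1 / (2 * \<kappa>)" by (simp add: abs_le_iff field_simps)
  moreover have "0 < 1 / (2 * \<kappa>)" using \<kappa> by simp
  ultimately have "\<bar>2 * t - 1\<bar> \<le> 1" by linarith
  then have "hat \<beta> X j k i = 1 - \<bar>2 * t - 1\<bar> powr \<beta>" by (simp add: hat_def \<gamma>_opt_def t_def)
  moreover have "\<bar>2 * t - 1\<bar> powr \<beta> \<le> (1 - 1 / (2 * \<kappa>)) powr \<beta>"
    using t \<beta> by (intro powr_mono2) auto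
  ultimately show ?thesis by simp
qed

lemma core_level_pos: "0 < \<beta> \<Longrightarrow> 0 < 1 - (1 - 1 / (2 * \<kappa>)) powr \<beta>"
proof -
  assume "0 < \<beta>"
  moreover have "0 \<le> 1 - 1 / (2 * \<kappa>)" "1 - 1 / (2 * \<kappa>) < 1" using \<kappa> by (auto simp: field_simps)
  ultimately show ?thesis using powr_less_mono2[of \<beta> "1 - 1 / (2 * \<kappa>)" 1] by simp
qed

text \<open>The kernel is \<open>\<beta>\<close>-Hoelder in the relative position, and moving the
  endpoints by \<open>d\<close> of \<open>k - j\<close> indices changes the relative position by a
  multiple of \<open>d / (k - j)\<close>. This is required also for indices lying in the larger of
  the two intervals only.\<close>

lemma hat_diff_le:
  assumes \<beta>: "0 < \<beta>" "\<beta> \<le> 1"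
    and jk: "1 \<le> j'" "j' \<le> j" "j \<le> j' + d" "j' < k'" "k' \<le> k" "k \<le> k' + d" "k \<le> n" "0 < d" "4 * d \<le> k - j"
    and i: "j' \<le> i" "i \<le> k"
  shows "\<bar>hat \<beta> X j k i - hat \<beta> X j' k' i\<bar> \<le> 8 * \<kappa>\<^sup>2 * (real d / real (k - j)) powr \<beta>"
proof -
  define m where "m = real (k - j)"
  define \<delta> where "\<delta> = real d"
  define W where "W = X k - X j"
  define W' where "W' = X k' - X j'"
  define x where "x = X i - X j"
  define y where "y = X j - X j'"
  have m: "0 < m" "4 * \<delta> \<le> m" "0 < \<delta>" using jk by (auto simp: m_def \<delta>_def)
  have c2: "0 \<le> c2"
  proof -
    have "c1 * m \<le> c2 * m" unfolding m_def using X_lower[of j k] X_upper[of j k] jk by linarith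
    then show ?thesis using m c1 by simp
  qed
  have "m - \<delta> \<le> real (k' - j')" using jk by (simp add: m_def \<delta>_def)
  then have m': "3 / 4 * m \<le> real (k' - j')" using m by simp
  have Wl: "c1 * m \<le> W" using X_lower[of j k] jk by (simp add: W_def m_def)
  have "c1 * (3 / 4 * m) \<le> c1 * real (k' - j')" using m' c1 by simp
  then have W'l: "3 / 4 * (c1 * m) \<le> W'" using X_lower[of j' k'] jk by (simp add: W'_def)
  have y: "0 \<le> y" "y \<le> c2 * \<delta>"
  proof -
    show "0 \<le> y" using X_le[of j' j] jk by (simp add: y_def)
    have "y \<le> c2 * real (j - j')" using X_upper[of j' j] jk by (simp add: y_def)
    also have "\<dots> \<le> c2 * \<delta>" using jk c2 by (intro mult_left_mono) (auto simp: \<delta>_def)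
    finally show "y \<le> c2 * \<delta>" .
  qed
  have kk: "0 \<le> X k - X k'" "X k - X k' \<le> c2 * \<delta>"
  proof -
    show "0 \<le> X k - X k'" using X_le[of k' k] jk by simp
    have "X k - X k' \<le> c2 * real (k - k')" using X_upper[of k' k] jk by simp
    also have "\<dots> \<le> c2 * \<delta>" using jk c2 by (intro mult_left_mono) (auto simp: \<delta>_def)
    finally show "X k - X k' \<le> c2 * \<delta>" .
  qed
  have x: "\<bar>x\<bar> \<le> c2 * m"
  proof (cases "j \<le> i")
    case True
    then have "0 \<le> x" "x \<le> c2 * real (i - j)" using X_le[of j i] X_upper[of j i] i jk by (auto simp: x_def)
    moreover have "c2 * real (i - j) \<le> c2 * m" using i jk c2 by (intro mult_left_mono) (auto simp: m_def)
    ultimately show ?thesis by simp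
  next
    case False
    then have "x \<le> 0" "- x \<le> y" using X_le[of i j] X_le[of j' i] i jk by (auto simp: x_def y_def)
    moreover have "c2 * \<delta> \<le> c2 * m" using m c2 by (intro mult_left_mono) auto
    ultimately show ?thesis using y by simp
  qed
  have pos: "0 < W" "0 < W'" using Wl W'l mult_pos_pos[OF c1 m(1)] by linarith+
  \<comment> \<open>The change of relative position splits into the shift of the left endpoint and
    the change of length, bounded by \<open>4/3 * \<kappa>\<close> and
    \<open>8/3 * \<kappa>\<^sup>2\<close> times \<open>\<delta> / m\<close>.\<close>
  have eq: "x / W - (x + y) / W' = - y / W' + x * (W' - W) / (W * W')"
    using pos by (simp add: field_simps)
  have 1: "\<bar>- y / W'\<bar> \<le> \<kappa> * c1 * \<delta> / (3 / 4 * (c1 * m))"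
  proof -
    have "y \<le> \<kappa> * c1 * \<delta>" using y \<kappa> m by (smt (verit) mult_right_mono)
    then have "y / W' \<le> \<kappa> * c1 * \<delta> / (3 / 4 * (c1 * m))"
      using y W'l c1 m by (intro frac_le) auto
    then show ?thesis using y pos by simp
  qed
  have 2: "\<bar>x * (W' - W) / (W * W')\<bar> \<le> (\<kappa> * c1 * m * (2 * (\<kappa> * c1 * \<delta>))) / (c1 * m * (3 / 4 * (c1 * m)))"
  proof -
    have "\<bar>W' - W\<bar> \<le> 2 * (\<kappa> * c1 * \<delta>)"
    proof -
      have "c2 * \<delta> \<le> \<kappa> * c1 * \<delta>" using \<kappa> m by (intro mult_right_mono) auto
      then show ?thesis using y kk by (simp add: W_def W'_def y_def abs_le_iff)
    qed
    moreover have "\<bar>x\<bar> \<le> \<kappa> * c1 * m" using x \<kappa> m by (smt (verit) mult_right_mono)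
    ultimately have "\<bar>x * (W' - W)\<bar> \<le> \<kappa> * c1 * m * (2 * (\<kappa> * c1 * \<delta>))"
      unfolding abs_mult by (intro mult_mono) auto
    moreover have "c1 * m * (3 / 4 * (c1 * m)) \<le> W * W'"
      using Wl W'l c1 m pos by (intro mult_mono) auto
    ultimately show ?thesis
      unfolding abs_divide using pos c1 m \<kappa>
      by (intro frac_le) (auto simp: abs_mult intro!: mult_nonneg_nonneg)
  qed
  have "\<bar>x / W - (x + y) / W'\<bar> \<le> 4 / 3 * (\<kappa> * (\<delta> / m)) + 8 / 3 * (\<kappa>\<^sup>2 * (\<delta> / m))"
  proof -
    have "\<kappa> * c1 * \<delta> / (3 / 4 * (c1 * m)) = 4 / 3 * (\<kappa> * (\<delta> / m))" using c1 m by simp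
    moreover have "(\<kappa> * c1 * m * (2 * (\<kappa> * c1 * \<delta>))) / (c1 * m * (3 / 4 * (c1 * m))) = 8 / 3 * (\<kappa>\<^sup>2 * (\<delta> / m))"
      using c1 m by (simp add: power2_eq_square)
    ultimately show ?thesis using 1 2 unfolding eq by linarith
  qed
  also have "\<dots> \<le> 4 * \<kappa>\<^sup>2 * (\<delta> / m)"
  proof -
    have "\<kappa> \<le> \<kappa>\<^sup>2" using \<kappa> by (simp add: power2_eq_square)
    then have "\<kappa> * (\<delta> / m) \<le> \<kappa>\<^sup>2 * (\<delta> / m)" using m by (intro mult_right_mono) auto
    moreover have "4 / 3 * p + 8 / 3 * q \<le> 4 * q" if "p \<le> q" for p q :: real using that by simp
    ultimately have "4 / 3 * (\<kappa> * (\<delta> / m)) + 8 / 3 * (\<kappa>\<^sup>2 * (\<delta> / m)) \<le> 4 * (\<kappa>\<^sup>2 * (\<delta> / m))" by blast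
    then show ?thesis by (simp only: mult.assoc)
  qed
  finally have u: "\<bar>x / W - (x + y) / W'\<bar> \<le> 4 * \<kappa>\<^sup>2 * (\<delta> / m)" .
  have "\<bar>hat \<beta> X j k i - hat \<beta> X j' k' i\<bar> \<le> \<bar>(2 * (x / W) - 1) - (2 * ((x + y) / W') - 1)\<bar> powr \<beta>"
  proof -
    have "x + y = X i - X j'" by (simp add: x_def y_def)
    then show ?thesis unfolding hat_def x_def[symmetric] W_def[symmetric] W'_def[symmetric]
      by (simp only:) (rule \<gamma>_opt_diff_le[OF \<beta>])
  qed
  also have "\<dots> \<le> (8 * \<kappa>\<^sup>2 * (\<delta> / m)) powr \<beta>"
  proof (intro powr_mono2)
    have "(2 * (x / W) - 1) - (2 * ((x + y) / W') - 1) = 2 * (x / W - (x + y) / W')" by argo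
    then show "\<bar>(2 * (x / W) - 1) - (2 * ((x + y) / W') - 1)\<bar> \<le> 8 * \<kappa>\<^sup>2 * (\<delta> / m)"
      using u by (simp only: abs_mult abs_numeral)
  qed (use \<beta> in auto)
  also have "\<dots> = (8 * \<kappa>\<^sup>2) powr \<beta> * (\<delta> / m) powr \<beta>"
    by (rule powr_mult)
  also have "\<dots> \<le> (8 * \<kappa>\<^sup>2) powr 1 * (\<delta> / m) powr \<beta>"
  proof (intro mult_right_mono powr_mono)
    have "1 \<le> \<kappa>\<^sup>2" using \<kappa> by simp
    then show "1 \<le> 8 * \<kappa>\<^sup>2" by linarith
  qed (use \<beta> in auto)
  also have "\<dots> = 8 * \<kappa>\<^sup>2 * (\<delta> / m) powr \<beta>" using \<kappa> by simp
  finally show ?thesis by (simp add: m_def \<delta>_def)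
qed

end

section \<open>Stability of ranks and of normalized coefficient vectors\<close>

lemma local_rank_le: "local_rank y j k i \<le> Suc k - j"
proof -
  have "local_rank y j k i \<le> card {j..k}" unfolding local_rank_def by (intro card_mono) auto
  then show ?thesis by simp
qed

text \<open>Both endpoints move in the same direction: one end only gains comparison indices and the
  other only loses them, so the error is \<open>d\<close> and not \<open>2 * d\<close>.\<close>

lemma local_rank_diff_le:
  assumes "j' \<le> j" "j \<le> j' + d" "k' \<le> k" "k \<le> k' + d"
  shows "\<bar>real (local_rank y j k i) - real (local_rank y j' k' i)\<bar> \<le> real d"
proof -
  let ?P = "\<lambda>m. \<bar>y m\<bar> \<le> \<bar>y i\<bar>"
  have "{m\<in>{j..k}. ?P m} \<subseteq> {m\<in>{j'..k'}. ?P m} \<union> {k'<..k}" using assms by auto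
  then have "card {m\<in>{j..k}. ?P m} \<le> card ({m\<in>{j'..k'}. ?P m} \<union> {k'<..k})" by (intro card_mono) auto
  also have "\<dots> \<le> card {m\<in>{j'..k'}. ?P m} + card {k'<..k}" by (rule card_Un_le)
  finally have 1: "local_rank y j k i \<le> local_rank y j' k' i + d" using assms by (simp add: local_rank_def)
  have "{m\<in>{j'..k'}. ?P m} \<subseteq> {m\<in>{j..k}. ?P m} \<union> {j'..<j}" using assms by auto
  then have "card {m\<in>{j'..k'}. ?P m} \<le> card ({m\<in>{j..k}. ?P m} \<union> {j'..<j})" by (intro card_mono) auto
  also have "\<dots> \<le> card {m\<in>{j..k}. ?P m} + card {j'..<j}" by (rule card_Un_le)
  finally have 2: "local_rank y j' k' i \<le> local_rank y j k i + d" using assms by (simp add: local_rank_def)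
  show ?thesis using 1 2 by linarith
qed

text \<open>Among \<open>N\<close> distinct positive integers at most half are bounded by
  \<open>N / 2\<close>; each of the others contributes at least \<open>(N / 2)^2\<close>.\<close>

lemma sum_squares_inj_ge:
  fixes R :: "nat \<Rightarrow> nat"
  assumes "finite A" "inj_on R A" "\<And>i. i \<in> A \<Longrightarrow> 1 \<le> R i"
  shows "real (card A) ^ 3 / 8 \<le> (\<Sum>i\<in>A. (real (R i))\<^sup>2)"
proof -
  define N where "N = card A"
  define S where "S = {i\<in>A. 2 * R i \<le> N}"
  have "card S = card (R ` S)" using assms(2) by (simp add: S_def card_image inj_on_def)
  also have "\<dots> \<le> card {1..N div 2}" using assms by (intro card_mono) (auto simp: S_def)
  finally have "card S \<le> N div 2" by simp
  moreover have "card (A - S) = N - card S" unfolding N_def using assms(1) by (intro card_Diff_subset) (auto simp: S_def)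
  ultimately have c: "real N / 2 \<le> real (card (A - S))" by linarith
  have "real N ^ 3 / 8 = real N / 2 * (real N / 2)\<^sup>2" by (simp add: power_divide power3_eq_cube power2_eq_square)
  also have "\<dots> \<le> real (card (A - S)) * (real N / 2)\<^sup>2" using c by (intro mult_right_mono) auto
  also have "\<dots> = (\<Sum>i\<in>A - S. (real N / 2)\<^sup>2)" by simp
  also have "\<dots> \<le> (\<Sum>i\<in>A - S. (real (R i))\<^sup>2)"
    by (intro sum_mono power_mono) (auto simp: S_def)
  also have "\<dots> \<le> (\<Sum>i\<in>A. (real (R i))\<^sup>2)" using assms by (intro sum_mono2) auto
  finally show ?thesis by (simp add: N_def)
qed

text \<open>The squared distance of two unit vectors is \<open>2 - 2 * c / (a * b)\<close> with
  \<open>c\<close> the inner product, and \<open>2 * a * b \<le> a^2 + b^2\<close> turns this into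
  the distance of the original vectors. No separate estimate for the difference of the norms is
  required.\<close>

lemma sum_normalized_diff_le:
  fixes v w :: "nat \<Rightarrow> real"
  assumes a: "0 < a" "(\<Sum>i\<in>A. (v i)\<^sup>2) = a\<^sup>2" and b: "0 < b" "(\<Sum>i\<in>A. (w i)\<^sup>2) = b\<^sup>2"
  shows "(\<Sum>i\<in>A. (v i / a - w i / b)\<^sup>2) \<le> (\<Sum>i\<in>A. (v i - w i)\<^sup>2) / (a * b)"
proof -
  define c where "c = (\<Sum>i\<in>A. v i * w i)"
  have "(\<Sum>i\<in>A. (v i / a - w i / b)\<^sup>2) = (\<Sum>i\<in>A. (v i)\<^sup>2) / a\<^sup>2 + (\<Sum>i\<in>A. (w i)\<^sup>2) / b\<^sup>2 - 2 * c / (a * b)"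
    by (simp add: power2_diff power_divide sum_subtractf sum.distrib sum_distrib_left sum_divide_distrib c_def mult_ac)
  also have "\<dots> = 2 - 2 * c / (a * b)" using a b by simp
  also have "\<dots> = (2 * (a * b) - 2 * c) / (a * b)" using a b by (simp add: diff_divide_distrib)
  also have "\<dots> \<le> (a\<^sup>2 + b\<^sup>2 - 2 * c) / (a * b)"
    using sum_squares_bound[of a b] a b by (intro divide_right_mono) (auto simp: mult_ac)
  also have "a\<^sup>2 + b\<^sup>2 - 2 * c = (\<Sum>i\<in>A. (v i - w i)\<^sup>2)"
    using a(2) b(2) by (simp add: power2_diff sum_subtractf sum.distrib sum_distrib_left c_def mult_ac)
  finally show ?thesis .
qed

definition rank_scale :: "real \<Rightarrow> (nat \<Rightarrow> real) \<Rightarrow> (nat \<Rightarrow> real) \<Rightarrow> nat \<Rightarrow> nat \<Rightarrow> nat \<Rightarrow> real" where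
  "rank_scale \<beta> X y n j k = sqrt (\<Sum>i=1..n. (hat \<beta> X j k i * real (local_rank y j k i))\<^sup>2)"

context quasi_uniform_design
begin

text \<open>On the core the weights are bounded below and, without ties, the ranks are distinct, so
  their squares add up to the order of the cubed length. The constant 216 is
  \<open>3 ^ 3 * 8\<close>, from \<open>card_core\<close> and
  \<open>sum_squares_inj_ge\<close>.\<close>

lemma rank_scale_ge:
  assumes \<beta>: "0 < \<beta>" and jk: "1 \<le> j" "j + 2 \<le> k" "k \<le> n" and y: "inj_on (\<lambda>i. \<bar>y i\<bar>) {1..n}"
  shows "(1 - (1 - 1 / (2 * \<kappa>)) powr \<beta>)\<^sup>2 / 216 * real (k - j) ^ 3 \<le> (rank_scale \<beta> X y n j k)\<^sup>2"
proof -
  define c where "c = 1 - (1 - 1 / (2 * \<kappa>)) powr \<beta>"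
  have c: "0 < c" using core_level_pos[OF \<beta>] by (simp add: c_def)
  have sub: "core j k \<subseteq> {j..k}" "core j k \<subseteq> {1..n}" "finite (core j k)" using jk by (auto simp: core_def)
  have inj: "inj_on (local_rank y j k) (core j k)"
    using inj_on_subset[OF inj_on_local_rank sub(1)] inj_on_subset[OF y] jk by auto
  have "c\<^sup>2 / 216 * real (k - j) ^ 3 = c\<^sup>2 * ((real (k - j) / 3) ^ 3 / 8)"
    by (simp add: power_divide)
  also have "\<dots> \<le> c\<^sup>2 * (real (card (core j k)) ^ 3 / 8)"
    using card_core[OF jk(2)] by (intro mult_left_mono divide_right_mono power_mono) auto
  also have "\<dots> \<le> c\<^sup>2 * (\<Sum>i\<in>core j k. (real (local_rank y j k i))\<^sup>2)"
    using sub by (intro mult_left_mono sum_squares_inj_ge inj local_rank_pos) auto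
  also have "\<dots> = (\<Sum>i\<in>core j k. (c * real (local_rank y j k i))\<^sup>2)"
    by (simp add: sum_distrib_left power_mult_distrib)
  also have "\<dots> \<le> (\<Sum>i\<in>core j k. (hat \<beta> X j k i * real (local_rank y j k i))\<^sup>2)"
    using hat_core[OF \<beta>] jk c by (intro sum_mono power_mono mult_right_mono) (auto simp: c_def)
  also have "\<dots> \<le> (\<Sum>i=1..n. (hat \<beta> X j k i * real (local_rank y j k i))\<^sup>2)"
    using sub by (intro sum_mono2) auto
  also have "\<dots> = (rank_scale \<beta> X y n j k)\<^sup>2" by (simp add: rank_scale_def sum_nonneg)
  finally show ?thesis by (simp add: c_def)
qed

text \<open>The default 0 for a vanishing denominator agrees with division by zero, so the case
  distinction disappears.\<close>

lemma local_signed_rank_stat_eq: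
  assumes jk: "1 \<le> j" "j < k" "k \<le> n"
  shows "local_signed_rank_stat (\<psi>_opt \<beta>) X y j k =
    (\<Sum>i=1..n. hat \<beta> X j k i * sgn (y i) * real (local_rank y j k i)) / rank_scale \<beta> X y n j k"
proof -
  have *: "(\<Sum>i=j..k. F (local_kernel (\<psi>_opt \<beta>) (X j) (X k) (X i)) i) = (\<Sum>i=1..n. F (hat \<beta> X j k i) i)"
    if "\<And>i. F 0 i = 0" for F :: "real \<Rightarrow> nat \<Rightarrow> real"
    using jk that by (intro sum.mono_neutral_cong_left) (auto simp: hat_eq_local_kernel hat_outside)
  show ?thesis
    using *[of "\<lambda>w i. w\<^sup>2 * (real (local_rank y j k i))\<^sup>2"] *[of "\<lambda>w i. w * sgn (y i) * real (local_rank y j k i)"]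
    by (simp add: local_signed_rank_stat_def Let_def rank_scale_def power_mult_distrib)
qed

text \<open>Sign flips keep absolute values, hence ranks and denominators. The statistic becomes
  linear in the flips, with a coefficient vector that does not depend on them.\<close>

lemma local_signed_rank_stat_signs:
  assumes jk: "1 \<le> j" "j < k" "k \<le> n" and s: "s \<in> signs n"
  shows "local_signed_rank_stat (\<psi>_opt \<beta>) X (\<lambda>i. s i * y i) j k =
    (\<Sum>i=1..n. sgn (y i) * hat \<beta> X j k i * real (local_rank y j k i) / rank_scale \<beta> X y n j k * s i)"
proof -
  have s1: "s i = -1 \<or> s i = 1" if "i \<in> {1..n}" for i
  proof -
    have "s i \<in> {-1, 1}" using s that unfolding signs_def by (rule PiE_mem)
    then show ?thesis by blast
  qed
  have s2: "\<bar>s i * y i\<bar> = \<bar>y i\<bar>" "sgn (s i * y i) = sgn (y i) * s i" if "i \<in> {1..n}" for i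
    using s1[OF that] by (auto simp: abs_mult sgn_mult)
  have r: "local_rank (\<lambda>i. s i * y i) j k i = local_rank y j k i" if "i \<in> {1..n}" for i
    unfolding local_rank_def using jk that by (intro arg_cong[where f = card]) (auto simp: s2)
  have "rank_scale \<beta> X (\<lambda>i. s i * y i) n j k = rank_scale \<beta> X y n j k"
    unfolding rank_scale_def by (intro arg_cong[where f = sqrt] sum.cong refl) (simp add: r)
  then have "local_signed_rank_stat (\<psi>_opt \<beta>) X (\<lambda>i. s i * y i) j k =
    (\<Sum>i=1..n. hat \<beta> X j k i * sgn (s i * y i) * real (local_rank (\<lambda>i. s i * y i) j k i)) / rank_scale \<beta> X y n j k"
    by (simp only: local_signed_rank_stat_eq[OF jk])
  also have "\<dots> = (\<Sum>i=1..n. sgn (y i) * hat \<beta> X j k i * real (local_rank y j k i) * s i) / rank_scale \<beta> X y n j k"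
    by (intro arg_cong2[where f = "(/)"] sum.cong refl) (simp only: r s2 mult_ac)
  finally show ?thesis by (simp add: sum_divide_distrib)
qed

text \<open>The change of kernel times rank is split into a kernel change weighted by the rank and a
  rank change weighted by the kernel. With \<open>m = k - j\<close>, each entry changes by order
  \<open>m * (d / m) powr \<beta>\<close>, at most \<open>2 * m\<close> entries are affected, and
  the squared norms are of order \<open>m ^ 3\<close>.\<close>

lemma increment_bound:
  assumes \<beta>: "0 < \<beta>" "\<beta> \<le> 1" and y: "inj_on (\<lambda>i. \<bar>y i\<bar>) {1..n}"
    and jk: "1 \<le> j'" "j' \<le> j" "j \<le> j' + d" "j' < k'" "k' \<le> k" "k \<le> k' + d" "k \<le> n" "0 < d" "4 * d \<le> k - j"
  defines "c \<equiv> (1 - (1 - 1 / (2 * \<kappa>)) powr \<beta>)\<^sup>2 / 216"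
  shows "(\<Sum>i=1..n. (sgn (y i) * hat \<beta> X j k i * real (local_rank y j k i) / rank_scale \<beta> X y n j k -
           sgn (y i) * hat \<beta> X j' k' i * real (local_rank y j' k' i) / rank_scale \<beta> X y n j' k')\<^sup>2)
     \<le> (51 * \<kappa>\<^sup>2 / sqrt c)\<^sup>2 * (real d / real (k - j)) powr (2 * \<beta>)"
proof -
  define m where "m = real (k - j)"
  define v where "v i = hat \<beta> X j k i * real (local_rank y j k i)" for i
  define v' where "v' i = hat \<beta> X j' k' i * real (local_rank y j' k' i)" for i
  define a where "a = rank_scale \<beta> X y n j k"
  define b where "b = rank_scale \<beta> X y n j' k'"
  define \<delta> where "\<delta> = (real d / m) powr \<beta>"
  have m: "4 \<le> m" "4 * real d \<le> m" "0 < real d" using jk by (auto simp: m_def)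
  have c: "0 < c" using core_level_pos[OF \<beta>(1)] by (simp add: c_def)
  have \<kappa>2: "1 \<le> \<kappa>\<^sup>2" using \<kappa> by simp
  have m': "m / 2 \<le> real (k' - j')" using jk by (simp add: m_def)
  have a2: "c * m ^ 3 \<le> a\<^sup>2" unfolding a_def m_def c_def
    using jk m y \<beta> by (intro rank_scale_ge) auto
  have "c * (m / 2) ^ 3 \<le> c * real (k' - j') ^ 3"
    using m' m c by (intro mult_left_mono power_mono) auto
  also have "\<dots> \<le> b\<^sup>2" unfolding b_def c_def
    using jk m y \<beta> by (intro rank_scale_ge) auto
  finally have b2: "c * m ^ 3 / 8 \<le> b\<^sup>2" by (simp add: power_divide)
  have ab0: "0 \<le> a" "0 \<le> b" by (auto simp: a_def b_def rank_scale_def intro!: sum_nonneg)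
  have cm: "0 < c * m ^ 3" using c m by simp
  then have ab: "0 < a" "0 < b" using a2 b2 ab0 by (auto simp: less_le)
  \<comment> \<open>The squared norms are at least \<open>p\<close> and \<open>p / 8\<close> for
    \<open>p = c * m ^ 3\<close>; this gives a lower bound \<open>p / 4\<close> for the product of
    the norms.\<close>
  have "(p / 4)\<^sup>2 \<le> p * (p / 8)" for p :: real by (simp add: power2_eq_square)
  then have "(c * m ^ 3 / 4)\<^sup>2 \<le> (c * m ^ 3) * (c * m ^ 3 / 8)" .
  also have "\<dots> \<le> a\<^sup>2 * b\<^sup>2" using a2 b2 cm by (intro mult_mono) auto
  finally have "(c * m ^ 3 / 4)\<^sup>2 \<le> (a * b)\<^sup>2" by (simp add: power_mult_distrib)
  then have abm: "c * m ^ 3 / 4 \<le> a * b" by (rule power2_le_imp_le) (use ab in simp)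
  have \<delta>: "real d / m \<le> \<delta>" "0 < \<delta>"
  proof -
    have "real d / m \<le> 1" "0 < real d / m" using m by auto
    then show "real d / m \<le> \<delta>" unfolding \<delta>_def using \<beta> powr_mono'[of \<beta> 1 "real d / m"] m by simp
    show "0 < \<delta>" unfolding \<delta>_def using m by simp
  qed
  have diff: "(v i - v' i)\<^sup>2 \<le> (18 * \<kappa>\<^sup>2 * m * \<delta>)\<^sup>2" if i: "j' \<le> i" "i \<le> k" for i
  proof -
    have "v i - v' i = (hat \<beta> X j k i - hat \<beta> X j' k' i) * real (local_rank y j k i)
       + hat \<beta> X j' k' i * (real (local_rank y j k i) - real (local_rank y j' k' i))"
      by (simp add: v_def v'_def algebra_simps)
    then have "\<bar>v i - v' i\<bar> \<le> \<bar>hat \<beta> X j k i - hat \<beta> X j' k' i\<bar> * real (local_rank y j k i)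
       + hat \<beta> X j' k' i * \<bar>real (local_rank y j k i) - real (local_rank y j' k' i)\<bar>"
      using \<gamma>_opt_bounds[OF \<beta>(1)] by (simp add: hat_def abs_mult order.trans[OF abs_triangle_ineq])
    also have "\<dots> \<le> (8 * \<kappa>\<^sup>2 * \<delta>) * (2 * m) + 1 * real d"
    proof (intro add_mono mult_mono)
      show "\<bar>hat \<beta> X j k i - hat \<beta> X j' k' i\<bar> \<le> 8 * \<kappa>\<^sup>2 * \<delta>"
        unfolding \<delta>_def m_def by (rule hat_diff_le) (use \<beta> jk i in auto)
      have "real (local_rank y j k i) \<le> real (Suc k - j)" using local_rank_le by (rule of_nat_mono)
      also have "\<dots> \<le> 2 * m" using jk m by (simp add: m_def)
      finally show "real (local_rank y j k i) \<le> 2 * m" .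
      show "hat \<beta> X j' k' i \<le> 1" using \<gamma>_opt_bounds[OF \<beta>(1)] by (simp add: hat_def)
      show "\<bar>real (local_rank y j k i) - real (local_rank y j' k' i)\<bar> \<le> real d"
        using jk by (intro local_rank_diff_le) auto
    qed (use \<delta> in auto)
    also have "real d \<le> 2 * \<kappa>\<^sup>2 * m * \<delta>"
    proof -
      have "real d \<le> m * \<delta>" using \<delta> m by (simp add: field_simps)
      also have "m * \<delta> \<le> \<kappa>\<^sup>2 * (m * \<delta>)" using mult_right_mono[OF \<kappa>2, of "m * \<delta>"] m \<delta> by simp
      also have "\<dots> \<le> 2 * (\<kappa>\<^sup>2 * (m * \<delta>))" using m \<delta> by simp
      finally show ?thesis by (simp add: mult.assoc)
    qed
    finally have "\<bar>v i - v' i\<bar> \<le> 18 * \<kappa>\<^sup>2 * m * \<delta>" by (simp add: algebra_simps)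
    then show ?thesis using abs_le_square_iff[of "v i - v' i" "18 * \<kappa>\<^sup>2 * m * \<delta>"] by linarith
  qed
  have "(\<Sum>i=1..n. (v i - v' i)\<^sup>2) = (\<Sum>i=j'..k. (v i - v' i)\<^sup>2)"
    using jk by (intro sum.mono_neutral_right) (auto simp: v_def v'_def hat_outside)
  also have "\<dots> \<le> (\<Sum>i=j'..k. (18 * \<kappa>\<^sup>2 * m * \<delta>)\<^sup>2)" by (intro sum_mono diff) auto
  also have "\<dots> = real (Suc k - j') * (18 * \<kappa>\<^sup>2 * m * \<delta>)\<^sup>2" by simp
  also have "\<dots> \<le> (2 * m) * (18 * \<kappa>\<^sup>2 * m * \<delta>)\<^sup>2"
    using jk m by (intro mult_right_mono) (auto simp: m_def)
  finally have E: "(\<Sum>i=1..n. (v i - v' i)\<^sup>2) \<le> 648 * \<kappa> ^ 4 * m ^ 3 * \<delta>\<^sup>2"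
    by (simp add: power_mult_distrib power2_eq_square power3_eq_cube power4_eq_xxxx mult_ac)
  have s1: "(\<Sum>i=1..n. (v i)\<^sup>2) = a\<^sup>2" "(\<Sum>i=1..n. (v' i)\<^sup>2) = b\<^sup>2"
    by (auto simp: a_def b_def rank_scale_def v_def v'_def sum_nonneg)
  have "(\<Sum>i=1..n. (sgn (y i) * hat \<beta> X j k i * real (local_rank y j k i) / a -
           sgn (y i) * hat \<beta> X j' k' i * real (local_rank y j' k' i) / b)\<^sup>2) \<le> (\<Sum>i=1..n. (v i / a - v' i / b)\<^sup>2)"
  proof (rule sum_mono)
    fix i
    have "(sgn (y i) * hat \<beta> X j k i * real (local_rank y j k i) / a -
           sgn (y i) * hat \<beta> X j' k' i * real (local_rank y j' k' i) / b)\<^sup>2 = (sgn (y i))\<^sup>2 * (v i / a - v' i / b)\<^sup>2"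
      by (simp add: v_def v'_def algebra_simps flip: power_mult_distrib)
    also have "\<dots> \<le> 1 * (v i / a - v' i / b)\<^sup>2" by (intro mult_right_mono) (auto simp: sgn_real_def)
    finally show "(sgn (y i) * hat \<beta> X j k i * real (local_rank y j k i) / a -
           sgn (y i) * hat \<beta> X j' k' i * real (local_rank y j' k' i) / b)\<^sup>2 \<le> (v i / a - v' i / b)\<^sup>2" by simp
  qed
  also have "\<dots> \<le> (\<Sum>i=1..n. (v i - v' i)\<^sup>2) / (a * b)"
    by (intro sum_normalized_diff_le s1 ab)
  also have "\<dots> \<le> 648 * \<kappa> ^ 4 * m ^ 3 * \<delta>\<^sup>2 / (c * m ^ 3 / 4)"
    using E abm cm by (intro frac_le) (use m in \<open>auto intro!: mult_nonneg_nonneg\<close>)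
  also have "\<dots> = 2592 * \<kappa> ^ 4 / c * \<delta>\<^sup>2" using m c by simp
  \<comment> \<open>\<open>2592 = 4 * 648\<close> is rounded up to the square of 51, so that the
    constant has the form \<open>C\<^sup>2\<close> expected by the chaining bound.\<close>
  also have "\<dots> \<le> 2601 * \<kappa> ^ 4 / c * \<delta>\<^sup>2" using c by (intro mult_right_mono divide_right_mono) auto
  also have "\<dots> = (51 * \<kappa>\<^sup>2 / sqrt c)\<^sup>2 * \<delta>\<^sup>2" using c by (simp add: power_divide power_mult_distrib)
  also have "\<delta>\<^sup>2 = (real d / m) powr (2 * \<beta>)"
    unfolding \<delta>_def using m by (subst powr_realpow[symmetric]) (auto simp: powr_powr mult.commute)
  finally show ?thesis unfolding a_def b_def m_def .
qed

end

text \<open>\<open>K\<close> is fixed before the design, the sample size and the vector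
  \<open>y\<close> of absolute values. This uniformity is what later bounds the critical value for
  all \<open>n\<close> and all rank vectors at once.\<close>

lemma null_tail:
  fixes \<beta> \<kappa> \<alpha> :: real
  assumes \<beta>: "0 < \<beta>" "\<beta> \<le> 1" and \<kappa>: "1 \<le> \<kappa>" and \<alpha>: "0 < \<alpha>"
  obtains K where "0 < K"
    and "\<And>X n c1 c2 (y :: nat \<Rightarrow> real). quasi_uniform_design X n c1 c2 \<kappa> \<Longrightarrow> 2 \<le> n \<Longrightarrow> inj_on (\<lambda>i. \<bar>y i\<bar>) {1..n} \<Longrightarrow>
      real (card {s\<in>signs n. K < multiscale_stat (\<psi>_opt \<beta>) X n (\<lambda>i. s i * y i)}) \<le> \<alpha> * 2 ^ n"
proof -
  define c where "c = (1 - (1 - 1 / (2 * \<kappa>)) powr \<beta>)\<^sup>2 / 216"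
  have "1 - 1 / (2 * \<kappa>) < 1" "0 \<le> 1 - 1 / (2 * \<kappa>)" using \<kappa> by (auto simp: field_simps)
  then have "(1 - 1 / (2 * \<kappa>)) powr \<beta> < 1" using \<beta> powr_less_mono2[of \<beta> "1 - 1 / (2 * \<kappa>)" 1] by simp
  then have "0 < c" by (simp add: c_def)
  then have "0 < 51 * \<kappa>\<^sup>2 / sqrt c" using \<kappa> by simp
  then obtain K where K: "0 < K"
    "\<And>n (u :: nat \<Rightarrow> nat \<Rightarrow> nat \<Rightarrow> real).
      (\<And>j k. 1 \<le> j \<Longrightarrow> j < k \<Longrightarrow> k \<le> n \<Longrightarrow> (\<Sum>i=1..n. (u j k i)\<^sup>2) \<le> 1) \<Longrightarrow>
      (\<And>j k j' k' d. 1 \<le> j' \<Longrightarrow> j' \<le> j \<Longrightarrow> j \<le> j' + d \<Longrightarrow> j' < k' \<Longrightarrow> k' \<le> k \<Longrightarrow> k \<le> k' + d \<Longrightarrow> k \<le> n \<Longrightarrow>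
        0 < d \<Longrightarrow> 4 * d \<le> k - j \<Longrightarrow> (\<Sum>i=1..n. (u j k i - u j' k' i)\<^sup>2) \<le> (51 * \<kappa>\<^sup>2 / sqrt c)\<^sup>2 * (real d / real (k - j)) powr (2 * \<beta>)) \<Longrightarrow>
      real (card {s\<in>signs n. \<exists>j k. 1 \<le> j \<and> j < k \<and> k \<le> n \<and>
           sqrt (2 * ln (real n / real (k - j))) + K < \<bar>\<Sum>i=1..n. u j k i * s i\<bar>}) \<le> \<alpha> * 2 ^ n"
    by (rule chaining[OF \<beta> _ \<alpha>]) blast
  show thesis
  proof (rule that[OF K(1)])
    fix X n c1 c2 and y :: "nat \<Rightarrow> real"
    assume "quasi_uniform_design X n c1 c2 \<kappa>" and n: "2 \<le> n" and y: "inj_on (\<lambda>i. \<bar>y i\<bar>) {1..n}"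
    then interpret quasi_uniform_design X n c1 c2 \<kappa> by simp
    define u where "u j k i = sgn (y i) * hat \<beta> X j k i * real (local_rank y j k i) / rank_scale \<beta> X y n j k" for j k i
    have U: "real (card {s\<in>signs n. \<exists>j k. 1 \<le> j \<and> j < k \<and> k \<le> n \<and>
           sqrt (2 * ln (real n / real (k - j))) + K < \<bar>\<Sum>i=1..n. u j k i * s i\<bar>}) \<le> \<alpha> * 2 ^ n"
    proof (rule K(2))
      fix j k
      \<comment> \<open>Equality can fail in general, as \<open>sgn 0 = 0\<close>; likewise a
        vanishing \<open>rank_scale\<close> makes the right-hand side 0 instead of 1.\<close>
      have "(\<Sum>i=1..n. (u j k i)\<^sup>2) \<le> (\<Sum>i=1..n. (hat \<beta> X j k i * real (local_rank y j k i))\<^sup>2) / (rank_scale \<beta> X y n j k)\<^sup>2"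
        unfolding sum_divide_distrib
      proof (rule sum_mono)
        fix i
        have "(u j k i)\<^sup>2 = (sgn (y i))\<^sup>2 * ((hat \<beta> X j k i * real (local_rank y j k i))\<^sup>2 / (rank_scale \<beta> X y n j k)\<^sup>2)"
          by (simp add: u_def power_mult_distrib power_divide)
        also have "\<dots> \<le> 1 * ((hat \<beta> X j k i * real (local_rank y j k i))\<^sup>2 / (rank_scale \<beta> X y n j k)\<^sup>2)"
          by (intro mult_right_mono) (auto simp: sgn_real_def)
        finally show "(u j k i)\<^sup>2 \<le> (hat \<beta> X j k i * real (local_rank y j k i))\<^sup>2 / (rank_scale \<beta> X y n j k)\<^sup>2" by simp
      qed
      also have "\<dots> \<le> 1" by (simp add: rank_scale_def sum_nonneg)
      finally show "(\<Sum>i=1..n. (u j k i)\<^sup>2) \<le> 1" .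
    next
      fix j k j' k' d :: nat
      assume "1 \<le> j'" "j' \<le> j" "j \<le> j' + d" "j' < k'" "k' \<le> k" "k \<le> k' + d" "k \<le> n" "0 < d" "4 * d \<le> k - j"
      then show "(\<Sum>i=1..n. (u j k i - u j' k' i)\<^sup>2) \<le> (51 * \<kappa>\<^sup>2 / sqrt c)\<^sup>2 * (real d / real (k - j)) powr (2 * \<beta>)"
        unfolding u_def c_def by (intro increment_bound \<beta> y) auto
    qed
    have "{s\<in>signs n. K < multiscale_stat (\<psi>_opt \<beta>) X n (\<lambda>i. s i * y i)} \<subseteq>
      {s\<in>signs n. \<exists>j k. 1 \<le> j \<and> j < k \<and> k \<le> n \<and>
           sqrt (2 * ln (real n / real (k - j))) + K < \<bar>\<Sum>i=1..n. u j k i * s i\<bar>}"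
    proof clarify
      fix s assume s: "s \<in> signs n" and gt: "K < multiscale_stat (\<psi>_opt \<beta>) X n (\<lambda>i. s i * y i)"
      have "multiscale_stat (\<psi>_opt \<beta>) X n (\<lambda>i. s i * y i) \<in>
        (\<lambda>(j, k). \<bar>local_signed_rank_stat (\<psi>_opt \<beta>) X (\<lambda>i. s i * y i) j k\<bar> - sqrt (2 * ln (real n / real (k - j)))) ` index_pairs n"
        unfolding multiscale_stat_eq by (intro Max_in finite_imageI finite_index_pairs) (use index_pairs_nonempty[OF n] in simp)
      then obtain p where p: "p \<in> index_pairs n" and "multiscale_stat (\<psi>_opt \<beta>) X n (\<lambda>i. s i * y i) =
          (case p of (j, k) \<Rightarrow> \<bar>local_signed_rank_stat (\<psi>_opt \<beta>) X (\<lambda>i. s i * y i) j k\<bar> - sqrt (2 * ln (real n / real (k - j))))"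
        by (rule imageE)
      moreover obtain j k where jk_eq: "p = (j, k)" by (cases p)
      ultimately have M: "multiscale_stat (\<psi>_opt \<beta>) X n (\<lambda>i. s i * y i) =
          \<bar>local_signed_rank_stat (\<psi>_opt \<beta>) X (\<lambda>i. s i * y i) j k\<bar> - sqrt (2 * ln (real n / real (k - j)))"
        by simp
      have jk: "1 \<le> j" "j < k" "k \<le> n" using p jk_eq by (simp_all add: index_pairs_def)
      have e: "local_signed_rank_stat (\<psi>_opt \<beta>) X (\<lambda>i. s i * y i) j k = (\<Sum>i=1..n. u j k i * s i)"
        unfolding local_signed_rank_stat_signs[OF jk s] u_def by (rule refl)
      have "sqrt (2 * ln (real n / real (k - j))) + K < \<bar>\<Sum>i=1..n. u j k i * s i\<bar>"
        using gt unfolding M e less_diff_eq by (subst add.commute)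
      then show "\<exists>j k. 1 \<le> j \<and> j < k \<and> k \<le> n \<and>
           sqrt (2 * ln (real n / real (k - j))) + K < \<bar>\<Sum>i=1..n. u j k i * s i\<bar>" using jk by blast
    qed
    then have "card {s\<in>signs n. K < multiscale_stat (\<psi>_opt \<beta>) X n (\<lambda>i. s i * y i)} \<le>
      card {s\<in>signs n. \<exists>j k. 1 \<le> j \<and> j < k \<and> k \<le> n \<and>
           sqrt (2 * ln (real n / real (k - j))) + K < \<bar>\<Sum>i=1..n. u j k i * s i\<bar>}"
      by (intro card_mono) auto
    then show "real (card {s\<in>signs n. K < multiscale_stat (\<psi>_opt \<beta>) X n (\<lambda>i. s i * y i)}) \<le> \<alpha> * 2 ^ n"
      using U by linarith
  qed
qed

section \<open>Measurability\<close>

lemma real_local_rank: "real (local_rank y j k i) = (\<Sum>m=j..k. if \<bar>y m\<bar> \<le> \<bar>y i\<bar> then 1 else 0)"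
  unfolding local_rank_def by (simp add: sum.If_cases Int_def)

lemma local_rank_cong:
  assumes "\<And>m. m \<in> {j..k} \<Longrightarrow> y m = z m" "y i = z i"
  shows "local_rank y j k i = local_rank z j k i"
  unfolding local_rank_def using assms by (intro arg_cong[where f = card]) auto

lemma local_signed_rank_stat_cong:
  assumes "\<And>m. m \<in> {j..k} \<Longrightarrow> y m = z m"
  shows "local_signed_rank_stat \<psi> X y j k = local_signed_rank_stat \<psi> X z j k"
proof -
  have "local_rank y j k i = local_rank z j k i" if "i \<in> {j..k}" for i
    using assms that by (intro local_rank_cong) auto
  then have "(\<Sum>i=j..k. (local_kernel \<psi> (X j) (X k) (X i))\<^sup>2 * (real (local_rank y j k i))\<^sup>2) =
      (\<Sum>i=j..k. (local_kernel \<psi> (X j) (X k) (X i))\<^sup>2 * (real (local_rank z j k i))\<^sup>2)"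
    "(\<Sum>i=j..k. local_kernel \<psi> (X j) (X k) (X i) * sgn (y i) * real (local_rank y j k i)) =
      (\<Sum>i=j..k. local_kernel \<psi> (X j) (X k) (X i) * sgn (z i) * real (local_rank z j k i))"
    using assms by (auto intro!: sum.cong)
  then show ?thesis by (simp only: local_signed_rank_stat_def Let_def)
qed

lemma multiscale_stat_cong:
  assumes "\<And>m. m \<in> {1..n} \<Longrightarrow> y m = z m"
  shows "multiscale_stat \<psi> X n y = multiscale_stat \<psi> X n z"
proof -
  have "local_signed_rank_stat \<psi> X y j k = local_signed_rank_stat \<psi> X z j k" if "1 \<le> j" "k \<le> n" for j k
    using assms that by (intro local_signed_rank_stat_cong) auto
  then show ?thesis unfolding multiscale_stat_eq
    by (intro arg_cong[where f = Max] image_cong) (auto simp: index_pairs_def)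
qed

lemma rank_vector_cong:
  assumes "\<And>m. m \<in> {1..n} \<Longrightarrow> y m = z m"
  shows "rank_vector n y = rank_vector n z"
  unfolding rank_vector_def using assms by (intro restrict_ext local_rank_cong) auto

lemma measurable_real_local_rank:
  assumes "\<And>m. m \<in> insert i {j..k} \<Longrightarrow> (\<lambda>\<omega>. y \<omega> m) \<in> borel_measurable N"
  shows "(\<lambda>\<omega>. real (local_rank (y \<omega>) j k i)) \<in> borel_measurable N"
  unfolding real_local_rank
proof (rule borel_measurable_sum)
  fix m assume "m \<in> {j..k}"
  then have [measurable]: "(\<lambda>\<omega>. y \<omega> m) \<in> borel_measurable N" "(\<lambda>\<omega>. y \<omega> i) \<in> borel_measurable N"
    using assms by auto
  show "(\<lambda>\<omega>. if \<bar>y \<omega> m\<bar> \<le> \<bar>y \<omega> i\<bar> then 1 else 0 :: real) \<in> borel_measurable N"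
    by measurable
qed

lemma measurable_local_signed_rank_stat:
  assumes "\<And>m. m \<in> {j..k} \<Longrightarrow> (\<lambda>\<omega>. y \<omega> m) \<in> borel_measurable N"
  shows "(\<lambda>\<omega>. local_signed_rank_stat \<psi> X (y \<omega>) j k) \<in> borel_measurable N"
proof -
  have r: "(\<lambda>\<omega>. real (local_rank (y \<omega>) j k i)) \<in> borel_measurable N" if "i \<in> {j..k}" for i
    using that assms by (intro measurable_real_local_rank) auto
  have s: "(\<lambda>\<omega>. sgn (y \<omega> i)) \<in> borel_measurable N" if "i \<in> {j..k}" for i
  proof -
    have [measurable]: "(\<lambda>\<omega>. y \<omega> i) \<in> borel_measurable N" by (rule assms[OF that])
    show ?thesis unfolding sgn_real_def by measurable
  qed
  define d where "d \<omega> = sqrt (\<Sum>i=j..k. (local_kernel \<psi> (X j) (X k) (X i))\<^sup>2 * (real (local_rank (y \<omega>) j k i))\<^sup>2)" for \<omega>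
  define a where "a \<omega> = (\<Sum>i=j..k. local_kernel \<psi> (X j) (X k) (X i) * sgn (y \<omega> i) * real (local_rank (y \<omega>) j k i))" for \<omega>
  have [measurable]: "d \<in> borel_measurable N" unfolding d_def
    by (intro borel_measurable_sqrt[THEN measurable_compose[rotated]] borel_measurable_sum borel_measurable_times borel_measurable_power r) simp_all
  have [measurable]: "a \<in> borel_measurable N" unfolding a_def
    by (intro borel_measurable_sum borel_measurable_times r s) simp_all
  have "(\<lambda>\<omega>. local_signed_rank_stat \<psi> X (y \<omega>) j k) = (\<lambda>\<omega>. if d \<omega> \<noteq> 0 then a \<omega> / d \<omega> else 0)"
    by (simp only: local_signed_rank_stat_def Let_def d_def a_def)
  also have "\<dots> \<in> borel_measurable N" by measurable
  finally show ?thesis .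
qed

lemma measurable_multiscale_stat:
  assumes "\<And>m. m \<in> {1..n} \<Longrightarrow> (\<lambda>\<omega>. y \<omega> m) \<in> borel_measurable N"
  shows "(\<lambda>\<omega>. multiscale_stat \<psi> X n (y \<omega>)) \<in> borel_measurable N"
proof -
  have "(\<lambda>\<omega>. Max ((\<lambda>p. case p of (j, k) \<Rightarrow> \<bar>local_signed_rank_stat \<psi> X (y \<omega>) j k\<bar> - sqrt (2 * ln (real n / real (k - j)))) ` index_pairs n))
      \<in> borel_measurable N"
  proof (rule borel_measurable_Max[OF finite_index_pairs])
    fix p assume p: "p \<in> index_pairs n"
    obtain j k where jk: "p = (j, k)" by (cases p)
    have [measurable]: "(\<lambda>\<omega>. local_signed_rank_stat \<psi> X (y \<omega>) j k) \<in> borel_measurable N"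
      by (rule measurable_local_signed_rank_stat, rule assms) (use p jk in \<open>auto simp: index_pairs_def\<close>)
    show "(\<lambda>\<omega>. case p of (j, k) \<Rightarrow> \<bar>local_signed_rank_stat \<psi> X (y \<omega>) j k\<bar> - sqrt (2 * ln (real n / real (k - j)))) \<in> borel_measurable N"
      unfolding jk prod.case by measurable
  qed
  then show ?thesis unfolding multiscale_stat_eq .
qed

lemma rank_vector_range: "rank_vector n y \<in> {1..n} \<rightarrow>\<^sub>E {1..n}"
proof (rule PiE_I)
  fix i assume i: "i \<in> {1..n}"
  have "card {m \<in> {1..n}. \<bar>y m\<bar> \<le> \<bar>y i\<bar>} \<le> card {1..n}" by (intro card_mono) auto
  moreover have "0 < card {m \<in> {1..n}. \<bar>y m\<bar> \<le> \<bar>y i\<bar>}" using i by (subst card_gt_0_iff) auto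
  ultimately show "rank_vector n y i \<in> {1..n}" using i by (simp add: rank_vector_def local_rank_def)
qed (simp only: rank_vector_def restrict_apply if_False)

lemma sets_rank_vector_eq:
  assumes "\<And>m. m \<in> {1..n} \<Longrightarrow> (\<lambda>\<omega>. y \<omega> m) \<in> borel_measurable N"
  shows "{\<omega>\<in>space N. rank_vector n (y \<omega>) = r} \<in> sets N"
proof -
  have m: "(\<lambda>\<omega>. real (local_rank (y \<omega>) 1 n i)) \<in> borel_measurable N" if "i \<in> {1..n}" for i
    by (rule measurable_real_local_rank, rule assms) (use that in auto)
  have "{\<omega>\<in>space N. rank_vector n (y \<omega>) = r} =
    {\<omega>\<in>space N. r \<in> extensional {1..n} \<and> (\<forall>i\<in>{1..n}. real (local_rank (y \<omega>) 1 n i) = real (r i))}"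
  proof -
    have "rank_vector n z = r \<longleftrightarrow> r \<in> extensional {1..n} \<and> (\<forall>i\<in>{1..n}. real (local_rank z 1 n i) = real (r i))" for z
    proof
      assume "rank_vector n z = r"
      then show "r \<in> extensional {1..n} \<and> (\<forall>i\<in>{1..n}. real (local_rank z 1 n i) = real (r i))"
        unfolding rank_vector_def by auto
    next
      assume *: "r \<in> extensional {1..n} \<and> (\<forall>i\<in>{1..n}. real (local_rank z 1 n i) = real (r i))"
      show "rank_vector n z = r"
        by (rule extensionalityI[of _ "{1..n}"]) (use * in \<open>auto simp: rank_vector_def\<close>)
    qed
    then show ?thesis by simp
  qed
  also have "\<dots> \<in> sets N"
  proof (intro sets.sets_Collect_conj sets.sets_Collect_const sets.sets_Collect_finite_All)
    fix i assume i: "i \<in> {1..n}"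
    note [measurable] = m[OF i]
    show "{\<omega>\<in>space N. real (local_rank (y \<omega>) 1 n i) = real (r i)} \<in> sets N" by measurable
  qed simp
  finally show ?thesis .
qed

text \<open>The critical value is an infimum depending on the rank vector. Splitting into the
  finitely many rank vectors makes it a constant on each piece.\<close>

lemma sets_test_rejects:
  assumes "\<And>m. m \<in> {1..n} \<Longrightarrow> (\<lambda>\<omega>. y \<omega> m) \<in> borel_measurable N"
  shows "{\<omega>\<in>space N. signed_rank_test M err \<psi> X n \<alpha> (y \<omega>) = 1} \<in> sets N"
proof -
  note [measurable] = measurable_multiscale_stat[of n y N \<psi> X, OF assms]
  have "{\<omega>\<in>space N. signed_rank_test M err \<psi> X n \<alpha> (y \<omega>) = 1} =
    (\<Union>r\<in>{1..n} \<rightarrow>\<^sub>E {1..n}. {\<omega>\<in>space N. rank_vector n (y \<omega>) = r} \<inter>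
       {\<omega>\<in>space N. critical_value M err \<psi> X n \<alpha> r < multiscale_stat \<psi> X n (y \<omega>)})"
  proof -
    have "signed_rank_test M err \<psi> X n \<alpha> z = 1 \<longleftrightarrow> critical_value M err \<psi> X n \<alpha> (rank_vector n z) < multiscale_stat \<psi> X n z" for z
      by (simp add: signed_rank_test_def)
    then show ?thesis
      by (intro set_eqI iffI; (elim UN_E)?) (rule UN_I[OF rank_vector_range], auto)
  qed
  also have "\<dots> \<in> sets N"
    by (intro sets.finite_UN sets.Int sets_rank_vector_eq assms finite_PiE) (auto, measurable)
  finally show ?thesis .
qed

lemma inj_on_abs_if_rank_vector:
  assumes "inj_on (rank_vector n y) {1..n}"
  shows "inj_on (\<lambda>i. \<bar>y i\<bar>) {1..n}"
proof (rule inj_onI)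
  fix i m assume "i \<in> {1..n}" "m \<in> {1..n}" "\<bar>y i\<bar> = \<bar>y m\<bar>"
  then have "rank_vector n y i = rank_vector n y m" by (simp add: rank_vector_def local_rank_def)
  then show "i = m" using \<open>i \<in> {1..n}\<close> \<open>m \<in> {1..n}\<close> by (rule inj_onD[OF assms])
qed

lemma rank_vector_signs:
  assumes "s \<in> signs n"
  shows "rank_vector n (\<lambda>i. s i * y i) = rank_vector n y"
proof -
  have "\<bar>s i * y i\<bar> = \<bar>y i\<bar>" if "i \<in> {1..n}" for i
  proof -
    have "s i \<in> {-1, 1}" using assms that unfolding signs_def by (rule PiE_mem)
    then show ?thesis by auto
  qed
  then show ?thesis unfolding rank_vector_def local_rank_def
    by (intro restrict_ext arg_cong[where f = card]) auto
qed

lemma rank_vector_permute: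
  assumes \<sigma>: "\<sigma> permutes {1..n}" and i: "i \<in> {1..n}"
  shows "rank_vector n (\<lambda>i. y (\<sigma> i)) i = rank_vector n y (\<sigma> i)"
proof -
  have im: "\<sigma> ` {1..n} = {1..n}" using \<sigma> by (rule permutes_image)
  have "{m \<in> \<sigma> ` {1..n}. \<bar>y m\<bar> \<le> \<bar>y (\<sigma> i)\<bar>} = \<sigma> ` {m \<in> {1..n}. \<bar>y (\<sigma> m)\<bar> \<le> \<bar>y (\<sigma> i)\<bar>}"
    by blast
  then have "{m \<in> {1..n}. \<bar>y m\<bar> \<le> \<bar>y (\<sigma> i)\<bar>} = \<sigma> ` {m \<in> {1..n}. \<bar>y (\<sigma> m)\<bar> \<le> \<bar>y (\<sigma> i)\<bar>}"
    unfolding im .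
  then have "card {m \<in> {1..n}. \<bar>y m\<bar> \<le> \<bar>y (\<sigma> i)\<bar>} = card {m \<in> {1..n}. \<bar>y (\<sigma> m)\<bar> \<le> \<bar>y (\<sigma> i)\<bar>}"
    by (simp only: card_image[OF inj_on_subset[OF permutes_inj[OF \<sigma>] subset_UNIV]])
  moreover have "\<sigma> i \<in> {1..n}" using permutes_in_image[OF \<sigma>] i by blast
  ultimately show ?thesis using i by (simp add: rank_vector_def local_rank_def)
qed

section \<open>The conditional null distribution\<close>

locale iid_symmetric_errors = prob_space M
  for M :: "'a measure" and err :: "nat \<Rightarrow> 'a \<Rightarrow> real" and f :: "real \<Rightarrow> real" and n :: nat +
  assumes f_nonneg: "\<And>y. 0 \<le> f y"
    and f_symmetric: "\<And>y. f (- y) = f y"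
    and f_measurable [measurable]: "f \<in> borel_measurable borel"
    and err_density: "\<And>i. i \<in> {1..n} \<Longrightarrow> distributed M lborel (err i) (\<lambda>y. ennreal (f y))"
    and err_indep: "indep_vars (\<lambda>_. borel) err {1..n}"
    and n_pos: "1 \<le> n"
begin

definition law :: "real measure" where
  "law = density lborel (\<lambda>y. ennreal (f y))"

lemma sets_law [simp, measurable_cong]: "sets law = sets borel"
  by (simp add: law_def)

lemma space_law [simp]: "space law = UNIV"
  by (simp add: law_def)

lemma err_measurable: "i \<in> {1..n} \<Longrightarrow> err i \<in> borel_measurable M"
  using err_density[of i] by (simp add: distributed_def)

lemma distr_err: "i \<in> {1..n} \<Longrightarrow> distr M borel (err i) = law"
  using distributed_distr_eq_density[OF err_density[of i]]
  by (simp add: law_def cong: distr_cong)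

lemma prob_space_law: "prob_space law"
  using distr_err[of 1] n_pos prob_space_distr[OF err_measurable[of 1]] by simp

lemma distr_uminus_law: "distr law borel uminus = law"
proof (rule measure_eqI)
  fix A assume "A \<in> sets (distr law borel uminus)"
  then have A [measurable]: "A \<in> sets borel" by simp
  have "emeasure (distr law borel uminus) A = emeasure law (uminus -` A)"
    by (subst emeasure_distr) auto
  also have "\<dots> = (\<integral>\<^sup>+x. ennreal (f x) * indicator (uminus -` A) x \<partial>lborel)"
    unfolding law_def by (subst emeasure_density) (auto intro: borel_measurable_uminus[THEN measurable_sets_borel])
  also have "\<dots> = (\<integral>\<^sup>+x. ennreal (f (- x)) * indicator A (- x) \<partial>lborel)"
    by (simp add: f_symmetric indicator_def)
  also have "\<dots> = (\<integral>\<^sup>+x. ennreal (f x) * indicator A x \<partial>lborel)"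
    using nn_integral_real_affine[of "\<lambda>x. ennreal (f x) * indicator A x" "-1" 0] by simp
  also have "\<dots> = emeasure law A" unfolding law_def by (subst emeasure_density) auto
  finally show "emeasure (distr law borel uminus) A = emeasure law A" .
qed simp

lemma distr_iid:
  assumes ind: "indep_vars (\<lambda>_. borel) Z {1..n}"
    and Z: "\<And>i. i \<in> {1..n} \<Longrightarrow> Z i \<in> borel_measurable M" "\<And>i. i \<in> {1..n} \<Longrightarrow> distr M borel (Z i) = law"
  shows "distr M (PiM {1..n} (\<lambda>_. borel)) (\<lambda>\<omega>. \<lambda>i\<in>{1..n}. Z i \<omega>) = PiM {1..n} (\<lambda>_. law)"
proof -
  have "distr M (PiM {1..n} (\<lambda>_. borel)) (\<lambda>\<omega>. \<lambda>i\<in>{1..n}. Z i \<omega>) = PiM {1..n} (\<lambda>i. distr M borel (Z i))"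
    by (rule iffD1[OF indep_vars_iff_distr_eq_PiM']) (use ind Z n_pos in auto)
  also have "\<dots> = PiM {1..n} (\<lambda>_. law)" using Z by (intro PiM_cong) auto
  finally show ?thesis .
qed

text \<open>Sign flips and permutations of the errors share one product law; through this identity
  the probability of an event can be computed after either operation.\<close>

lemma prob_iid_eq:
  assumes Z: "distr M (PiM {1..n} (\<lambda>_. borel)) (\<lambda>\<omega>. \<lambda>i\<in>{1..n}. Z i \<omega>) = PiM {1..n} (\<lambda>_. law)"
    and Zm: "\<And>i. i \<in> {1..n} \<Longrightarrow> Z i \<in> borel_measurable M"
    and E: "E \<in> sets (PiM {1..n} (\<lambda>_. borel))"
  shows "prob {\<omega>\<in>space M. (\<lambda>i\<in>{1..n}. Z i \<omega>) \<in> E} = measure (PiM {1..n} (\<lambda>_. law)) E"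
proof -
  have "(\<lambda>\<omega>. \<lambda>i\<in>{1..n}. Z i \<omega>) \<in> measurable M (PiM {1..n} (\<lambda>_. borel))"
    using Zm by (intro measurable_restrict) auto
  then show ?thesis unfolding Z[symmetric] using E by (subst measure_distr) (auto simp: vimage_def Int_def conj_commute)
qed

lemma distr_err_joint:
  "distr M (PiM {1..n} (\<lambda>_. borel)) (\<lambda>\<omega>. \<lambda>i\<in>{1..n}. err i \<omega>) = PiM {1..n} (\<lambda>_. law)"
  using err_indep err_measurable distr_err by (rule distr_iid)

lemma distr_err_signs:
  assumes "s \<in> signs n"
  shows "distr M (PiM {1..n} (\<lambda>_. borel)) (\<lambda>\<omega>. \<lambda>i\<in>{1..n}. s i * err i \<omega>) = PiM {1..n} (\<lambda>_. law)"
proof (rule distr_iid)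
  show "indep_vars (\<lambda>_. borel) (\<lambda>i \<omega>. s i * err i \<omega>) {1..n}"
    by (rule indep_vars_compose2[OF err_indep]) auto
  fix i assume i: "i \<in> {1..n}"
  note [measurable] = err_measurable[OF i]
  show "(\<lambda>\<omega>. s i * err i \<omega>) \<in> borel_measurable M" by measurable
  have "s i \<in> {-1, 1}" using assms i unfolding signs_def by (rule PiE_mem)
  then consider "s i = 1" | "s i = -1" by blast
  then show "distr M borel (\<lambda>\<omega>. s i * err i \<omega>) = law"
  proof cases
    case 1
    then show ?thesis using distr_err[OF i] by simp
  next
    case 2
    have "distr M borel (\<lambda>\<omega>. s i * err i \<omega>) = distr (distr M borel (err i)) borel uminus"
      by (subst distr_distr) (auto simp: 2 comp_def)
    then show ?thesis by (simp add: distr_err[OF i] distr_uminus_law)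
  qed
qed

lemma distr_err_permute:
  assumes "\<sigma> permutes {1..n}"
  shows "distr M (PiM {1..n} (\<lambda>_. borel)) (\<lambda>\<omega>. \<lambda>i\<in>{1..n}. err (\<sigma> i) \<omega>) = PiM {1..n} (\<lambda>_. law)"
proof -
  have mem: "\<sigma> i \<in> {1..n}" if "i \<in> {1..n}" for i using permutes_in_image[OF assms] that by blast
  have "distr M (PiM {1..n} (\<lambda>_. borel)) (\<lambda>\<omega>. \<lambda>i\<in>{1..n}. err (\<sigma> i) \<omega>) =
     distr (distr M (PiM {1..n} (\<lambda>_. borel)) (\<lambda>\<omega>. \<lambda>i\<in>{1..n}. err i \<omega>)) (PiM {1..n} (\<lambda>_. borel)) (\<lambda>z. \<lambda>i\<in>{1..n}. z (\<sigma> i))"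
  proof (subst distr_distr)
    show "(\<lambda>z. \<lambda>i\<in>{1..n}. z (\<sigma> i)) \<in> PiM {1..n} (\<lambda>_. borel) \<rightarrow>\<^sub>M PiM {1..n} (\<lambda>_. borel)"
      using mem by (intro measurable_restrict measurable_component_singleton)
    show "(\<lambda>\<omega>. \<lambda>i\<in>{1..n}. err i \<omega>) \<in> M \<rightarrow>\<^sub>M PiM {1..n} (\<lambda>_. borel)"
      by (intro measurable_restrict err_measurable)
    have "(\<lambda>i\<in>{1..n}. err (\<sigma> i) \<omega>) = ((\<lambda>z. \<lambda>i\<in>{1..n}. z (\<sigma> i)) \<circ> (\<lambda>\<omega>. \<lambda>i\<in>{1..n}. err i \<omega>)) \<omega>" for \<omega>
      using mem by (auto simp: fun_eq_iff)
    then show "distr M (PiM {1..n} (\<lambda>_. borel)) (\<lambda>\<omega>. \<lambda>i\<in>{1..n}. err (\<sigma> i) \<omega>) =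
      distr M (PiM {1..n} (\<lambda>_. borel)) ((\<lambda>z. \<lambda>i\<in>{1..n}. z (\<sigma> i)) \<circ> (\<lambda>\<omega>. \<lambda>i\<in>{1..n}. err i \<omega>))"
      by (intro distr_cong) auto
  qed
  also have "\<dots> = distr (PiM {1..n} (\<lambda>_. law)) (PiM {1..n} (\<lambda>_. law)) (\<lambda>z. \<lambda>i\<in>{1..n}. z (\<sigma> i))"
    unfolding distr_err_joint by (intro distr_cong sets_PiM_cong) auto
  also have "\<dots> = PiM {1..n} (\<lambda>_. law)"
    using permutes_inj_on[OF assms] mem prob_space_law by (intro distr_PiM_reindex) auto
  finally show ?thesis .
qed

lemma indep_blocks:
  assumes "A \<inter> B = {}" "A \<subseteq> {1..n}" "B \<subseteq> {1..n}"
    and "g \<in> PiM A (\<lambda>_. borel) \<rightarrow>\<^sub>M N1" "g' \<in> PiM B (\<lambda>_. borel) \<rightarrow>\<^sub>M N2"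
  shows "indep_var N1 (\<lambda>\<omega>. g (\<lambda>i\<in>A. err i \<omega>)) N2 (\<lambda>\<omega>. g' (\<lambda>i\<in>B. err i \<omega>))"
  using indep_var_compose[OF indep_var_restrict[OF err_indep assms(1-3)] assms(4-5)] by (simp add: comp_def)

lemma distr_err_pair:
  assumes "i \<in> {1..n}" "m \<in> {1..n}" "i \<noteq> m"
  shows "distr M (borel \<Otimes>\<^sub>M borel) (\<lambda>\<omega>. (err i \<omega>, err m \<omega>)) = law \<Otimes>\<^sub>M law"
proof -
  have "indep_var borel (err i) borel (err m)"
    using indep_blocks[of "{i}" "{m}" "\<lambda>z. z i" borel "\<lambda>z. z m" borel] assms by simp
  then show ?thesis using assms by (simp add: indep_var_distribution_eq distr_err)
qed

lemma distr_err_triple: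
  assumes "i \<in> {1..n}" "m \<in> {1..n}" "m' \<in> {1..n}" "i \<noteq> m" "i \<noteq> m'" "m \<noteq> m'"
  shows "distr M (borel \<Otimes>\<^sub>M (borel \<Otimes>\<^sub>M borel)) (\<lambda>\<omega>. (err i \<omega>, (err m \<omega>, err m' \<omega>))) = law \<Otimes>\<^sub>M (law \<Otimes>\<^sub>M law)"
proof -
  let ?A = "PiM {i} (\<lambda>_. borel :: real measure)" and ?B = "PiM {m, m'} (\<lambda>_. borel :: real measure)"
  let ?X = "\<lambda>\<omega>. \<lambda>j\<in>{i}. err j \<omega>" and ?Y = "\<lambda>\<omega>. \<lambda>j\<in>{m, m'}. err j \<omega>"
  let ?g = "\<lambda>z. z i" and ?h = "\<lambda>z. (z m, z m')"
  have [measurable]: "?h \<in> ?B \<rightarrow>\<^sub>M borel \<Otimes>\<^sub>M borel" "?g \<in> ?A \<rightarrow>\<^sub>M borel"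
    by (intro measurable_Pair measurable_component_singleton; simp)+
  have [measurable]: "?X \<in> M \<rightarrow>\<^sub>M ?A" "?Y \<in> M \<rightarrow>\<^sub>M ?B"
    using assms err_measurable by (auto intro!: measurable_restrict)
  have "indep_var ?A ?X ?B ?Y"
    using assms by (intro indep_var_restrict[OF err_indep]) auto
  then have eq: "distr M ?A ?X \<Otimes>\<^sub>M distr M ?B ?Y = distr M (?A \<Otimes>\<^sub>M ?B) (\<lambda>\<omega>. (?X \<omega>, ?Y \<omega>))"
    by (simp add: indep_var_distribution_eq)
  have "law \<Otimes>\<^sub>M (law \<Otimes>\<^sub>M law) = distr (distr M ?A ?X) borel ?g \<Otimes>\<^sub>M distr (distr M ?B ?Y) (borel \<Otimes>\<^sub>M borel) ?h"
    using assms by (simp add: distr_distr comp_def distr_err distr_err_pair)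
  also have "\<dots> = distr (distr M ?A ?X \<Otimes>\<^sub>M distr M ?B ?Y) (borel \<Otimes>\<^sub>M (borel \<Otimes>\<^sub>M borel)) (\<lambda>(z, w). (?g z, ?h w))"
  proof (rule pair_measure_distr)
    have "prob_space (distr (distr M ?B ?Y) (borel \<Otimes>\<^sub>M borel) ?h)"
      by (intro prob_space.prob_space_distr prob_space_distr) measurable
    then show "sigma_finite_measure (distr (distr M ?B ?Y) (borel \<Otimes>\<^sub>M borel) ?h)"
      by (rule prob_space_imp_sigma_finite)
  qed measurable
  also have "\<dots> = distr M (borel \<Otimes>\<^sub>M (borel \<Otimes>\<^sub>M borel)) (\<lambda>\<omega>. (err i \<omega>, (err m \<omega>, err m' \<omega>)))"
    unfolding eq by (subst distr_distr) (auto simp: comp_def)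
  finally show ?thesis by simp
qed

lemma law_countable_null: "countable A \<Longrightarrow> AE x in law. x \<notin> A"
proof -
  assume "countable A"
  then have "AE x in lborel. x \<notin> A"
    by (intro AE_not_in countable_imp_null_set_lborel)
  then have "AE x in lborel. 0 < ennreal (f x) \<longrightarrow> x \<notin> A" by eventually_elim simp
  then show ?thesis unfolding law_def by (subst AE_density) auto
qed

text \<open>By Fubini: given the first error, a tie forces the second one into a set of at most two
  points, which is null for a law with a density.\<close>

lemma AE_no_tie:
  assumes im: "i \<in> {1..n}" "m \<in> {1..n}" "i \<noteq> m"
  shows "AE \<omega> in M. \<bar>a + err i \<omega>\<bar> \<noteq> \<bar>b + err m \<omega>\<bar>"
proof -
  interpret law: prob_space law by (rule prob_space_law)
  interpret P: pair_sigma_finite law law ..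
  have "AE p in law \<Otimes>\<^sub>M law. \<bar>a + fst p\<bar> \<noteq> \<bar>b + snd p\<bar>"
  proof (rule P.AE_pair_measure)
    show "{p \<in> space (law \<Otimes>\<^sub>M law). \<bar>a + fst p\<bar> \<noteq> \<bar>b + snd p\<bar>} \<in> sets (law \<Otimes>\<^sub>M law)" by measurable
    show "AE x in law. AE y in law. \<bar>a + fst (x, y)\<bar> \<noteq> \<bar>b + snd (x, y)\<bar>"
    proof (rule AE_I2)
      fix x
      have "AE y in law. y \<notin> {\<bar>a + x\<bar> - b, - \<bar>a + x\<bar> - b}" by (rule law_countable_null) auto
      then show "AE y in law. \<bar>a + fst (x, y)\<bar> \<noteq> \<bar>b + snd (x, y)\<bar>"
        by eventually_elim auto
    qed
  qed
  then have "AE p in distr M (borel \<Otimes>\<^sub>M borel) (\<lambda>\<omega>. (err i \<omega>, err m \<omega>)). \<bar>a + fst p\<bar> \<noteq> \<bar>b + snd p\<bar>"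
    by (simp only: distr_err_pair[OF im])
  then show ?thesis
    using err_measurable[OF im(1)] err_measurable[OF im(2)] by (subst (asm) AE_distr_iff) auto
qed

lemma AE_inj_on_abs: "AE \<omega> in M. inj_on (\<lambda>i. \<bar>l i + err i \<omega>\<bar>) {1..n}"
proof -
  have "AE \<omega> in M. \<forall>i\<in>{1..n}. \<forall>m\<in>{1..n}. i \<noteq> m \<longrightarrow> \<bar>l i + err i \<omega>\<bar> \<noteq> \<bar>l m + err m \<omega>\<bar>"
    by (intro AE_finite_allI AE_impI AE_no_tie) auto
  then show ?thesis by eventually_elim (auto simp: inj_on_def)
qed

end

section \<open>Rank events of positive probability and symmetrization over sign flips\<close>

context iid_symmetric_errors
begin

lemma observation_null: "observation (\<lambda>_. 0) X err \<omega> = (\<lambda>i. err i \<omega>)"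
  by (simp add: observation_def fun_eq_iff)

lemma sets_rank_vector_err: "{\<omega>\<in>space M. rank_vector n (\<lambda>i. err i \<omega>) = r} \<in> sets M"
  by (rule sets_rank_vector_eq) (rule err_measurable)

text \<open>On a null event the elementary conditional probability would be 0 and bound nothing.
  Almost surely there are no ties, so one of the finitely many injective rank vectors has positive
  probability; permuting the errors preserves their law and carries this vector to any
  other.\<close>

lemma prob_rank_vector_pos:
  assumes y: "inj_on (\<lambda>i. \<bar>y i\<bar>) {1..n}"
  shows "0 < prob {\<omega>\<in>space M. rank_vector n (\<lambda>i. err i \<omega>) = rank_vector n y}"
proof -
  define r where "r = rank_vector n y"
  let ?R = "\<lambda>\<omega>. rank_vector n (\<lambda>i. err i \<omega>)"
  have inj_rank: "inj_on (rank_vector n z) {1..n}" if "inj_on (\<lambda>i. \<bar>z i\<bar>) {1..n}" for z :: "nat \<Rightarrow> real"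
    using inj_on_local_rank[OF that] by (simp only: rank_vector_def inj_on_restrict_eq)
  define B where "B = {r0 \<in> {1..n} \<rightarrow>\<^sub>E {1..n}. inj_on r0 {1..n}}"
  have finB: "finite B" unfolding B_def by (intro finite_subset[OF _ finite_PiE[of "{1..n}" "\<lambda>_. {1..n}"]]) auto
  have "AE \<omega> in M. ?R \<omega> \<in> B"
    using AE_inj_on_abs[of "\<lambda>_. 0"]
  proof eventually_elim
    case (elim \<omega>)
    then show ?case using inj_rank[of "\<lambda>i. err i \<omega>"] rank_vector_range by (simp add: B_def)
  qed
  then have "prob (\<Union>r0\<in>B. {\<omega>\<in>space M. ?R \<omega> = r0}) = 1"
    by (intro prob_eq_1[THEN iffD2] sets.finite_UN finB sets_rank_vector_err) (auto elim: eventually_mono simp: AE_conj_iff)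
  moreover have "prob (\<Union>r0\<in>B. {\<omega>\<in>space M. ?R \<omega> = r0}) \<le> (\<Sum>r0\<in>B. prob {\<omega>\<in>space M. ?R \<omega> = r0})"
    using finB sets_rank_vector_err by (intro measure_UNION_le) auto
  ultimately have "(\<Sum>r0\<in>B. prob {\<omega>\<in>space M. ?R \<omega> = r0}) \<noteq> 0" by linarith
  then obtain r0 where r0: "r0 \<in> B" "prob {\<omega>\<in>space M. ?R \<omega> = r0} \<noteq> 0"
    by (meson sum.neutral)
  have bij: "bij_betw q {1..n} {1..n}" if "q \<in> {1..n} \<rightarrow>\<^sub>E {1..n}" "inj_on q {1..n}" for q
    using that endo_inj_surj[of "{1..n}" q] by (auto simp: bij_betw_def)
  have r_bij: "bij_betw r {1..n} {1..n}" unfolding r_def using rank_vector_range inj_rank[OF y] by (rule bij)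
  have r0_bij: "bij_betw r0 {1..n} {1..n}" using r0 by (intro bij) (auto simp: B_def)
  \<comment> \<open>The permutation \<open>r0^-1 o r\<close> of \<open>{1..n}\<close>, extended by
    the identity, so that \<open>r0 o \<sigma> = r\<close> on \<open>{1..n}\<close>.\<close>
  define \<sigma> where "\<sigma> i = (if i \<in> {1..n} then the_inv_into {1..n} r0 (r i) else i)" for i
  have "bij_betw (the_inv_into {1..n} r0 \<circ> r) {1..n} {1..n}"
    by (rule bij_betw_trans[OF r_bij bij_betw_the_inv_into[OF r0_bij]])
  then have "bij_betw \<sigma> {1..n} {1..n}" by (rule bij_betw_cong[THEN iffD1, rotated]) (simp add: \<sigma>_def)
  then have \<sigma>: "\<sigma> permutes {1..n}" by (rule bij_imp_permutes) (simp only: \<sigma>_def if_False)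
  have r0\<sigma>: "r0 (\<sigma> i) = r i" if "i \<in> {1..n}" for i
    using f_the_inv_into_f_bij_betw[OF r0_bij, of "r i"] bij_betwE[OF r_bij] that by (simp add: \<sigma>_def)
  define E where "E = {z\<in>space (PiM {1..n} (\<lambda>_. borel :: real measure)). rank_vector n z = r}"
  have E: "E \<in> sets (PiM {1..n} (\<lambda>_. borel))" unfolding E_def
    by (rule sets_rank_vector_eq) (rule measurable_component_singleton)
  have "{\<omega>\<in>space M. ?R \<omega> = r0} \<subseteq> {\<omega>\<in>space M. (\<lambda>i\<in>{1..n}. err (\<sigma> i) \<omega>) \<in> E}"
  proof clarify
    fix \<omega> assume \<omega>: "\<omega> \<in> space M" "r0 = ?R \<omega>"
    have "rank_vector n (\<lambda>i\<in>{1..n}. err (\<sigma> i) \<omega>) = rank_vector n (\<lambda>i. err (\<sigma> i) \<omega>)"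
      by (rule rank_vector_cong) simp
    also have "\<dots> = r"
    proof (rule extensionalityI[of _ "{1..n}"])
      fix i assume i: "i \<in> {1..n}"
      show "rank_vector n (\<lambda>i. err (\<sigma> i) \<omega>) i = r i"
        using rank_vector_permute[OF \<sigma> i, of "\<lambda>i. err i \<omega>"] r0\<sigma>[OF i] \<omega>(2) by simp
    qed (auto simp: r_def rank_vector_def)
    finally show "(\<lambda>i\<in>{1..n}. err (\<sigma> i) \<omega>) \<in> E"
      by (simp add: E_def space_PiM)
  qed
  moreover have \<sigma>m: "err (\<sigma> i) \<in> borel_measurable M" if "i \<in> {1..n}" for i
    using permutes_in_image[OF \<sigma>] that err_measurable by blast
  have [measurable]: "(\<lambda>\<omega>. \<lambda>i\<in>{1..n}. err (\<sigma> i) \<omega>) \<in> M \<rightarrow>\<^sub>M PiM {1..n} (\<lambda>_. borel)"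
    by (intro measurable_restrict \<sigma>m)
  have "{\<omega>\<in>space M. (\<lambda>i\<in>{1..n}. err (\<sigma> i) \<omega>) \<in> E} \<in> sets M" using E by measurable
  ultimately have "prob {\<omega>\<in>space M. ?R \<omega> = r0} \<le> prob {\<omega>\<in>space M. (\<lambda>i\<in>{1..n}. err (\<sigma> i) \<omega>) \<in> E}"
    by (intro finite_measure_mono)
  also have "\<dots> = measure (PiM {1..n} (\<lambda>_. law)) E"
    by (rule prob_iid_eq[OF distr_err_permute[OF \<sigma>] \<sigma>m E])
  also have "\<dots> = prob {\<omega>\<in>space M. (\<lambda>i\<in>{1..n}. err i \<omega>) \<in> E}"
    by (rule prob_iid_eq[OF distr_err_joint err_measurable E, symmetric])
  also have "{\<omega>\<in>space M. (\<lambda>i\<in>{1..n}. err i \<omega>) \<in> E} = {\<omega>\<in>space M. ?R \<omega> = r}"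
  proof -
    have "rank_vector n (\<lambda>i\<in>{1..n}. err i \<omega>) = ?R \<omega>" for \<omega> by (rule rank_vector_cong) simp
    then show ?thesis by (auto simp: E_def space_PiM)
  qed
  finally show ?thesis using r0(2) measure_nonneg[of M "{\<omega>\<in>space M. ?R \<omega> = r0}"] unfolding r_def by linarith
qed

text \<open>Symmetrization: for every sign vector \<open>s\<close> the event \<open>F s\<close> has
  the same probability, since the flipped errors have the law of the errors and the same ranks.
  Summing the indicators of all \<open>F s\<close> and applying the counting bound at each outcome
  gives the claim after integration.\<close>

lemma prob_null_rank_ge:
  assumes r: "inj_on r {1..n}"
    and K: "\<And>z. inj_on (\<lambda>i. \<bar>z i\<bar>) {1..n} \<Longrightarrow> real (card {s\<in>signs n. K < multiscale_stat \<psi> X n (\<lambda>i. s i * z i)}) \<le> \<alpha> * 2 ^ n"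
  shows "(1 - \<alpha>) * prob {\<omega>\<in>space M. rank_vector n (\<lambda>i. err i \<omega>) = r} \<le>
    prob {\<omega>\<in>space M. multiscale_stat \<psi> X n (\<lambda>i. err i \<omega>) \<le> K \<and> rank_vector n (\<lambda>i. err i \<omega>) = r}"
proof -
  let ?R = "\<lambda>\<omega>. rank_vector n (\<lambda>i. err i \<omega>)"
  define E where "E = {z\<in>space (PiM {1..n} (\<lambda>_. borel :: real measure)). multiscale_stat \<psi> X n z \<le> K} \<inter>
     {z\<in>space (PiM {1..n} (\<lambda>_. borel :: real measure)). rank_vector n z = r}"
  have E: "E \<in> sets (PiM {1..n} (\<lambda>_. borel))" unfolding E_def
  proof (rule sets.Int)
    have [measurable]: "multiscale_stat \<psi> X n \<in> borel_measurable (PiM {1..n} (\<lambda>_. borel :: real measure))"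
      by (rule measurable_multiscale_stat) (rule measurable_component_singleton)
    show "{z\<in>space (PiM {1..n} (\<lambda>_. borel :: real measure)). multiscale_stat \<psi> X n z \<le> K} \<in> sets (PiM {1..n} (\<lambda>_. borel))"
      by measurable
    show "{z\<in>space (PiM {1..n} (\<lambda>_. borel :: real measure)). rank_vector n z = r} \<in> sets (PiM {1..n} (\<lambda>_. borel))"
      by (rule sets_rank_vector_eq) (rule measurable_component_singleton)
  qed
  define F where "F s = {\<omega>\<in>space M. multiscale_stat \<psi> X n (\<lambda>i. s i * err i \<omega>) \<le> K \<and> ?R \<omega> = r}" for s :: "nat \<Rightarrow> real"
  have F_eq: "{\<omega>\<in>space M. (\<lambda>i\<in>{1..n}. s i * err i \<omega>) \<in> E} = F s" if "s \<in> signs n" for s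
  proof -
    have "rank_vector n (\<lambda>i\<in>{1..n}. s i * err i \<omega>) = ?R \<omega>" for \<omega>
      using rank_vector_signs[OF that, of "\<lambda>i. err i \<omega>"] by (metis (mono_tags, lifting) rank_vector_cong restrict_apply')
    moreover have "multiscale_stat \<psi> X n (\<lambda>i\<in>{1..n}. s i * err i \<omega>) = multiscale_stat \<psi> X n (\<lambda>i. s i * err i \<omega>)" for \<omega>
      by (rule multiscale_stat_cong) simp
    ultimately show ?thesis by (auto simp: E_def F_def space_PiM)
  qed
  have sm: "(\<lambda>\<omega>. s i * err i \<omega>) \<in> borel_measurable M" if "i \<in> {1..n}" for s :: "nat \<Rightarrow> real" and i
    using err_measurable[OF that] by measurable
  have Fs: "F s \<in> sets M" if "s \<in> signs n" for s
  proof -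
    have [measurable]: "(\<lambda>\<omega>. \<lambda>i\<in>{1..n}. s i * err i \<omega>) \<in> M \<rightarrow>\<^sub>M PiM {1..n} (\<lambda>_. borel)"
      by (intro measurable_restrict sm)
    show ?thesis unfolding F_eq[OF that, symmetric] using E by measurable
  qed
  have prob_F: "prob (F s) = measure (PiM {1..n} (\<lambda>_. law)) E" if "s \<in> signs n" for s
    unfolding F_eq[OF that, symmetric] using distr_err_signs[OF that] sm E by (rule prob_iid_eq)
  have one: "(\<lambda>i\<in>{1..n}. 1) \<in> signs n" by (auto simp: signs_def)
  define p where "p = prob {\<omega>\<in>space M. multiscale_stat \<psi> X n (\<lambda>i. err i \<omega>) \<le> K \<and> ?R \<omega> = r}"
  have "F (\<lambda>i\<in>{1..n}. 1) = {\<omega>\<in>space M. multiscale_stat \<psi> X n (\<lambda>i. err i \<omega>) \<le> K \<and> ?R \<omega> = r}"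
  proof -
    have "multiscale_stat \<psi> X n (\<lambda>i. (\<lambda>i\<in>{1..n}. 1) i * err i \<omega>) = multiscale_stat \<psi> X n (\<lambda>i. err i \<omega>)" for \<omega>
      by (rule multiscale_stat_cong) simp
    then show ?thesis by (simp only: F_def)
  qed
  then have p: "prob (F s) = p" if "s \<in> signs n" for s
    using prob_F[OF one] prob_F[OF that] by (simp only: p_def)
  have int: "integrable M (indicat_real A)" if "A \<in> sets M" for A
    using that by (intro integrable_real_indicator) (simp_all add: emeasure_eq_measure)
  let ?Er = "{\<omega>\<in>space M. ?R \<omega> = r}"
  have "(1 - \<alpha>) * 2 ^ n * prob ?Er = (\<integral>\<omega>. (1 - \<alpha>) * 2 ^ n * indicator ?Er \<omega> \<partial>M)"
    using sets_rank_vector_err by simp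
  also have "\<dots> \<le> (\<integral>\<omega>. (\<Sum>s\<in>signs n. indicator (F s) \<omega>) \<partial>M)"
  proof (rule integral_mono)
    show "integrable M (\<lambda>\<omega>. (1 - \<alpha>) * 2 ^ n * indicator ?Er \<omega> :: real)"
      by (intro integrable_mult_right int sets_rank_vector_err)
    show "integrable M (\<lambda>\<omega>. \<Sum>s\<in>signs n. indicator (F s) \<omega> :: real)"
      by (intro Bochner_Integration.integrable_sum int Fs)
    fix \<omega> assume \<omega>: "\<omega> \<in> space M"
    show "(1 - \<alpha>) * 2 ^ n * indicator ?Er \<omega> \<le> (\<Sum>s\<in>signs n. indicator (F s) \<omega> :: real)"
    proof (cases "?R \<omega> = r")
      case True
      then have "inj_on (\<lambda>i. \<bar>err i \<omega>\<bar>) {1..n}" using r inj_on_abs_if_rank_vector by blast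
      note K' = K[OF this]
      let ?B = "{s\<in>signs n. K < multiscale_stat \<psi> X n (\<lambda>i. s i * err i \<omega>)}"
      have "(\<Sum>s\<in>signs n. indicator (F s) \<omega> :: real) = (\<Sum>s\<in>signs n. if s \<in> ?B then 0 else 1)"
        using \<omega> True by (intro sum.cong) (auto simp: F_def indicator_def)
      also have "\<dots> = (\<Sum>s\<in>signs n - ?B. 1)" by (intro sum.mono_neutral_cong_right) auto
      also have "\<dots> = real (card (signs n - ?B))" by simp
      also have "\<dots> = real (card (signs n)) - real (card ?B)"
        by (subst card_Diff_subset) (auto intro!: of_nat_diff card_mono)
      also have "\<dots> \<ge> (1 - \<alpha>) * 2 ^ n" using K' by (simp add: card_signs algebra_simps)
      finally show ?thesis using True \<omega> by simp
    qed (simp add: sum_nonneg)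
  qed
  also have "\<dots> = (\<Sum>s\<in>signs n. prob (F s))"
    using Fs by (subst Bochner_Integration.integral_sum) (auto intro: int)
  also have "\<dots> = 2 ^ n * p" using p by (simp add: card_signs)
  finally show ?thesis unfolding p_def by simp
qed

lemma critical_value_le:
  assumes \<alpha>: "0 < \<alpha>" and K: "0 < K"
    "\<And>z. inj_on (\<lambda>i. \<bar>z i\<bar>) {1..n} \<Longrightarrow> real (card {s\<in>signs n. K < multiscale_stat \<psi> X n (\<lambda>i. s i * z i)}) \<le> \<alpha> * 2 ^ n"
    and y: "inj_on (\<lambda>i. \<bar>y i\<bar>) {1..n}"
  shows "critical_value M err \<psi> X n \<alpha> (rank_vector n y) \<le> K"
proof -
  have r: "inj_on (rank_vector n y) {1..n}"
    using inj_on_local_rank[OF y] by (simp only: rank_vector_def inj_on_restrict_eq)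
  have "1 - \<alpha> \<le> cond_prob M (\<lambda>\<omega>. multiscale_stat \<psi> X n (observation (\<lambda>_. 0) X err \<omega>) \<le> K)
      (\<lambda>\<omega>. rank_vector n (observation (\<lambda>_. 0) X err \<omega>) = rank_vector n y)"
    unfolding cond_prob_def observation_null
    using prob_null_rank_ge[OF r K(2)] prob_rank_vector_pos[OF y]
    by (simp only: pos_le_divide_eq)
  then show ?thesis unfolding critical_value_def
    using K(1) by (intro cInf_lower bdd_belowI[of _ 0]) auto
qed

end

section \<open>Comparisons and ranks of shifted errors\<close>

locale lipschitz_symmetric_errors = iid_symmetric_errors M err f n
  for M :: "'a measure" and err f n +
  fixes B :: real
  assumes f_lipschitz: "\<And>u v. \<bar>f u - f v\<bar> \<le> B * \<bar>u - v\<bar>" and B_pos: "0 < B"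
begin

sublocale law: prob_space law by (rule prob_space_law)
sublocale law_pair: pair_prob_space law law ..

lemma f_continuous: "isCont f x"
proof -
  have "((\<lambda>y. B * \<bar>y - x\<bar>) \<longlongrightarrow> B * \<bar>x - x\<bar>) (at x)" by (intro tendsto_intros)
  then have "((\<lambda>y. B * \<bar>y - x\<bar>) \<longlongrightarrow> 0) (at x)" by simp
  then have "((\<lambda>y. f y - f x) \<longlongrightarrow> 0) (at x)"
    by (rule Lim_null_comparison[rotated]) (use f_lipschitz in auto)
  then show ?thesis by (simp add: isCont_def LIM_zero_iff)
qed

lemma integrable_law_bounded:
  fixes g :: "real \<Rightarrow> real"
  assumes "g \<in> borel_measurable borel" "\<And>x. \<bar>g x\<bar> \<le> C"
  shows "integrable law g"
  using assms by (intro law.integrable_const_bound[of _ C]) auto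

lemma emeasure_law: "A \<in> sets borel \<Longrightarrow> emeasure law A = (\<integral>\<^sup>+x. ennreal (f x) * indicator A x \<partial>lborel)"
  unfolding law_def by (subst emeasure_density) auto

lemma measure_law_ge:
  assumes "s \<le> t" "0 \<le> v" "\<And>u. s \<le> u \<Longrightarrow> u < t \<Longrightarrow> v \<le> f u"
  shows "v * (t - s) \<le> measure law {s..<t}"
proof -
  have "ennreal (v * (t - s)) = (\<integral>\<^sup>+x. ennreal v * indicator {s..<t} x \<partial>lborel)"
    using assms by (subst nn_integral_cmult_indicator) (auto simp: ennreal_mult)
  also have "\<dots> \<le> emeasure law {s..<t}"
    using assms(3) by (subst emeasure_law) (auto intro!: nn_integral_mono ennreal_leI simp: indicator_def)
  finally show ?thesis by (simp add: law.emeasure_eq_measure)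
qed

lemma measure_law_le:
  assumes "s \<le> t" "0 \<le> v" "\<And>u. s \<le> u \<Longrightarrow> u \<le> t \<Longrightarrow> f u \<le> v"
  shows "measure law {s..t} \<le> v * (t - s)"
proof -
  have "emeasure law {s..t} \<le> (\<integral>\<^sup>+x. ennreal v * indicator {s..t} x \<partial>lborel)"
    using assms(3) by (subst emeasure_law) (auto intro!: nn_integral_mono ennreal_leI simp: indicator_def)
  also have "\<dots> = ennreal (v * (t - s))"
    using assms by (subst nn_integral_cmult_indicator) (auto simp: ennreal_mult)
  finally show ?thesis using assms by (simp add: law.emeasure_eq_measure)
qed

definition f_max :: real where "f_max = 2 * sqrt B"

lemma f_max_pos: "0 < f_max" using B_pos by (simp add: f_max_def)

text \<open>A Lipschitz density stays above \<open>f u / 2\<close> on an interval of length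
  \<open>f u / (2 * B)\<close>, which carries mass at least \<open>(f u)^2 / (4 * B)\<close>; this
  mass is at most 1.\<close>

lemma f_le_max: "f u \<le> f_max"
proof -
  define d where "d = f u / (2 * B)"
  have d: "0 \<le> d" using f_nonneg B_pos by (simp add: d_def)
  have "f u / 2 * (u + d - u) \<le> measure law {u..<u + d}"
  proof (rule measure_law_ge)
    fix x assume x: "u \<le> x" "x < u + d"
    have "B * \<bar>u - x\<bar> \<le> B * d" using x B_pos by (intro mult_left_mono) auto
    also have "\<dots> = f u / 2" using B_pos by (simp add: d_def)
    finally show "f u / 2 \<le> f x" using f_lipschitz[of u x] by linarith
  qed (use d f_nonneg in auto)
  also have "\<dots> \<le> 1" by (rule law.prob_le_1)
  finally have "(f u)\<^sup>2 \<le> 4 * B" using B_pos by (simp add: d_def field_simps power2_eq_square)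
  then have "(f u)\<^sup>2 \<le> (2 * sqrt B)\<^sup>2" using B_pos by (simp add: power_mult_distrib)
  then show ?thesis unfolding f_max_def by (rule power2_le_imp_le) (use B_pos in simp)
qed

lemma measure_law_interval_le: "s \<le> t \<Longrightarrow> measure law {s..t} \<le> f_max * (t - s)"
  using f_le_max f_max_pos by (intro measure_law_le) auto

lemma AE_law_neq: "AE u in law. u \<noteq> x"
  using law_countable_null[of "{x}"] by simp

lemma measure_law_atMost: "measure law {..- x} = measure law {x..}"
proof -
  have "measure law {..- x} = measure (distr law borel uminus) {..- x}" by (simp add: distr_uminus_law)
  also have "\<dots> = measure law (uminus -` {..- x})" by (subst measure_distr) auto
  also have "uminus -` {..- x} = {x..}" by auto
  finally show ?thesis .
qed

text \<open>Summing \<open>w i * cmp (y i) (y m)\<close> over \<open>i\<close> and \<open>m\<close> gives the numerator of the signed rank statistic.\<close>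

definition cmp :: "real \<Rightarrow> real \<Rightarrow> real" where
  "cmp x y = (if \<bar>y\<bar> \<le> \<bar>x\<bar> then sgn x else 0)"

lemma abs_cmp_le: "\<bar>cmp x y\<bar> \<le> 1"
  by (simp add: cmp_def sgn_real_def)

text \<open>With \<open>q = \<bar>z\<bar>\<close>, the value is 1 for \<open>u\<close> above
  \<open>q - a\<close> and -1 for \<open>u\<close> below \<open>- q - a\<close>. By symmetry of the
  law the second probability is that of exceeding \<open>q + a\<close>, and the difference is the
  mass of an interval of length \<open>2 * a\<close>.\<close>

lemma integral_cmp:
  assumes a: "0 \<le> a"
  shows "(\<integral>u. cmp (u + a) z \<partial>law) = measure law {\<bar>z\<bar> - a..<\<bar>z\<bar> + a}"
proof -
  define q where "q = \<bar>z\<bar>"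
  have int: "integrable law (indicat_real A)" if "A \<in> sets borel" for A
    using that by (intro integrable_real_indicator) (simp_all add: law.emeasure_eq_measure)
  have "(\<integral>u. cmp (u + a) z \<partial>law) = (\<integral>u. indicator {q - a..} u - indicator {..- (q + a)} u \<partial>law)"
  proof (rule integral_cong_AE)
    show "(\<lambda>u. cmp (u + a) z) \<in> borel_measurable law" unfolding cmp_def sgn_real_def by measurable
    show "AE u in law. cmp (u + a) z = indicator {q - a..} u - indicator {..- (q + a)} u"
      using AE_law_neq[of "- a"]
      by eventually_elim (auto simp: cmp_def q_def indicator_def sgn_real_def abs_if)
  qed simp
  also have "\<dots> = measure law {q - a..} - measure law {..- (q + a)}"
    using int by (subst Bochner_Integration.integral_diff) auto
  also have "\<dots> = measure law {q - a..} - measure law {q + a..}"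
    by (simp only: measure_law_atMost)
  also have "\<dots> = measure law ({q - a..} - {q + a..})"
    using a by (subst law.finite_measure_Diff) auto
  also have "{q - a..} - {q + a..} = {q - a..<q + a}" by auto
  finally show ?thesis by (simp add: q_def)
qed

text \<open>First-order expansion in the shift \<open>a\<close>: the interval of length
  \<open>2 * a\<close> is centred at \<open>\<bar>v + b\<bar>\<close>, where the density differs
  from \<open>f v\<close> by at most \<open>B * b\<close>. Averaging over \<open>v\<close> will turn
  \<open>f v\<close> into \<open>f_energy\<close>.\<close>

lemma integral_cmp_ge_small:
  assumes "0 \<le> a" "0 \<le> b"
  shows "2 * a * (f v - B * (a + b)) \<le> (\<integral>u. cmp (u + a) (v + b) \<partial>law)"
proof (cases "0 \<le> f v - B * (a + b)")
  case True
  define q where "q = \<bar>v + b\<bar>"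
  have fq: "f q = f (v + b)" using f_symmetric[of "v + b"] by (simp add: q_def abs_if)
  have "(f v - B * (a + b)) * (q + a - (q - a)) \<le> measure law {q - a..<q + a}"
  proof (rule measure_law_ge)
    fix u assume u: "q - a \<le> u" "u < q + a"
    have "B * \<bar>q - u\<bar> \<le> B * a" using u B_pos by (intro mult_left_mono) auto
    moreover have "\<bar>f v - f (v + b)\<bar> \<le> B * b" using f_lipschitz[of v "v + b"] assms by simp
    ultimately show "f v - B * (a + b) \<le> f u"
      using f_lipschitz[of q u] fq by (simp add: distrib_left abs_le_iff)
  qed (use assms True in auto)
  then show ?thesis unfolding integral_cmp[OF assms(1)] q_def by (simp add: mult_ac)
next
  case False
  then have "2 * a * (f v - B * (a + b)) \<le> 0" using assms by (intro mult_nonneg_nonpos) auto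
  also have "0 \<le> (\<integral>u. cmp (u + a) (v + b) \<partial>law)" unfolding integral_cmp[OF assms(1)] by simp
  finally show ?thesis .
qed

text \<open>For shifts of any size only a piece of length \<open>\<tau>\<close> adjacent to
  \<open>\<bar>v\<bar>\<close> is kept. Such a piece fits into the interval around
  \<open>\<bar>v + b\<bar>\<close> because \<open>\<bar>v\<bar>\<close> is within
  \<open>b \<le> a\<close> of the centre, so the bound applies when the first error carries the
  larger shift.\<close>

lemma integral_cmp_ge_large:
  assumes "0 \<le> \<tau>" "\<tau> \<le> b" "b \<le> a"
  shows "\<tau> * (f v - B * \<tau>) \<le> (\<integral>u. cmp (u + a) (v + b) \<partial>law)"
proof (cases "0 \<le> f v - B * \<tau>")
  case True
  define q where "q = \<bar>v + b\<bar>"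
  define s where "s = (if \<bar>v\<bar> \<le> q then \<bar>v\<bar> else \<bar>v\<bar> - \<tau>)"
  have fv: "f \<bar>v\<bar> = f v" by (simp add: abs_if f_symmetric)
  have q: "\<bar>v\<bar> - b \<le> q" "q \<le> \<bar>v\<bar> + b" using assms by (auto simp: q_def abs_if)
  have "(f v - B * \<tau>) * (s + \<tau> - s) \<le> measure law {s..<s + \<tau>}"
  proof (rule measure_law_ge)
    fix u assume u: "s \<le> u" "u < s + \<tau>"
    have "B * \<bar>\<bar>v\<bar> - u\<bar> \<le> B * \<tau>" using u B_pos by (intro mult_left_mono) (auto simp: s_def split: if_splits)
    then show "f v - B * \<tau> \<le> f u"
      using f_lipschitz[of "\<bar>v\<bar>" u] fv by (simp add: abs_le_iff)
  qed (use assms True in auto)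
  also have "\<dots> \<le> measure law {q - a..<q + a}"
    using q assms by (intro law.finite_measure_mono) (auto simp: s_def split: if_splits)
  finally show ?thesis using assms unfolding q_def by (subst integral_cmp) (auto simp: mult_ac)
next
  case False
  then have "\<tau> * (f v - B * \<tau>) \<le> 0" using assms by (intro mult_nonneg_nonpos) auto
  also have "0 \<le> (\<integral>u. cmp (u + a) (v + b) \<partial>law)" using assms by (subst integral_cmp) auto
  finally show ?thesis .
qed

definition f_energy :: real where "f_energy = (LINT y|lborel. (f y)\<^sup>2)"

lemma integrable_f: "integrable lborel f"
proof (rule integrableI_nonneg)
  have "(\<integral>\<^sup>+x. ennreal (f x) \<partial>lborel) = emeasure law UNIV" by (simp add: emeasure_law)
  also have "\<dots> = 1" using law.emeasure_space_1 by simp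
  finally show "(\<integral>\<^sup>+x. ennreal (f x) \<partial>lborel) < \<infinity>" by simp
qed (use f_nonneg in auto)

lemma integral_law: "g \<in> borel_measurable borel \<Longrightarrow> integral\<^sup>L law g = (LINT x|lborel. f x * g x)"
  unfolding law_def by (subst integral_density) (use f_nonneg in auto)

lemma integral_law_f: "integral\<^sup>L law f = f_energy"
  by (subst integral_law) (auto simp: f_energy_def power2_eq_square)

lemma f_energy_pos: "0 < f_energy"
proof (rule ccontr)
  assume "\<not> 0 < f_energy"
  moreover have "0 \<le> (LINT y|lborel. (f y)\<^sup>2)" by (intro Bochner_Integration.integral_nonneg) simp
  ultimately have 0: "(LINT y|lborel. (f y)\<^sup>2) = 0" by (simp add: f_energy_def)
  have "integrable lborel (\<lambda>y. (f y)\<^sup>2)"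
  proof (rule Bochner_Integration.integrable_bound)
    show "integrable lborel (\<lambda>y. f_max * f y)" using integrable_f by simp
    show "AE y in lborel. norm ((f y)\<^sup>2) \<le> norm (f_max * f y)"
      using f_le_max f_nonneg f_max_pos by (auto simp: power2_eq_square intro!: mult_right_mono)
  qed simp
  then have "AE y in lborel. (f y)\<^sup>2 = 0"
    using 0 integral_nonneg_eq_0_iff_AE[of lborel "\<lambda>y. (f y)\<^sup>2"] by simp
  then have "AE y in lborel. ennreal (f y) = 0" by eventually_elim simp
  then have "(\<integral>\<^sup>+x. ennreal (f x) \<partial>lborel) = 0" by (subst nn_integral_0_iff_AE) auto
  moreover have "(\<integral>\<^sup>+x. ennreal (f x) \<partial>lborel) = emeasure law UNIV" by (simp add: emeasure_law)
  ultimately show False using law.emeasure_space_1 by simp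
qed

lemma expectation_pair:
  fixes g :: "real \<Rightarrow> real \<Rightarrow> real"
  assumes im: "i \<in> {1..n}" "m \<in> {1..n}" "i \<noteq> m"
    and g [measurable]: "(\<lambda>p. g (fst p) (snd p)) \<in> borel_measurable (borel \<Otimes>\<^sub>M borel)" and C: "\<And>x y. \<bar>g x y\<bar> \<le> C"
  shows "expectation (\<lambda>\<omega>. g (err i \<omega>) (err m \<omega>)) = (\<integral>v. (\<integral>u. g u v \<partial>law) \<partial>law)"
    and "integrable law (\<lambda>v. \<integral>u. g u v \<partial>law)"
proof -
  have [measurable]: "err i \<in> borel_measurable M" "err m \<in> borel_measurable M" using err_measurable im by auto
  have "expectation (\<lambda>\<omega>. g (err i \<omega>) (err m \<omega>)) =
    (\<integral>p. g (fst p) (snd p) \<partial>distr M (borel \<Otimes>\<^sub>M borel) (\<lambda>\<omega>. (err i \<omega>, err m \<omega>)))"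
    by (subst integral_distr) auto
  also have "\<dots> = (\<integral>p. g (fst p) (snd p) \<partial>(law \<Otimes>\<^sub>M law))" by (simp only: distr_err_pair[OF im])
  finally have 1: "expectation (\<lambda>\<omega>. g (err i \<omega>) (err m \<omega>)) = (\<integral>p. g (fst p) (snd p) \<partial>(law \<Otimes>\<^sub>M law))" .
  have "integrable (law \<Otimes>\<^sub>M law) (\<lambda>p. g (fst p) (snd p))"
    using C by (intro law_pair.P.integrable_const_bound[of _ C]) auto
  then have int: "integrable (law \<Otimes>\<^sub>M law) (\<lambda>(u, v). g u v)" by (simp add: case_prod_beta')
  show "expectation (\<lambda>\<omega>. g (err i \<omega>) (err m \<omega>)) = (\<integral>v. (\<integral>u. g u v \<partial>law) \<partial>law)"
    unfolding 1 using law_pair.integral_snd[OF int] by (simp add: case_prod_beta')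
  show "integrable law (\<lambda>v. \<integral>u. g u v \<partial>law)"
    using law_pair.integrable_snd[OF int] by simp
qed

lemma integrable_law_f: "integrable law f"
  using f_le_max f_nonneg by (intro integrable_law_bounded[of _ f_max]) auto

lemma
  assumes im: "i \<in> {1..n}" "m \<in> {1..n}" "i \<noteq> m"
  shows expectation_cmp_nonneg: "0 \<le> a \<Longrightarrow> 0 \<le> expectation (\<lambda>\<omega>. cmp (err i \<omega> + a) (err m \<omega> + b))"
    and expectation_cmp_ge_small: "0 \<le> a \<Longrightarrow> 0 \<le> b \<Longrightarrow>
      2 * a * (f_energy - B * (a + b)) \<le> expectation (\<lambda>\<omega>. cmp (err i \<omega> + a) (err m \<omega> + b))"
    and expectation_cmp_ge_large: "0 \<le> \<tau> \<Longrightarrow> \<tau> \<le> b \<Longrightarrow> b \<le> a \<Longrightarrow>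
      \<tau> * (f_energy - B * \<tau>) \<le> expectation (\<lambda>\<omega>. cmp (err i \<omega> + a) (err m \<omega> + b))"
proof -
  have ms: "(\<lambda>p. cmp (fst p + a) (snd p + b)) \<in> borel_measurable (borel \<Otimes>\<^sub>M borel)"
    unfolding cmp_def sgn_real_def by measurable
  note E = expectation_pair[OF im, of "\<lambda>u v. cmp (u + a) (v + b)", OF ms abs_cmp_le]
  show "0 \<le> expectation (\<lambda>\<omega>. cmp (err i \<omega> + a) (err m \<omega> + b))" if "0 \<le> a"
    unfolding E(1) integral_cmp[OF that] by simp
  show "2 * a * (f_energy - B * (a + b)) \<le> expectation (\<lambda>\<omega>. cmp (err i \<omega> + a) (err m \<omega> + b))"
    if "0 \<le> a" "0 \<le> b"
  proof -
    have "2 * a * (f_energy - B * (a + b)) = (\<integral>v. 2 * a * (f v - B * (a + b)) \<partial>law)"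
      using integrable_law_f law.prob_space by (simp add: integral_law_f)
    also have "\<dots> \<le> expectation (\<lambda>\<omega>. cmp (err i \<omega> + a) (err m \<omega> + b))"
      unfolding E(1) using integrable_law_f E(2) integral_cmp_ge_small[OF that] by (intro integral_mono) auto
    finally show ?thesis .
  qed
  show "\<tau> * (f_energy - B * \<tau>) \<le> expectation (\<lambda>\<omega>. cmp (err i \<omega> + a) (err m \<omega> + b))"
    if "0 \<le> \<tau>" "\<tau> \<le> b" "b \<le> a"
  proof -
    have "\<tau> * (f_energy - B * \<tau>) = (\<integral>v. \<tau> * (f v - B * \<tau>) \<partial>law)"
      using integrable_law_f law.prob_space by (simp add: integral_law_f)
    also have "\<dots> \<le> expectation (\<lambda>\<omega>. cmp (err i \<omega> + a) (err m \<omega> + b))"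
      unfolding E(1) using integrable_law_f E(2) integral_cmp_ge_large[OF that] by (intro integral_mono) auto
    finally show ?thesis .
  qed
qed

lemma expectation_cmp_diag:
  assumes i: "i \<in> {1..n}" and a: "0 \<le> a"
  shows "0 \<le> expectation (\<lambda>\<omega>. cmp (err i \<omega> + a) (err i \<omega> + a))"
proof -
  have "expectation (\<lambda>\<omega>. cmp (err i \<omega> + a) (err i \<omega> + a)) = (\<integral>u. cmp (u + a) 0 \<partial>distr M borel (err i))"
    using err_measurable[OF i] by (subst integral_distr) (auto simp: cmp_def sgn_real_def)
  also have "\<dots> = measure law {\<bar>0\<bar> - a..<\<bar>0\<bar> + a}" unfolding distr_err[OF i] by (rule integral_cmp[OF a])
  finally show ?thesis by simp
qed

end

text \<open>Only related pairs contribute a covariance, and each contributes at most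
  \<open>1 + 1\<close>.\<close>

lemma (in prob_space) variance_sum_le:
  fixes Z :: "'i \<Rightarrow> 'a \<Rightarrow> real"
  assumes T: "finite T" and Zm: "\<And>t. t \<in> T \<Longrightarrow> Z t \<in> borel_measurable M"
    and Z1: "\<And>t \<omega>. t \<in> T \<Longrightarrow> \<bar>Z t \<omega>\<bar> \<le> 1"
    and Nb: "\<And>t. t \<in> T \<Longrightarrow> card {t'\<in>T. rel t t'} \<le> d"
    and uncorr: "\<And>t t'. t \<in> T \<Longrightarrow> t' \<in> T \<Longrightarrow> \<not> rel t t' \<Longrightarrow>
       expectation (\<lambda>\<omega>. Z t \<omega> * Z t' \<omega>) = expectation (Z t) * expectation (Z t')"
  shows "variance (\<lambda>\<omega>. \<Sum>t\<in>T. Z t \<omega>) \<le> 2 * real d * real (card T)"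
proof -
  have int: "integrable M (Z t)" if "t \<in> T" for t
    using Zm Z1 that by (intro integrable_const_bound[of _ 1]) auto
  have bnd2: "\<bar>Z t \<omega> * Z t' \<omega>\<bar> \<le> 1" if "t \<in> T" "t' \<in> T" for t t' \<omega>
    using Z1[OF that(1), of \<omega>] Z1[OF that(2), of \<omega>] by (simp add: abs_mult mult_le_one)
  have int2: "integrable M (\<lambda>\<omega>. Z t \<omega> * Z t' \<omega>)" if "t \<in> T" "t' \<in> T" for t t'
    using Zm that bnd2 by (intro integrable_const_bound[of _ 1]) auto
  have e1: "\<bar>expectation (Z t)\<bar> \<le> 1" if "t \<in> T" for t
  proof -
    have "\<bar>expectation (Z t)\<bar> \<le> expectation (\<lambda>\<omega>. \<bar>Z t \<omega>\<bar>)" by (rule integral_abs_bound)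
    also have "\<dots> \<le> expectation (\<lambda>\<omega>. 1)" using int that Z1 by (intro integral_mono) auto
    finally show ?thesis by (simp add: prob_space)
  qed
  have e2: "expectation (\<lambda>\<omega>. Z t \<omega> * Z t' \<omega>) \<le> 1" if "t \<in> T" "t' \<in> T" for t t'
  proof -
    have "expectation (\<lambda>\<omega>. Z t \<omega> * Z t' \<omega>) \<le> expectation (\<lambda>\<omega>. 1)"
      using int2 that bnd2 by (intro integral_mono) (auto simp: abs_le_iff)
    then show ?thesis by (simp add: prob_space)
  qed
  have sq: "(\<Sum>t\<in>T. Z t \<omega>)\<^sup>2 = (\<Sum>t\<in>T. \<Sum>t'\<in>T. Z t \<omega> * Z t' \<omega>)" for \<omega>
    by (simp add: power2_eq_square sum_product)
  have es: "expectation (\<lambda>\<omega>. \<Sum>t\<in>T. Z t \<omega>) = (\<Sum>t\<in>T. expectation (Z t))"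
    using int by (simp add: Bochner_Integration.integral_sum)
  have "variance (\<lambda>\<omega>. \<Sum>t\<in>T. Z t \<omega>) = expectation (\<lambda>\<omega>. (\<Sum>t\<in>T. Z t \<omega>)\<^sup>2) - (expectation (\<lambda>\<omega>. \<Sum>t\<in>T. Z t \<omega>))\<^sup>2"
  proof (rule variance_eq)
    show "integrable M (\<lambda>\<omega>. \<Sum>t\<in>T. Z t \<omega>)" using int by (rule Bochner_Integration.integrable_sum)
    show "integrable M (\<lambda>\<omega>. (\<Sum>t\<in>T. Z t \<omega>)\<^sup>2)"
      unfolding sq using int2 by (intro Bochner_Integration.integrable_sum)
  qed
  also have "expectation (\<lambda>\<omega>. (\<Sum>t\<in>T. Z t \<omega>)\<^sup>2) = (\<Sum>t\<in>T. \<Sum>t'\<in>T. expectation (\<lambda>\<omega>. Z t \<omega> * Z t' \<omega>))"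
    unfolding sq using int2 by (simp add: Bochner_Integration.integral_sum)
  also note es
  also have "(\<Sum>t\<in>T. \<Sum>t'\<in>T. expectation (\<lambda>\<omega>. Z t \<omega> * Z t' \<omega>)) - (\<Sum>t\<in>T. expectation (Z t))\<^sup>2 =
      (\<Sum>t\<in>T. \<Sum>t'\<in>T. expectation (\<lambda>\<omega>. Z t \<omega> * Z t' \<omega>) - expectation (Z t) * expectation (Z t'))"
    by (simp add: power2_eq_square sum_product sum_subtractf)
  also have "\<dots> \<le> (\<Sum>t\<in>T. \<Sum>t'\<in>T. if rel t t' then 2 else 0)"
  proof (intro sum_mono)
    fix t t' assume t: "t \<in> T" "t' \<in> T"
    have "\<bar>expectation (Z t) * expectation (Z t')\<bar> \<le> 1"
      using e1[OF t(1)] e1[OF t(2)] by (simp add: abs_mult mult_le_one)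
    then show "expectation (\<lambda>\<omega>. Z t \<omega> * Z t' \<omega>) - expectation (Z t) * expectation (Z t') \<le> (if rel t t' then 2 else 0)"
      using e2[OF t] uncorr[OF t] by (auto simp: abs_le_iff)
  qed
  also have "\<dots> = (\<Sum>t\<in>T. 2 * real (card {t'\<in>T. rel t t'}))"
    using T by (simp add: sum.If_cases Int_def mult.commute)
  also have "\<dots> \<le> (\<Sum>t\<in>T. 2 * real d)" using Nb by (intro sum_mono) auto
  also have "\<dots> = 2 * real d * real (card T)" by simp
  finally show ?thesis by (simp only: es)
qed

section \<open>Concentration of sums over triples and the law of the absolute errors\<close>

context lipschitz_symmetric_errors
begin

text \<open>Triples of indices with disjoint supports are independent, so that a sum over \<open>I\<^sup>3\<close> of bounded
  functions of three errors has a variance of order \<open>card I ^ 5\<close> only.\<close>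

lemma prob_triple_sum_deviation:
  fixes G :: "nat \<Rightarrow> nat \<Rightarrow> nat \<Rightarrow> real \<times> real \<times> real \<Rightarrow> real"
  assumes I: "I \<subseteq> {1..n}" "I \<noteq> {}"
    and Gm [measurable]: "\<And>i m m'. G i m m' \<in> borel_measurable (borel \<Otimes>\<^sub>M borel \<Otimes>\<^sub>M borel)"
    and G1: "\<And>i m m' x. \<bar>G i m m' x\<bar> \<le> 1" and t: "0 < t"
  defines "S \<equiv> \<lambda>\<omega>. \<Sum>i\<in>I. \<Sum>m\<in>I. \<Sum>m'\<in>I. G i m m' (err i \<omega>, err m \<omega>, err m' \<omega>)"
  shows "prob {\<omega>\<in>space M. t * sqrt (real (card I) ^ 5) \<le> \<bar>S \<omega> - expectation S\<bar>} \<le> 18 / t\<^sup>2"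
proof -
  have fin: "finite I" using I finite_subset by blast
  define N where "N = card I"
  have N: "0 < N" using fin I by (simp add: N_def card_gt_0_iff)
  define T where "T = I \<times> I \<times> I"
  define Z where "Z = (\<lambda>(i, m, m') \<omega>. G i m m' (err i \<omega>, err m \<omega>, err m' \<omega>))"
  define supp where "supp = (\<lambda>(i, m, m'). {i, m, m' :: nat})"
  define rel where "rel = (\<lambda>t t'. supp t \<inter> supp t' \<noteq> {})"
  have S: "S = (\<lambda>\<omega>. \<Sum>t\<in>T. Z t \<omega>)"
    by (simp add: S_def T_def Z_def sum.cartesian_product case_prod_beta')
  have em: "err i \<in> borel_measurable M" if "i \<in> I" for i using err_measurable I that by blast
  have Zm: "Z t \<in> borel_measurable M" if t: "t \<in> T" for t
  proof -
    obtain i m m' where t': "t = (i, m, m')" "i \<in> I" "m \<in> I" "m' \<in> I" using t by (auto simp: T_def)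
    then have [measurable]: "err i \<in> borel_measurable M" "err m \<in> borel_measurable M" "err m' \<in> borel_measurable M"
      using em by auto
    show ?thesis unfolding t' Z_def prod.case by measurable
  qed
  have var: "variance S \<le> 2 * real (9 * N\<^sup>2) * real (card T)"
    unfolding S
  proof (rule variance_sum_le[of T Z rel])
    show "finite T" using fin by (simp add: T_def)
    show "Z t \<in> borel_measurable M" if "t \<in> T" for t using Zm[OF that] .
    show "\<bar>Z t \<omega>\<bar> \<le> 1" for t \<omega> using G1 by (simp add: Z_def case_prod_beta')
  next
    fix t assume t: "t \<in> T"
    obtain i m m' where t': "t = (i, m, m')" by (cases t)
    \<comment> \<open>The triples containing \<open>x\<close>, at most \<open>3 * N\<^sup>2\<close>
      many. A triple related to \<open>(i, m, m')\<close> contains one of these three indices,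
      whence \<open>9 * N\<^sup>2\<close>.\<close>
    define U where "U x = ({x} \<times> I \<times> I) \<union> (I \<times> {x} \<times> I) \<union> (I \<times> I \<times> {x})" for x
    have cU: "card (U x) \<le> 3 * N\<^sup>2" for x
    proof -
      have "card (U x) \<le> card ({x} \<times> I \<times> I) + card (I \<times> {x} \<times> I) + card (I \<times> I \<times> {x})"
        unfolding U_def by (intro order.trans[OF card_Un_le] add_mono card_Un_le order.refl)
      then show ?thesis by (simp add: card_cartesian_product N_def power2_eq_square)
    qed
    have "{t'\<in>T. rel t t'} \<subseteq> U i \<union> U m \<union> U m'"
      by (auto simp: t' T_def rel_def supp_def U_def)
    then have "card {t'\<in>T. rel t t'} \<le> card (U i \<union> U m \<union> U m')"
      using fin by (intro card_mono) (auto simp: U_def)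
    also have "\<dots> \<le> card (U i) + card (U m) + card (U m')"
      by (intro order.trans[OF card_Un_le] add_mono card_Un_le order.refl)
    also have "\<dots> \<le> 9 * N\<^sup>2" using cU[of i] cU[of m] cU[of m'] by simp
    finally show "card {t'\<in>T. rel t t'} \<le> 9 * N\<^sup>2" .
  next
    fix t t' assume t: "t \<in> T" "t' \<in> T" "\<not> rel t t'"
    obtain i m m' where ti: "t = (i, m, m')" by (cases t)
    obtain j k k' where tj: "t' = (j, k, k')" by (cases t')
    have A: "supp t \<inter> supp t' = {}" "supp t \<subseteq> {1..n}" "supp t' \<subseteq> {1..n}"
      using t I by (auto simp: rel_def supp_def T_def)
    have g: "(\<lambda>z. G i m m' (z i, z m, z m')) \<in> borel_measurable (PiM (supp t) (\<lambda>_. borel))"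
      "(\<lambda>z. G j k k' (z j, z k, z k')) \<in> borel_measurable (PiM (supp t') (\<lambda>_. borel))"
      by (intro measurable_compose[OF _ Gm] measurable_Pair measurable_component_singleton; simp add: ti tj supp_def)+
    have "indep_var borel (\<lambda>\<omega>. (\<lambda>z. G i m m' (z i, z m, z m')) (\<lambda>i\<in>supp t. err i \<omega>))
       borel (\<lambda>\<omega>. (\<lambda>z. G j k k' (z j, z k, z k')) (\<lambda>i\<in>supp t'. err i \<omega>))"
      by (rule indep_blocks[OF A g])
    then have ind: "indep_var borel (Z t) borel (Z t')"
      by (simp add: Z_def ti tj supp_def)
    have int: "integrable M (Z t)" if "t \<in> T" for t
      using Zm[OF that] G1 by (intro integrable_const_bound[of _ 1]) (auto simp: Z_def case_prod_beta')
    show "expectation (\<lambda>\<omega>. Z t \<omega> * Z t' \<omega>) = expectation (Z t) * expectation (Z t')"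
      by (rule indep_var_lebesgue_integral[OF ind int[OF t(1)] int[OF t(2)]])
  qed
  have Sm: "S \<in> borel_measurable M" unfolding S using Zm by (intro borel_measurable_sum) auto
  have Sb: "\<bar>S \<omega>\<bar> \<le> real (card T)" for \<omega>
  proof -
    have "\<bar>S \<omega>\<bar> \<le> (\<Sum>t\<in>T. \<bar>Z t \<omega>\<bar>)" unfolding S by (rule sum_abs)
    also have "\<dots> \<le> (\<Sum>t\<in>T. 1)" using G1 by (intro sum_mono) (simp add: Z_def case_prod_beta')
    finally show ?thesis by simp
  qed
  have int2: "integrable M (\<lambda>\<omega>. (S \<omega>)\<^sup>2)"
    using Sm Sb by (intro integrable_const_bound[of _ "(real (card T))\<^sup>2"]) (auto simp: abs_le_square_iff[symmetric] simp del: abs_of_nat intro: order.trans)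
  have pos: "0 < t * sqrt (real (card I) ^ 5)" using t N by (simp add: N_def)
  have "prob {\<omega>\<in>space M. t * sqrt (real (card I) ^ 5) \<le> \<bar>S \<omega> - expectation S\<bar>} \<le> variance S / (t * sqrt (real (card I) ^ 5))\<^sup>2"
    by (rule Chebyshev_inequality[OF Sm int2 pos])
  also have "\<dots> \<le> 18 * real N ^ 5 / (t * sqrt (real (card I) ^ 5))\<^sup>2"
  proof (rule divide_right_mono)
    have "2 * real (9 * N\<^sup>2) * real (card T) = 18 * real N ^ 5"
      by (simp add: T_def card_cartesian_product N_def power2_eq_square eval_nat_numeral)
    then show "variance S \<le> 18 * real N ^ 5" using var by simp
  qed simp
  also have "\<dots> = 18 / t\<^sup>2" using N by (simp add: power_mult_distrib N_def)
  finally show ?thesis .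
qed

lemma real_distribution_law: "real_distribution law"
  by (simp add: real_distribution_def real_distribution_axioms_def prob_space_law)

text \<open>Lipschitz continuity of the density gives the remainder \<open>B * h^2\<close>. Allowing
  \<open>x\<close> to be either end of the interval treats both one-sided increments
  together.\<close>

lemma cdf_law_deriv: "(cdf law has_real_derivative f x) (at x)"
proof -
  interpret L: real_distribution law by (rule real_distribution_law)
  have bound: "\<bar>cdf law t - cdf law s - f x * (t - s)\<bar> \<le> B * (t - s)\<^sup>2" if st: "s < t" "x = s \<or> x = t" for s t
  proof -
    have d: "cdf law t - cdf law s = measure law {s<..t}" using L.cdf_diff_eq[of s t] st by simp
    have cl: "\<bar>f x - f u\<bar> \<le> B * (t - s)" if "s \<le> u" "u \<le> t" for u
    proof -
      have "B * \<bar>x - u\<bar> \<le> B * (t - s)" using that st B_pos by (intro mult_left_mono) auto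
      then show ?thesis using f_lipschitz[of x u] by linarith
    qed
    have up: "measure law {s<..t} \<le> (f x + B * (t - s)) * (t - s)"
    proof -
      have "measure law {s<..t} \<le> measure law {s..t}" by (intro law.finite_measure_mono) auto
      also have "\<dots> \<le> (f x + B * (t - s)) * (t - s)"
      proof (rule measure_law_le)
        show "0 \<le> f x + B * (t - s)" using f_nonneg[of x] B_pos st by simp
        show "f u \<le> f x + B * (t - s)" if "s \<le> u" "u \<le> t" for u using cl[OF that] by linarith
      qed (use st in auto)
      finally show ?thesis .
    qed
    have low: "(f x - B * (t - s)) * (t - s) \<le> measure law {s<..t}"
    proof (cases "0 \<le> f x - B * (t - s)")
      case True
      have "(f x - B * (t - s)) * (t - s) \<le> measure law {s..<t}"
      proof (rule measure_law_ge)
        show "f x - B * (t - s) \<le> f u" if "s \<le> u" "u < t" for u using cl[of u] that by linarith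
      qed (use st True in auto)
      also have "\<dots> = measure law {s<..t}"
        using AE_law_neq[of s] AE_law_neq[of t]
        by (intro law.finite_measure_eq_AE) (auto elim!: eventually_elim2)
      finally show ?thesis .
    next
      case False
      then have "(f x - B * (t - s)) * (t - s) \<le> 0" using st by (intro mult_nonpos_nonneg) auto
      then show ?thesis using measure_nonneg[of law "{s<..t}"] by linarith
    qed
    show ?thesis unfolding d using up low by (simp add: abs_le_iff power2_eq_square algebra_simps)
  qed
  have "((\<lambda>h. (cdf law (x + h) - cdf law x) / h - f x) \<longlongrightarrow> 0) (at 0)"
  proof (rule Lim_null_comparison)
    show "eventually (\<lambda>h. norm ((cdf law (x + h) - cdf law x) / h - f x) \<le> B * \<bar>h\<bar>) (at 0)"
    proof (unfold eventually_at_filter, intro always_eventually allI impI)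
      fix h :: real assume h: "h \<noteq> 0"
      have "\<bar>cdf law (x + h) - cdf law x - f x * h\<bar> \<le> B * h\<^sup>2"
      proof (cases "0 < h")
        case True
        then show ?thesis using bound[of x "x + h"] by simp
      next
        case False
        then show ?thesis using bound[of "x + h" x] h by (simp add: abs_le_iff)
      qed
      then have "\<bar>cdf law (x + h) - cdf law x - f x * h\<bar> / \<bar>h\<bar> \<le> B * h\<^sup>2 / \<bar>h\<bar>"
        by (rule divide_right_mono) simp
      moreover have "B * h\<^sup>2 / \<bar>h\<bar> = B * \<bar>h\<bar>" using h by (simp add: power2_eq_square abs_if)
      moreover have "(cdf law (x + h) - cdf law x) / h - f x = (cdf law (x + h) - cdf law x - f x * h) / h"
        using h by (simp add: diff_divide_distrib)
      ultimately show "norm ((cdf law (x + h) - cdf law x) / h - f x) \<le> B * \<bar>h\<bar>"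
        by (simp add: abs_divide)
    qed
    have "((\<lambda>h. B * \<bar>h\<bar>) \<longlongrightarrow> B * \<bar>0\<bar>) (at (0::real))" by (intro tendsto_intros)
    then show "((\<lambda>h. B * \<bar>h\<bar>) \<longlongrightarrow> 0) (at (0::real))" by simp
  qed
  then show ?thesis by (simp add: DERIV_def LIM_zero_iff)
qed

definition abs_cdf :: "real \<Rightarrow> real" where "abs_cdf x = measure law {- x..x}"

lemma abs_cdf_eq: "0 \<le> x \<Longrightarrow> abs_cdf x = 2 * cdf law x - 1"
proof -
  assume x: "0 \<le> x"
  have "measure law {- x..x} = measure law ({..x} - {..<- x})" by (intro arg_cong[where f = "measure law"]) auto
  also have "\<dots> = measure law {..x} - measure law {..<- x}"
    using x by (intro law.finite_measure_Diff) auto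
  also have "measure law {..<- x} = measure law {..- x}"
    using AE_law_neq[of "- x"] by (intro law.finite_measure_eq_AE) (auto elim!: eventually_mono)
  also have "measure law {..- x} = measure law {x..}" by (rule measure_law_atMost)
  also have "measure law {x..} = measure law {x<..}"
    using AE_law_neq[of x] by (intro law.finite_measure_eq_AE) (auto elim!: eventually_mono)
  also have "measure law {x<..} = 1 - measure law {..x}"
  proof -
    have "{x<..} = space law - {..x}" by auto
    then show ?thesis using law.prob_compl[of "{..x}"] by simp
  qed
  finally show ?thesis by (simp add: abs_cdf_def cdf_def)
qed

text \<open>By symmetry \<open>2 * cdf law x - 1\<close> is odd, so squaring removes the absolute
  value and leaves an integrand with an explicit antiderivative.\<close>

lemma abs_cdf_sq: "(abs_cdf \<bar>x\<bar>)\<^sup>2 = (2 * cdf law x - 1)\<^sup>2"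
proof (cases "0 \<le> x")
  case True
  then show ?thesis by (simp add: abs_cdf_eq)
next
  case False
  have "cdf law (- x) = 1 - cdf law x"
  proof -
    have "cdf law x = measure law {..- (- x)}" by (simp add: cdf_def)
    also have "\<dots> = measure law {- x..}" by (rule measure_law_atMost)
    also have "\<dots> = measure law {- x<..}"
      using AE_law_neq[of "- x"] by (intro law.finite_measure_eq_AE) (auto elim!: eventually_mono)
    also have "\<dots> = 1 - measure law {..- x}"
    proof -
      have "{- x<..} = space law - {..- x}" by auto
      then show ?thesis using law.prob_compl[of "{..- x}"] by simp
    qed
    finally show ?thesis by (simp add: cdf_def)
  qed
  then show ?thesis using False by (simp add: abs_cdf_eq power2_commute)
qed

lemma integrable_abs_cdf_sq: "integrable law (\<lambda>u. (abs_cdf \<bar>u\<bar>)\<^sup>2)"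
proof (rule integrable_law_bounded[of _ 1])
  show "(\<lambda>u. (abs_cdf \<bar>u\<bar>)\<^sup>2) \<in> borel_measurable borel" unfolding abs_cdf_sq
    by (intro borel_measurable_power borel_measurable_diff borel_measurable_times borel_measurable_const borel_measurable_continuous_onI continuous_at_imp_continuous_on ballI DERIV_isCont[OF cdf_law_deriv])
  show "\<bar>(abs_cdf \<bar>u\<bar>)\<^sup>2\<bar> \<le> 1" for u
    using law.prob_le_1 by (simp add: abs_cdf_def power_le_one)
qed

text \<open>\<open>abs_cdf\<close> is the distribution function of the absolute errors, so this is the second moment of a uniform variable.\<close>

lemma integral_abs_cdf_sq: "(\<integral>u. (abs_cdf \<bar>u\<bar>)\<^sup>2 \<partial>law) = 1 / 3"
proof -
  interpret L: real_distribution law by (rule real_distribution_law)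
  \<comment> \<open>The antiderivative runs from \<open>- 1 / 6\<close> to \<open>1 / 6\<close>,
    which gives the integral \<open>1 / 3\<close>.\<close>
  let ?g = "\<lambda>u. f u * (2 * cdf law u - 1)\<^sup>2" and ?G = "\<lambda>u. (2 * cdf law u - 1) ^ 3 / 6"
  have lim: "((?G \<circ> real_of_ereal) \<longlongrightarrow> (2 * 0 - 1) ^ 3 / 6) (at_right (-\<infinity>))"
    "((?G \<circ> real_of_ereal) \<longlongrightarrow> (2 * 1 - 1) ^ 3 / 6) (at_left \<infinity>)"
    unfolding ereal_tendsto_simps by (intro tendsto_intros L.cdf_lim_at_bot L.cdf_lim_at_top_prob; simp)+
  have "(LBINT u=-\<infinity>..\<infinity>. ?g u) = (2 * 1 - 1) ^ 3 / 6 - (2 * 0 - 1) ^ 3 / 6"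
  proof (rule interval_integral_FTC_nonneg(2)[OF _ _ _ _ lim])
    fix u :: real
    show "DERIV ?G u :> ?g u"
      by (auto intro!: derivative_eq_intros cdf_law_deriv simp: power2_eq_square)
    show "isCont ?g u"
      by (intro isCont_mult isCont_power isCont_diff f_continuous DERIV_isCont[OF cdf_law_deriv] continuous_const)
  qed (use f_nonneg in auto)
  then have "(LINT u|lborel. ?g u) = 1 / 3"
    by (simp add: interval_lebesgue_integral_def set_lebesgue_integral_def)
  moreover have "(\<integral>u. (abs_cdf \<bar>u\<bar>)\<^sup>2 \<partial>law) = (LINT u|lborel. ?g u)"
    unfolding abs_cdf_sq
    by (rule integral_law) (intro borel_measurable_power borel_measurable_diff borel_measurable_times borel_measurable_const borel_measurable_continuous_onI continuous_at_imp_continuous_on ballI DERIV_isCont[OF cdf_law_deriv])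
  ultimately show ?thesis by simp
qed

end

text \<open>A positive numerator rules out a vanishing denominator, so the default value 0 of the
  statistic does not occur here.\<close>

lemma local_signed_rank_stat_ge:
  assumes num: "a \<le> (\<Sum>i=j..k. local_kernel \<psi> (X j) (X k) (X i) * sgn (y i) * real (local_rank y j k i))" and a: "0 < a"
    and den: "(\<Sum>i=j..k. (local_kernel \<psi> (X j) (X k) (X i))\<^sup>2 * (real (local_rank y j k i))\<^sup>2) \<le> V"
  shows "a / sqrt V \<le> local_signed_rank_stat \<psi> X y j k"
proof -
  define w where "w i = local_kernel \<psi> (X j) (X k) (X i)" for i
  define r where "r i = real (local_rank y j k i)" for i
  define D where "D = (\<Sum>i=j..k. (w i)\<^sup>2 * (r i)\<^sup>2)"
  define N where "N = (\<Sum>i=j..k. w i * sgn (y i) * r i)"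
  have N: "a \<le> N" using num by (simp add: N_def w_def r_def)
  have "0 < D"
  proof (rule ccontr)
    assume "\<not> 0 < D"
    moreover have "0 \<le> D" unfolding D_def by (intro sum_nonneg) simp
    ultimately have "D = 0" by simp
    then have z: "(w i)\<^sup>2 * (r i)\<^sup>2 = 0" if "i \<in> {j..k}" for i
      using that unfolding D_def by (subst (asm) sum_nonneg_eq_0_iff) auto
    have "N = 0" unfolding N_def
    proof (intro sum.neutral ballI)
      fix i assume "i \<in> {j..k}"
      from z[OF this] show "w i * sgn (y i) * r i = 0" by auto
    qed
    then show False using N a by simp
  qed
  moreover have "D \<le> V" using den by (simp add: D_def w_def r_def)
  ultimately have "a / sqrt V \<le> N / sqrt D"
    using N a by (intro frac_le) auto
  also have "\<dots> = local_signed_rank_stat \<psi> X y j k"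
    using \<open>0 < D\<close> by (simp add: local_signed_rank_stat_def Let_def D_def N_def w_def r_def)
  finally show ?thesis .
qed

text \<open>Of the two orders of a pair of distinct indices at least one satisfies
  \<open>l m \<le> l i\<close>. This provides enough pairs to which
  \<open>integral_cmp_ge_large\<close> applies.\<close>

lemma card_ordered_pairs_ge:
  fixes l :: "nat \<Rightarrow> real"
  assumes "finite A"
  shows "real (card A) * (real (card A) - 1) / 2 \<le> (\<Sum>i\<in>A. \<Sum>m\<in>A - {i}. if l m \<le> l i then 1 else 0)"
proof -
  define C where "C = (\<Sum>i\<in>A. \<Sum>m\<in>A. if i \<noteq> m \<and> l m \<le> l i then 1 else 0 :: real)"
  have C1: "(\<Sum>i\<in>A. \<Sum>m\<in>A - {i}. if l m \<le> l i then 1 else 0) = C" unfolding C_def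
    using assms by (intro sum.cong refl sum.mono_neutral_cong_left) auto
  have C2: "C = (\<Sum>i\<in>A. \<Sum>m\<in>A. if i \<noteq> m \<and> l i \<le> l m then 1 else 0 :: real)" unfolding C_def
    by (subst sum.swap) (intro sum.cong refl, auto)
  have "real (card A) * (real (card A) - 1) = (\<Sum>i\<in>A. \<Sum>m\<in>A. if i \<noteq> m then 1 else 0 :: real)"
  proof -
    have "(\<Sum>m\<in>A. if i \<noteq> m then 1 else 0 :: real) = real (card A) - 1" if "i \<in> A" for i
    proof -
      have "(\<Sum>m\<in>A. if i \<noteq> m then 1 else 0 :: real) = (\<Sum>m\<in>A. 1 - (if i = m then 1 else 0))"
        by (intro sum.cong) auto
      then show ?thesis using that assms by (simp add: sum_subtractf)
    qed
    then show ?thesis by simp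
  qed
  also have "\<dots> \<le> (\<Sum>i\<in>A. \<Sum>m\<in>A. (if i \<noteq> m \<and> l m \<le> l i then 1 else 0) + (if i \<noteq> m \<and> l i \<le> l m then 1 else 0))"
    by (intro sum_mono) auto
  also have "\<dots> = C + C" by (simp only: sum.distrib C_def[symmetric] C2[symmetric])
  finally show ?thesis unfolding C1 by simp
qed

context lipschitz_symmetric_errors
begin

text \<open>Given the error \<open>u\<close> at \<open>i\<close>, both other errors must lie in
  \<open>[- \<bar>u\<bar> - 2 * \<Lambda>, \<bar>u\<bar> + 2 * \<Lambda>]\<close>, whose mass is at
  most \<open>abs_cdf \<bar>u\<bar> + d\<close> with
  \<open>d = 4 * f_max * \<Lambda> \<le> 1\<close>. Squaring costs at most \<open>3 * d\<close>, and
  the main term integrates to \<open>1 / 3\<close>.\<close>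

lemma expectation_triple_le:
  assumes im: "i \<in> {1..n}" "m \<in> {1..n}" "m' \<in> {1..n}" "i \<noteq> m" "i \<noteq> m'" "m \<noteq> m'"
    and l: "\<bar>l i\<bar> \<le> \<Lambda>" "\<bar>l m\<bar> \<le> \<Lambda>" "\<bar>l m'\<bar> \<le> \<Lambda>" and \<Lambda>: "4 * f_max * \<Lambda> \<le> 1"
  shows "prob {\<omega>\<in>space M. \<bar>l m + err m \<omega>\<bar> \<le> \<bar>l i + err i \<omega>\<bar> \<and> \<bar>l m' + err m' \<omega>\<bar> \<le> \<bar>l i + err i \<omega>\<bar>} \<le> 1 / 3 + 12 * f_max * \<Lambda>"
proof -
  have \<Lambda>0: "0 \<le> \<Lambda>" using l by linarith
  define E where "E = {p :: real \<times> real \<times> real. \<bar>l m + fst (snd p)\<bar> \<le> \<bar>l i + fst p\<bar> \<and> \<bar>l m' + snd (snd p)\<bar> \<le> \<bar>l i + fst p\<bar>}"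
  have [measurable]: "(\<lambda>p :: real \<times> real \<times> real. \<bar>l i + fst p\<bar>) \<in> borel_measurable (borel \<Otimes>\<^sub>M (borel \<Otimes>\<^sub>M borel))"
    "(\<lambda>p :: real \<times> real \<times> real. \<bar>l m + fst (snd p)\<bar>) \<in> borel_measurable (borel \<Otimes>\<^sub>M (borel \<Otimes>\<^sub>M borel))"
    "(\<lambda>p :: real \<times> real \<times> real. \<bar>l m' + snd (snd p)\<bar>) \<in> borel_measurable (borel \<Otimes>\<^sub>M (borel \<Otimes>\<^sub>M borel))"
    by measurable
  have "E = {p \<in> space (borel \<Otimes>\<^sub>M (borel \<Otimes>\<^sub>M borel)). \<bar>l m + fst (snd p)\<bar> \<le> \<bar>l i + fst p\<bar>} \<inter>
      {p \<in> space (borel \<Otimes>\<^sub>M (borel \<Otimes>\<^sub>M borel)). \<bar>l m' + snd (snd p)\<bar> \<le> \<bar>l i + fst p\<bar>}"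
    by (auto simp: E_def space_pair_measure)
  also have "\<dots> \<in> sets (borel \<Otimes>\<^sub>M (borel \<Otimes>\<^sub>M borel))"
    by (intro sets.Int borel_measurable_le) measurable
  finally have E: "E \<in> sets (borel \<Otimes>\<^sub>M (borel \<Otimes>\<^sub>M borel))" .
  moreover have "sets (law \<Otimes>\<^sub>M (law \<Otimes>\<^sub>M law)) = sets (borel \<Otimes>\<^sub>M (borel \<Otimes>\<^sub>M borel))"
    by (intro sets_pair_measure_cong sets_law)
  ultimately have E': "E \<in> sets (law \<Otimes>\<^sub>M (law \<Otimes>\<^sub>M law))" by (simp only:)
  have [measurable]: "err i \<in> borel_measurable M" "err m \<in> borel_measurable M" "err m' \<in> borel_measurable M"
    using err_measurable im by auto
  have "emeasure M {\<omega>\<in>space M. \<bar>l m + err m \<omega>\<bar> \<le> \<bar>l i + err i \<omega>\<bar> \<and> \<bar>l m' + err m' \<omega>\<bar> \<le> \<bar>l i + err i \<omega>\<bar>}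
      = emeasure (distr M (borel \<Otimes>\<^sub>M (borel \<Otimes>\<^sub>M borel)) (\<lambda>\<omega>. (err i \<omega>, (err m \<omega>, err m' \<omega>)))) E"
    using E by (subst emeasure_distr) (auto simp: E_def vimage_def Int_def conj_commute intro!: arg_cong[where f = "emeasure M"])
  also have "\<dots> = emeasure (law \<Otimes>\<^sub>M (law \<Otimes>\<^sub>M law)) E" by (simp only: distr_err_triple[OF im])
  also have "\<dots> = (\<integral>\<^sup>+u. emeasure (law \<Otimes>\<^sub>M law) (Pair u -` E) \<partial>law)"
    by (rule law_pair.P.emeasure_pair_measure_alt[OF E'])
  also have "\<dots> \<le> (\<integral>\<^sup>+u. ennreal ((abs_cdf \<bar>u\<bar>)\<^sup>2 + 12 * f_max * \<Lambda>) \<partial>law)"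
  proof (rule nn_integral_mono)
    fix u
    define x where "x = \<bar>l i + u\<bar>"
    define S where "S = {- \<bar>u\<bar> - 2 * \<Lambda>..\<bar>u\<bar> + 2 * \<Lambda>}"
    have S: "v \<in> S" if "\<bar>c + v\<bar> \<le> \<bar>l i + u\<bar>" "\<bar>c\<bar> \<le> \<Lambda>" for c v
      using that l(1) unfolding S_def atLeastAtMost_iff by linarith
    have "Pair u -` E \<subseteq> S \<times> S"
    proof (clarsimp simp: E_def, intro conjI)
      fix v v' assume "\<bar>l m + v\<bar> \<le> \<bar>l i + u\<bar>" "\<bar>l m' + v'\<bar> \<le> \<bar>l i + u\<bar>"
      then show "v \<in> S" "v' \<in> S" using S l by blast+
    qed
    then have "emeasure (law \<Otimes>\<^sub>M law) (Pair u -` E) \<le> emeasure (law \<Otimes>\<^sub>M law) (S \<times> S)"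
      by (rule emeasure_mono) (simp add: S_def)
    also have "\<dots> = emeasure law S * emeasure law S"
      by (rule law.emeasure_pair_measure_Times) (simp_all add: S_def)
    also have "\<dots> = ennreal ((measure law S)\<^sup>2)"
      by (simp add: law.emeasure_eq_measure power2_eq_square ennreal_mult)
    also have "\<dots> \<le> ennreal ((abs_cdf \<bar>u\<bar>)\<^sup>2 + 12 * f_max * \<Lambda>)"
    proof (rule ennreal_leI)
      define d where "d = 4 * f_max * \<Lambda>"
      have d: "0 \<le> d" "d \<le> 1" using \<Lambda> \<Lambda>0 f_max_pos by (auto simp: d_def)
      have "measure law S \<le> measure law ({- \<bar>u\<bar>..\<bar>u\<bar>} \<union> ({\<bar>u\<bar>..\<bar>u\<bar> + 2 * \<Lambda>} \<union> {- \<bar>u\<bar> - 2 * \<Lambda>..- \<bar>u\<bar>}))"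
        by (intro law.finite_measure_mono) (auto simp: S_def)
      also have "\<dots> \<le> measure law {- \<bar>u\<bar>..\<bar>u\<bar>} + (measure law {\<bar>u\<bar>..\<bar>u\<bar> + 2 * \<Lambda>} + measure law {- \<bar>u\<bar> - 2 * \<Lambda>..- \<bar>u\<bar>})"
        by (intro order.trans[OF measure_Un_le] add_mono measure_Un_le order.refl) auto
      also have "\<dots> \<le> abs_cdf \<bar>u\<bar> + (f_max * (2 * \<Lambda>) + f_max * (2 * \<Lambda>))"
        using measure_law_interval_le[of "\<bar>u\<bar>" "\<bar>u\<bar> + 2 * \<Lambda>"] measure_law_interval_le[of "- \<bar>u\<bar> - 2 * \<Lambda>" "- \<bar>u\<bar>"] \<Lambda>0
        unfolding abs_cdf_def by (intro add_mono) auto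
      also have "\<dots> = abs_cdf \<bar>u\<bar> + d" by (simp add: d_def)
      finally have "(measure law S)\<^sup>2 \<le> (abs_cdf \<bar>u\<bar> + d)\<^sup>2" by (intro power_mono) auto
      also have "\<dots> = (abs_cdf \<bar>u\<bar>)\<^sup>2 + 2 * (abs_cdf \<bar>u\<bar> * d) + d * d" by (simp add: power2_eq_square algebra_simps)
      also have "\<dots> \<le> (abs_cdf \<bar>u\<bar>)\<^sup>2 + 2 * (1 * d) + 1 * d"
        using d law.prob_le_1 by (intro add_mono mult_left_mono mult_right_mono order.refl) (auto simp: abs_cdf_def)
      finally show "(measure law S)\<^sup>2 \<le> (abs_cdf \<bar>u\<bar>)\<^sup>2 + 12 * f_max * \<Lambda>" by (simp add: d_def mult_ac)
    qed
    finally show "emeasure (law \<Otimes>\<^sub>M law) (Pair u -` E) \<le> ennreal ((abs_cdf \<bar>u\<bar>)\<^sup>2 + 12 * f_max * \<Lambda>)" .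
  qed
  also have "\<dots> = ennreal (\<integral>u. (abs_cdf \<bar>u\<bar>)\<^sup>2 + 12 * f_max * \<Lambda> \<partial>law)"
  proof (rule nn_integral_eq_integral)
    show "AE u in law. 0 \<le> (abs_cdf \<bar>u\<bar>)\<^sup>2 + 12 * f_max * \<Lambda>" using f_max_pos \<Lambda>0 by auto
    show "integrable law (\<lambda>u. (abs_cdf \<bar>u\<bar>)\<^sup>2 + 12 * f_max * \<Lambda>)"
      by (intro Bochner_Integration.integrable_add integrable_abs_cdf_sq) simp
  qed
  also have "(\<integral>u. (abs_cdf \<bar>u\<bar>)\<^sup>2 + 12 * f_max * \<Lambda> \<partial>law) = 1 / 3 + 12 * f_max * \<Lambda>"
    using integrable_abs_cdf_sq integral_abs_cdf_sq law.prob_space by (simp add: Bochner_Integration.integral_add)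
  finally show ?thesis
    unfolding emeasure_eq_measure by (subst (asm) ennreal_le_iff) (use f_max_pos \<Lambda>0 in simp_all)
qed

end

section \<open>Moments and deviations of numerator and denominator on one interval\<close>

locale rank_interval = lipschitz_symmetric_errors M err f n B
  for M :: "'a measure" and err f n B +
  fixes j k :: nat and w l :: "nat \<Rightarrow> real"
  assumes jk: "1 \<le> j" "j < k" "k \<le> n"
    and w: "\<And>i. i \<in> {j..k} \<Longrightarrow> 0 \<le> w i \<and> w i \<le> 1"
begin

definition I :: "nat set" where "I = {j..k}"
definition p :: real where "p = real (card I)"
definition Y :: "'a \<Rightarrow> nat \<Rightarrow> real" where "Y \<omega> i = l i + err i \<omega>"
definition num :: "'a \<Rightarrow> real" where "num \<omega> = (\<Sum>i\<in>I. w i * sgn (Y \<omega> i) * real (local_rank (Y \<omega>) j k i))"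
definition den2 :: "'a \<Rightarrow> real" where "den2 \<omega> = (\<Sum>i\<in>I. (w i)\<^sup>2 * (real (local_rank (Y \<omega>) j k i))\<^sup>2)"

lemma I: "I \<subseteq> {1..n}" "I \<noteq> {}" "finite I" using jk by (auto simp: I_def)

lemma p_ge: "2 \<le> p" using jk by (simp add: p_def I_def)

lemma w_I: "i \<in> I \<Longrightarrow> 0 \<le> w i" "i \<in> I \<Longrightarrow> w i \<le> 1" using w by (auto simp: I_def)

lemma err_m: "i \<in> I \<Longrightarrow> err i \<in> borel_measurable M" using err_measurable I by blast

lemma num_eq: "num \<omega> = (\<Sum>i\<in>I. \<Sum>m\<in>I. w i * cmp (err i \<omega> + l i) (err m \<omega> + l m))"
  unfolding num_def real_local_rank I_def[symmetric] sum_distrib_left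
  by (intro sum.cong refl) (simp add: cmp_def Y_def add.commute)

lemma den2_eq: "den2 \<omega> = (\<Sum>i\<in>I. \<Sum>m\<in>I. \<Sum>m'\<in>I. (w i)\<^sup>2 * (if \<bar>l m + err m \<omega>\<bar> \<le> \<bar>l i + err i \<omega>\<bar> \<and> \<bar>l m' + err m' \<omega>\<bar> \<le> \<bar>l i + err i \<omega>\<bar> then 1 else 0))"
proof -
  have "(real (local_rank (Y \<omega>) j k i))\<^sup>2 = (\<Sum>m\<in>I. \<Sum>m'\<in>I.
      (if \<bar>l m + err m \<omega>\<bar> \<le> \<bar>l i + err i \<omega>\<bar> \<and> \<bar>l m' + err m' \<omega>\<bar> \<le> \<bar>l i + err i \<omega>\<bar> then 1 else 0))" for i
    unfolding real_local_rank I_def[symmetric] power2_eq_square sum_product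
    by (intro sum.cong refl) (simp add: Y_def)
  then show ?thesis by (simp only: den2_def sum_distrib_left)
qed

text \<open>The numerator is a sum over pairs. A dummy third index multiplies it by
  \<open>p\<close>, and \<open>sqrt (p ^ 5) = p * sqrt (p ^ 3)\<close> turns the bound for triples
  into one for pairs.\<close>

lemma prob_num_deviation:
  assumes t: "0 < t"
  shows "prob {\<omega>\<in>space M. t * sqrt (p ^ 3) \<le> \<bar>num \<omega> - expectation num\<bar>} \<le> 18 / t\<^sup>2"
proof -
  \<comment> \<open>The weights are only controlled on \<open>I\<close>, whereas the deviation bound
    asks for summands bounded by 1 at all indices.\<close>
  define w' where "w' i = (if i \<in> I then w i else 0)" for i
  have w': "\<bar>w' i\<bar> \<le> 1" for i using w_I by (auto simp: w'_def)
  define G where "G = (\<lambda>i m (m' :: nat) (x, y, z :: real). w' i * cmp (x + l i) (y + l m))"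
  have Gm: "G i m m' \<in> borel_measurable (borel \<Otimes>\<^sub>M borel \<Otimes>\<^sub>M borel)" for i m m'
    unfolding G_def cmp_def sgn_real_def case_prod_beta' by measurable
  have G1: "\<bar>G i m m' x\<bar> \<le> 1" for i m m' x
    using w'[of i] abs_cmp_le by (auto simp: G_def case_prod_beta' abs_mult intro!: mult_le_one)
  define S where "S = (\<lambda>\<omega>. \<Sum>i\<in>I. \<Sum>m\<in>I. \<Sum>m'\<in>I. G i m m' (err i \<omega>, err m \<omega>, err m' \<omega>))"
  have S: "S \<omega> = p * num \<omega>" for \<omega>
  proof -
    have "S \<omega> = (\<Sum>i\<in>I. \<Sum>m\<in>I. p * (w i * cmp (err i \<omega> + l i) (err m \<omega> + l m)))"
      unfolding S_def by (intro sum.cong refl) (simp add: G_def w'_def p_def)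
    then show ?thesis by (simp only: num_eq sum_distrib_left)
  qed
  have ES: "expectation S = p * expectation num"
  proof -
    have "S = (\<lambda>\<omega>. p * num \<omega>)" using S by (simp add: fun_eq_iff)
    then show ?thesis by simp
  qed
  have "sqrt (p ^ 5) = p * sqrt (p ^ 3)"
  proof -
    have "p ^ 5 = p\<^sup>2 * p ^ 3" by (simp add: power_add[symmetric])
    also have "sqrt \<dots> = sqrt (p\<^sup>2) * sqrt (p ^ 3)" by (rule real_sqrt_mult)
    finally show ?thesis using p_ge by simp
  qed
  then have S1: "t * sqrt (p ^ 5) \<le> \<bar>S \<omega> - expectation S\<bar> \<longleftrightarrow> t * sqrt (p ^ 3) \<le> \<bar>num \<omega> - expectation num\<bar>" for \<omega>
    unfolding S ES right_diff_distrib[symmetric] abs_mult using p_ge by (simp add: mult.left_commute)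
  have S0: "(\<Sum>i\<in>I. \<Sum>m\<in>I. \<Sum>m'\<in>I. G i m m' (err i \<omega>, err m \<omega>, err m' \<omega>)) = S \<omega>" for \<omega>
    by (simp only: S_def)
  show ?thesis unfolding S1[symmetric]
    using prob_triple_sum_deviation[where G = G, OF I(1,2) Gm G1 t] by (simp only: S0 p_def[symmetric])
qed

lemma prob_den2_deviation:
  assumes t: "0 < t"
  shows "prob {\<omega>\<in>space M. t * sqrt (p ^ 5) \<le> \<bar>den2 \<omega> - expectation den2\<bar>} \<le> 18 / t\<^sup>2"
proof -
  define w' where "w' i = (if i \<in> I then (w i)\<^sup>2 else 0)" for i
  have w': "\<bar>w' i\<bar> \<le> 1" for i using w_I by (auto simp: w'_def power_le_one)
  define G where "G = (\<lambda>i m m' (x, y, z :: real). w' i * (if \<bar>l m + y\<bar> \<le> \<bar>l i + x\<bar> \<and> \<bar>l m' + z\<bar> \<le> \<bar>l i + x\<bar> then 1 else 0 :: real))"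
  have Gm: "G i m m' \<in> borel_measurable (borel \<Otimes>\<^sub>M borel \<Otimes>\<^sub>M borel)" for i m m'
    unfolding G_def case_prod_beta' by measurable
  have G1: "\<bar>G i m m' x\<bar> \<le> 1" for i m m' x
    using w'[of i] by (auto simp: G_def case_prod_beta')
  have S: "(\<Sum>i\<in>I. \<Sum>m\<in>I. \<Sum>m'\<in>I. G i m m' (err i \<omega>, err m \<omega>, err m' \<omega>)) = den2 \<omega>" for \<omega>
    unfolding den2_eq by (intro sum.cong refl) (simp add: G_def w'_def)
  show ?thesis
    using prob_triple_sum_deviation[where G = G, OF I(1,2) Gm G1 t] by (simp only: S p_def[symmetric])
qed

lemma expectation_num:
  "expectation num = (\<Sum>i\<in>I. \<Sum>m\<in>I. w i * expectation (\<lambda>\<omega>. cmp (err i \<omega> + l i) (err m \<omega> + l m)))"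
proof -
  have int: "integrable M (\<lambda>\<omega>. w i * cmp (err i \<omega> + l i) (err m \<omega> + l m))" if "i \<in> I" "m \<in> I" for i m
  proof (intro integrable_mult_right integrable_const_bound[of _ 1])
    have [measurable]: "err i \<in> borel_measurable M" "err m \<in> borel_measurable M" using err_m that by auto
    show "(\<lambda>\<omega>. cmp (err i \<omega> + l i) (err m \<omega> + l m)) \<in> borel_measurable M"
      unfolding cmp_def sgn_real_def by measurable
  qed (use abs_cmp_le in auto)
  have "expectation num = expectation (\<lambda>\<omega>. \<Sum>i\<in>I. \<Sum>m\<in>I. w i * cmp (err i \<omega> + l i) (err m \<omega> + l m))"
    by (rule Bochner_Integration.integral_cong) (simp_all add: num_eq)
  also have "\<dots> = (\<Sum>i\<in>I. \<Sum>m\<in>I. expectation (\<lambda>\<omega>. w i * cmp (err i \<omega> + l i) (err m \<omega> + l m)))"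
    using int by (simp add: Bochner_Integration.integral_sum)
  finally show ?thesis by simp
qed

text \<open>The first-order bound applies to pairs of distinct indices, which gives
  \<open>p - 1\<close> partners for each index; diagonal terms are nonnegative and dropped.\<close>

lemma expectation_num_ge_small:
  assumes l: "\<And>i. i \<in> I \<Longrightarrow> 0 \<le> l i \<and> l i \<le> \<Lambda>"
  shows "2 * (p - 1) * (f_energy - 2 * B * \<Lambda>) * (\<Sum>i\<in>I. w i * l i) \<le> expectation num"
proof -
  have "2 * (p - 1) * (f_energy - 2 * B * \<Lambda>) * (\<Sum>i\<in>I. w i * l i) =
      (\<Sum>i\<in>I. \<Sum>m\<in>I - {i}. w i * (2 * l i * (f_energy - 2 * B * \<Lambda>)))"
  proof -
    have "real (card (I - {i})) = p - 1" if "i \<in> I" for i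
      using that I(3) p_ge by (simp add: p_def of_nat_diff card_gt_0_iff Suc_le_eq I(2))
    then have "(\<Sum>i\<in>I. \<Sum>m\<in>I - {i}. w i * (2 * l i * (f_energy - 2 * B * \<Lambda>))) =
        (\<Sum>i\<in>I. 2 * (p - 1) * (f_energy - 2 * B * \<Lambda>) * (w i * l i))"
      by (intro sum.cong refl) (simp only: sum_constant mult_ac)
    then show ?thesis by (simp only: sum_distrib_left)
  qed
  also have "\<dots> \<le> (\<Sum>i\<in>I. \<Sum>m\<in>I - {i}. w i * expectation (\<lambda>\<omega>. cmp (err i \<omega> + l i) (err m \<omega> + l m)))"
  proof (intro sum_mono mult_left_mono)
    fix i m assume im: "i \<in> I" "m \<in> I - {i}"
    have "2 * l i * (f_energy - 2 * B * \<Lambda>) \<le> 2 * l i * (f_energy - B * (l i + l m))"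
    proof (intro mult_left_mono)
      have "B * (l i + l m) \<le> B * (\<Lambda> + \<Lambda>)" using l[of i] l[of m] im B_pos by (intro mult_left_mono add_mono) auto
      then show "f_energy - 2 * B * \<Lambda> \<le> f_energy - B * (l i + l m)" by (simp add: algebra_simps)
    qed (use l im in auto)
    also have "\<dots> \<le> expectation (\<lambda>\<omega>. cmp (err i \<omega> + l i) (err m \<omega> + l m))"
      using im I l by (intro expectation_cmp_ge_small) auto
    finally show "2 * l i * (f_energy - 2 * B * \<Lambda>) \<le> expectation (\<lambda>\<omega>. cmp (err i \<omega> + l i) (err m \<omega> + l m))" .
  qed (use w_I in auto)
  also have "\<dots> \<le> (\<Sum>i\<in>I. \<Sum>m\<in>I. w i * expectation (\<lambda>\<omega>. cmp (err i \<omega> + l i) (err m \<omega> + l m)))"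
  proof (intro sum_mono)
    fix i assume i: "i \<in> I"
    have "0 \<le> w i * expectation (\<lambda>\<omega>. cmp (err i \<omega> + l i) (err i \<omega> + l i))"
      using i I l w_I by (intro mult_nonneg_nonneg expectation_cmp_diag) auto
    then show "(\<Sum>m\<in>I - {i}. w i * expectation (\<lambda>\<omega>. cmp (err i \<omega> + l i) (err m \<omega> + l m))) \<le>
       (\<Sum>m\<in>I. w i * expectation (\<lambda>\<omega>. cmp (err i \<omega> + l i) (err m \<omega> + l m)))"
      using i I(3) by (simp add: sum.remove[of I i])
  qed
  finally show ?thesis by (simp only: expectation_num)
qed

text \<open>Two halves make the factor \<open>1 / 4\<close>:
  \<open>2 * B * \<tau> \<le> f_energy\<close> keeps half of \<open>\<tau> * f_energy\<close>, and
  half of the ordered pairs in \<open>A\<close> have the larger signal in first place. All remaining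
  terms are nonnegative.\<close>

lemma expectation_num_ge_large:
  assumes l: "\<And>i. i \<in> I \<Longrightarrow> \<tau> \<le> l i" and \<tau>: "0 \<le> \<tau>" "2 * B * \<tau> \<le> f_energy"
    and A: "A \<subseteq> I" "\<And>i. i \<in> A \<Longrightarrow> c \<le> w i" and c: "0 \<le> c"
  shows "c * \<tau> * f_energy / 4 * (real (card A) * (real (card A) - 1)) \<le> expectation num"
proof -
  let ?E = "\<lambda>i m. expectation (\<lambda>\<omega>. cmp (err i \<omega> + l i) (err m \<omega> + l m))"
  have l0: "0 \<le> l i" if "i \<in> I" for i using l[OF that] \<tau> by linarith
  have E0: "0 \<le> ?E i m" if "i \<in> I" "m \<in> I" for i m
  proof (cases "i = m")
    case True
    then show ?thesis using that I l0 by (auto intro!: expectation_cmp_diag)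
  next
    case False
    then show ?thesis using that I l0 by (intro expectation_cmp_nonneg) auto
  qed
  have finA: "finite A" using A(1) I(3) finite_subset by blast
  have "c * \<tau> * f_energy / 4 * (real (card A) * (real (card A) - 1)) = c * (\<tau> * f_energy / 2) * (real (card A) * (real (card A) - 1) / 2)"
    by simp
  also have "\<dots> \<le> c * (\<tau> * f_energy / 2) * (\<Sum>i\<in>A. \<Sum>m\<in>A - {i}. if l m \<le> l i then 1 else 0)"
    using c \<tau> f_energy_pos by (intro mult_left_mono card_ordered_pairs_ge finA) auto
  also have "\<dots> = (\<Sum>i\<in>A. \<Sum>m\<in>A - {i}. c * (\<tau> * f_energy / 2) * (if l m \<le> l i then 1 else 0))"
    by (simp only: sum_distrib_left)
  also have "\<dots> \<le> (\<Sum>i\<in>A. \<Sum>m\<in>A - {i}. w i * ?E i m)"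
  proof (intro sum_mono)
    fix i m assume im: "i \<in> A" "m \<in> A - {i}"
    then have im': "i \<in> I" "m \<in> I" "i \<noteq> m" using A by auto
    show "c * (\<tau> * f_energy / 2) * (if l m \<le> l i then 1 else 0) \<le> w i * ?E i m"
    proof (cases "l m \<le> l i")
      case True
      have "\<tau> * f_energy / 2 \<le> \<tau> * (f_energy - B * \<tau>)"
      proof -
        have "\<tau> * (f_energy / 2) \<le> \<tau> * (f_energy - B * \<tau>)" using \<tau> by (intro mult_left_mono) auto
        then show ?thesis by simp
      qed
      also have "\<dots> \<le> ?E i m" using im' I l[OF im'(2)] \<tau> True by (intro expectation_cmp_ge_large) auto
      finally have "c * (\<tau> * f_energy / 2) \<le> w i * ?E i m"
        using A(2)[OF im(1)] c \<tau> f_energy_pos by (intro mult_mono) auto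
      then show ?thesis using True by simp
    next
      case False
      then show ?thesis using E0[OF im'(1,2)] w_I(1)[OF im'(1)] by simp
    qed
  qed
  also have "\<dots> \<le> (\<Sum>i\<in>A. \<Sum>m\<in>I. w i * ?E i m)"
    using A(1) I(3) E0 w_I by (intro sum_mono sum_mono2) (auto intro!: mult_nonneg_nonneg)
  also have "\<dots> \<le> (\<Sum>i\<in>I. \<Sum>m\<in>I. w i * ?E i m)"
    using A(1) I(3) E0 w_I by (intro sum_mono2) (auto intro!: sum_nonneg mult_nonneg_nonneg)
  finally show ?thesis by (simp only: expectation_num)
qed

text \<open>The bound near \<open>1 / 3\<close> holds for three distinct indices. For each
  \<open>i\<close>, coincidences among \<open>i\<close>, \<open>m\<close> and \<open>m'\<close>
  affect at most \<open>3 * p\<close> pairs, each costing at most 1.\<close>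

lemma expectation_den2_le:
  assumes l: "\<And>i. i \<in> I \<Longrightarrow> \<bar>l i\<bar> \<le> \<Lambda>" and \<Lambda>: "4 * f_max * \<Lambda> \<le> 1"
  shows "expectation den2 \<le> (p\<^sup>2 * (1 / 3 + 12 * f_max * \<Lambda>) + 3 * p) * (\<Sum>i\<in>I. (w i)\<^sup>2)"
proof -
  define ev where "ev i m m' = {\<omega>\<in>space M. \<bar>l m + err m \<omega>\<bar> \<le> \<bar>l i + err i \<omega>\<bar> \<and> \<bar>l m' + err m' \<omega>\<bar> \<le> \<bar>l i + err i \<omega>\<bar>}" for i m m'
  define q where "q = 1 / 3 + 12 * f_max * \<Lambda>"
  obtain i0 where "i0 \<in> I" using I(2) by blast
  then have "0 \<le> \<Lambda>" using l[of i0] by linarith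
  then have q: "0 \<le> q" using f_max_pos by (simp add: q_def)
  have ev: "ev i m m' \<in> sets M" if "i \<in> I" "m \<in> I" "m' \<in> I" for i m m'
  proof -
    have [measurable]: "err i \<in> borel_measurable M" "err m \<in> borel_measurable M" "err m' \<in> borel_measurable M"
      using err_m that by auto
    show ?thesis unfolding ev_def by measurable
  qed
  have int: "integrable M (indicat_real A)" if "A \<in> sets M" for A
    using that by (intro integrable_real_indicator) (simp_all add: emeasure_eq_measure)
  have "expectation den2 = expectation (\<lambda>\<omega>. \<Sum>i\<in>I. \<Sum>m\<in>I. \<Sum>m'\<in>I. (w i)\<^sup>2 * indicator (ev i m m') \<omega>)"
    by (rule Bochner_Integration.integral_cong) (auto simp: den2_eq ev_def indicator_def intro!: sum.cong)
  also have "\<dots> = (\<Sum>i\<in>I. \<Sum>m\<in>I. \<Sum>m'\<in>I. (w i)\<^sup>2 * prob (ev i m m'))"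
    using int ev by (simp add: Bochner_Integration.integral_sum integrable_mult_right)
  also have "\<dots> = (\<Sum>i\<in>I. (w i)\<^sup>2 * (\<Sum>m\<in>I. \<Sum>m'\<in>I. prob (ev i m m')))"
    by (simp add: sum_distrib_left)
  also have "\<dots> \<le> (\<Sum>i\<in>I. (w i)\<^sup>2 * (p\<^sup>2 * q + 3 * p))"
  proof (intro sum_mono mult_left_mono)
    fix i assume i: "i \<in> I"
    have "(\<Sum>m\<in>I. \<Sum>m'\<in>I. prob (ev i m m')) \<le>
       (\<Sum>m\<in>I. \<Sum>m'\<in>I. q + ((if m = i then 1 else 0) + (if m' = i then 1 else 0) + (if m = m' then 1 else 0)))"
    proof (intro sum_mono)
      fix m m' assume m: "m \<in> I" "m' \<in> I"
      show "prob (ev i m m') \<le> q + ((if m = i then 1 else 0) + (if m' = i then 1 else 0) + (if m = m' then 1 else 0))"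
      proof (cases "m = i \<or> m' = i \<or> m = m'")
        case True
        have "prob (ev i m m') \<le> q + 1" using prob_le_1[of "ev i m m'"] q by linarith
        moreover have "(1::real) \<le> (if m = i then 1 else 0) + (if m' = i then 1 else 0) + (if m = m' then 1 else 0)"
          using True by auto
        ultimately show ?thesis by linarith
      next
        case False
        have "prob (ev i m m') \<le> q" unfolding ev_def q_def
          using False i m I(1) l \<Lambda> by (intro expectation_triple_le) auto
        then show ?thesis using False by simp
      qed
    qed
    also have "\<dots> = p\<^sup>2 * q + 3 * p"
      using i I(3) by (simp add: sum.distrib p_def power2_eq_square sum_distrib_left[symmetric])
    finally show "(\<Sum>m\<in>I. \<Sum>m'\<in>I. prob (ev i m m')) \<le> p\<^sup>2 * q + 3 * p" .
  qed simp
  also have "\<dots> = (p\<^sup>2 * q + 3 * p) * (\<Sum>i\<in>I. (w i)\<^sup>2)"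
    by (simp only: sum_distrib_right mult.commute)
  finally show ?thesis by (simp only: q_def)
qed

lemma num_measurable: "num \<in> borel_measurable M" and den2_measurable: "den2 \<in> borel_measurable M"
proof -
  have Ym: "(\<lambda>\<omega>. Y \<omega> m) \<in> borel_measurable M" if "m \<in> {j..k}" for m
    using err_m[of m] that by (simp add: Y_def I_def)
  have r: "(\<lambda>\<omega>. real (local_rank (Y \<omega>) j k i)) \<in> borel_measurable M" if "i \<in> I" for i
    using that by (intro measurable_real_local_rank Ym) (auto simp: I_def)
  have s: "(\<lambda>\<omega>. sgn (Y \<omega> i)) \<in> borel_measurable M" if "i \<in> I" for i
  proof -
    have [measurable]: "(\<lambda>\<omega>. Y \<omega> i) \<in> borel_measurable M" using Ym that by (simp add: I_def)
    show ?thesis unfolding sgn_real_def by measurable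
  qed
  have "(\<lambda>\<omega>. \<Sum>i\<in>I. w i * sgn (Y \<omega> i) * real (local_rank (Y \<omega>) j k i)) \<in> borel_measurable M"
    by (intro borel_measurable_sum borel_measurable_times r s) simp_all
  then show "num \<in> borel_measurable M" by (simp add: num_def[abs_def])
  have "(\<lambda>\<omega>. \<Sum>i\<in>I. (w i)\<^sup>2 * (real (local_rank (Y \<omega>) j k i))\<^sup>2) \<in> borel_measurable M"
    by (intro borel_measurable_sum borel_measurable_times borel_measurable_power r) simp_all
  then show "den2 \<in> borel_measurable M" by (simp add: den2_def[abs_def])
qed

lemma prob_num_le:
  assumes t: "0 < t"
  shows "prob {\<omega>\<in>space M. num \<omega> < expectation num - t * sqrt (p ^ 3)} \<le> 18 / t\<^sup>2"
proof -
  note [measurable] = num_measurable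
  have "prob {\<omega>\<in>space M. num \<omega> < expectation num - t * sqrt (p ^ 3)} \<le>
      prob {\<omega>\<in>space M. t * sqrt (p ^ 3) \<le> \<bar>num \<omega> - expectation num\<bar>}"
    by (rule finite_measure_mono) auto
  then show ?thesis using prob_num_deviation[OF t] by linarith
qed

lemma prob_den2_gt:
  assumes t: "0 < t"
  shows "prob {\<omega>\<in>space M. expectation den2 + t * sqrt (p ^ 5) < den2 \<omega>} \<le> 18 / t\<^sup>2"
proof -
  note [measurable] = den2_measurable
  have "prob {\<omega>\<in>space M. expectation den2 + t * sqrt (p ^ 5) < den2 \<omega>} \<le>
      prob {\<omega>\<in>space M. t * sqrt (p ^ 5) \<le> \<bar>den2 \<omega> - expectation den2\<bar>}"
    by (rule finite_measure_mono) auto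
  then show ?thesis using prob_den2_deviation[OF t] by linarith
qed

lemma den2_le: "den2 \<omega> \<le> p ^ 3"
proof -
  have "den2 \<omega> \<le> (\<Sum>i\<in>I. 1 * p\<^sup>2)" unfolding den2_def
  proof (intro sum_mono mult_mono power_mono)
    fix i assume i: "i \<in> I"
    show "(w i)\<^sup>2 \<le> 1" using w_I[OF i] by (simp add: power_le_one)
    have "card I = Suc k - j" by (simp add: I_def)
    then show "real (local_rank (Y \<omega>) j k i) \<le> p" using local_rank_le[of "Y \<omega>" j k i] by (simp add: p_def)
  qed auto
  then show ?thesis by (simp add: p_def power3_eq_cube power2_eq_square)
qed

lemma measurable_stat: "(\<lambda>\<omega>. local_signed_rank_stat \<psi> X (Y \<omega>) j k) \<in> borel_measurable M"
proof (rule measurable_local_signed_rank_stat)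
  show "(\<lambda>\<omega>. Y \<omega> m) \<in> borel_measurable M" if "m \<in> {j..k}" for m
    using err_m[of m] that by (simp add: Y_def I_def)
qed

lemma stat_ge_if:
  assumes wX: "\<And>i. i \<in> {j..k} \<Longrightarrow> w i = local_kernel \<psi> (X j) (X k) (X i)"
    and "a \<le> num \<omega>" "0 < a" "den2 \<omega> \<le> V"
  shows "a / sqrt V \<le> local_signed_rank_stat \<psi> X (Y \<omega>) j k"
proof (rule local_signed_rank_stat_ge)
  show "a \<le> (\<Sum>i=j..k. local_kernel \<psi> (X j) (X k) (X i) * sgn (Y \<omega> i) * real (local_rank (Y \<omega>) j k i))"
    using assms by (simp add: num_def I_def)
  show "(\<Sum>i=j..k. (local_kernel \<psi> (X j) (X k) (X i))\<^sup>2 * (real (local_rank (Y \<omega>) j k i))\<^sup>2) \<le> V"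
    using assms by (simp add: den2_def I_def)
qed (use assms in auto)

text \<open>The deterministic bound \<open>den2 \<le> p ^ 3\<close> suffices when constants do not
  matter, so only the numerator has to concentrate.\<close>

lemma prob_stat_less_crude:
  assumes wX: "\<And>i. i \<in> {j..k} \<Longrightarrow> w i = local_kernel \<psi> (X j) (X k) (X i)"
    and t: "0 < t" and \<mu>: "\<mu> \<le> expectation num" "t * sqrt (p ^ 3) < \<mu>"
  shows "prob {\<omega>\<in>space M. local_signed_rank_stat \<psi> X (Y \<omega>) j k < \<mu> / sqrt (p ^ 3) - t} \<le> 18 / t\<^sup>2"
proof -
  note [measurable] = num_measurable measurable_stat
  have "prob {\<omega>\<in>space M. local_signed_rank_stat \<psi> X (Y \<omega>) j k < \<mu> / sqrt (p ^ 3) - t} \<le>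
      prob {\<omega>\<in>space M. num \<omega> < expectation num - t * sqrt (p ^ 3)}"
  proof (rule finite_measure_mono)
    show "{\<omega>\<in>space M. local_signed_rank_stat \<psi> X (Y \<omega>) j k < \<mu> / sqrt (p ^ 3) - t} \<subseteq>
      {\<omega>\<in>space M. num \<omega> < expectation num - t * sqrt (p ^ 3)}"
    proof (clarify, rule ccontr)
      fix \<omega> assume lt: "local_signed_rank_stat \<psi> X (Y \<omega>) j k < \<mu> / sqrt (p ^ 3) - t"
        and "\<not> num \<omega> < expectation num - t * sqrt (p ^ 3)"
      then have "\<mu> - t * sqrt (p ^ 3) \<le> num \<omega>" "0 < \<mu> - t * sqrt (p ^ 3)" using \<mu> by auto
      then have "(\<mu> - t * sqrt (p ^ 3)) / sqrt (p ^ 3) \<le> local_signed_rank_stat \<psi> X (Y \<omega>) j k"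
        using den2_le by (intro stat_ge_if[OF wX]) auto
      moreover have "(\<mu> - t * sqrt (p ^ 3)) / sqrt (p ^ 3) = \<mu> / sqrt (p ^ 3) - t"
        using p_ge by (simp add: diff_divide_distrib)
      ultimately show False using lt by linarith
    qed
  qed measurable
  then show ?thesis using prob_num_le[OF t] by linarith
qed

text \<open>Here the denominator must be of the right size as well; its deviation accounts for the
  second \<open>18 / t^2\<close>.\<close>

lemma prob_stat_less_sharp:
  assumes wX: "\<And>i. i \<in> {j..k} \<Longrightarrow> w i = local_kernel \<psi> (X j) (X k) (X i)"
    and t: "0 < t" and \<mu>: "\<mu> \<le> expectation num" "t * sqrt (p ^ 3) < \<mu>" and v: "expectation den2 \<le> v"
  shows "prob {\<omega>\<in>space M. local_signed_rank_stat \<psi> X (Y \<omega>) j k < (\<mu> - t * sqrt (p ^ 3)) / sqrt (v + t * sqrt (p ^ 5))} \<le> 36 / t\<^sup>2"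
proof -
  note [measurable] = num_measurable den2_measurable measurable_stat
  let ?A = "{\<omega>\<in>space M. num \<omega> < expectation num - t * sqrt (p ^ 3)}"
  let ?B = "{\<omega>\<in>space M. expectation den2 + t * sqrt (p ^ 5) < den2 \<omega>}"
  have "prob {\<omega>\<in>space M. local_signed_rank_stat \<psi> X (Y \<omega>) j k < (\<mu> - t * sqrt (p ^ 3)) / sqrt (v + t * sqrt (p ^ 5))} \<le>
      prob (?A \<union> ?B)"
  proof (rule finite_measure_mono)
    show "{\<omega>\<in>space M. local_signed_rank_stat \<psi> X (Y \<omega>) j k < (\<mu> - t * sqrt (p ^ 3)) / sqrt (v + t * sqrt (p ^ 5))} \<subseteq> ?A \<union> ?B"
    proof (rule subsetI, rule ccontr)
      fix \<omega> assume *: "\<omega> \<in> {\<omega>\<in>space M. local_signed_rank_stat \<psi> X (Y \<omega>) j k < (\<mu> - t * sqrt (p ^ 3)) / sqrt (v + t * sqrt (p ^ 5))}"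
        and "\<omega> \<notin> ?A \<union> ?B"
      then have "\<mu> - t * sqrt (p ^ 3) \<le> num \<omega>" "0 < \<mu> - t * sqrt (p ^ 3)" "den2 \<omega> \<le> v + t * sqrt (p ^ 5)"
        using \<mu> v by auto
      then have "(\<mu> - t * sqrt (p ^ 3)) / sqrt (v + t * sqrt (p ^ 5)) \<le> local_signed_rank_stat \<psi> X (Y \<omega>) j k"
        by (intro stat_ge_if[OF wX]) auto
      then show False using * by auto
    qed
  qed measurable
  also have "\<dots> \<le> prob ?A + prob ?B" by (rule measure_Un_le) measurable
  finally show ?thesis using prob_num_le[OF t] prob_den2_gt[OF t] by linarith
qed

end

section \<open>Quantile designs\<close>

locale design =
  fixes h :: "real \<Rightarrow> real" and h0 h1 :: real
  assumes h_continuous: "continuous_on {0..1} h"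
    and h_density: "prob_space (design_law h)"
    and h0: "0 < h0" and h_bounds: "\<And>x. x \<in> {0..1} \<Longrightarrow> h0 \<le> h x \<and> h x \<le> h1"
begin

lemma h_measurable: "(\<lambda>x. indicator {0..1} x * h x) \<in> borel_measurable borel"
  using borel_measurable_continuous_on_indicator[OF _ h_continuous] by (simp add: scaleR_conv_of_real)

lemma sets_design_law [simp]: "sets (design_law h) = sets borel"
  by (simp add: design_law_def)

lemma real_distribution_design: "real_distribution (design_law h)"
  using h_density by (simp add: real_distribution_def real_distribution_axioms_def)

abbreviation "H \<equiv> cdf (design_law h)"

lemma emeasure_design:
  assumes "A \<in> sets borel"
  shows "emeasure (design_law h) A = (\<integral>\<^sup>+x. ennreal (indicator {0..1} x * h x) * indicator A x \<partial>lborel)"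
  unfolding design_law_def using h_measurable assms by (subst emeasure_density) auto

lemma H_diff:
  assumes "x \<le> y"
  shows "H y - H x = measure (design_law h) {x<..y}"
proof -
  interpret D: real_distribution "design_law h" by (rule real_distribution_design)
  show ?thesis using D.cdf_diff_eq[of x y] assms by (cases "x = y") auto
qed

lemma H_diff_ge:
  assumes "0 \<le> x" "x \<le> y" "y \<le> 1" "0 \<le> v" "\<And>u. x \<le> u \<Longrightarrow> u \<le> y \<Longrightarrow> v \<le> h u"
  shows "v * (y - x) \<le> H y - H x"
proof -
  interpret D: real_distribution "design_law h" by (rule real_distribution_design)
  have "ennreal (v * (y - x)) = (\<integral>\<^sup>+u. ennreal v * indicator {x<..y} u \<partial>lborel)"
    using assms by (subst nn_integral_cmult_indicator) (auto simp: ennreal_mult)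
  also have "\<dots> \<le> emeasure (design_law h) {x<..y}"
    using assms by (subst emeasure_design) (auto intro!: nn_integral_mono ennreal_leI simp: indicator_def)
  finally show ?thesis using assms by (simp add: D.emeasure_eq_measure H_diff)
qed

lemma H_diff_le:
  assumes "0 \<le> x" "x \<le> y" "y \<le> 1" "0 \<le> v" "\<And>u. x \<le> u \<Longrightarrow> u \<le> y \<Longrightarrow> h u \<le> v"
  shows "H y - H x \<le> v * (y - x)"
proof -
  interpret D: real_distribution "design_law h" by (rule real_distribution_design)
  have "emeasure (design_law h) {x<..y} \<le> (\<integral>\<^sup>+u. ennreal v * indicator {x<..y} u \<partial>lborel)"
    using assms by (subst emeasure_design) (auto intro!: nn_integral_mono ennreal_leI simp: indicator_def)
  also have "\<dots> = ennreal (v * (y - x))"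
    using assms by (subst nn_integral_cmult_indicator) (auto simp: ennreal_mult)
  finally show ?thesis using assms by (simp add: D.emeasure_eq_measure H_diff)
qed

lemma h1_pos: "0 < h1" using h_bounds[of 0] h0 by force

lemma H_Lipschitz:
  assumes "0 \<le> x" "x \<le> y" "y \<le> 1"
  shows "h0 * (y - x) \<le> H y - H x" "H y - H x \<le> h1 * (y - x)"
  using assms h_bounds h0 h1_pos by (auto intro!: H_diff_ge H_diff_le)

lemma H_0: "H 0 = 0"
proof -
  interpret D: real_distribution "design_law h" by (rule real_distribution_design)
  have "emeasure (design_law h) {..0} = (\<integral>\<^sup>+x. ennreal (indicator {0..1} x * h x) * indicator {..0} x \<partial>lborel)"
    by (rule emeasure_design) simp
  also have "\<dots> = (\<integral>\<^sup>+x. 0 \<partial>(lborel :: real measure))"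
    by (intro nn_integral_cong_AE) (use AE_lborel_singleton[of 0] in \<open>eventually_elim, auto simp: indicator_def\<close>)
  finally show ?thesis by (simp add: cdf_def D.emeasure_eq_measure)
qed

lemma H_1: "H 1 = 1"
proof -
  interpret D: real_distribution "design_law h" by (rule real_distribution_design)
  have "emeasure (design_law h) {..1} = emeasure (design_law h) UNIV"
    by (subst (1 2) emeasure_design) (auto intro!: nn_integral_cong simp: indicator_def)
  then have "measure (design_law h) {..1} = measure (design_law h) (space (design_law h))"
    by (simp add: measure_def)
  then show ?thesis using D.prob_space by (simp add: cdf_def)
qed

lemma H_strict_mono: "0 \<le> x \<Longrightarrow> x < y \<Longrightarrow> y \<le> 1 \<Longrightarrow> H x < H y"
  using H_Lipschitz(1)[of x y] mult_pos_pos[OF h0, of "y - x"] by simp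

lemma H_le_iff: "x \<in> {0..1} \<Longrightarrow> y \<in> {0..1} \<Longrightarrow> H x \<le> H y \<longleftrightarrow> x \<le> y"
  using H_strict_mono[of x y] H_strict_mono[of y x] by (cases x y rule: linorder_cases) auto

lemma inj_on_H: "inj_on H {0..1}"
  using H_le_iff by (intro inj_onI) (metis order.antisym order.refl)

lemma continuous_on_H: "continuous_on {0..1} H"
proof (rule continuous_on_subset[OF lipschitz_on_continuous_on])
  show "h1-lipschitz_on {0..1} H"
  proof (rule lipschitz_onI)
    fix x y :: real assume xy: "x \<in> {0..1}" "y \<in> {0..1}"
    show "dist (H x) (H y) \<le> h1 * dist x y"
    proof (cases "x \<le> y")
      case True
      then show ?thesis using H_Lipschitz[of x y] H_le_iff[of x y] xy by (simp add: dist_real_def)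
    next
      case False
      then show ?thesis using H_Lipschitz[of y x] H_le_iff[of y x] xy by (simp add: dist_real_def)
    qed
  qed (use h1_pos in simp)
qed simp

lemma H_image: "v \<in> {0..1} \<Longrightarrow> v \<in> H ` {0..1}"
  using IVT'[of H 0 v 1, OF _ _ _ continuous_on_H] H_0 H_1 by (auto simp: image_iff Bex_def)

lemma design_point:
  assumes "i \<le> n" "0 < n"
  shows "design_point h n i \<in> {0..1}" "H (design_point h n i) = real i / real n"
proof -
  have "real i / real n \<in> H ` {0..1}" using assms by (intro H_image) auto
  then show "design_point h n i \<in> {0..1}" "H (design_point h n i) = real i / real n"
    unfolding design_point_def by (rule the_inv_into_into[OF inj_on_H _ order.refl], rule f_the_inv_into_f[OF inj_on_H])
qed

lemma design_point_mono: "i \<le> i' \<Longrightarrow> i' \<le> n \<Longrightarrow> 0 < n \<Longrightarrow> design_point h n i \<le> design_point h n i'"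
  using H_le_iff[of "design_point h n i" "design_point h n i'"] design_point[of i n] design_point[of i' n]
  by (simp add: divide_right_mono)

lemma design_point_gap_le:
  assumes "i < n" "0 < v" "\<And>u. design_point h n i \<le> u \<Longrightarrow> u \<le> design_point h n (Suc i) \<Longrightarrow> v \<le> h u"
  shows "design_point h n (Suc i) - design_point h n i \<le> 1 / (real n * v)"
proof -
  have "v * (design_point h n (Suc i) - design_point h n i) \<le> H (design_point h n (Suc i)) - H (design_point h n i)"
    using assms design_point[of i n] design_point[of "Suc i" n] design_point_mono[of i "Suc i" n]
    by (intro H_diff_ge) auto
  also have "\<dots> = 1 / real n"
    using assms by (simp add: design_point diff_divide_distrib[symmetric])
  finally show ?thesis using assms by (simp add: field_simps)
qed

lemma quasi_uniform:
  assumes "0 < n"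
  shows "quasi_uniform_design (design_point h n) n (1 / (real n * h1)) (1 / (real n * h0)) (h1 / h0)"
proof
  show "0 < 1 / (real n * h1)" using assms h1_pos by simp
  show "1 \<le> h1 / h0" using h_bounds[of 0] h0 by simp
  show "1 / (real n * h0) \<le> h1 / h0 * (1 / (real n * h1))" using assms h1_pos h0 by (simp add: mult.commute)
  fix i i' assume i: "1 \<le> i" "i \<le> i'" "i' \<le> n"
  have X: "0 \<le> design_point h n i" "design_point h n i \<le> design_point h n i'" "design_point h n i' \<le> 1"
    using i assms design_point[of i n] design_point[of i' n] design_point_mono[of i i' n] by auto
  have d: "H (design_point h n i') - H (design_point h n i) = real (i' - i) / real n"
    using i assms by (simp add: design_point of_nat_diff diff_divide_distrib)
  show "1 / (real n * h1) * real (i' - i) \<le> design_point h n i' - design_point h n i"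
    using H_Lipschitz(2)[OF X] h1_pos assms unfolding d by (simp add: field_simps)
  show "design_point h n i' - design_point h n i \<le> 1 / (real n * h0) * real (i' - i)"
    using H_Lipschitz(1)[OF X] h0 assms unfolding d by (simp add: field_simps)
qed

lemma obtain_window:
  assumes n: "0 < n" and w: "0 < w" "0 < x0 - w" "x0 + w \<le> 1" "2 \<le> real n * h0 * w"
  obtains j k where "1 \<le> j" "j + 2 \<le> k" "k \<le> n"
    "x0 - w \<le> design_point h n j" "design_point h n j \<le> x0 - w + 1 / (real n * h0)"
    "design_point h n k \<le> x0 + w" "x0 + w - 1 / (real n * h0) \<le> design_point h n k"
    "real n * h0 * w \<le> real (k - j)" "real (k - j) \<le> 2 * (real n * h1 * w)"
proof -
  have Hpos: "0 < H (x0 - w)" using H_strict_mono[of 0 "x0 - w"] H_0 w by simp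
  have Hle: "H (x0 + w) \<le> 1" using H_le_iff[of "x0 + w" 1] H_1 w by simp
  \<comment> \<open>\<open>j\<close> and \<open>k\<close> are the outermost design points inside the
    window; \<open>0 < x0 - w\<close> makes \<open>H (x0 - w)\<close> positive, so that
    \<open>1 \<le> j\<close>.\<close>
  define j where "j = nat \<lceil>real n * H (x0 - w)\<rceil>"
  define k where "k = nat \<lfloor>real n * H (x0 + w)\<rfloor>"
  have nH: "0 < real n * H (x0 - w)" using n Hpos by simp
  have d: "h0 * (2 * w) \<le> H (x0 + w) - H (x0 - w)" "H (x0 + w) - H (x0 - w) \<le> h1 * (2 * w)"
    using H_Lipschitz[of "x0 - w" "x0 + w"] w by auto
  then have nd: "2 * (real n * h0 * w) \<le> real n * H (x0 + w) - real n * H (x0 - w)"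
    "real n * H (x0 + w) - real n * H (x0 - w) \<le> 2 * (real n * h1 * w)"
    using n mult_left_mono[OF d(1), of "real n"] mult_left_mono[OF d(2), of "real n"] by (auto simp: algebra_simps)
  have j: "real n * H (x0 - w) \<le> real j" "real j < real n * H (x0 - w) + 1" using nH unfolding j_def by linarith+
  have k: "real k \<le> real n * H (x0 + w)" "real n * H (x0 + w) < real k + 1"
    using nH nd w unfolding k_def by linarith+
  have kn: "k \<le> n"
  proof -
    have "real k \<le> real n" using k(1) Hle mult_left_mono[OF Hle, of "real n"] by simp
    then show ?thesis by simp
  qed
  have "1 \<le> j" using nH j(1) by (cases j) auto
  have gap: "2 * (real n * h0 * w) - 2 < real k - real j" using nd j k by linarith
  then have "real j + 2 < real k + 1" using w(4) by linarith
  then have jk: "j + 2 \<le> k" by linarith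
  let ?X = "design_point h n"
  have X: "?X j \<in> {0..1}" "?X k \<in> {0..1}" "real n * H (?X j) = real j" "real n * H (?X k) = real k"
    using design_point[of j n] design_point[of k n] jk kn n by auto
  have xm: "x0 - w \<in> {0..1}" "x0 + w \<in> {0..1}" using w by auto
  have conv: "a \<le> b" if "real n * a \<le> real n * b" for a b using that n by simp
  have 1: "x0 - w \<le> ?X j" using H_le_iff[OF xm(1) X(1)] conv[of "H (x0 - w)" "H (?X j)"] X j by simp
  have 2: "?X k \<le> x0 + w" using H_le_iff[OF X(2) xm(2)] conv[of "H (?X k)" "H (x0 + w)"] X k by simp
  have 3: "?X j \<le> x0 - w + 1 / (real n * h0)"
  proof -
    have "real n * (h0 * (?X j - (x0 - w))) \<le> real n * (H (?X j) - H (x0 - w))"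
      using H_Lipschitz(1)[of "x0 - w" "?X j"] 1 X xm by (intro mult_left_mono) auto
    also have "\<dots> \<le> 1" using j X by (simp add: right_diff_distrib)
    finally show ?thesis using n h0 by (simp add: field_simps)
  qed
  have 4: "x0 + w - 1 / (real n * h0) \<le> ?X k"
  proof -
    have "real n * (h0 * (x0 + w - ?X k)) \<le> real n * (H (x0 + w) - H (?X k))"
      using H_Lipschitz(1)[of "?X k" "x0 + w"] 2 X xm by (intro mult_left_mono) auto
    also have "\<dots> \<le> 1" using k X by (simp add: right_diff_distrib)
    finally show ?thesis using n h0 by (simp add: field_simps)
  qed
  have 5: "real n * h0 * w \<le> real (k - j)" "real (k - j) \<le> 2 * (real n * h1 * w)"
    using gap w(4) nd j k jk by auto
  show thesis by (rule that[OF \<open>1 \<le> j\<close> jk kn 1 3 2 4 5])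
qed

end

section \<open>Riemann sums of the squared kernel\<close>

lemma lborel_integral_\<gamma>_opt_sq_affine:
  assumes "0 < \<beta>" "\<beta> \<le> 1" "0 < r"
  shows "integrable lborel (\<lambda>x. (\<gamma>_opt \<beta> ((x - c) / r))\<^sup>2)"
    and "(LINT x|lborel. (\<gamma>_opt \<beta> ((x - c) / r))\<^sup>2) = r * (L2_norm (\<gamma>_opt \<beta>))\<^sup>2"
proof -
  have e: "(x - c) / r = - c / r + 1 / r * x" for x by (simp add: diff_divide_distrib)
  have int: "integrable lborel (\<lambda>x. (\<gamma>_opt \<beta> x)\<^sup>2)" by (rule \<gamma>_opt_minimizes(3)[OF assms(1,2)])
  show "integrable lborel (\<lambda>x. (\<gamma>_opt \<beta> ((x - c) / r))\<^sup>2)"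
    unfolding e using lborel_integrable_real_affine[OF int, of "1 / r" "- c / r"] assms by simp
  have "(LINT x|lborel. (\<gamma>_opt \<beta> x)\<^sup>2) = 1 / r * (LINT x|lborel. (\<gamma>_opt \<beta> (- c / r + 1 / r * x))\<^sup>2)"
    using lborel_integral_real_affine[of "1 / r" "\<lambda>x. (\<gamma>_opt \<beta> x)\<^sup>2" "- c / r"] assms by simp
  moreover have "(L2_norm (\<gamma>_opt \<beta>))\<^sup>2 = (LINT x|lborel. (\<gamma>_opt \<beta> x)\<^sup>2)"
    unfolding L2_norm_def by (intro real_sqrt_pow2 Bochner_Integration.integral_nonneg) simp
  ultimately show "(LINT x|lborel. (\<gamma>_opt \<beta> ((x - c) / r))\<^sup>2) = r * (L2_norm (\<gamma>_opt \<beta>))\<^sup>2"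
    unfolding e using assms by simp
qed

context design
begin

text \<open>A left-endpoint Riemann sum. The local lower bound \<open>v\<close> of \<open>h\<close>
  bounds the gaps by \<open>1 / (n * v)\<close> and sits in the leading term, which must be sharp;
  the global bound \<open>h0\<close> appears in the Hoelder error only.\<close>

lemma sum_hat_sq_ge:
  assumes \<beta>: "0 < \<beta>" "\<beta> \<le> 1" and jk: "1 \<le> j" "j < k" "k \<le> n"
    and v: "h0 \<le> v" "\<And>u. design_point h n j \<le> u \<Longrightarrow> u \<le> design_point h n k \<Longrightarrow> v \<le> h u"
  defines "r \<equiv> (design_point h n k - design_point h n j) / 2"
  shows "real n * v * r * (L2_norm (\<gamma>_opt \<beta>))\<^sup>2 - 2 * real (k - j) * (1 / (real n * h0 * r)) powr \<beta>
     \<le> (\<Sum>i=j..k. (hat \<beta> (design_point h n) j k i)\<^sup>2)"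
proof -
  let ?X = "design_point h n"
  define c where "c = (?X j + ?X k) / 2"
  define \<phi> where "\<phi> x = (\<gamma>_opt \<beta> ((x - c) / r))\<^sup>2" for x
  define \<eta> where "\<eta> = (1 / (real n * h0 * r)) powr \<beta>"
  have n: "0 < n" using jk by simp
  interpret Q: quasi_uniform_design ?X n "1 / (real n * h1)" "1 / (real n * h0)" "h1 / h0"
    by (rule quasi_uniform[OF n])
  have r: "0 < r" unfolding r_def using Q.X_less[of j k] jk by simp
  have vpos: "0 < v" using v h0 by linarith
  have hat: "(hat \<beta> ?X j k i)\<^sup>2 = \<phi> (?X i)" for i
  proof -
    have d: "0 < ?X k - ?X j" using Q.X_less[of j k] jk by simp
    have "2 * ((?X i - ?X j) / (?X k - ?X j)) - 1 = (?X i - c) / r"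
      using d by (simp add: c_def r_def field_simps)
    then show ?thesis by (simp only: hat_def \<phi>_def)
  qed
  have \<phi>0: "0 \<le> \<phi> x" for x by (simp add: \<phi>_def)
  have gap: "?X (Suc i) - ?X i \<le> 1 / (real n * v)" if "i \<in> {j..<k}" for i
  proof (rule design_point_gap_le)
    show "v \<le> h u" if "?X i \<le> u" "u \<le> ?X (Suc i)" for u
      using v(2)[of u] that \<open>i \<in> {j..<k}\<close> design_point_mono[of j i n] design_point_mono[of "Suc i" k n] jk n by auto
  qed (use that jk vpos in auto)
  have gap0: "1 / (real n * v) \<le> 1 / (real n * h0)" using v h0 n by (intro divide_left_mono) auto
  have \<phi>_diff: "\<phi> x \<le> \<phi> y + 2 * \<eta>" if "\<bar>x - y\<bar> \<le> 1 / (real n * h0)" for x y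
  proof -
    let ?a = "\<gamma>_opt \<beta> ((x - c) / r)" and ?b = "\<gamma>_opt \<beta> ((y - c) / r)"
    have ab: "0 \<le> ?a" "?a \<le> 1" "0 \<le> ?b" "?b \<le> 1" using \<gamma>_opt_bounds[OF \<beta>(1)] by auto
    have "\<bar>?a - ?b\<bar> \<le> \<bar>(x - c) / r - (y - c) / r\<bar> powr \<beta>" by (rule \<gamma>_opt_diff_le[OF \<beta>])
    also have "(x - c) / r - (y - c) / r = (x - y) / r" by (simp add: diff_divide_distrib)
    also have "\<bar>(x - y) / r\<bar> powr \<beta> \<le> \<eta>" unfolding \<eta>_def
    proof (rule powr_mono2)
      have "\<bar>x - y\<bar> / r \<le> 1 / (real n * h0) / r" using that r by (intro divide_right_mono) auto
      then show "\<bar>(x - y) / r\<bar> \<le> 1 / (real n * h0 * r)" using r by (simp add: abs_divide)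
    qed (use \<beta> in auto)
    finally have "?a - ?b \<le> \<eta>" by linarith
    then have "(?a - ?b) * (?a + ?b) \<le> \<eta> * (?a + ?b)" using ab by (intro mult_right_mono) auto
    also have "\<dots> \<le> \<eta> * 2" using ab by (intro mult_left_mono) (auto simp: \<eta>_def)
    finally show ?thesis by (simp add: \<phi>_def power2_eq_square algebra_simps)
  qed
  \<comment> \<open>On each gap \<open>\<phi>\<close> exceeds its value at the left end by at most
    \<open>2 * \<eta>\<close>, since a square of numbers in [0,1] varies at most twice as much as
    the numbers; outside the interval \<open>\<phi>\<close> vanishes.\<close>
  have pt: "\<phi> x \<le> (\<Sum>i=j..<k. (\<phi> (?X i) + 2 * \<eta>) * indicator {?X i..<?X (Suc i)} x)" for x
  proof (cases "?X j \<le> x \<and> x < ?X k")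
    case True
    define i where "i = Max {i\<in>{j..<k}. ?X i \<le> x}"
    have "j \<in> {i\<in>{j..<k}. ?X i \<le> x}" using True jk by simp
    then have "i \<in> {i\<in>{j..<k}. ?X i \<le> x}" unfolding i_def by (intro Max_in) auto
    then have i: "i \<in> {j..<k}" "?X i \<le> x" by auto
    have imax: "i' \<le> i" if "i' \<in> {j..<k}" "?X i' \<le> x" for i'
      unfolding i_def using that by (intro Max_ge) auto
    have xi: "x < ?X (Suc i)"
    proof (cases "Suc i = k")
      case True
      then show ?thesis using \<open>?X j \<le> x \<and> x < ?X k\<close> by simp
    next
      case False
      then show ?thesis using imax[of "Suc i"] i by force
    qed
    have "\<phi> x \<le> (\<phi> (?X i) + 2 * \<eta>) * indicator {?X i..<?X (Suc i)} x"
      using \<phi>_diff[of x "?X i"] gap[OF i(1)] gap0 i xi by simp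
    also have "\<dots> \<le> (\<Sum>i=j..<k. (\<phi> (?X i) + 2 * \<eta>) * indicator {?X i..<?X (Suc i)} x)"
      using i(1) \<phi>0 by (intro member_le_sum) (auto simp: \<eta>_def)
    finally show ?thesis .
  next
    case False
    have "\<not> \<bar>(x - c) / r\<bar> < 1"
    proof
      assume "\<bar>(x - c) / r\<bar> < 1"
      then have "\<bar>x - c\<bar> < r" using r by (simp add: abs_divide)
      then show False using False by (auto simp: c_def r_def abs_less_iff field_simps)
    qed
    then have "\<phi> x = 0" by (auto simp: \<phi>_def \<gamma>_opt_def)
    then show ?thesis using \<phi>0 by (auto intro!: sum_nonneg mult_nonneg_nonneg simp: \<eta>_def)
  qed
  have ico: "integrable lborel (indicat_real {a..<b})" for a b :: real
    by (cases "a \<le> b") auto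
  have "r * (L2_norm (\<gamma>_opt \<beta>))\<^sup>2 = (LINT x|lborel. \<phi> x)"
    unfolding \<phi>_def by (rule lborel_integral_\<gamma>_opt_sq_affine(2)[OF \<beta> r, symmetric])
  also have "\<dots> \<le> (LINT x|lborel. (\<Sum>i=j..<k. (\<phi> (?X i) + 2 * \<eta>) * indicator {?X i..<?X (Suc i)} x))"
  proof (rule integral_mono[OF _ _ pt])
    show "integrable lborel \<phi>" unfolding \<phi>_def by (rule lborel_integral_\<gamma>_opt_sq_affine(1)[OF \<beta> r])
    show "integrable lborel (\<lambda>x. \<Sum>i=j..<k. (\<phi> (?X i) + 2 * \<eta>) * indicator {?X i..<?X (Suc i)} x)"
      by (intro Bochner_Integration.integrable_sum integrable_mult_right ico)
  qed
  also have "\<dots> = (\<Sum>i=j..<k. (\<phi> (?X i) + 2 * \<eta>) * (?X (Suc i) - ?X i))"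
  proof (subst Bochner_Integration.integral_sum)
    show "integrable lborel (\<lambda>x. (\<phi> (?X i) + 2 * \<eta>) * indicator {?X i..<?X (Suc i)} x)" for i
      by (intro integrable_mult_right ico)
    show "(\<Sum>i=j..<k. LINT x|lborel. (\<phi> (?X i) + 2 * \<eta>) * indicator {?X i..<?X (Suc i)} x) =
       (\<Sum>i=j..<k. (\<phi> (?X i) + 2 * \<eta>) * (?X (Suc i) - ?X i))"
      using design_point_mono jk n by (intro sum.cong refl) (simp add: Suc_le_eq)
  qed
  also have "\<dots> \<le> (\<Sum>i=j..<k. (\<phi> (?X i) + 2 * \<eta>) * (1 / (real n * v)))"
    using gap \<phi>0 by (intro sum_mono mult_left_mono) (auto simp: \<eta>_def)
  also have "\<dots> = (\<Sum>i=j..<k. \<phi> (?X i) + 2 * \<eta>) * (1 / (real n * v))" by (simp only: sum_distrib_right)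
  also have "(\<Sum>i=j..<k. \<phi> (?X i) + 2 * \<eta>) = (\<Sum>i=j..<k. \<phi> (?X i)) + 2 * real (k - j) * \<eta>"
    by (simp add: sum.distrib)
  finally have "r * (L2_norm (\<gamma>_opt \<beta>))\<^sup>2 * (real n * v) \<le> (\<Sum>i=j..<k. \<phi> (?X i)) + 2 * real (k - j) * \<eta>"
    using n vpos by (simp add: pos_le_divide_eq)
  moreover have "(\<Sum>i=j..<k. \<phi> (?X i)) \<le> (\<Sum>i=j..k. \<phi> (?X i))" using \<phi>0 by (intro sum_mono2) auto
  ultimately show ?thesis unfolding hat \<eta>_def by (simp add: mult_ac)
qed

end

section \<open>Power on a single window\<close>

text \<open>Numerator noise and denominator are both of order \<open>p powr (3/2)\<close>, because
  \<open>V\<close> is at least \<open>s * p ^ 3 / 3\<close>; the noise costs a constant.\<close>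

lemma ratio_noise_le:
  fixes p S V s t :: real
  assumes "0 < p" "0 < s" "s * p \<le> S" "S * p\<^sup>2 / 3 \<le> V" "0 \<le> t"
  shows "t * sqrt (p ^ 3) / sqrt V \<le> t * sqrt (3 / s)"
proof -
  have S: "0 < S" using mult_pos_pos[OF assms(2,1)] assms(3) by linarith
  have "0 < S * p\<^sup>2 / 3" using assms(1) S by simp
  then have V: "0 < V" using assms(4) by linarith
  have "p ^ 3 / V \<le> p ^ 3 / (S * p\<^sup>2 / 3)"
    using assms S V by (intro divide_left_mono) auto
  also have "\<dots> = 3 * (p / S)" using assms S by (simp add: power3_eq_cube power2_eq_square)
  also have "\<dots> \<le> 3 * (1 / s)" using assms S by (simp add: field_simps)
  finally have "sqrt (p ^ 3 / V) \<le> sqrt (3 / s)" by simp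
  then have "t * sqrt (p ^ 3 / V) \<le> t * sqrt (3 / s)" using assms by (intro mult_left_mono) auto
  then show ?thesis by (simp add: real_sqrt_divide)
qed

text \<open>The factor \<open>2 * sqrt 3\<close> arises as \<open>2 * (p - 1) * c * U\<close> over
  \<open>p * sqrt (S / 3)\<close>. The error \<open>\<delta>\<close> enters linearly through
  \<open>sqrt (1 + \<delta>) \<le> 1 + \<delta>\<close> and
  \<open>1 - \<delta> \<le> 1 / (1 + \<delta>)\<close>.\<close>

lemma ratio_signal_ge:
  fixes p S V U c \<delta> \<mu> :: real
  assumes p: "1 < p" and S: "0 < S" and V: "0 < V" "V \<le> S * p\<^sup>2 / 3 * (1 + \<delta>)" and \<delta>: "0 \<le> \<delta>"
    and c: "0 \<le> c" and U: "0 \<le> U" and \<mu>: "2 * (p - 1) * c * U \<le> \<mu>"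
  shows "2 * sqrt 3 * (1 - 1 / p) * c * (1 - \<delta>) * (U / sqrt S) \<le> \<mu> / sqrt V"
proof -
  define Z where "Z = 2 * (p - 1) * c * U"
  have Z: "0 \<le> Z" using p c U by (simp add: Z_def)
  have "sqrt V \<le> sqrt (S * p\<^sup>2 / 3 * (1 + \<delta>)\<^sup>2)"
  proof -
    have "V \<le> S * p\<^sup>2 / 3 * ((1 + \<delta>) * 1)" using V by simp
    also have "\<dots> \<le> S * p\<^sup>2 / 3 * ((1 + \<delta>) * (1 + \<delta>))" using S \<delta> by (intro mult_left_mono) auto
    finally show ?thesis by (simp add: power2_eq_square)
  qed
  also have "\<dots> = sqrt S * p / sqrt 3 * (1 + \<delta>)"
    using p \<delta> by (simp add: real_sqrt_mult real_sqrt_divide)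
  finally have sV: "sqrt V \<le> sqrt S * p / sqrt 3 * (1 + \<delta>)" .
  have "(1 - \<delta>) * (1 + \<delta>) \<le> 1" by (simp add: algebra_simps)
  then have d: "1 - \<delta> \<le> 1 / (1 + \<delta>)" using \<delta> by (simp add: pos_le_divide_eq)
  have "2 * sqrt 3 * (1 - 1 / p) * c * (1 - \<delta>) * (U / sqrt S) = Z / (sqrt S * p / sqrt 3) * (1 - \<delta>)"
    using p S by (simp add: Z_def field_simps)
  also have "\<dots> \<le> Z / (sqrt S * p / sqrt 3) * (1 / (1 + \<delta>))"
    using Z S p d by (intro mult_left_mono) auto
  also have "\<dots> = Z / (sqrt S * p / sqrt 3 * (1 + \<delta>))" by simp
  also have "\<dots> \<le> Z / sqrt V" using sV V Z by (intro divide_left_mono) (auto intro!: mult_pos_pos divide_pos_pos simp: S \<delta> less_trans[OF zero_less_one p] add_pos_nonneg)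
  also have "\<dots> \<le> \<mu> / sqrt V" using \<mu> V by (intro divide_right_mono) (auto simp: Z_def)
  finally show ?thesis .
qed

text \<open>\<open>U\<close> is the inner product of kernel and signal. As the signal dominates a
  multiple of the kernel, the quotient by \<open>sqrt S\<close> is at least that multiple of the
  kernel norm; \<open>s * p \<le> S\<close> controls the discretization loss.\<close>

lemma ratio_projection_ge:
  fixes S U s p e v D :: real
  assumes p: "0 < p" and s: "0 < s" "s * p \<le> S" and e: "0 \<le> e" and v: "0 < v"
    and U: "(1 + \<epsilon>) / sqrt v * (D * S - e * p) \<le> U" and \<epsilon>: "0 \<le> \<epsilon>"
  shows "(1 + \<epsilon>) * (D * sqrt (S / v) - e * sqrt (p / (s * v))) \<le> U / sqrt S"
proof -
  have S: "0 < S" using mult_pos_pos[OF s(1) p] s(2) by linarith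
  have "p / sqrt S \<le> sqrt (p / s)"
  proof -
    have "p / sqrt S = sqrt (p\<^sup>2 / S)" using p by (simp add: real_sqrt_divide)
    also have "\<dots> \<le> sqrt (p / s)"
    proof -
      have "p\<^sup>2 / S \<le> p\<^sup>2 / (s * p)" using s p S by (intro divide_left_mono) auto
      then show ?thesis using p by (simp add: power2_eq_square)
    qed
    finally show ?thesis .
  qed
  then have "e / sqrt v * (p / sqrt S) \<le> e / sqrt v * sqrt (p / s)" using e v by (intro mult_left_mono) auto
  then have e1: "e * p / sqrt S / sqrt v \<le> e * sqrt (p / (s * v))" by (simp add: real_sqrt_divide real_sqrt_mult mult.commute)
  have "(1 + \<epsilon>) * (D * sqrt (S / v) - e * sqrt (p / (s * v))) \<le> (1 + \<epsilon>) * (D * sqrt (S / v) - e * p / sqrt S / sqrt v)"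
    using e1 \<epsilon> by (intro mult_left_mono) auto
  also have "\<dots> = (1 + \<epsilon>) / sqrt v * (D * S - e * p) / sqrt S"
  proof -
    have "sqrt (S / v) = S / sqrt S / sqrt v" using S by (simp add: real_sqrt_divide real_div_sqrt)
    then show ?thesis by (simp add: diff_divide_distrib right_diff_distrib mult.commute)
  qed
  also have "\<dots> \<le> U / sqrt S" using U S by (intro divide_right_mono) auto
  finally show ?thesis .
qed

lemma sqrt_ge_self: "0 \<le> x \<Longrightarrow> x \<le> 1 \<Longrightarrow> x \<le> sqrt (x::real)"
  by (intro real_le_rsqrt) (simp add: power2_eq_square mult_left_le)

text \<open>The three conclusions reproduce the first three hypotheses with \<open>s + x\<close> for
  \<open>s\<close>, so a product of many factors is treated by iteration.\<close>

lemma one_minus_mult_ge: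
  fixes P x s :: real
  assumes "1 - s \<le> P" "P \<le> 1" "0 \<le> P" "0 \<le> x" "x \<le> 1"
  shows "1 - (s + x) \<le> P * (1 - x)" "P * (1 - x) \<le> 1" "0 \<le> P * (1 - x)"
proof -
  have "P * x \<le> 1 * x" using assms by (intro mult_right_mono) auto
  then show "1 - (s + x) \<le> P * (1 - x)" using assms by (simp add: right_diff_distrib)
  show "P * (1 - x) \<le> 1" using assms by (intro mult_le_one) auto
  show "0 \<le> P * (1 - x)" using assms by simp
qed

text \<open>The quantities \<open>v\<close> and \<open>r\<close> of the actual window are traded for
  the ideal \<open>v'\<close> and \<open>w\<close>, each at the price of a factor near 1. These
  factors leave the square root because \<open>P \<le> sqrt P\<close> on [0,1].\<close>

lemma ratio_window_ge:
  fixes n w G r v v' x3 x4 x5 S :: real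
  assumes pos: "0 < n" "0 < w" "0 < G" "0 < v" "0 < v'"
    and x: "0 \<le> x3" "x3 \<le> 1" "0 \<le> x4" "x4 \<le> 1" "0 \<le> x5" "x5 \<le> 1"
    and v: "(1 - x3) * v' \<le> v" and r: "(1 - x4) * w \<le> r" and S: "n * v * r * G * (1 - x5) \<le> S"
  shows "sqrt (n * w * G) * ((1 - x3) * (1 - x4) * (1 - x5)) \<le> sqrt (S / v')"
proof -
  let ?P = "(1 - x3) * (1 - x4) * (1 - x5)"
  have P: "0 \<le> ?P" "?P \<le> 1" using x by (auto intro!: mult_nonneg_nonneg mult_le_one)
  have "n * w * G * ?P = n * ((1 - x3) * v') * ((1 - x4) * w) * G * (1 - x5) / v'"
    using pos by simp
  also have "\<dots> \<le> n * v * r * G * (1 - x5) / v'"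
    using pos x v r by (intro divide_right_mono mult_right_mono mult_mono mult_left_mono) auto
  also have "\<dots> \<le> S / v'" using S pos by (intro divide_right_mono) auto
  finally have "sqrt (n * w * G * ?P) \<le> sqrt (S / v')" by simp
  moreover have "sqrt (n * w * G) * ?P \<le> sqrt (n * w * G) * sqrt ?P"
    using sqrt_ge_self[OF P] pos by (intro mult_left_mono) auto
  ultimately show ?thesis by (simp add: real_sqrt_mult)
qed

section \<open>The sharp lower bound on one window\<close>

locale regression = lipschitz_symmetric_errors M err f n B + design h h0 h1
  for M :: "'a measure" and err f n B h h0 h1
begin

abbreviation "X \<equiv> design_point h n"
definition \<kappa> :: real where "\<kappa> = h1 / h0"

lemma \<kappa>_ge_1: "1 \<le> \<kappa>" using h_bounds[of 0] h0 by (simp add: \<kappa>_def)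

sublocale Q: quasi_uniform_design X n "1 / (real n * h1)" "1 / (real n * h0)" \<kappa>
  unfolding \<kappa>_def using n_pos by (intro quasi_uniform) simp

definition core_level :: "real \<Rightarrow> real" where
  "core_level \<beta> = 1 - (1 - 1 / (2 * \<kappa>)) powr \<beta>"

lemma core_level_pos: "0 < \<beta> \<Longrightarrow> 0 < core_level \<beta>"
  using Q.core_level_pos by (simp add: core_level_def)

lemma rank_interval_kernel:
  assumes \<beta>: "0 < \<beta>" and jk: "1 \<le> j" "j < k" "k \<le> n"
  shows "rank_interval M err f n B j k (hat \<beta> X j k)"
proof unfold_locales
  fix i show "0 \<le> hat \<beta> X j k i \<and> hat \<beta> X j k i \<le> 1"
    using \<gamma>_opt_bounds[OF \<beta>] by (simp add: hat_def)
qed (use jk in auto)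

text \<open>A bound of the right order only, used in error terms. The 6 is \<open>2 * 3\<close>: the
  number of indices is at most twice \<open>k - j\<close>, which is at most three times the size of
  the core.\<close>

lemma sum_hat_sq_ge_core:
  assumes \<beta>: "0 < \<beta>" and jk: "1 \<le> j" "j + 2 \<le> k" "k \<le> n"
  shows "(core_level \<beta>)\<^sup>2 / 6 * real (card {j..k}) \<le> (\<Sum>i=j..k. (hat \<beta> X j k i)\<^sup>2)"
proof -
  have "real (card {j..k}) \<le> 6 * real (card (Q.core j k))"
    using Q.card_core[OF jk(2)] jk by simp
  then have "(core_level \<beta>)\<^sup>2 / 6 * real (card {j..k}) \<le> (core_level \<beta>)\<^sup>2 / 6 * (6 * real (card (Q.core j k)))"
    by (intro mult_left_mono) auto
  also have "\<dots> = (\<Sum>i\<in>Q.core j k. (core_level \<beta>)\<^sup>2)" by simp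
  also have "\<dots> \<le> (\<Sum>i\<in>Q.core j k. (hat \<beta> X j k i)\<^sup>2)"
  proof (intro sum_mono power_mono)
    show "core_level \<beta> \<le> hat \<beta> X j k i" if "i \<in> Q.core j k" for i
      unfolding core_level_def using Q.hat_core[OF \<beta> jk(1) _ jk(3) that] jk by simp
  qed (use core_level_pos[OF \<beta>] in simp)
  also have "\<dots> \<le> (\<Sum>i=j..k. (hat \<beta> X j k i)\<^sup>2)"
    by (intro sum_mono2) (auto simp: Q.core_def)
  finally show ?thesis .
qed

end

lemma L2_norm_\<gamma>_opt_sq_pos:
  assumes \<beta>: "0 < \<beta>" "\<beta> \<le> 1"
  shows "0 < (L2_norm (\<gamma>_opt \<beta>))\<^sup>2"
proof -
  define c where "c = 1 - (1 / 2) powr \<beta>"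
  have c: "0 < c" using powr_less_mono2[of \<beta> "1 / 2" 1] \<beta> by (simp add: c_def)
  have "c\<^sup>2 = (LINT x|lborel. c\<^sup>2 * indicator {- (1 / 2)..1 / 2 :: real} x)" by simp
  also have "\<dots> \<le> (LINT x|lborel. (\<gamma>_opt \<beta> x)\<^sup>2)"
  proof (rule integral_mono)
    show "integrable lborel (\<lambda>x. (\<gamma>_opt \<beta> x)\<^sup>2)" by (rule \<gamma>_opt_minimizes(3)[OF \<beta>])
    show "integrable lborel (\<lambda>x. c\<^sup>2 * indicator {- (1 / 2)..1 / 2 :: real} x)" by simp
    fix x :: real
    show "c\<^sup>2 * indicator {- (1 / 2)..1 / 2} x \<le> (\<gamma>_opt \<beta> x)\<^sup>2"
    proof (cases "\<bar>x\<bar> \<le> 1 / 2")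
      case True
      then have "\<bar>x\<bar> powr \<beta> \<le> (1 / 2) powr \<beta>" using \<beta> by (intro powr_mono2) auto
      then have "c \<le> \<gamma>_opt \<beta> x" using True by (simp add: \<gamma>_opt_def c_def)
      then have "c\<^sup>2 \<le> (\<gamma>_opt \<beta> x)\<^sup>2" using c by (intro power_mono) auto
      then show ?thesis by (simp add: indicator_def)
    next
      case False
      then have "x \<notin> {- (1 / 2)..1 / 2}" unfolding atLeastAtMost_iff by linarith
      then show ?thesis by simp
    qed
  qed
  also have "\<dots> = (L2_norm (\<gamma>_opt \<beta>))\<^sup>2"
    unfolding L2_norm_def by (intro real_sqrt_pow2[symmetric] Bochner_Integration.integral_nonneg) simp
  finally show ?thesis using c by (smt (verit) zero_less_power)
qed

context regression
begin

definition energy :: "real \<Rightarrow> real" where "energy \<beta> = (L2_norm (\<gamma>_opt \<beta>))\<^sup>2"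
definition mass :: "real \<Rightarrow> real" where "mass \<beta> = (core_level \<beta>)\<^sup>2 / 6"

text \<open>Relative and absolute error of the sharp lower bound for a window of \<open>y\<close> (up to constants) design points, when
  the signal is at most \<open>\<Lambda>\<close> and \<open>h\<close> oscillates by at most \<open>\<omega>\<close> on the window.\<close>

definition rel_err :: "real \<Rightarrow> real \<Rightarrow> real \<Rightarrow> real \<Rightarrow> real \<Rightarrow> real" where
  "rel_err \<beta> t \<Lambda> \<omega> y = 1 / y + 2 * B * (2 * \<Lambda> / sqrt h0) / f_energy +
     (36 * f_max * (2 * \<Lambda> / sqrt h0) + 9 / y + 3 * t / (mass \<beta> * sqrt y)) +
     2 * \<omega> / h0 + 1 / y + 8 * \<kappa> * (2 / y) powr \<beta> / energy \<beta>"

definition abs_err :: "real \<Rightarrow> real \<Rightarrow> real \<Rightarrow> real \<Rightarrow> real \<Rightarrow> real" where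
  "abs_err \<beta> L t \<epsilon> y = 2 * sqrt 3 * f_energy * (1 + \<epsilon>) * (L * (1 / (real n * h0)) powr \<beta>) * sqrt (3 * \<kappa> * y / (mass \<beta> * h0))
     + t * sqrt (3 / mass \<beta>)"

text \<open>The half-width is chosen by \<open>L * w powr \<beta> = D\<close>, so that the Hoelder
  minorant \<open>D - L * \<bar>u - x0\<bar> powr \<beta>\<close> of the signal is the kernel scaled
  to height \<open>D\<close> and vanishes at the ends of the window. Kernel and worst-case signal
  then have the same shape, which makes the quotient of mean numerator and denominator
  sharp.\<close>

lemma power_sharp:
  assumes \<beta>: "0 < \<beta>" "\<beta> \<le> 1" and L: "0 < L" and D: "0 < D" and \<epsilon>: "0 \<le> \<epsilon>" and t: "0 < t"
    and w: "L * w powr \<beta> = D" "0 < w" "0 < x0 - w" "x0 + w \<le> 1"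
    and g: "g \<in> holder_class \<beta> L {0..1}" and l: "\<And>x. x \<in> {0..1} \<Longrightarrow> l x = g x / sqrt (h x)"
    and gx0: "(1 + \<epsilon>) * D \<le> g x0" "g x0 \<le> \<Lambda>" "D \<le> \<Lambda>"
    and \<omega>: "\<And>u. x0 - w \<le> u \<Longrightarrow> u \<le> x0 + w \<Longrightarrow> \<bar>h u - h x0\<bar> \<le> \<omega>"
    and \<Lambda>: "4 * f_max * (2 * \<Lambda> / sqrt h0) \<le> 1"
  defines "y \<equiv> real n * h0 * w"
  assumes y: "2 \<le> y"
  defines "a \<equiv> (1 + \<epsilon>) * (2 * sqrt 3 * f_energy * D * sqrt (real n * w * energy \<beta>)) * (1 - rel_err \<beta> t \<Lambda> \<omega> y) - abs_err \<beta> L t \<epsilon> y"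
  assumes a: "0 < a"
  shows "\<exists>j k. 1 \<le> j \<and> j < k \<and> k \<le> n \<and> y \<le> real (k - j) \<and>
    prob {\<omega>\<in>space M. local_signed_rank_stat (\<psi>_opt \<beta>) X (observation l X err \<omega>) j k < a} \<le> 36 / t\<^sup>2"
proof -
  have n: "0 < n" using n_pos by simp
  have nr: "0 < real n" using n by simp
  obtain j k where jk: "1 \<le> j" "j + 2 \<le> k" "k \<le> n"
    and Xj: "x0 - w \<le> X j" "X j \<le> x0 - w + 1 / (real n * h0)"
    and Xk: "X k \<le> x0 + w" "x0 + w - 1 / (real n * h0) \<le> X k"
    and m: "y \<le> real (k - j)" "real (k - j) \<le> 2 * (real n * h1 * w)"
    unfolding y_def using obtain_window[OF n w(2) w(3) w(4)] y by (auto simp: y_def)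
  have jk': "j < k" using jk by simp
  have y0: "0 < y" using y by simp
  have G: "0 < energy \<beta>" unfolding energy_def by (rule L2_norm_\<gamma>_opt_sq_pos[OF \<beta>])
  have s0: "0 < mass \<beta>" using core_level_pos[OF \<beta>(1)] by (simp add: mass_def)
  have f: "0 < f_energy" "0 < f_max" using f_energy_pos f_max_pos by auto
  have \<kappa>: "1 \<le> \<kappa>" by (rule \<kappa>_ge_1)
  have \<Lambda>0: "0 < \<Lambda>" using gx0 D by linarith
  have x0I: "x0 \<in> {0..1}" using w by auto
  have \<omega>0: "0 \<le> \<omega>" using \<omega>[of x0] w by simp
  \<comment> \<open>Half-width and centre of the interval spanned by design points; compared with
    \<open>w\<close> and \<open>x0\<close> they are off by at most
    \<open>ny = w / y\<close>.\<close>
  define r where "r = (X k - X j) / 2"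
  define c where "c = (X j + X k) / 2"
  define ny where "ny = 1 / (real n * h0)"
  note Xj' = Xj[folded ny_def] and Xk' = Xk[folded ny_def]
  have nyw: "ny = w / y" using nr h0 w by (simp add: ny_def y_def)
  have r: "(1 - 1 / y) * w \<le> r" "r \<le> w" "0 < r" "w / 2 \<le> r"
  proof -
    show "r \<le> w" using Xj Xk by (simp add: r_def)
    have half: "u \<le> z / 2" if "2 * u \<le> z" for u z :: real using that by simp
    have "2 * (w - ny) \<le> X k - X j" using Xj'(2) Xk'(2) by (simp only: right_diff_distrib)
    then have "w - ny \<le> r" unfolding r_def by (rule half)
    moreover have "w - ny = (1 - 1 / y) * w" by (simp add: nyw left_diff_distrib)
    ultimately show r1: "(1 - 1 / y) * w \<le> r" by simp
    have "1 / 2 * w \<le> (1 - 1 / y) * w" using y w by (intro mult_right_mono) (auto simp: field_simps)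
    then show "w / 2 \<le> r" using r1 by linarith
    then show "0 < r" using w by linarith
  qed
  have cx: "\<bar>c - x0\<bar> \<le> ny" 
  proof -
    have *: "\<bar>(a + b) / 2 - x0\<bar> \<le> ny" if "x0 - w \<le> a" "a \<le> x0 - w + ny" "b \<le> x0 + w" "x0 + w - ny \<le> b" for a b :: real
      using that unfolding abs_le_iff by argo
    show ?thesis unfolding c_def by (rule *[OF Xj' Xk'])
  qed
  have XI: "x0 - w \<le> X i" "X i \<le> x0 + w" "X i \<in> {0..1}" if "i \<in> {j..k}" for i
    using that jk Xj Xk w design_point_mono[of j i n] design_point_mono[of i k n] n by auto
  have w_powr: "L * \<bar>u\<bar> powr \<beta> \<le> D" if "\<bar>u\<bar> \<le> w" for u
  proof -
    have "\<bar>u\<bar> powr \<beta> \<le> w powr \<beta>" using that \<beta> by (intro powr_mono2) auto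
    then show ?thesis using w(1) L mult_left_mono[of "\<bar>u\<bar> powr \<beta>" "w powr \<beta>" L] by simp
  qed
  have g_diff: "\<bar>g u - g x0\<bar> \<le> L * \<bar>u - x0\<bar> powr \<beta>" if "u \<in> {0..1}" for u
    using g that x0I by (auto simp: holder_class_def)
  define S where "S = (\<Sum>i=j..k. (hat \<beta> X j k i)\<^sup>2)"
  define p where "p = real (card {j..k})"
  have pm: "p = real (k - j) + 1" using jk by (simp add: p_def)
  have p: "y \<le> p" "1 < p" "p \<le> 3 * \<kappa> * y"
  proof -
    show "y \<le> p" "1 < p" using m y pm by auto
    have "real n * h1 * w = \<kappa> * y" using h0 by (simp add: \<kappa>_def y_def)
    moreover have "1 * 1 \<le> \<kappa> * y" using \<kappa> y by (intro mult_mono) auto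
    ultimately show "p \<le> 3 * \<kappa> * y" using m pm by simp
  qed
  have S: "mass \<beta> * p \<le> S" unfolding mass_def S_def p_def by (rule sum_hat_sq_ge_core[OF \<beta>(1) jk])
  have S0: "0 < S" using mult_pos_pos[OF s0, of p] S p by linarith
  interpret RI: rank_interval M err f n B j k "hat \<beta> X j k" "\<lambda>i. l (X i)"
    by (rule rank_interval_kernel[OF \<beta>(1) jk(1) jk' jk(3)])
  have RIp: "RI.p = p" and RII: "RI.I = {j..k}" by (simp_all add: RI.p_def RI.I_def p_def)
  \<comment> \<open>\<open>v\<close> and \<open>v'\<close> enclose \<open>h\<close> on the window;
    the maximum keeps \<open>v\<close> above \<open>h0\<close> even if the oscillation bound is
    large.\<close>
  define v where "v = max h0 (h x0 - \<omega>)"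
  define v' where "v' = h x0 + \<omega>"
  have hx0: "h0 \<le> h x0" using h_bounds[OF x0I] by simp
  have v: "h0 \<le> v" "0 < v'" using hx0 h0 \<omega>0 by (auto simp: v_def v'_def)
  have vh: "v \<le> h u" "h u \<le> v'" if "x0 - w \<le> u" "u \<le> x0 + w" for u
    using \<omega>[OF that] h_bounds[of u] that w by (auto simp: v_def v'_def abs_le_iff)
  define e where "e = L * ny powr \<beta>"
  have e: "0 \<le> e" using L by (simp add: e_def)
  text \<open>Pointwise, the signal dominates the kernel up to the shift of the window by discretization.\<close>
  have gX: "(1 + \<epsilon>) * (D * hat \<beta> X j k i - e) \<le> g (X i)" if i: "i \<in> {j..k}" for i
  proof -
    define z where "z = X i - c"
    have zr: "\<bar>z\<bar> \<le> r" using design_point_mono[of j i n] design_point_mono[of i k n] i jk n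
      by (auto simp: z_def c_def r_def abs_le_iff field_simps)
    have hat: "hat \<beta> X j k i = 1 - (\<bar>z\<bar> / r) powr \<beta>"
    proof -
      have "2 * ((X i - X j) / (X k - X j)) - 1 = z / r"
        using r(3) by (simp add: z_def c_def r_def field_simps)
      moreover have "\<bar>z / r\<bar> \<le> 1" using zr r by (simp add: abs_divide)
      ultimately show ?thesis using r by (simp add: hat_def \<gamma>_opt_def abs_divide)
    qed
    have "L * \<bar>X i - x0\<bar> powr \<beta> \<le> L * (\<bar>z\<bar> powr \<beta> + ny powr \<beta>)"
    proof (intro mult_left_mono)
      \<comment> \<open>Subadditivity of the power, read off from the Hoelder property of
        \<open>\<gamma>_opt\<close>; both arguments lie in [-1,1], where \<open>\<gamma>_opt\<close>
        is 1 minus the power.\<close>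
      have "\<bar>X i - x0\<bar> powr \<beta> - \<bar>z\<bar> powr \<beta> \<le> \<bar>c - x0\<bar> powr \<beta>"
      proof (cases "\<bar>X i - x0\<bar> \<le> 1 \<and> \<bar>z\<bar> \<le> 1")
        case True
        then show ?thesis using \<gamma>_opt_diff_le[OF \<beta>, of "X i - x0" z] by (simp add: \<gamma>_opt_def z_def)
      next
        case False
        have "\<bar>X i - x0\<bar> \<le> 1" using XI[OF i] x0I by (auto simp: abs_le_iff)
        moreover have "\<bar>z\<bar> \<le> 1"
        proof -
          have "w \<le> 1" using w by linarith
          then show ?thesis using zr r by linarith
        qed
        ultimately show ?thesis using False by blast
      qed
      also have "\<bar>c - x0\<bar> powr \<beta> \<le> ny powr \<beta>" using cx \<beta> by (intro powr_mono2) auto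
      finally show "\<bar>X i - x0\<bar> powr \<beta> \<le> \<bar>z\<bar> powr \<beta> + ny powr \<beta>" by simp
    qed (use L in simp)
    also have "\<dots> \<le> D * (\<bar>z\<bar> / r) powr \<beta> + e"
    proof -
      have "L * \<bar>z\<bar> powr \<beta> = D * (\<bar>z\<bar> / w) powr \<beta>"
        using w by (simp add: powr_divide w(1)[symmetric])
      also have "\<dots> \<le> D * (\<bar>z\<bar> / r) powr \<beta>"
        using D r w \<beta> by (intro mult_left_mono powr_mono2 divide_left_mono) auto
      finally show ?thesis by (simp add: e_def distrib_left)
    qed
    finally have 1: "L * \<bar>X i - x0\<bar> powr \<beta> \<le> D * (\<bar>z\<bar> / r) powr \<beta> + e" .
    have "(1 + \<epsilon>) * (D * hat \<beta> X j k i - e) = (1 + \<epsilon>) * (D - (D * (\<bar>z\<bar> / r) powr \<beta> + e))"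
      by (simp add: hat algebra_simps)
    also have "\<dots> \<le> (1 + \<epsilon>) * (D - L * \<bar>X i - x0\<bar> powr \<beta>)"
      using 1 \<epsilon> by (intro mult_left_mono) auto
    also have "\<dots> = (1 + \<epsilon>) * D - L * \<bar>X i - x0\<bar> powr \<beta> - \<epsilon> * (L * \<bar>X i - x0\<bar> powr \<beta>)"
      by (simp add: algebra_simps)
    also have "\<dots> \<le> g x0 - L * \<bar>X i - x0\<bar> powr \<beta>" 
    proof -
      have "0 \<le> \<epsilon> * (L * \<bar>X i - x0\<bar> powr \<beta>)" using \<epsilon> L by simp
      then show ?thesis using gx0(1) by linarith
    qed
    also have "\<dots> \<le> g (X i)" using g_diff[OF XI(3)[OF i]] by (simp add: abs_le_iff)
    finally show ?thesis .
  qed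
  have gX0: "0 \<le> g (X i)" "g (X i) \<le> 2 * \<Lambda>" if i: "i \<in> {j..k}" for i
  proof -
    have "L * \<bar>X i - x0\<bar> powr \<beta> \<le> D" using XI[OF i] by (intro w_powr) (auto simp: abs_le_iff)
    moreover have "D \<le> (1 + \<epsilon>) * D" using D \<epsilon> by simp
    ultimately show "0 \<le> g (X i)" "g (X i) \<le> 2 * \<Lambda>"
      using g_diff[OF XI(3)[OF i]] gx0 unfolding abs_le_iff by linarith+
  qed
  define \<Lambda>' where "\<Lambda>' = 2 * \<Lambda> / sqrt h0"
  have lX: "0 \<le> l (X i) \<and> l (X i) \<le> \<Lambda>'" if i: "i \<in> {j..k}" for i
  proof -
    have "g (X i) / sqrt (h (X i)) \<le> 2 * \<Lambda> / sqrt h0"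
      using gX0[OF i] h_bounds[OF XI(3)[OF i]] h0 by (intro frac_le) auto
    then show ?thesis using l[OF XI(3)[OF i]] gX0[OF i] h_bounds[OF XI(3)[OF i]] h0 by (simp add: \<Lambda>'_def)
  qed
  define U where "U = (\<Sum>i=j..k. hat \<beta> X j k i * l (X i))"
  have hat0: "0 \<le> hat \<beta> X j k i" "hat \<beta> X j k i \<le> 1" for i using \<gamma>_opt_bounds[OF \<beta>(1)] by (auto simp: hat_def)
  have U0: "0 \<le> U" unfolding U_def using hat0 lX by (intro sum_nonneg mult_nonneg_nonneg) auto
  have U: "(1 + \<epsilon>) / sqrt v' * (D * S - e * p) \<le> U"
  proof -
    have "(1 + \<epsilon>) / sqrt v' * (D * S - e * p) = (\<Sum>i=j..k. (1 + \<epsilon>) / sqrt v' * (D * (hat \<beta> X j k i)\<^sup>2 - e))"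
      by (simp add: S_def p_def sum_distrib_left sum_subtractf right_diff_distrib mult_ac)
    also have "\<dots> \<le> U" unfolding U_def
    proof (rule sum_mono)
      fix i assume i: "i \<in> {j..k}"
      \<comment> \<open>\<open>hat \<le> 1\<close> moves the weight off the error \<open>e\<close>,
        so that summation produces \<open>D * S - e * p\<close>.\<close>
      have "D * (hat \<beta> X j k i)\<^sup>2 - e \<le> hat \<beta> X j k i * (D * hat \<beta> X j k i - e)"
        using e hat0[of i] mult_right_mono[of "hat \<beta> X j k i" 1 e] by (simp add: power2_eq_square algebra_simps)
      then have "(1 + \<epsilon>) * (D * (hat \<beta> X j k i)\<^sup>2 - e) \<le> (1 + \<epsilon>) * (hat \<beta> X j k i * (D * hat \<beta> X j k i - e))"
        using \<epsilon> by (intro mult_left_mono) auto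
      also have "\<dots> = hat \<beta> X j k i * ((1 + \<epsilon>) * (D * hat \<beta> X j k i - e))" by (simp only: mult_ac)
      also have "\<dots> \<le> hat \<beta> X j k i * g (X i)" using gX[OF i] hat0 by (intro mult_left_mono) auto
      finally have "(1 + \<epsilon>) * (D * (hat \<beta> X j k i)\<^sup>2 - e) / sqrt v' \<le> hat \<beta> X j k i * g (X i) / sqrt v'"
        using v by (intro divide_right_mono) auto
      also have "\<dots> \<le> hat \<beta> X j k i * g (X i) / sqrt (h (X i))"
        using vh(2)[OF XI(1,2)[OF i]] h_bounds[OF XI(3)[OF i]] h0 v hat0 gX0[OF i]
        by (intro divide_left_mono) auto
      finally show "(1 + \<epsilon>) / sqrt v' * (D * (hat \<beta> X j k i)\<^sup>2 - e) \<le> hat \<beta> X j k i * l (X i)"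
        using l[OF XI(3)[OF i]] by simp
    qed
    finally show ?thesis .
  qed
  define x2 where "x2 = 2 * B * \<Lambda>' / f_energy"
  define \<delta>' where "\<delta>' = 36 * f_max * \<Lambda>' + 9 / y + 3 * t / (mass \<beta> * sqrt y)"
  define x3 where "x3 = 2 * \<omega> / h0"
  define x5 where "x5 = 8 * \<kappa> * (2 / y) powr \<beta> / energy \<beta>"
  have re: "rel_err \<beta> t \<Lambda> \<omega> y = 1 / y + x2 + \<delta>' + x3 + 1 / y + x5"
    by (simp add: rel_err_def x2_def \<delta>'_def x3_def x5_def \<Lambda>'_def)
  have \<Lambda>'0: "0 < \<Lambda>'" using \<Lambda>0 h0 by (simp add: \<Lambda>'_def)
  have nonneg: "0 \<le> x2" "0 \<le> \<delta>'" "0 \<le> x3" "0 \<le> x5" "0 \<le> 1 / y"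
    using B_pos f \<Lambda>'0 y0 t s0 h0 \<omega>0 \<kappa> G by (auto simp: x2_def \<delta>'_def x3_def x5_def intro!: add_nonneg_nonneg)
  define A where "A = 2 * sqrt 3 * f_energy * D * sqrt (real n * w * energy \<beta>)"
  have A: "0 < A" using f D nr w G by (simp add: A_def)
  have ae: "0 \<le> abs_err \<beta> L t \<epsilon> y" unfolding abs_err_def using f \<epsilon> L t s0 \<kappa> y0 h0
    by (intro add_nonneg_nonneg mult_nonneg_nonneg) auto
  \<comment> \<open>Otherwise \<open>a\<close> would not be positive. This bounds each single error
    term by 1 without further assumptions.\<close>
  have re1: "rel_err \<beta> t \<Lambda> \<omega> y < 1"
  proof (rule ccontr)
    assume "\<not> rel_err \<beta> t \<Lambda> \<omega> y < 1"
    then have "(1 + \<epsilon>) * A * (1 - rel_err \<beta> t \<Lambda> \<omega> y) \<le> 0" using \<epsilon> A by (intro mult_nonneg_nonpos) auto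
    then show False using a ae unfolding a_def A_def by linarith
  qed
  then have le1: "x2 \<le> 1" "\<delta>' \<le> 1" "x3 \<le> 1" "x5 \<le> 1" "1 / y \<le> 1" using nonneg unfolding re by linarith+
  have ratio_v: "(1 - x3) * v' \<le> v"
  proof -
    have "(1 - x3) * v' = h x0 + \<omega> - 2 * \<omega> * (v' / h0)" by (simp add: x3_def v'_def left_diff_distrib)
    also have "\<dots> \<le> h x0 + \<omega> - 2 * \<omega> * 1"
    proof -
      have "1 \<le> v' / h0" using hx0 \<omega>0 h0 by (simp add: v'_def)
      then have "2 * \<omega> * 1 \<le> 2 * \<omega> * (v' / h0)" using \<omega>0 by (intro mult_left_mono) auto
      then show ?thesis by linarith
    qed
    also have "\<dots> \<le> v" by (simp add: v_def)
    finally show ?thesis .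
  qed
  have S_ge: "real n * v * r * energy \<beta> * (1 - x5) \<le> S"
  proof -
    define N where "N = real n * v * r"
    have N: "y / 2 \<le> N"
    proof -
      have "real n * h0 * (w / 2) \<le> real n * v * r" using v r h0 w nr by (intro mult_mono) auto
      then show ?thesis by (simp add: N_def y_def)
    qed
    have \<eta>: "(1 / (real n * h0 * r)) powr \<beta> \<le> (2 / y) powr \<beta>"
    proof (rule powr_mono2)
      have "real n * h0 * (w / 2) \<le> real n * h0 * r" using r h0 nr by (intro mult_left_mono) auto
      then have "1 / (real n * h0 * r) \<le> 1 / (y / 2)" using y0 by (intro divide_left_mono) (auto simp: y_def intro!: mult_pos_pos simp: nr h0 r)
      then show "1 / (real n * h0 * r) \<le> 2 / y" by simp
    qed (use \<beta> nr h0 r in auto)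
    have mk: "real (k - j) \<le> 2 * \<kappa> * y"
    proof -
      have "real n * h1 * w = \<kappa> * y" using h0 by (simp add: \<kappa>_def y_def)
      then show ?thesis using m by simp
    qed
    have "2 * real (k - j) * (1 / (real n * h0 * r)) powr \<beta> \<le> 2 * (2 * \<kappa> * y) * (2 / y) powr \<beta>"
      using mk \<eta> y0 \<kappa> by (intro mult_mono) auto
    also have "\<dots> = y / 2 * (energy \<beta> * x5)" using G by (simp add: x5_def)
    also have "\<dots> \<le> N * (energy \<beta> * x5)" using N G nonneg by (intro mult_right_mono) auto
    finally have 1: "2 * real (k - j) * (1 / (real n * h0 * r)) powr \<beta> \<le> N * (energy \<beta> * x5)" .
    have "real n * v * r * energy \<beta> - 2 * real (k - j) * (1 / (real n * h0 * r)) powr \<beta> \<le> S"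
      unfolding S_def r_def energy_def
      by (rule sum_hat_sq_ge[OF \<beta> jk(1) jk' jk(3) v(1)]) (use vh Xj Xk in auto)
    then show ?thesis using 1 by (simp add: N_def algebra_simps)
  qed
  define V where "V = (p\<^sup>2 * (1 / 3 + 12 * f_max * \<Lambda>') + 3 * p) * S + t * sqrt (p ^ 5)"
  define \<mu> where "\<mu> = 2 * (p - 1) * (f_energy - 2 * B * \<Lambda>') * U"
  have mu: "\<mu> \<le> expectation RI.num"
    using RI.expectation_num_ge_small[of \<Lambda>'] lX unfolding \<mu>_def U_def RIp RII by auto
  have den: "expectation RI.den2 \<le> (p\<^sup>2 * (1 / 3 + 12 * f_max * \<Lambda>') + 3 * p) * S"
    using RI.expectation_den2_le[of \<Lambda>'] lX \<Lambda> unfolding S_def RIp RII by (auto simp: \<Lambda>'_def)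
  have V1: "S * p\<^sup>2 / 3 \<le> V"
    unfolding V_def using S0 p f \<Lambda>'0 t by (simp add: algebra_simps add_nonneg_nonneg)
  have V0: "0 < V"
  proof -
    have "0 < S * p\<^sup>2 / 3" using S0 p by simp
    then show ?thesis using V1 by linarith
  qed
  have V2: "V \<le> S * p\<^sup>2 / 3 * (1 + \<delta>')"
  proof -
    have "t * sqrt (p ^ 5) \<le> S * p\<^sup>2 / 3 * (3 * t / (mass \<beta> * sqrt y))"
    proof -
      have "sqrt (p ^ 5) = p\<^sup>2 * sqrt p"
      proof -
        have "p ^ 5 = (p\<^sup>2)\<^sup>2 * p" by (simp add: power_mult[symmetric] power_Suc2[symmetric] del: power_Suc)
        then have "sqrt (p ^ 5) = sqrt ((p\<^sup>2)\<^sup>2) * sqrt p" by (simp only: real_sqrt_mult)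
        then show ?thesis by (simp only: real_sqrt_abs) simp
      qed
      moreover have "sqrt p \<le> S / (mass \<beta> * sqrt y)"
      proof -
        have "sqrt p * sqrt y \<le> sqrt p * sqrt p" using p y0 by (intro mult_left_mono) auto
        then have "mass \<beta> * (sqrt p * sqrt y) \<le> mass \<beta> * p" using s0 p by (intro mult_left_mono) auto
        then have "sqrt p * (mass \<beta> * sqrt y) \<le> S" using S by (simp only: mult_ac)
        then show ?thesis using s0 y0 by (simp add: pos_le_divide_eq)
      qed
      ultimately have "t * sqrt (p ^ 5) \<le> t * (p\<^sup>2 * (S / (mass \<beta> * sqrt y)))"
        using t by (simp only:) (intro mult_left_mono, auto)
      then show ?thesis by (simp add: mult_ac)
    qed
    moreover have "3 * p * S \<le> S * p\<^sup>2 / 3 * (9 / y)"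
    proof -
      have "S * p\<^sup>2 / 3 * (9 / p) \<le> S * p\<^sup>2 / 3 * (9 / y)" using S0 p y0 by (intro mult_left_mono divide_left_mono) auto
      moreover have "S * p\<^sup>2 / 3 * (9 / p) = 3 * p * S" using p by (simp add: power2_eq_square)
      ultimately show ?thesis by simp
    qed
    ultimately show ?thesis unfolding V_def \<delta>'_def by (simp add: algebra_simps)
  qed
  define c0 where "c0 = f_energy * (1 - x2)"
  have c0: "f_energy - 2 * B * \<Lambda>' = c0" using f by (simp add: c0_def x2_def right_diff_distrib)
  have c00: "0 \<le> c0" using f le1 by (simp add: c0_def)
  have r1: "2 * sqrt 3 * (1 - 1 / p) * c0 * (1 - \<delta>') * (U / sqrt S) \<le> \<mu> / sqrt V"
    by (rule ratio_signal_ge) (use p S0 V0 V2 nonneg c00 U0 in \<open>auto simp: \<mu>_def c0\<close>)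
  have r2: "(1 + \<epsilon>) * (D * sqrt (S / v') - e * sqrt (p / (mass \<beta> * v'))) \<le> U / sqrt S"
    by (rule ratio_projection_ge) (use p S s0 e v U \<epsilon> in auto)
  have r3: "sqrt (real n * w * energy \<beta>) * ((1 - x3) * (1 - 1 / y) * (1 - x5)) \<le> sqrt (S / v')"
    by (rule ratio_window_ge[where v = v and r = r]) (use nr w G v h0 nonneg le1 ratio_v r S_ge in auto)
  have r4: "t * sqrt (p ^ 3) / sqrt V \<le> t * sqrt (3 / mass \<beta>)"
    by (rule ratio_noise_le) (use p s0 S V1 t in auto)
  have r5: "e * sqrt (p / (mass \<beta> * v')) \<le> e * sqrt (3 * \<kappa> * y / (mass \<beta> * h0))"
  proof (intro mult_left_mono real_sqrt_le_mono e)
    have "p / (mass \<beta> * v') \<le> p / (mass \<beta> * h0)"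
      using p s0 h0 v hx0 \<omega>0 by (intro divide_left_mono mult_left_mono) (auto simp: v'_def)
    also have "\<dots> \<le> 3 * \<kappa> * y / (mass \<beta> * h0)" using p s0 h0 by (intro divide_right_mono) auto
    finally show "p / (mass \<beta> * v') \<le> 3 * \<kappa> * y / (mass \<beta> * h0)" .
  qed
  \<comment> \<open>These factors come from the rank sums: finite \<open>p\<close>, second-order
    effect of the shifts, size of the denominator. The three further factors of \<open>P\<close>
    come from the oscillation of \<open>h\<close>, the trimmed window and the Riemann sum.\<close>
  define P0 where "P0 = (1 - 1 / p) * (1 - x2) * (1 - \<delta>')"
  have p1: "1 / p \<le> 1 / y" "0 \<le> 1 / p" using p y0 by (auto simp: frac_le)
  have P0: "0 \<le> P0" "P0 \<le> 1"
    using p1 le1 nonneg by (auto simp: P0_def intro!: mult_nonneg_nonneg mult_le_one)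
  define P where "P = (1 - 1 / p) * (1 - x2) * (1 - \<delta>') * (1 - x3) * (1 - 1 / y) * (1 - x5)"
  have P: "1 - rel_err \<beta> t \<Lambda> \<omega> y \<le> P"
  proof -
    have b: "1 - 1 / y \<le> 1 - 1 / p" "1 - 1 / p \<le> 1" "0 \<le> 1 - 1 / p" using p1 le1 by auto
    note q1 = one_minus_mult_ge[OF b nonneg(1) le1(1)]
    note q2 = one_minus_mult_ge[OF q1 nonneg(2) le1(2)]
    note q3 = one_minus_mult_ge[OF q2 nonneg(3) le1(3)]
    note q4 = one_minus_mult_ge[OF q3 nonneg(5) le1(5)]
    note q5 = one_minus_mult_ge[OF q4 nonneg(4) le1(4)]
    show ?thesis using q5(1) unfolding re P_def by simp
  qed
  define Z where "Z = sqrt (real n * w * energy \<beta>) * ((1 - x3) * (1 - 1 / y) * (1 - x5))"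
  define eE where "eE = e * sqrt (3 * \<kappa> * y / (mass \<beta> * h0))"
  have eE: "0 \<le> eE" unfolding eE_def using e \<kappa> y0 s0 h0 by (intro mult_nonneg_nonneg) auto
  \<comment> \<open>\<open>P0\<close> multiplies signal and discretization error alike; it is kept
    in the first and estimated by 1 in the second.\<close>
  have "(1 + \<epsilon>) * A * (1 - rel_err \<beta> t \<Lambda> \<omega> y) - 2 * sqrt 3 * f_energy * (1 + \<epsilon>) * eE \<le>
     (1 + \<epsilon>) * A * P - 2 * sqrt 3 * f_energy * (1 + \<epsilon>) * eE * P0"
  proof (rule diff_mono)
    show "(1 + \<epsilon>) * A * (1 - rel_err \<beta> t \<Lambda> \<omega> y) \<le> (1 + \<epsilon>) * A * P" using P \<epsilon> A by (intro mult_left_mono) auto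
    have "2 * sqrt 3 * f_energy * (1 + \<epsilon>) * eE * P0 \<le> 2 * sqrt 3 * f_energy * (1 + \<epsilon>) * eE * 1"
      using P0 f \<epsilon> eE by (intro mult_left_mono mult_nonneg_nonneg) auto
    then show "2 * sqrt 3 * f_energy * (1 + \<epsilon>) * eE * P0 \<le> 2 * sqrt 3 * f_energy * (1 + \<epsilon>) * eE" by simp
  qed
  also have "\<dots> = 2 * sqrt 3 * f_energy * P0 * ((1 + \<epsilon>) * (D * Z - eE))"
  proof -
    have "(1 + \<epsilon>) * (F * D * q) * (P0 * z) - F * (1 + \<epsilon>) * eE * P0 = F * P0 * ((1 + \<epsilon>) * (D * (q * z) - eE))" for F q z
      by (simp add: algebra_simps)
    from this[of "2 * sqrt 3 * f_energy" "sqrt (real n * w * energy \<beta>)" "(1 - x3) * (1 - 1 / y) * (1 - x5)"]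
    show ?thesis by (simp only: A_def P_def P0_def Z_def mult.assoc)
  qed
  also have "\<dots> \<le> 2 * sqrt 3 * f_energy * P0 * (U / sqrt S)"
  proof (rule mult_left_mono)
    have "(1 + \<epsilon>) * (D * Z - eE) \<le> (1 + \<epsilon>) * (D * sqrt (S / v') - e * sqrt (p / (mass \<beta> * v')))"
      using r3 r5 D \<epsilon> by (intro mult_left_mono diff_mono) (auto simp: Z_def eE_def)
    then show "(1 + \<epsilon>) * (D * Z - eE) \<le> U / sqrt S" using r2 by linarith
  qed (use f P0 in simp)
  also have "\<dots> = 2 * sqrt 3 * (1 - 1 / p) * c0 * (1 - \<delta>') * (U / sqrt S)" by (simp add: P0_def c0_def)
  also have "\<dots> \<le> \<mu> / sqrt V" by (rule r1)
  finally have main: "a \<le> (\<mu> - t * sqrt (p ^ 3)) / sqrt V"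
    using r4 unfolding a_def abs_err_def A_def eE_def e_def ny_def diff_divide_distrib by (simp add: mult_ac)
  have mu_pos: "t * sqrt (p ^ 3) < \<mu>"
    using a main V0 by (smt (verit) divide_nonpos_pos real_sqrt_gt_zero)
  have "prob {\<omega>\<in>space M. local_signed_rank_stat (\<psi>_opt \<beta>) X (RI.Y \<omega>) j k < (\<mu> - t * sqrt (p ^ 3)) / sqrt V} \<le> 36 / t\<^sup>2"
    unfolding V_def
  proof (rule RI.prob_stat_less_sharp[unfolded RIp])
    show "hat \<beta> X j k i = local_kernel (\<psi>_opt \<beta>) (X j) (X k) (X i)" if "i \<in> {j..k}" for i
      using that jk jk' by (intro Q.hat_eq_local_kernel[symmetric]) auto
  qed (use t mu mu_pos den in auto)
  moreover have "RI.Y \<omega> = observation l X err \<omega>" for \<omega>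
    by (simp add: RI.Y_def observation_def fun_eq_iff)
  moreover have "prob {\<omega>\<in>space M. local_signed_rank_stat (\<psi>_opt \<beta>) X (RI.Y \<omega>) j k < a} \<le>
      prob {\<omega>\<in>space M. local_signed_rank_stat (\<psi>_opt \<beta>) X (RI.Y \<omega>) j k < (\<mu> - t * sqrt (p ^ 3)) / sqrt V}"
  proof (rule finite_measure_mono)
    have [measurable]: "(\<lambda>\<omega>. local_signed_rank_stat (\<psi>_opt \<beta>) X (RI.Y \<omega>) j k) \<in> borel_measurable M"
      by (rule RI.measurable_stat)
    show "{\<omega>\<in>space M. local_signed_rank_stat (\<psi>_opt \<beta>) X (RI.Y \<omega>) j k < (\<mu> - t * sqrt (p ^ 3)) / sqrt V} \<in> sets M"
      by measurable
  qed (use main in auto)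
  ultimately show ?thesis using jk jk' m by (intro exI[of _ j] exI[of _ k]) auto
qed

end

section \<open>Sign symmetry, the crude bound for high signals, and rejection\<close>

lemma local_signed_rank_stat_uminus:
  "local_signed_rank_stat \<psi> X (\<lambda>i. - y i) j k = - local_signed_rank_stat \<psi> X y j k"
proof -
  have r: "local_rank (\<lambda>i. - y i) j k i = local_rank y j k i" for i by (simp add: local_rank_def)
  show ?thesis by (simp add: local_signed_rank_stat_def Let_def r sum_negf)
qed

lemma multiscale_stat_uminus: "multiscale_stat \<psi> X n (\<lambda>i. - y i) = multiscale_stat \<psi> X n y"
  unfolding multiscale_stat_eq local_signed_rank_stat_uminus by simp

context regression
begin

text \<open>The half-width satisfies \<open>L * w powr \<beta> = \<Lambda> / 2\<close>, so the
  signal stays above half its guaranteed height on the whole window. The peak has no upper bound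
  here, hence expansions in the shift are replaced by
  \<open>expectation_num_ge_large\<close>.\<close>

lemma power_crude:
  assumes \<beta>: "0 < \<beta>" "\<beta> \<le> 1" and L: "0 < L" and \<Lambda>: "0 < \<Lambda>" and t: "0 < t"
    and w: "L * w powr \<beta> = \<Lambda> / 2" "0 < w" "0 < x0 - w" "x0 + w \<le> 1"
    and g: "g \<in> holder_class \<beta> L {0..1}" and l: "\<And>x. x \<in> {0..1} \<Longrightarrow> l x = g x / sqrt (h x)"
    and gx0: "\<Lambda> \<le> g x0"
  defines "\<tau> \<equiv> \<Lambda> / (2 * sqrt h1)"
  assumes \<tau>: "2 * B * \<tau> \<le> f_energy"
  defines "y \<equiv> real n * h0 * w"
  assumes y: "6 \<le> y"
  defines "a \<equiv> core_level \<beta> * \<tau> * f_energy / 288 * sqrt y - t"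
  assumes a: "0 < a"
  shows "\<exists>j k. 1 \<le> j \<and> j < k \<and> k \<le> n \<and> y \<le> real (k - j) \<and>
    prob {\<omega>\<in>space M. local_signed_rank_stat (\<psi>_opt \<beta>) X (observation l X err \<omega>) j k < a} \<le> 18 / t\<^sup>2"
proof -
  have n: "0 < n" using n_pos by simp
  obtain j k where jk: "1 \<le> j" "j + 2 \<le> k" "k \<le> n"
    and Xj: "x0 - w \<le> X j" "X j \<le> x0 - w + 1 / (real n * h0)"
    and Xk: "X k \<le> x0 + w" "x0 + w - 1 / (real n * h0) \<le> X k"
    and m: "y \<le> real (k - j)" "real (k - j) \<le> 2 * (real n * h1 * w)"
    unfolding y_def using obtain_window[OF n w(2) w(3) w(4)] y by (auto simp: y_def)
  have jk': "j < k" using jk by simp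
  have x0I: "x0 \<in> {0..1}" using w by auto
  have \<tau>0: "0 < \<tau>" using \<Lambda> h1_pos by (simp add: \<tau>_def)
  have XI: "x0 - w \<le> X i" "X i \<le> x0 + w" "X i \<in> {0..1}" if "i \<in> {j..k}" for i
    using that jk Xj Xk w design_point_mono[of j i n] design_point_mono[of i k n] n by auto
  interpret RI: rank_interval M err f n B j k "hat \<beta> X j k" "\<lambda>i. l (X i)"
    by (rule rank_interval_kernel[OF \<beta>(1) jk(1) jk' jk(3)])
  have lX: "\<tau> \<le> l (X i)" if i: "i \<in> RI.I" for i
  proof -
    have i': "i \<in> {j..k}" using i by (simp add: RI.I_def)
    have "L * \<bar>X i - x0\<bar> powr \<beta> \<le> \<Lambda> / 2"
    proof -
      have "\<bar>X i - x0\<bar> powr \<beta> \<le> w powr \<beta>" using XI[OF i'] \<beta> by (intro powr_mono2) (auto simp: abs_le_iff)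
      then have "L * \<bar>X i - x0\<bar> powr \<beta> \<le> L * w powr \<beta>" using L by (intro mult_left_mono) auto
      then show ?thesis using w(1) by linarith
    qed
    moreover have "\<bar>g (X i) - g x0\<bar> \<le> L * \<bar>X i - x0\<bar> powr \<beta>"
      using g x0I XI(3)[OF i'] by (auto simp: holder_class_def)
    ultimately have "\<Lambda> / 2 \<le> g (X i)" using gx0 by linarith
    then have "\<Lambda> / 2 / sqrt h1 \<le> g (X i) / sqrt (h (X i))"
      using h_bounds[OF XI(3)[OF i']] h0 \<Lambda> by (intro frac_le) auto
    then show ?thesis using l[OF XI(3)[OF i']] by (simp add: \<tau>_def)
  qed
  define N where "N = real (card (Q.core j k))"
  define c where "c = core_level \<beta>"
  have c: "0 < c" using core_level_pos[OF \<beta>(1)] by (simp add: c_def)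
  define \<mu> where "\<mu> = c * \<tau> * f_energy / 4 * (N * (N - 1))"
  have mu: "\<mu> \<le> expectation RI.num" unfolding \<mu>_def N_def
  proof (rule RI.expectation_num_ge_large[OF lX])
    show "Q.core j k \<subseteq> RI.I" by (auto simp: Q.core_def RI.I_def)
    show "c \<le> hat \<beta> X j k i" if "i \<in> Q.core j k" for i
      unfolding c_def core_level_def by (rule Q.hat_core[OF \<beta>(1) jk(1) jk' jk(3) that])
  qed (use \<tau>0 \<tau> c in auto)
  have p: "RI.p = real (k - j) + 1" using jk by (simp add: RI.p_def RI.I_def)
  have N: "real (k - j) / 3 \<le> N" using Q.card_core[OF jk(2)] by (simp add: N_def)
  have m6: "6 \<le> real (k - j)" using m y by linarith
  \<comment> \<open>With \<open>m = k - j \<ge> 6\<close>: \<open>p \<le> 2 * m\<close>,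
    \<open>N \<ge> m / 3\<close> and \<open>N - 1 \<ge> m / 6\<close>, so \<open>N * (N - 1)\<close>
    is at least \<open>p^2 / 72\<close>, and \<open>288 = 4 * 72\<close>.\<close>
  have mu_ge: "c * \<tau> * f_energy / 288 * RI.p\<^sup>2 \<le> \<mu>"
  proof -
    have "RI.p\<^sup>2 / 72 \<le> real (k - j) / 3 * (real (k - j) / 6)"
    proof -
      have "RI.p \<le> 2 * real (k - j)" using p m6 by simp
      then have "RI.p\<^sup>2 \<le> (2 * real (k - j))\<^sup>2" by (intro power_mono) (auto simp: p)
      then show ?thesis by (simp add: power2_eq_square)
    qed
    also have "\<dots> \<le> N * (N - 1)" using N m6 by (intro mult_mono) auto
    finally have "c * \<tau> * f_energy / 4 * (RI.p\<^sup>2 / 72) \<le> \<mu>"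
      unfolding \<mu>_def using c \<tau>0 f_energy_pos by (intro mult_left_mono) auto
    then show ?thesis by simp
  qed
  have p0: "0 < RI.p" "y \<le> RI.p" using p m y by auto
  have main: "a \<le> \<mu> / sqrt (RI.p ^ 3) - t"
  proof -
    have sq: "sqrt (RI.p ^ 3) * sqrt RI.p = RI.p\<^sup>2"
    proof -
      have "sqrt (RI.p ^ 3) * sqrt RI.p = sqrt ((RI.p\<^sup>2)\<^sup>2)"
        by (simp add: real_sqrt_mult[symmetric] power2_eq_square power3_eq_cube mult_ac)
      then show ?thesis by (simp only: real_sqrt_abs) simp
    qed
    have "c * \<tau> * f_energy / 288 * sqrt y \<le> c * \<tau> * f_energy / 288 * sqrt RI.p"
      using c \<tau>0 f_energy_pos p0 by (intro mult_left_mono) auto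
    also have "\<dots> = c * \<tau> * f_energy / 288 * RI.p\<^sup>2 / sqrt (RI.p ^ 3)"
      using p0 by (simp add: sq[symmetric])
    also have "\<dots> \<le> \<mu> / sqrt (RI.p ^ 3)" using mu_ge p0 by (intro divide_right_mono) auto
    finally show ?thesis by (simp add: a_def c_def)
  qed
  have mu_pos: "t * sqrt (RI.p ^ 3) < \<mu>"
  proof -
    have "t < \<mu> / sqrt (RI.p ^ 3)" using a main by linarith
    then show ?thesis using p0 by (simp add: pos_less_divide_eq)
  qed
  have "prob {\<omega>\<in>space M. local_signed_rank_stat (\<psi>_opt \<beta>) X (RI.Y \<omega>) j k < \<mu> / sqrt (RI.p ^ 3) - t} \<le> 18 / t\<^sup>2"
  proof (rule RI.prob_stat_less_crude)
    show "hat \<beta> X j k i = local_kernel (\<psi>_opt \<beta>) (X j) (X k) (X i)" if "i \<in> {j..k}" for i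
      using that jk jk' by (intro Q.hat_eq_local_kernel[symmetric]) auto
  qed (use t mu mu_pos in auto)
  moreover have "RI.Y \<omega> = observation l X err \<omega>" for \<omega>
    by (simp add: RI.Y_def observation_def fun_eq_iff)
  moreover have "prob {\<omega>\<in>space M. local_signed_rank_stat (\<psi>_opt \<beta>) X (RI.Y \<omega>) j k < a} \<le>
      prob {\<omega>\<in>space M. local_signed_rank_stat (\<psi>_opt \<beta>) X (RI.Y \<omega>) j k < \<mu> / sqrt (RI.p ^ 3) - t}"
  proof (rule finite_measure_mono)
    have [measurable]: "(\<lambda>\<omega>. local_signed_rank_stat (\<psi>_opt \<beta>) X (RI.Y \<omega>) j k) \<in> borel_measurable M"
      by (rule RI.measurable_stat)
    show "{\<omega>\<in>space M. local_signed_rank_stat (\<psi>_opt \<beta>) X (RI.Y \<omega>) j k < \<mu> / sqrt (RI.p ^ 3) - t} \<in> sets M"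
      by measurable
  qed (use main in auto)
  ultimately show ?thesis using jk jk' m by (intro exI[of _ j] exI[of _ k]) auto
qed

lemma observation_measurable: "i \<in> {1..n} \<Longrightarrow> (\<lambda>\<omega>. observation l X err \<omega> i) \<in> borel_measurable M"
  using err_measurable[of i] by (simp add: observation_def)

lemma multiscale_stat_large:
  assumes jk: "1 \<le> j" "j < k" "k \<le> n" "y \<le> real (k - j)" and y: "0 < y"
    and pr: "prob {\<omega>\<in>space M. local_signed_rank_stat \<psi> X (observation l X err \<omega>) j k < a} \<le> q"
    and K: "K < a - sqrt (2 * ln (real n / y))"
  shows "1 - q \<le> prob {\<omega>\<in>space M. K < multiscale_stat \<psi> X n (observation l X err \<omega>)}"
proof -
  have [measurable]: "(\<lambda>\<omega>. local_signed_rank_stat \<psi> X (observation l X err \<omega>) j k) \<in> borel_measurable M"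
    using jk by (intro measurable_local_signed_rank_stat observation_measurable) auto
  have [measurable]: "(\<lambda>\<omega>. multiscale_stat \<psi> X n (observation l X err \<omega>)) \<in> borel_measurable M"
    by (intro measurable_multiscale_stat observation_measurable)
  have "1 - q \<le> 1 - prob {\<omega>\<in>space M. local_signed_rank_stat \<psi> X (observation l X err \<omega>) j k < a}" using pr by simp
  also have "\<dots> = prob (space M - {\<omega>\<in>space M. local_signed_rank_stat \<psi> X (observation l X err \<omega>) j k < a})"
    by (subst prob_compl) measurable
  also have "\<dots> \<le> prob {\<omega>\<in>space M. K < multiscale_stat \<psi> X n (observation l X err \<omega>)}"
  proof (rule finite_measure_mono)
    show "space M - {\<omega>\<in>space M. local_signed_rank_stat \<psi> X (observation l X err \<omega>) j k < a} \<subseteq>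
        {\<omega>\<in>space M. K < multiscale_stat \<psi> X n (observation l X err \<omega>)}"
    proof clarify
      fix \<omega> assume \<omega>: "\<omega> \<in> space M" "\<not> local_signed_rank_stat \<psi> X (observation l X err \<omega>) j k < a"
      have "real n / real (k - j) \<le> real n / y" using jk y by (intro divide_left_mono) auto
      then have "ln (real n / real (k - j)) \<le> ln (real n / y)" using jk y by (intro ln_mono) auto
      then have "sqrt (2 * ln (real n / real (k - j))) \<le> sqrt (2 * ln (real n / y))" by simp
      then show "K < multiscale_stat \<psi> X n (observation l X err \<omega>)"
        using multiscale_stat_ge[OF jk(1-3), of \<psi> X "observation l X err \<omega>"] K \<omega>(2) by linarith
    qed
  qed measurable
  finally show ?thesis .
qed

text \<open>Reflected errors satisfy the same assumptions, so a negative peak is handled by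
  reflecting signal and observations, which leaves the statistic unchanged.\<close>

lemma regression_uminus: "regression M (\<lambda>i \<omega>. - err i \<omega>) f n B h h0 h1"
proof -
  have "lipschitz_symmetric_errors M (\<lambda>i \<omega>. - err i \<omega>) f n B"
  proof unfold_locales
    fix i assume i: "i \<in> {1..n}"
    note [measurable] = err_measurable[OF i]
    have "distr M lborel (\<lambda>\<omega>. - err i \<omega>) = distr M borel (\<lambda>\<omega>. - err i \<omega>)" by (rule distr_cong) auto
    also have "\<dots> = distr (distr M borel (err i)) borel uminus" by (subst distr_distr) (auto simp: comp_def)
    also have "\<dots> = law" by (simp add: distr_err[OF i] distr_uminus_law)
    finally show "distributed M lborel (\<lambda>\<omega>. - err i \<omega>) (\<lambda>y. ennreal (f y))"
      by (simp add: distributed_def law_def)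
  next
    show "indep_vars (\<lambda>_. borel) (\<lambda>i \<omega>. - err i \<omega>) {1..n}"
      by (rule indep_vars_compose2[OF err_indep]) auto
  qed (use f_nonneg f_symmetric n_pos f_lipschitz B_pos in auto)
  then show ?thesis by (rule regression.intro) (rule design_axioms)
qed

text \<open>Almost surely the observations have no ties, and on such samples the critical value is
  at most \<open>K\<close> whatever the signal, since it depends on the observed rank vector
  only.\<close>

lemma prob_reject_ge:
  assumes \<alpha>: "0 < \<alpha>" and K: "0 < K"
    "\<And>z. inj_on (\<lambda>i. \<bar>z i\<bar>) {1..n} \<Longrightarrow> real (card {s\<in>signs n. K < multiscale_stat \<psi> X n (\<lambda>i. s i * z i)}) \<le> \<alpha> * 2 ^ n"
  shows "prob {\<omega>\<in>space M. K < multiscale_stat \<psi> X n (observation l X err \<omega>)} \<le>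
    prob {\<omega>\<in>space M. signed_rank_test M err \<psi> X n \<alpha> (observation l X err \<omega>) = 1}"
proof (rule finite_measure_mono_AE)
  show "AE \<omega> in M. \<omega> \<in> {\<omega>\<in>space M. K < multiscale_stat \<psi> X n (observation l X err \<omega>)} \<longrightarrow>
      \<omega> \<in> {\<omega>\<in>space M. signed_rank_test M err \<psi> X n \<alpha> (observation l X err \<omega>) = 1}"
    using AE_inj_on_abs[of "\<lambda>i. l (X i)"]
  proof eventually_elim
    case (elim \<omega>)
    then have "inj_on (\<lambda>i. \<bar>observation l X err \<omega> i\<bar>) {1..n}" by (simp add: observation_def)
    then have "critical_value M err \<psi> X n \<alpha> (rank_vector n (observation l X err \<omega>)) \<le> K"
      by (intro critical_value_le[OF \<alpha> K(1)] K(2))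
    then show ?case by (auto simp: signed_rank_test_def)
  qed
  show "{\<omega>\<in>space M. signed_rank_test M err \<psi> X n \<alpha> (observation l X err \<omega>) = 1} \<in> sets M"
    by (intro sets_test_rejects observation_measurable)
qed

text \<open>The sharp bound applies if the signal is below \<open>\<Lambda>\<close> at its peak, the crude one otherwise.\<close>

lemma power_one_sided:
  assumes \<beta>: "0 < \<beta>" "\<beta> \<le> 1" and L: "0 < L" and t: "0 < t" and \<epsilon>: "0 \<le> \<epsilon>"
    and D: "0 < D" "D \<le> \<Lambda>" and K: "0 < K"
    and w: "L * w powr \<beta> = D" "0 < w" "0 < x0 - w" "x0 + w \<le> 1"
    and w': "L * w' powr \<beta> = \<Lambda> / 2" "0 < w'" "0 < x0 - w'" "x0 + w' \<le> 1"
    and g: "g \<in> holder_class \<beta> L {0..1}" and l: "\<And>x. x \<in> {0..1} \<Longrightarrow> l x = g x / sqrt (h x)"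
    and gx0: "(1 + \<epsilon>) * D \<le> g x0"
    and osc: "\<And>u. x0 - w \<le> u \<Longrightarrow> u \<le> x0 + w \<Longrightarrow> \<bar>h u - h x0\<bar> \<le> \<sigma>"
    and \<Lambda>: "4 * f_max * (2 * \<Lambda> / sqrt h0) \<le> 1" "2 * B * (\<Lambda> / (2 * sqrt h1)) \<le> f_energy"
    and y: "2 \<le> real n * h0 * w" "6 \<le> real n * h0 * w'" "real n * h0 * w \<le> real n" "real n * h0 * w' \<le> real n"
    and sharp: "K + sqrt (2 * ln (real n / (real n * h0 * w))) < (1 + \<epsilon>) * (2 * sqrt 3 * f_energy * D * sqrt (real n * w * energy \<beta>)) *
       (1 - rel_err \<beta> t \<Lambda> \<sigma> (real n * h0 * w)) - abs_err \<beta> L t \<epsilon> (real n * h0 * w)"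
    and crude: "K + sqrt (2 * ln (real n / (real n * h0 * w'))) < core_level \<beta> * (\<Lambda> / (2 * sqrt h1)) * f_energy / 288 * sqrt (real n * h0 * w') - t"
  shows "1 - 36 / t\<^sup>2 \<le> prob {\<omega>\<in>space M. K < multiscale_stat (\<psi>_opt \<beta>) X n (observation l X err \<omega>)}"
proof -
  have ge1: "1 \<le> real n / (real n * h0 * w)" "1 \<le> real n / (real n * h0 * w')"
    using y by (subst le_divide_eq_1_pos; linarith)+
  show ?thesis
  proof (cases "g x0 \<le> \<Lambda>")
  case True
  have "0 \<le> sqrt (2 * ln (real n / (real n * h0 * w)))" using ge1 by simp
  then have a: "0 < (1 + \<epsilon>) * (2 * sqrt 3 * f_energy * D * sqrt (real n * w * energy \<beta>)) *
       (1 - rel_err \<beta> t \<Lambda> \<sigma> (real n * h0 * w)) - abs_err \<beta> L t \<epsilon> (real n * h0 * w)"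
    using sharp K by linarith
  obtain j k where jk: "1 \<le> j" "j < k" "k \<le> n" "real n * h0 * w \<le> real (k - j)"
    "prob {\<omega>\<in>space M. local_signed_rank_stat (\<psi>_opt \<beta>) X (observation l X err \<omega>) j k < (1 + \<epsilon>) * (2 * sqrt 3 * f_energy * D * sqrt (real n * w * energy \<beta>)) *
       (1 - rel_err \<beta> t \<Lambda> \<sigma> (real n * h0 * w)) - abs_err \<beta> L t \<epsilon> (real n * h0 * w)} \<le> 36 / t\<^sup>2"
    using power_sharp[OF \<beta> L D(1) \<epsilon> t w g l gx0 True D(2) osc \<Lambda>(1) y(1) a] by blast
  show ?thesis by (rule multiscale_stat_large[OF jk(1-4) _ jk(5)]) (use y sharp in auto)
next
  case False
  have "0 \<le> sqrt (2 * ln (real n / (real n * h0 * w')))" using ge1 by simp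
  then have a: "0 < core_level \<beta> * (\<Lambda> / (2 * sqrt h1)) * f_energy / 288 * sqrt (real n * h0 * w') - t"
    using crude K by linarith
  have "0 < \<Lambda>" "\<Lambda> \<le> g x0" using D False by auto
  then obtain j k where jk: "1 \<le> j" "j < k" "k \<le> n" "real n * h0 * w' \<le> real (k - j)"
    "prob {\<omega>\<in>space M. local_signed_rank_stat (\<psi>_opt \<beta>) X (observation l X err \<omega>) j k < core_level \<beta> * (\<Lambda> / (2 * sqrt h1)) * f_energy / 288 * sqrt (real n * h0 * w') - t} \<le> 18 / t\<^sup>2"
    using power_crude[OF \<beta> L _ t w' g l _ \<Lambda>(2) y(2) a] by blast
  have "1 - 18 / t\<^sup>2 \<le> prob {\<omega>\<in>space M. K < multiscale_stat (\<psi>_opt \<beta>) X n (observation l X err \<omega>)}"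
    by (rule multiscale_stat_large[OF jk(1-4) _ jk(5)]) (use y crude in auto)
  moreover have "18 / t\<^sup>2 \<le> 36 / t\<^sup>2" by (intro divide_right_mono) auto
  ultimately show ?thesis by linarith
  qed
qed

end

section \<open>Asymptotics\<close>

text \<open>With \<open>y\<close> the window size, relative errors of order
  \<open>y powr (- s)\<close> are negligible even after multiplication by the leading term
  \<open>sqrt (ln n)\<close>.\<close>

lemma window_size_tendsto:
  fixes c \<theta> s :: real
  assumes "0 < c" "0 < \<theta>" "\<theta> < 1" "0 < s"
  shows "((\<lambda>n::nat. sqrt (ln (real n)) * (c * real n powr (1 - \<theta>) * ln (real n) powr \<theta>) powr (- s)) \<longlongrightarrow> 0) sequentially"
proof -
  define \<eta> where "\<eta> = 1 - \<theta>"
  have "0 < \<eta>" using assms by (simp add: \<eta>_def)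
  then show ?thesis unfolding \<eta>_def[symmetric] using assms by real_asymp
qed

lemma window_size_filterlim:
  fixes c \<theta> :: real
  assumes "0 < c" "0 < \<theta>" "\<theta> < 1"
  shows "filterlim (\<lambda>n::nat. c * real n powr (1 - \<theta>) * ln (real n) powr \<theta>) at_top sequentially"
proof -
  define \<eta> where "\<eta> = 1 - \<theta>"
  have "0 < \<eta>" using assms by (simp add: \<eta>_def)
  then show ?thesis unfolding \<eta>_def[symmetric] using assms by real_asymp
qed

lemma window_width_tendsto:
  fixes c \<theta> :: real
  assumes "0 < c" "0 < \<theta>"
  shows "(\<lambda>n::nat. c * (ln (real n) / real n) powr \<theta>) \<longlonglongrightarrow> 0"
  using assms by real_asymp

text \<open>The logarithmic modulus of \<open>h\<close> enters here: for a window of width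
  \<open>w\<close> the oscillation is of order \<open>1 / ln (1 / w)\<close>, that is
  \<open>1 / ln n\<close>, and thus \<open>o(1 / sqrt (ln n))\<close>.\<close>

lemma log_width_tendsto:
  fixes c \<theta> C :: real
  assumes "0 < c" "0 < \<theta>"
  shows "(\<lambda>n::nat. sqrt (ln (real n)) * (C / ln (1 / (c * (ln (real n) / real n) powr \<theta>)))) \<longlonglongrightarrow> 0"
  using assms by real_asymp

text \<open>The left side equals \<open>\<theta> * ln n - \<theta> * ln (ln n) - ln c\<close>, and
  the double logarithm eventually beats the constant. The scale penalty is therefore at most
  \<open>sqrt (2 * \<theta> * ln n)\<close> without an additive error.\<close>

lemma eventually_log_width_le:
  fixes c \<theta> :: real
  assumes "0 < c" "0 < \<theta>"
  shows "eventually (\<lambda>n::nat. ln (1 / (c * (ln (real n) / real n) powr \<theta>)) \<le> \<theta> * ln (real n)) sequentially"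
  using assms by real_asymp

lemma eventually_signal_le:
  fixes d \<beta> \<theta> :: real
  assumes "0 < d" "0 < \<theta>"
  shows "eventually (\<lambda>n::nat. d * (ln (real n) / real n) powr \<theta> \<le> 1 / ln (real n)) sequentially"
  using assms by real_asymp

text \<open>On the long window the penalty grows only like \<open>sqrt (ln (ln n))\<close>, whereas
  the right side is \<open>sqrt n\<close> up to logarithmic factors; any constant \<open>c\<close>
  will do.\<close>

lemma eventually_crude_gt:
  fixes c L h \<beta> t K :: real
  assumes "0 < c" "0 < L" "0 < h" "0 < \<beta>"
  shows "eventually (\<lambda>n::nat. K + sqrt (2 * ln (1 / (h * (1 / ln (real n) / (2 * L)) powr (1 / \<beta>)))) <
     c * (1 / ln (real n)) * sqrt (real n * h * (1 / ln (real n) / (2 * L)) powr (1 / \<beta>)) - t) sequentially"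
proof -
  define b where "b = 1 / \<beta>"
  have "0 < b" using assms by (simp add: b_def)
  then show ?thesis unfolding b_def[symmetric] using assms by real_asymp
qed

lemma crude_width_tendsto:
  fixes L \<beta> :: real
  assumes "0 < L" "0 < \<beta>"
  shows "(\<lambda>n::nat. (1 / ln (real n) / (2 * L)) powr (1 / \<beta>)) \<longlonglongrightarrow> 0"
proof -
  define b where "b = 1 / \<beta>"
  have "0 < b" using assms by (simp add: b_def)
  then show ?thesis unfolding b_def[symmetric] using assms by real_asymp
qed

lemma crude_size_filterlim:
  fixes L \<beta> h :: real
  assumes "0 < L" "0 < \<beta>" "0 < h"
  shows "filterlim (\<lambda>n::nat. real n * h * (1 / ln (real n) / (2 * L)) powr (1 / \<beta>)) at_top sequentially"
proof -
  define b where "b = 1 / \<beta>"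
  have "0 < b" using assms by (simp add: b_def)
  then show ?thesis unfolding b_def[symmetric] using assms by real_asymp
qed

lemma lipschitz_if_bounded_deriv:
  fixes f :: "real \<Rightarrow> real"
  assumes "\<And>y. f differentiable (at y)" "\<And>y. \<bar>deriv f y\<bar> \<le> B"
  shows "\<bar>f u - f v\<bar> \<le> B * \<bar>u - v\<bar>"
proof -
  have "norm (f u - f v) \<le> B * norm (u - v)"
  proof (rule field_differentiable_bound[where S = UNIV and f' = "deriv f"])
    show "(f has_field_derivative deriv f z) (at z within UNIV)" for z
      using assms(1)[of z] by (simp add: DERIV_deriv_iff_real_differentiable)
  qed (use assms in auto)
  then show ?thesis by simp
qed

lemma modulus_of_continuity_ge:
  assumes h: "\<And>x. x \<in> S \<Longrightarrow> 0 \<le> h x \<and> h x \<le> C" and xy: "x \<in> S" "y \<in> S" "\<bar>x - y\<bar> \<le> \<delta>"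
  shows "\<bar>h x - h y\<bar> \<le> modulus_of_continuity S h \<delta>"
proof -
  have "(case (x, y) of (x, y) \<Rightarrow> \<bar>h x - h y\<bar>) \<le> modulus_of_continuity S h \<delta>"
    unfolding modulus_of_continuity_def
  proof (rule cSUP_upper)
    show "bdd_above ((\<lambda>(x, y). \<bar>h x - h y\<bar>) ` {(x, y). x \<in> S \<and> y \<in> S \<and> \<bar>x - y\<bar> \<le> \<delta>})"
    proof (rule bdd_aboveI[of _ C], clarsimp)
      fix u v assume "u \<in> S" "v \<in> S"
      then show "\<bar>h u - h v\<bar> \<le> C" using h[of u] h[of v] by linarith
    qed
  qed (use xy in auto)
  then show ?thesis by simp
qed

context regression
begin

lemma power_two_sided:
  assumes \<beta>: "0 < \<beta>" "\<beta> \<le> 1" and L: "0 < L" and t: "0 < t" and \<epsilon>: "0 \<le> \<epsilon>"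
    and D: "0 < D" "D \<le> \<Lambda>" and K: "0 < K"
    and w: "L * w powr \<beta> = D" "0 < w" "0 < x0 - w" "x0 + w \<le> 1"
    and w': "L * w' powr \<beta> = \<Lambda> / 2" "0 < w'" "0 < x0 - w'" "x0 + w' \<le> 1"
    and g: "g \<in> holder_class \<beta> L {0..1}" and l: "\<And>x. x \<in> {0..1} \<Longrightarrow> l x = g x / sqrt (h x)"
    and gx0: "(1 + \<epsilon>) * D \<le> \<bar>g x0\<bar>"
    and osc: "\<And>u. x0 - w \<le> u \<Longrightarrow> u \<le> x0 + w \<Longrightarrow> \<bar>h u - h x0\<bar> \<le> \<sigma>"
    and \<Lambda>: "4 * f_max * (2 * \<Lambda> / sqrt h0) \<le> 1" "2 * B * (\<Lambda> / (2 * sqrt h1)) \<le> f_energy"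
    and y: "2 \<le> real n * h0 * w" "6 \<le> real n * h0 * w'" "real n * h0 * w \<le> real n" "real n * h0 * w' \<le> real n"
    and sharp: "K + sqrt (2 * ln (real n / (real n * h0 * w))) < (1 + \<epsilon>) * (2 * sqrt 3 * f_energy * D * sqrt (real n * w * energy \<beta>)) *
       (1 - rel_err \<beta> t \<Lambda> \<sigma> (real n * h0 * w)) - abs_err \<beta> L t \<epsilon> (real n * h0 * w)"
    and crude: "K + sqrt (2 * ln (real n / (real n * h0 * w'))) < core_level \<beta> * (\<Lambda> / (2 * sqrt h1)) * f_energy / 288 * sqrt (real n * h0 * w') - t"
  shows "1 - 36 / t\<^sup>2 \<le> prob {\<omega>\<in>space M. K < multiscale_stat (\<psi>_opt \<beta>) X n (observation l X err \<omega>)}"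
proof (cases "0 \<le> g x0")
  case True
  then have gx0': "(1 + \<epsilon>) * D \<le> g x0" using gx0 by simp
  show ?thesis by (rule power_one_sided[OF \<beta> L t \<epsilon> D K w w' g l gx0' osc \<Lambda> y sharp crude])
next
  case False
  interpret N: regression M "\<lambda>i \<omega>. - err i \<omega>" f n B h h0 h1 by (rule regression_uminus)
  have g': "(\<lambda>x. - g x) \<in> holder_class \<beta> L {0..1}" using g by (auto simp: holder_class_def abs_minus_commute)
  have l': "- l x = - g x / sqrt (h x)" if "x \<in> {0..1}" for x using l[OF that] by simp
  have gx0': "(1 + \<epsilon>) * D \<le> - g x0" using gx0 False by simp
  have "1 - 36 / t\<^sup>2 \<le> prob {\<omega>\<in>space M. K < multiscale_stat (\<psi>_opt \<beta>) X n (observation (\<lambda>x. - l x) X (\<lambda>i \<omega>. - err i \<omega>) \<omega>)}"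
    by (rule N.power_one_sided[OF \<beta> L t \<epsilon> D K w w' g' l' gx0' osc \<Lambda> y sharp crude])
  moreover have "observation (\<lambda>x. - l x) X (\<lambda>i \<omega>. - err i \<omega>) \<omega> = (\<lambda>i. - observation l X err \<omega> i)" for \<omega>
    by (simp add: observation_def fun_eq_iff)
  ultimately show ?thesis by (simp add: multiscale_stat_uminus)
qed

end

text \<open>The exponent of \<open>d\<close> makes \<open>D^2 * w\<close>, which is
  \<open>D powr ((2 * \<beta> + 1) / \<beta>)\<close> up to the power of \<open>L\<close>, linear in
  \<open>x / n\<close>. The base of \<open>d\<close> then cancels \<open>12 * c^2 * G\<close>, and
  with \<open>x = ln n\<close> the squared leading term is exactly the squared scale
  penalty.\<close>

lemma d_star_identity:
  fixes \<beta> L c G x :: real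
  assumes \<beta>: "0 < \<beta>" and L: "0 < L" and c: "0 < c" and G: "0 < G" and n: "0 < n" and x: "0 < x"
  defines "d \<equiv> (2 * L powr (1 / \<beta>) / ((2 * \<beta> + 1) * 12 * c\<^sup>2 * G)) powr (\<beta> / (2 * \<beta> + 1))"
  defines "D \<equiv> d * (x / n) powr (\<beta> / (2 * \<beta> + 1))"
  defines "w \<equiv> (D / L) powr (1 / \<beta>)"
  shows "w = (d / L) powr (1 / \<beta>) * (x / n) powr (1 / (2 * \<beta> + 1))"
    and "2 * sqrt 3 * c * D * sqrt (n * w * G) = sqrt (2 * (1 / (2 * \<beta> + 1)) * x)"
proof -
  define b where "b = 2 * \<beta> + 1"
  have b: "0 < b" using \<beta> by (simp add: b_def)
  define Q where "Q = 2 * L powr (1 / \<beta>) / (b * 12 * c\<^sup>2 * G)"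
  have Q: "0 < Q" using L b c G by (simp add: Q_def)
  have dQ: "d = Q powr (\<beta> / b)" by (simp only: d_def Q_def b_def)
  have d: "0 < d" using Q by (simp add: dQ)
  have D: "0 < D" using d n x by (simp add: D_def)
  have DQ: "D = (Q * (x / n)) powr (\<beta> / b)"
    by (simp only: D_def dQ b_def[symmetric] powr_mult)
  show "w = (d / L) powr (1 / \<beta>) * (x / n) powr (1 / (2 * \<beta> + 1))"
    using \<beta> d L x n by (simp add: w_def D_def powr_mult powr_powr powr_divide)
  have "D\<^sup>2 * w = D powr 2 * D powr (1 / \<beta>) / L powr (1 / \<beta>)"
    using D L by (simp add: w_def powr_divide)
  also have "D powr 2 * D powr (1 / \<beta>) = D powr (b / \<beta>)"
  proof -
    have "2 + 1 / \<beta> = b / \<beta>" using \<beta> by (simp add: b_def field_simps)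
    then show ?thesis by (simp only: powr_add[symmetric])
  qed
  also have "D powr (b / \<beta>) = Q * (x / n)"
    unfolding DQ using Q x n \<beta> b by (simp add: powr_powr)
  finally have Dw: "D\<^sup>2 * w = Q * (x / n) / L powr (1 / \<beta>)" .
  have w: "0 < w" using D L by (simp add: w_def)
  have "(2 * sqrt 3 * c * D * sqrt (n * w * G))\<^sup>2 = 12 * c\<^sup>2 * n * G * (D\<^sup>2 * w)"
    using n w G by (simp add: power_mult_distrib)
  also have "\<dots> = 2 * (1 / b) * x"
    unfolding Dw Q_def using n G c L b by (simp add: field_simps)
  finally have "sqrt ((2 * sqrt 3 * c * D * sqrt (n * w * G))\<^sup>2) = sqrt (2 * (1 / b) * x)" by simp
  then show "2 * sqrt 3 * c * D * sqrt (n * w * G) = sqrt (2 * (1 / (2 * \<beta> + 1)) * x)"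
    using c D n w G by (simp add: b_def)
qed

lemma sup_norm_on_greater:
  assumes "a \<le> b" "T < sup_norm_on {a..b} g"
  shows "\<exists>x. a \<le> x \<and> x \<le> b \<and> T \<le> \<bar>g x\<bar>"
proof (rule ccontr)
  assume "\<nexists>x. a \<le> x \<and> x \<le> b \<and> T \<le> \<bar>g x\<bar>"
  then have "\<bar>g x\<bar> \<le> T" if "x \<in> {a..b}" for x using that by force
  then have "(SUP x\<in>{a..b}. \<bar>g x\<bar>) \<le> T" using assms(1) by (intro cSUP_least) auto
  then show False using assms(2) by (simp add: sup_norm_on_def)
qed

text \<open>For each \<open>\<delta>\<close> the rejection probability eventually exceeds
  \<open>1 - \<delta>\<close> uniformly over the alternatives, because window sizes, thresholds and
  error terms depend on \<open>n\<close> alone and not on the signal or the location of its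
  peak.\<close>

theorem theorem3:
  fixes \<beta> L \<alpha> a b :: real
    and f h :: "real \<Rightarrow> real"
    and M :: "nat \<Rightarrow> 'a measure"
    and err :: "nat \<Rightarrow> nat \<Rightarrow> 'a \<Rightarrow> real"
    and \<epsilon> :: "nat \<Rightarrow> real"
  assumes \<beta>: "0 < \<beta>" "\<beta> \<le> 1"
    and L: "0 < L"
    and \<alpha>: "0 < \<alpha>" "\<alpha> < 1"
    and f_nonneg: "\<And>y. 0 \<le> f y"
    and f_symmetric: "\<And>y. f (- y) = f y"
    and f_differentiable: "\<And>y. f differentiable (at y)"
    and f_deriv_bounded: "bounded (range (deriv f))"
    and f_deriv_integrable: "integrable lborel (deriv f)"
    and prob_space_M: "\<And>n. prob_space (M n)"
    and err_density: "\<And>n i. i \<in> {1..n} \<Longrightarrow> distributed (M n) lborel (err n i) (\<lambda>y. ennreal (f y))"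
    and err_indep: "\<And>n. prob_space.indep_vars (M n) (\<lambda>_. borel) (err n) {1..n}"
    and h_pos: "\<And>x. x \<in> {0..1} \<Longrightarrow> 0 < h x"
    and h_continuous: "continuous_on {0..1} h"
    and h_density: "prob_space (design_law h)"
    and h_bounded_variation: "bounded_variation_on {0..1} h"
    and h_modulus: "modulus_of_continuity {0..1} h \<in> O[at_right 0](\<lambda>\<delta>. 1 / ln (1 / \<delta>))"
    and \<epsilon>_pos: "\<And>n. 0 < \<epsilon> n"
    and \<epsilon>_tendsto_0: "\<epsilon> \<longlonglongrightarrow> 0"
    and \<epsilon>_slow: "filterlim (\<lambda>n. sqrt (ln (real n)) * \<epsilon> n) at_top sequentially"
    and J: "0 < a" "a \<le> b" "b < 1"
  shows "liminf (\<lambda>n.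
           INF l \<in> {l \<in> weighted_holder_class h \<beta> L.
                      sup_norm_on {a..b} (\<lambda>x. l x * sqrt (h x)) \<ge> (1 + \<epsilon> n) * d_star \<beta> L f * rate \<beta> n}.
             ereal \<P>(\<omega> in M n.
               signed_rank_test (M n) (err n) (\<psi>_opt \<beta>) (design_point h n) n \<alpha>
                 (observation l (design_point h n) (err n) \<omega>) = 1)) = 1"
proof -
  obtain B where B: "0 < B" "\<And>y. \<bar>deriv f y\<bar> \<le> B"
    using f_deriv_bounded unfolding bounded_pos by auto
  have f_lip: "\<bar>f u - f v\<bar> \<le> B * \<bar>u - v\<bar>" for u v
    by (rule lipschitz_if_bounded_deriv[OF f_differentiable B(2)])
  have f_meas: "f \<in> borel_measurable borel"
    by (intro borel_measurable_continuous_onI continuous_at_imp_continuous_on ballI differentiable_imp_continuous_within f_differentiable)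
  obtain xl where xl: "xl \<in> {0..1}" "\<And>x. x \<in> {0..1} \<Longrightarrow> h xl \<le> h x"
    using continuous_attains_inf[OF compact_Icc _ h_continuous] by auto
  obtain xu where xu: "xu \<in> {0..1}" "\<And>x. x \<in> {0..1} \<Longrightarrow> h x \<le> h xu"
    using continuous_attains_sup[OF compact_Icc _ h_continuous] by auto
  define h0 where "h0 = h xl"
  define h1 where "h1 = h xu"
  have h0: "0 < h0" using h_pos[OF xl(1)] by (simp add: h0_def)
  have hb: "h0 \<le> h x \<and> h x \<le> h1" if "x \<in> {0..1}" for x using xl(2)[OF that] xu(2)[OF that] by (simp add: h0_def h1_def)
  have h1: "0 < h1" "h0 \<le> h1" using hb[of 0] h0 by auto
  define \<kappa> where "\<kappa> = h1 / h0"
  have \<kappa>: "1 \<le> \<kappa>" using h1 h0 by (simp add: \<kappa>_def)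
  obtain K where K: "0 < K"
    "\<And>X n c1 c2 (y :: nat \<Rightarrow> real). quasi_uniform_design X n c1 c2 \<kappa> \<Longrightarrow> 2 \<le> n \<Longrightarrow> inj_on (\<lambda>i. \<bar>y i\<bar>) {1..n} \<Longrightarrow>
      real (card {s\<in>signs n. K < multiscale_stat (\<psi>_opt \<beta>) X n (\<lambda>i. s i * y i)}) \<le> \<alpha> * 2 ^ n"
    by (rule null_tail[OF \<beta> \<kappa> \<alpha>(1)]) blast
  have reg: "regression (M n) (err n) f n B h h0 h1" if "1 \<le> n" for n
  proof -
    have "iid_symmetric_errors (M n) (err n) f n"
      using f_nonneg f_symmetric f_meas err_density err_indep that prob_space_M
      by (simp add: iid_symmetric_errors_def iid_symmetric_errors_axioms_def)
    then have "lipschitz_symmetric_errors (M n) (err n) f n B"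
      using f_lip B(1) by (simp add: lipschitz_symmetric_errors_def lipschitz_symmetric_errors_axioms_def)
    moreover have "design h h0 h1" using h_continuous h_density h0 hb by (simp add: design_def)
    ultimately show ?thesis by (rule regression.intro)
  qed
  define c0 where "c0 = (LINT y|lborel. (f y)\<^sup>2)"
  define fm where "fm = 2 * sqrt B"
  define G where "G = (L2_norm (\<gamma>_opt \<beta>))\<^sup>2"
  define cl where "cl = 1 - (1 - 1 / (2 * \<kappa>)) powr \<beta>"
  define ms where "ms = cl\<^sup>2 / 6"
  \<comment> \<open>The positivity of the constants of \<open>f\<close> and \<open>h\<close> does
    not involve \<open>n\<close>, so it is taken from the instance with one observation.\<close>
  interpret R1: regression "M 1" "err 1" f 1 B h h0 h1 by (rule reg) simp
  have c0: "0 < c0" using R1.f_energy_pos by (simp add: R1.f_energy_def c0_def)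
  have G: "0 < G" unfolding G_def by (rule L2_norm_\<gamma>_opt_sq_pos[OF \<beta>])
  have cl: "0 < cl" using R1.core_level_pos[OF \<beta>(1)] by (simp add: R1.core_level_def R1.\<kappa>_def \<kappa>_def cl_def)
  have ms: "0 < ms" using cl by (simp add: ms_def)
  define \<theta> where "\<theta> = 1 / (2 * \<beta> + 1)"
  have \<theta>: "0 < \<theta>" "\<theta> < 1" using \<beta> by (auto simp: \<theta>_def)
  define d where "d = d_star \<beta> L f"
  have d: "0 < d" using L \<beta> c0 G by (simp add: d_def d_star_def c0_def[symmetric] G_def[symmetric])
  define D where "D n = d * rate \<beta> n" for n
  define w where "w n = (D n / L) powr (1 / \<beta>)" for n
  define k0 where "k0 = (d / L) powr (1 / \<beta>)"
  have k0: "0 < k0" using d L by (simp add: k0_def)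
  \<comment> \<open>Any level with \<open>D n \<le> \<Lambda> n\<close> and \<open>sqrt (ln n) * \<Lambda> n \<longlonglongrightarrow> 0\<close> separates the sharp from the crude regime.\<close>
  define \<Lambda> where "\<Lambda> n = 1 / ln (real n)" for n
  define w' where "w' n = (\<Lambda> n / (2 * L)) powr (1 / \<beta>)" for n
  define y where "y n = real n * h0 * w n" for n
  obtain C where C: "0 < C" and mod: "eventually (\<lambda>\<delta>. norm (modulus_of_continuity {0..1} h \<delta>) \<le> C * norm (1 / ln (1 / \<delta>))) (at_right 0)"
    using landau_o.bigE[OF h_modulus] by blast
  define \<sigma> where "\<sigma> n = C / ln (1 / w n)" for n
  define Sq where "Sq n = sqrt (ln (real n))" for n :: nat
  define q where "q = sqrt (2 * \<theta>)"
  have q: "0 < q" using \<theta> by (simp add: q_def)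
  have big: "0 < real n" "0 < ln (real n)" if "2 \<le> n" for n :: nat using that by auto
  have D_eq: "D n = d * (ln (real n) / real n) powr (\<beta> / (2 * \<beta> + 1))" for n by (simp add: D_def rate_def)
  have d_eq: "d = (2 * L powr (1 / \<beta>) / ((2 * \<beta> + 1) * 12 * c0\<^sup>2 * G)) powr (\<beta> / (2 * \<beta> + 1))"
    by (simp only: d_def d_star_def c0_def G_def)
  have w_eq: "w n = k0 * (ln (real n) / real n) powr \<theta>"
    and S_eq: "2 * sqrt 3 * c0 * D n * sqrt (real n * w n * G) = q * Sq n" if "2 \<le> n" for n
  proof -
    note id = d_star_identity[OF \<beta>(1) L c0 G big[OF that], folded d_eq D_eq, folded w_def k0_def \<theta>_def]
    show "w n = k0 * (ln (real n) / real n) powr \<theta>" by (rule id(1))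
    show "2 * sqrt 3 * c0 * D n * sqrt (real n * w n * G) = q * Sq n"
      unfolding id(2) by (simp add: q_def Sq_def real_sqrt_mult)
  qed
  have D_pos: "0 < D n" if "2 \<le> n" for n using d big[OF that] by (simp add: D_eq)
  have w_pos: "0 < w n" if "2 \<le> n" for n using D_pos[OF that] L by (simp add: w_def)
  have y_pos: "0 < y n" if "2 \<le> n" for n using w_pos[OF that] big[OF that] h0 by (simp add: y_def)
  have \<Lambda>_pos: "0 < \<Lambda> n" if "2 \<le> n" for n using big[OF that] by (simp add: \<Lambda>_def)
  have w'_pos: "0 < w' n" if "2 \<le> n" for n using \<Lambda>_pos[OF that] L by (simp add: w'_def)
  have y_eq: "y n = h0 * k0 * real n powr (1 - \<theta>) * ln (real n) powr \<theta>" if "2 \<le> n" for n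
    using big[OF that] by (simp add: y_def w_eq[OF that] powr_divide powr_diff)
  have ev2: "eventually (\<lambda>n::nat. 2 \<le> n) sequentially" by (rule eventually_ge_at_top)
  have hk: "0 < h0 * k0" using h0 k0 by simp
  have w_lim: "w \<longlonglongrightarrow> 0"
    by (rule Lim_transform_eventually[OF window_width_tendsto[OF k0 \<theta>(1)]])
      (use ev2 in \<open>eventually_elim, simp add: w_eq\<close>)
  have w'_lim: "w' \<longlonglongrightarrow> 0"
    unfolding w'_def \<Lambda>_def using crude_width_tendsto[OF L \<beta>(1)] .
  have y_lim: "filterlim y at_top sequentially"
    by (rule filterlim_mono_eventually[OF window_size_filterlim[OF hk \<theta>] order.refl order.refl])
      (use ev2 in \<open>eventually_elim, simp add: y_eq\<close>)
  have y'_lim: "filterlim (\<lambda>n. real n * h0 * w' n) at_top sequentially"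
    unfolding w'_def \<Lambda>_def using crude_size_filterlim[OF L \<beta>(1) h0] .
  have \<Lambda>_lim: "\<Lambda> \<longlonglongrightarrow> 0" unfolding \<Lambda>_def by real_asymp
  have Sy_lim: "(\<lambda>n. Sq n * y n powr (- s)) \<longlonglongrightarrow> 0" if "0 < s" for s
    unfolding Sq_def
    by (rule Lim_transform_eventually[OF window_size_tendsto[OF hk \<theta> that]])
      (use ev2 in \<open>eventually_elim, simp add: y_eq\<close>)
  have S\<Lambda>_lim: "(\<lambda>n. Sq n * \<Lambda> n) \<longlonglongrightarrow> 0" unfolding Sq_def \<Lambda>_def by real_asymp
  have S\<sigma>_lim: "(\<lambda>n. Sq n * \<sigma> n) \<longlonglongrightarrow> 0"
    unfolding Sq_def \<sigma>_def
    by (rule Lim_transform_eventually[OF log_width_tendsto[OF k0 \<theta>(1), of C]])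
      (use ev2 in \<open>eventually_elim, simp add: w_eq\<close>)
  have w_right: "filterlim w (at_right 0) sequentially"
  proof (rule tendsto_imp_filterlim_at_right[OF w_lim])
    show "eventually (\<lambda>n. 0 < w n) sequentially" using ev2 by eventually_elim (rule w_pos)
  qed
  have ev_mod: "eventually (\<lambda>n. modulus_of_continuity {0..1} h (w n) \<le> \<sigma> n) sequentially"
  proof -
    have "eventually (\<lambda>n. norm (modulus_of_continuity {0..1} h (w n)) \<le> C * norm (1 / ln (1 / w n))) sequentially"
      by (rule eventually_compose_filterlim[OF mod w_right])
    moreover have "eventually (\<lambda>n. w n < 1) sequentially" by (rule order_tendstoD(2)[OF w_lim]) simp
    ultimately show ?thesis using ev2
    proof eventually_elim
      case (elim n)
      then have "0 < ln (1 / w n)" using w_pos[of n] by (simp add: ln_div)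
      then show ?case using elim(1) by (simp add: \<sigma>_def)
    qed
  qed
  have ev_small: "eventually (\<lambda>n. u n < c) sequentially" if "u \<longlonglongrightarrow> 0" "0 < c" for u :: "nat \<Rightarrow> real" and c
    by (rule order_tendstoD(2)[OF that])
  have reject: "eventually (\<lambda>n. \<forall>l\<in>weighted_holder_class h \<beta> L.
      (1 + \<epsilon> n) * d * rate \<beta> n \<le> sup_norm_on {a..b} (\<lambda>x. l x * sqrt (h x)) \<longrightarrow>
      1 - \<delta> \<le> \<P>(\<omega> in M n. signed_rank_test (M n) (err n) (\<psi>_opt \<beta>) (design_point h n) n \<alpha>
                 (observation l (design_point h n) (err n) \<omega>) = 1)) sequentially" if \<delta>: "0 < \<delta>" for \<delta>
  proof -
    \<comment> \<open>Chosen so that the Chebyshev bound \<open>36 / t^2\<close> equals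
      \<open>\<delta>\<close>; it is constant in \<open>n\<close> and costs only a bounded amount in
      the statistic.\<close>
    define t where "t = 6 / sqrt \<delta>"
    have t: "0 < t" "36 / t\<^sup>2 = \<delta>" using \<delta> by (auto simp: t_def power_divide)
    define rel where "rel n = 1 / y n + 2 * B * (2 * \<Lambda> n / sqrt h0) / c0 +
     (36 * fm * (2 * \<Lambda> n / sqrt h0) + 9 / y n + 3 * t / (ms * sqrt (y n))) +
     2 * \<sigma> n / h0 + 1 / y n + 8 * \<kappa> * (2 / y n) powr \<beta> / G" for n
    define abse where "abse n = 2 * sqrt 3 * c0 * (1 + \<epsilon> n / 2) * (L * (1 / (real n * h0)) powr \<beta>) * sqrt (3 * \<kappa> * y n / (ms * h0))
       + t * sqrt (3 / ms)" for n
    \<comment> \<open>The relative error multiplies a leading term of order \<open>Sq n\<close>, so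
      convergence of \<open>rel\<close> to 0 alone would not suffice. The coefficient 11 collects
      the terms \<open>1 / y\<close>, \<open>9 / y\<close> and \<open>1 / y\<close>.\<close>
    have rel_lim: "(\<lambda>n. Sq n * rel n) \<longlonglongrightarrow> 0"
    proof (rule Lim_transform_eventually)
      show "(\<lambda>n. 11 * (Sq n * y n powr (- 1)) + (4 * B / (sqrt h0 * c0) + 72 * fm / sqrt h0) * (Sq n * \<Lambda> n) +
          3 * t / ms * (Sq n * y n powr (- (1 / 2))) + 2 / h0 * (Sq n * \<sigma> n) +
          8 * \<kappa> * 2 powr \<beta> / G * (Sq n * y n powr (- \<beta>))) \<longlonglongrightarrow> 0"
        by (intro tendsto_add_zero tendsto_mult_right_zero Sy_lim S\<Lambda>_lim S\<sigma>_lim) (use \<beta> in simp_all)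
      show "eventually (\<lambda>n. 11 * (Sq n * y n powr (- 1)) + (4 * B / (sqrt h0 * c0) + 72 * fm / sqrt h0) * (Sq n * \<Lambda> n) +
          3 * t / ms * (Sq n * y n powr (- (1 / 2))) + 2 / h0 * (Sq n * \<sigma> n) +
          8 * \<kappa> * 2 powr \<beta> / G * (Sq n * y n powr (- \<beta>)) = Sq n * rel n) sequentially"
        using ev2
      proof eventually_elim
        case (elim n)
        have p1: "y n powr (- 1) = 1 / y n" using y_pos[OF elim] by (simp add: powr_minus_divide)
        have p2: "y n powr (- (1 / 2)) = 1 / sqrt (y n)" using y_pos[OF elim] by (simp add: powr_minus_divide powr_half_sqrt)
        have p3: "(2 / y n) powr \<beta> = 2 powr \<beta> * y n powr (- \<beta>)" using y_pos[OF elim] by (simp add: powr_divide powr_minus_divide)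
        show ?case unfolding rel_def p1 p2 p3 by (simp add: algebra_simps)
      qed
    qed
    have abs_lim: "(\<lambda>n. 2 * sqrt (3 * \<kappa> / ms) / sqrt G * q * (Sq n * y n powr (- \<beta>))) \<longlonglongrightarrow> 0"
      by (intro tendsto_mult_right_zero Sy_lim \<beta>)
    \<comment> \<open>The surplus \<open>q / 2 * Sq n * \<epsilon> n\<close> must cover the critical
      value \<open>K\<close>, the relative error \<open>2 * q\<close> and the absolute error
      \<open>1 + t * sqrt (3 / ms)\<close>; one unit of slack remains.\<close>
    have \<epsilon>_large: "eventually (\<lambda>n. 2 / q * (K + 2 * q + 2 + t * sqrt (3 / ms)) < Sq n * \<epsilon> n) sequentially"
      using \<epsilon>_slow unfolding filterlim_at_top_dense Sq_def by blast
    have ev_abs: "eventually (\<lambda>n. abse n \<le> 1 + t * sqrt (3 / ms)) sequentially"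
      using ev2 ev_small[OF abs_lim zero_less_one] ev_small[OF \<epsilon>_tendsto_0 zero_less_two]
    proof eventually_elim
      case (elim n)
      have nyw: "1 / (real n * h0) = w n / y n" using w_pos[OF elim(1)] big[OF elim(1)] h0 by (simp add: y_def)
      \<comment> \<open>One design gap is the fraction \<open>1 / y n\<close> of the half-width and
        \<open>L * w n powr \<beta> = D n\<close>, so discretization costs the leading term times
        \<open>y n powr (- \<beta>)\<close>.\<close>
      have LD: "L * (1 / (real n * h0)) powr \<beta> = D n * y n powr (- \<beta>)"
      proof -
        have "L * w n powr \<beta> = D n" using L D_pos[OF elim(1)] \<beta> by (simp add: w_def powr_powr)
        then show ?thesis unfolding nyw using y_pos[OF elim(1)] w_pos[OF elim(1)] by (simp add: powr_divide powr_minus_divide)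
      qed
      have sq: "sqrt (3 * \<kappa> * y n / (ms * h0)) = sqrt (3 * \<kappa> / ms) / sqrt G * sqrt (real n * w n * G)"
        using G h0 by (simp add: y_def real_sqrt_mult real_sqrt_divide)
      have "abse n - t * sqrt (3 / ms) = (1 + \<epsilon> n / 2) * (sqrt (3 * \<kappa> / ms) / sqrt G) * (2 * sqrt 3 * c0 * D n * sqrt (real n * w n * G)) * y n powr (- \<beta>)"
        unfolding abse_def LD sq by (simp add: mult_ac)
      also have "\<dots> = (1 + \<epsilon> n / 2) * (sqrt (3 * \<kappa> / ms) / sqrt G * q * (Sq n * y n powr (- \<beta>)))"
        unfolding S_eq[OF elim(1)] by (simp add: mult_ac)
      also have "\<dots> \<le> 2 * (sqrt (3 * \<kappa> / ms) / sqrt G * q * (Sq n * y n powr (- \<beta>)))"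
        using elim(3) \<kappa> ms G q big[OF elim(1)] by (intro mult_right_mono mult_nonneg_nonneg) (auto simp: Sq_def)
      also have "\<dots> \<le> 1" using elim(2) by simp
      finally show ?case by simp
    qed
    have ev_sharp: "eventually (\<lambda>n. K + sqrt (2 * ln (real n / (real n * h0 * w n))) <
        (1 + \<epsilon> n / 2) * (2 * sqrt 3 * c0 * D n * sqrt (real n * w n * G)) * (1 - rel n) - abse n) sequentially"
      using ev2 ev_abs ev_small[OF rel_lim zero_less_one] ev_small[OF \<epsilon>_tendsto_0 zero_less_two] \<epsilon>_large
        eventually_log_width_le[OF hk \<theta>(1)]
    proof eventually_elim
      case (elim n)
      have "real n / (real n * h0 * w n) = 1 / (h0 * k0 * (ln (real n) / real n) powr \<theta>)"
        using big[OF elim(1)] by (simp add: w_eq[OF elim(1)])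
      then have "2 * ln (real n / (real n * h0 * w n)) \<le> 2 * \<theta> * ln (real n)" using elim(6) by simp
      then have s1: "sqrt (2 * ln (real n / (real n * h0 * w n))) \<le> q * Sq n"
        unfolding q_def Sq_def real_sqrt_mult[symmetric] by (rule real_sqrt_le_mono)
      have "(1 + \<epsilon> n / 2) * q * (Sq n * rel n) \<le> (1 + \<epsilon> n / 2) * q * 1"
        using elim(3) \<epsilon>_pos[of n] q by (intro mult_left_mono) auto
      also have "\<dots> \<le> 2 * q * 1" using elim(4) q by (intro mult_right_mono) auto
      finally have s2: "(1 + \<epsilon> n / 2) * q * (Sq n * rel n) \<le> 2 * q" by simp
      have "q / 2 * (2 / q * (K + 2 * q + 2 + t * sqrt (3 / ms))) < q / 2 * (Sq n * \<epsilon> n)"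
        using elim(5) q by (intro mult_strict_left_mono) auto
      then have s3: "K + 2 * q + 2 + t * sqrt (3 / ms) < q / 2 * (Sq n * \<epsilon> n)" using q by simp
      have "(1 + \<epsilon> n / 2) * (q * Sq n) * (1 - rel n) = q * Sq n + q / 2 * (Sq n * \<epsilon> n) - (1 + \<epsilon> n / 2) * q * (Sq n * rel n)"
        by (simp add: field_simps)
      then show ?case unfolding S_eq[OF elim(1)] using s1 s2 s3 elim(2) by linarith
    qed
    have ev_crude: "eventually (\<lambda>n. K + sqrt (2 * ln (real n / (real n * h0 * w' n))) <
        cl * (\<Lambda> n / (2 * sqrt h1)) * c0 / 288 * sqrt (real n * h0 * w' n) - t) sequentially"
    proof -
      have "0 < cl / (2 * sqrt h1) * c0 / 288" using cl h1 c0 by simp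
      from eventually_crude_gt[OF this L h0 \<beta>(1), of K t] ev2 show ?thesis
      proof eventually_elim
        case (elim n)
        have "real n / (real n * h0 * w' n) = 1 / (h0 * w' n)" using big[OF elim(2)] by simp
        moreover have "cl * (\<Lambda> n / (2 * sqrt h1)) * c0 / 288 = cl / (2 * sqrt h1) * c0 / 288 * \<Lambda> n" by (simp add: field_simps)
        ultimately show ?case using elim(1) unfolding w'_def \<Lambda>_def by (simp add: mult_ac)
      qed
    qed
    have ev_D: "eventually (\<lambda>n. D n \<le> \<Lambda> n) sequentially"
      unfolding D_eq \<Lambda>_def using \<beta> by (intro eventually_signal_le d) auto
    have ev_L1: "eventually (\<lambda>n. \<Lambda> n < 1 / (8 * fm / sqrt h0)) sequentially"
      using B(1) h0 by (intro ev_small[OF \<Lambda>_lim]) (auto simp: fm_def)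
    have ev_L2: "eventually (\<lambda>n. \<Lambda> n < c0 / (B / sqrt h1)) sequentially"
      using B(1) h1 c0 by (intro ev_small[OF \<Lambda>_lim]) auto
    \<comment> \<open>Half-widths below \<open>a\<close> and \<open>1 - b\<close> keep every window
      around a point of \<open>J\<close> inside the unit interval; below \<open>1 / h0\<close> they
      make the logarithms in the scale penalties nonnegative.\<close>
    have "0 < min (min a (1 - b)) (1 / h0)" using J h0 by simp
    note ev_w = ev_small[OF w_lim this] ev_small[OF w'_lim this]
    have ev_y: "eventually (\<lambda>n. 2 \<le> y n) sequentially" "eventually (\<lambda>n. 6 \<le> real n * h0 * w' n) sequentially"
      using y_lim y'_lim by (auto simp: filterlim_at_top)
    show ?thesis
      using ev2 ev_sharp ev_crude ev_D ev_L1 ev_L2 ev_w ev_y ev_mod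
    proof eventually_elim
      case (elim n)
      note n2 = elim(1)
      interpret R: regression "M n" "err n" f n B h h0 h1 by (rule reg) (use n2 in simp)
      have R_eqs: "R.f_energy = c0" "R.f_max = fm" "R.energy \<beta> = G" "R.\<kappa> = \<kappa>" "R.core_level \<beta> = cl" "R.mass \<beta> = ms"
        by (simp_all add: R.f_energy_def R.f_max_def R.energy_def R.\<kappa>_def R.core_level_def R.mass_def c0_def fm_def G_def \<kappa>_def cl_def ms_def)
      have R_rel: "R.rel_err \<beta> t (\<Lambda> n) (\<sigma> n) (real n * h0 * w n) = rel n"
        by (simp only: R.rel_err_def R_eqs rel_def y_def)
      have R_abs: "R.abs_err \<beta> L t (\<epsilon> n / 2) (real n * h0 * w n) = abse n"
        by (simp only: R.abs_err_def R_eqs abse_def y_def)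
      show ?case
      proof (intro ballI impI)
        fix l assume l: "l \<in> weighted_holder_class h \<beta> L"
          and sup: "(1 + \<epsilon> n) * d * rate \<beta> n \<le> sup_norm_on {a..b} (\<lambda>x. l x * sqrt (h x))"
        obtain g where g: "g \<in> holder_class \<beta> L {0..1}" and lg: "\<And>x. x \<in> {0..1} \<Longrightarrow> l x = g x / sqrt (h x)"
          using l by (auto simp: weighted_holder_class_def)
        \<comment> \<open>Half of the surplus is given up so that the supremum norm exceeds the
          level strictly and some point of \<open>J\<close> reaches it, whether or not the supremum
          is attained.\<close>
        have "(1 + \<epsilon> n / 2) * D n < (1 + \<epsilon> n) * D n"
          using \<epsilon>_pos[of n] D_pos[OF n2] by (intro mult_strict_right_mono) auto
        also have "\<dots> \<le> sup_norm_on {a..b} (\<lambda>x. l x * sqrt (h x))" using sup by (simp add: D_def mult.assoc)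
        finally obtain x0 where x0: "a \<le> x0" "x0 \<le> b" "(1 + \<epsilon> n / 2) * D n \<le> \<bar>l x0 * sqrt (h x0)\<bar>"
          using sup_norm_on_greater[OF J(2)] by blast
        have x0I: "x0 \<in> {0..1}" using x0 J by auto
        have gx0: "(1 + \<epsilon> n / 2) * D n \<le> \<bar>g x0\<bar>" using x0(3) lg[OF x0I] h_pos[OF x0I] by simp
        have win: "0 < x0 - w n" "x0 + w n \<le> 1" "0 < x0 - w' n" "x0 + w' n \<le> 1" using elim x0 by auto
        have osc: "\<bar>h u - h x0\<bar> \<le> \<sigma> n" if "x0 - w n \<le> u" "u \<le> x0 + w n" for u
        proof -
          have "\<bar>h u - h x0\<bar> \<le> modulus_of_continuity {0..1} h (w n)"
          proof (rule modulus_of_continuity_ge)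
            show "0 \<le> h x \<and> h x \<le> h1" if "x \<in> {0..1}" for x using hb[OF that] h0 by auto
          qed (use that win x0I in auto)
          then show ?thesis using elim by linarith
        qed
        have Lw: "L * w n powr \<beta> = D n" using L D_pos[OF n2] \<beta> by (simp add: w_def powr_powr)
        have Lw': "L * w' n powr \<beta> = \<Lambda> n / 2" using L \<Lambda>_pos[OF n2] \<beta> by (simp add: w'_def powr_powr)
        have L1: "4 * R.f_max * (2 * \<Lambda> n / sqrt h0) \<le> 1"
        proof -
          have "0 < 8 * fm / sqrt h0" using B(1) h0 by (simp add: fm_def)
          then have "\<Lambda> n * (8 * fm / sqrt h0) < 1" using elim by (simp only: pos_less_divide_eq)
          then show ?thesis unfolding R_eqs by (simp add: mult_ac)
        qed
        have L2: "2 * B * (\<Lambda> n / (2 * sqrt h1)) \<le> R.f_energy"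
        proof -
          have "0 < B / sqrt h1" using B(1) h1 by simp
          then have "\<Lambda> n * (B / sqrt h1) < c0" using elim by (simp only: pos_less_divide_eq)
          then show ?thesis unfolding R_eqs by (simp add: mult_ac)
        qed
        have yn: "real n * h0 * v \<le> real n" if "v < min (min a (1 - b)) (1 / h0)" for v
        proof -
          have "h0 * v \<le> 1" using that h0 by (simp add: field_simps)
          then show ?thesis using mult_left_mono[of "h0 * v" 1 "real n"] by (simp add: mult.assoc)
        qed
        have "1 - 36 / t\<^sup>2 \<le> R.prob {\<omega>\<in>space (M n). K < multiscale_stat (\<psi>_opt \<beta>) (design_point h n) n (observation l (design_point h n) (err n) \<omega>)}"
          by (rule R.power_two_sided[where \<epsilon> = "\<epsilon> n / 2", OF \<beta> L t(1) _ D_pos[OF n2] _ K(1) Lw w_pos[OF n2] win(1,2) Lw' w'_pos[OF n2] win(3,4) g lg gx0 osc L1 L2, unfolded R_rel R_abs R_eqs])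
            (use elim \<epsilon>_pos[of n] yn in \<open>auto simp: y_def less_imp_le\<close>)
        also have "\<dots> \<le> R.prob {\<omega>\<in>space (M n). signed_rank_test (M n) (err n) (\<psi>_opt \<beta>) (design_point h n) n \<alpha>
                 (observation l (design_point h n) (err n) \<omega>) = 1}"
          by (rule R.prob_reject_ge[OF \<alpha>(1) K(1)], rule K(2)[OF R.Q.quasi_uniform_design_axioms[unfolded R_eqs] n2])
        finally show "1 - \<delta> \<le> R.prob {\<omega>\<in>space (M n). signed_rank_test (M n) (err n) (\<psi>_opt \<beta>) (design_point h n) n \<alpha>
                 (observation l (design_point h n) (err n) \<omega>) = 1}" by (simp only: t(2))
      qed
    qed
  qed
  define Cls where "Cls n = {l \<in> weighted_holder_class h \<beta> L.
      sup_norm_on {a..b} (\<lambda>x. l x * sqrt (h x)) \<ge> (1 + \<epsilon> n) * d * rate \<beta> n}" for n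
  define P where "P n l = \<P>(\<omega> in M n. signed_rank_test (M n) (err n) (\<psi>_opt \<beta>) (design_point h n) n \<alpha>
                 (observation l (design_point h n) (err n) \<omega>) = 1)" for n l
  \<comment> \<open>Over an empty class the infimum in \<open>ereal\<close> would be infinite, so
    the upper bound 1 requires a member: a constant Hoelder function divided by
    \<open>sqrt h\<close>.\<close>
  have nonempty: "Cls n \<noteq> {}" for n
  proof -
    define c where "c = \<bar>(1 + \<epsilon> n) * d * rate \<beta> n\<bar>"
    have "(\<lambda>x. c / sqrt (h x)) \<in> weighted_holder_class h \<beta> L"
    proof -
      have "(\<lambda>_. c) \<in> holder_class \<beta> L {0..1}" using L by (simp add: holder_class_def)
      then show ?thesis unfolding weighted_holder_class_def by (intro CollectI bexI[of _ "\<lambda>_. c"] ballI refl)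
    qed
    moreover have "sup_norm_on {a..b} (\<lambda>x. c / sqrt (h x) * sqrt (h x)) = c"
    proof -
      have "(SUP x\<in>{a..b}. \<bar>c / sqrt (h x) * sqrt (h x)\<bar>) = (SUP x\<in>{a..b}. c)"
      proof (rule SUP_cong[OF refl])
        fix x assume "x \<in> {a..b}"
        then have "0 < h x" using J by (intro h_pos) auto
        then show "\<bar>c / sqrt (h x) * sqrt (h x)\<bar> = c" by (simp add: c_def)
      qed
      then show ?thesis using J by (simp add: sup_norm_on_def)
    qed
    ultimately have "(\<lambda>x. c / sqrt (h x)) \<in> Cls n" by (simp add: Cls_def c_def)
    then show ?thesis by blast
  qed
  have "liminf (\<lambda>n. INF l\<in>Cls n. ereal (P n l)) = 1"
  proof (rule antisym)
    have "(INF l\<in>Cls n. ereal (P n l)) \<le> 1" for n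
    proof -
      obtain l where "l \<in> Cls n" using nonempty by blast
      then have "(INF l\<in>Cls n. ereal (P n l)) \<le> ereal (P n l)" by (rule INF_lower)
      also have "\<dots> \<le> 1" using prob_space.prob_le_1[OF prob_space_M] by (simp add: P_def)
      finally show ?thesis .
    qed
    then have "liminf (\<lambda>n. INF l\<in>Cls n. ereal (P n l)) \<le> liminf (\<lambda>n. 1)"
      by (intro Liminf_mono always_eventually) simp
    then show "liminf (\<lambda>n. INF l\<in>Cls n. ereal (P n l)) \<le> 1" by (simp add: Liminf_const)
    show "1 \<le> liminf (\<lambda>n. INF l\<in>Cls n. ereal (P n l))"
    proof (rule ereal_le_epsilon2)
      fix \<delta> :: real assume \<delta>: "0 < \<delta>"
      have "eventually (\<lambda>n. ereal (1 - \<delta>) \<le> (INF l\<in>Cls n. ereal (P n l))) sequentially"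
        using reject[OF \<delta>]
      proof eventually_elim
        case (elim n)
        then show ?case by (intro INF_greatest) (auto simp: Cls_def P_def)
      qed
      then have "ereal (1 - \<delta>) \<le> liminf (\<lambda>n. INF l\<in>Cls n. ereal (P n l))" by (rule Liminf_bounded)
      then have "ereal (1 - \<delta>) + ereal \<delta> \<le> liminf (\<lambda>n. INF l\<in>Cls n. ereal (P n l)) + ereal \<delta>" by (rule add_right_mono)
      then show "1 \<le> liminf (\<lambda>n. INF l\<in>Cls n. ereal (P n l)) + ereal \<delta>" by (simp add: one_ereal_def)
    qed
  qed
  then show ?thesis by (simp only: Cls_def P_def d_def)
qed

end
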